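(* Let $h$ be a sense-preserving homeomorphism of $\mathbb{R}$ onto itself and let $\gamma(z)=\frac{z-i}{z+i}$. Then $h$ is strongly vanishing symmetric (i.e. $h\in\mathrm{SQS}(\mathbb{R})$ and $\log h'\in\mathrm{CMO}(\mathbb{R})$) if and only if $\gamma\circ h\circ\gamma^{-1}$ is strongly symmetric on the unit circle $S^1$ (i.e. $\gamma\circ h\circ\gamma^{-1}\in\mathrm{SQS}(S^1)$ and the logarithm of its derivative lies in $\mathrm{VMO}(S^1)$).
   Context: $\gamma$ is the Cayley transform, mapping $\mathbb{H}$ onto the unit disk $\mathbb{D}$ and $\mathbb{R}\cup\{\infty\}$ onto $S^1$; $h$ is extended by $h(\infty)=\infty$, so $\gamma\circ h\circ\gamma^{-1}$ is a sense-preserving homeomorphism of $S^1$ fixing $1$. For an interval $I$ (or arc of $S^1$), $|I|$ is its length and $f_I$ the mean of $f$ over $I$. $\mathrm{BMO}(\mathbb{R})$ is the space of locally integrable $f$ on $\mathbb{R}$ with $\|f\|_*=\sup_I \frac1{|I|}\int_I|f-f_I|dx<\infty$; $\mathrm{CMO}(\mathbb{R})$ is the closure in $\mathrm{BMO}(\mathbb{R})$, with respect to $\|\cdot\|_*$, of the continuous functions with compact support (functions modulo constants). $\mathrm{BMO}(S^1)$ is defined in the same way using arcs $I\subset S^1$ and arc length, and $\mathrm{VMO}(S^1)$ is the set of $f\in\mathrm{BMO}(S^1)$ with $\lim_{|I|\to0}\frac1{|I|}\int_I|f-f_I|=0$ (uniformly in arcs $I$). A sense-preserving homeomorphism $h$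 of $\mathbb{R}$ onto itself belongs to $\mathrm{SQS}(\mathbb{R})$ if there are constants $0<C_1,C_2<\infty$ such that $|h(A)|/|h(I)|\le C_1(|A|/|I|)^{C_2}$ for all bounded intervals $I$ and all measurable $A\subset I$; such $h$ is locally absolutely continuous. $\mathrm{SQS}(S^1)$ is defined in the same way for sense-preserving homeomorphisms of $S^1$, using arcs and arc length. A homeomorphism $k$ of $S^1$ is strongly symmetric if $k\in\mathrm{SQS}(S^1)$ and $\log k'\in\mathrm{VMO}(S^1)$, where $k'$ denotes the (positive) derivative with respect to arc length. *)

theory Defs
  imports "HOL-Analysis.Analysis"
begin

subsection \<open>Intervals, arcs and arc length\<close>

definition bounded_intervals :: "real set set" where
  "bounded_intervals = {I. is_interval I \<and> bounded I \<and> 0 < measure lebesgue I}"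

definition arcs :: "complex set set" where
  "arcs = {cis ` J | J. J \<in> bounded_intervals \<and> measure lebesgue J \<le> 2 * pi}"

text \<open>Arc length as a complete measure with space \<open>sphere 0 1\<close>: a set of points of the circle is
  measurable iff its set of angles in \<open>[0, 2\<pi>)\<close> is Lebesgue measurable.\<close>

definition arclength :: "complex measure" where
  "arclength = embed_measure (lebesgue_on {0..<2 * pi}) cis"

subsection \<open>Mean oscillation\<close>

text \<open>The following notions are used with \<open>(M, \<I>) = (lebesgue, bounded_intervals)\<close> for the line and
  \<open>(M, \<I>) = (arclength, arcs)\<close> for the circle.\<close>

definition mean_on :: "'a measure \<Rightarrow> 'a set \<Rightarrow> ('a \<Rightarrow> real) \<Rightarrow> real" where
  "mean_on M I f = (1 / measure M I) * (LINT x:I|M. f x)"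

definition mean_osc :: "'a measure \<Rightarrow> 'a set \<Rightarrow> ('a \<Rightarrow> real) \<Rightarrow> real" where
  "mean_osc M I f = mean_on M I (\<lambda>x. \<bar>f x - mean_on M I f\<bar>)"

definition BMO :: "'a measure \<Rightarrow> 'a set set \<Rightarrow> ('a \<Rightarrow> real) set" where
  "BMO M \<I> = {f. (\<forall>I\<in>\<I>. set_integrable M I f) \<and> bdd_above ((\<lambda>I. mean_osc M I f) ` \<I>)}"

definition BMO_norm :: "'a measure \<Rightarrow> 'a set set \<Rightarrow> ('a \<Rightarrow> real) \<Rightarrow> real" where
  "BMO_norm M \<I> f = (SUP I\<in>\<I>. mean_osc M I f)"

text \<open>\<open>BMO_norm\<close> is a seminorm vanishing on constants, so the closure of the compactly supported
  continuous functions modulo constants is the closure with respect to this seminorm.\<close>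

definition CMO_real :: "(real \<Rightarrow> real) set" where
  "CMO_real = {f \<in> BMO lebesgue bounded_intervals.
     \<forall>\<epsilon>>0. \<exists>g. continuous_on UNIV g \<and> compact (closure {x. g x \<noteq> 0}) \<and>
       BMO_norm lebesgue bounded_intervals (\<lambda>x. f x - g x) < \<epsilon>}"

definition VMO_circle :: "(complex \<Rightarrow> real) set" where
  "VMO_circle = {f \<in> BMO arclength arcs.
     \<forall>\<epsilon>>0. \<exists>\<delta>>0. \<forall>I\<in>arcs. measure arclength I < \<delta> \<longrightarrow> mean_osc arclength I f < \<epsilon>}"

subsection \<open>Strongly quasisymmetric homeomorphisms\<close>

definition sense_preserving_homeo_real :: "(real \<Rightarrow> real) \<Rightarrow> bool" where
  "sense_preserving_homeo_real h \<longleftrightarrow> (\<exists>g. homeomorphism UNIV UNIV h g) \<and> strict_mono h"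

text \<open>Preserving the sense of the circle means having an increasing lift to the angle variable.
  Only the values of \<open>k\<close> on the circle matter.\<close>

definition sense_preserving_homeo_circle :: "(complex \<Rightarrow> complex) \<Rightarrow> bool" where
  "sense_preserving_homeo_circle k \<longleftrightarrow> (\<exists>g. homeomorphism (sphere 0 1) (sphere 0 1) k g) \<and>
     (\<exists>\<phi>. continuous_on UNIV \<phi> \<and> strict_mono \<phi> \<and> (\<forall>t. k (cis t) = cis (\<phi> t)))"

text \<open>The condition for Borel \<open>A\<close> already makes \<open>h\<close> absolutely continuous, so that images of Lebesgue
  measurable sets are measurable; the convention that \<open>measure\<close> is \<open>0\<close> on nonmeasurable sets
  therefore plays no role.\<close>

definition strong_qs_condition :: "'a measure \<Rightarrow> 'a set set \<Rightarrow> ('a \<Rightarrow> 'a) \<Rightarrow> bool" where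
  "strong_qs_condition M \<I> h \<longleftrightarrow> (\<exists>C1>0. \<exists>C2>0. \<forall>I\<in>\<I>. \<forall>A\<in>sets M. A \<subseteq> I \<longrightarrow>
     measure M (h ` A) / measure M (h ` I) \<le> C1 * (measure M A / measure M I) powr C2)"

definition SQS_real :: "(real \<Rightarrow> real) set" where
  "SQS_real = {h. sense_preserving_homeo_real h \<and> strong_qs_condition lebesgue bounded_intervals h}"

definition SQS_circle :: "(complex \<Rightarrow> complex) set" where
  "SQS_circle = {k. sense_preserving_homeo_circle k \<and> strong_qs_condition arclength arcs k}"

subsection \<open>Strongly vanishing symmetric and strongly symmetric homeomorphisms\<close>

text \<open>If \<open>k (cis t) = cis (\<phi> t)\<close> with \<open>\<phi>\<close> increasing, then the derivative of \<open>k\<close> with respect to arc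
  length is \<open>\<phi>' t\<close>, the norm of the velocity \<open>\<i> * \<phi>' t * cis (\<phi> t)\<close> of \<open>k (cis t)\<close>.\<close>

definition circle_deriv :: "(complex \<Rightarrow> complex) \<Rightarrow> complex \<Rightarrow> real" where
  "circle_deriv k z = norm (vector_derivative (\<lambda>t. k (cis t)) (at (Arg z)))"

text \<open>The derivatives below exist and are positive almost everywhere for strongly quasisymmetric
  maps, so the values of \<open>deriv\<close>, \<open>vector_derivative\<close> and \<open>ln\<close> outside their domains are immaterial.\<close>

definition strongly_vanishing_symmetric :: "(real \<Rightarrow> real) \<Rightarrow> bool" where
  "strongly_vanishing_symmetric h \<longleftrightarrow> h \<in> SQS_real \<and> (\<lambda>x. ln (deriv h x)) \<in> CMO_real"

definition strongly_symmetric :: "(complex \<Rightarrow> complex) \<Rightarrow> bool" where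
  "strongly_symmetric k \<longleftrightarrow> k \<in> SQS_circle \<and> (\<lambda>z. ln (circle_deriv k z)) \<in> VMO_circle"

subsection \<open>The Cayley transform on the extended real line\<close>

definition cayley :: "complex \<Rightarrow> complex" where
  "cayley z = (z - \<i>) / (z + \<i>)"

text \<open>\<open>\<real> \<union> {\<infinity>}\<close> is modelled by \<open>real option\<close> with \<open>None\<close> for \<open>\<infinity>\<close>; the extension of \<open>h\<close> by
  \<open>h \<infinity> = \<infinity>\<close> is then \<open>map_option h\<close>.\<close>

definition cayley_boundary :: "real option \<Rightarrow> complex" where
  "cayley_boundary p = (case p of None \<Rightarrow> 1 | Some x \<Rightarrow> cayley (complex_of_real x))"

definition cayley_conj :: "(real \<Rightarrow> real) \<Rightarrow> complex \<Rightarrow> complex" where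
  "cayley_conj h = cayley_boundary \<circ> map_option h \<circ> inv cayley_boundary"

lemma bij_betw_cayley_boundary: "bij_betw cayley_boundary UNIV (sphere 0 1)"
proof -
  have nz: "complex_of_real x + \<i> \<noteq> 0" for x
    by (simp add: complex_eq_iff)
  have ne1: "cayley (complex_of_real x) \<noteq> 1" for x
    using nz[of x] by (simp add: cayley_def divide_eq_1_iff)
  have "inj cayley_boundary"
  proof (rule injI)
    fix p q assume eq: "cayley_boundary p = cayley_boundary q"
    show "p = q"
    proof (cases p; cases q)
      fix x y assume [simp]: "p = Some x" "q = Some y"
      have "(complex_of_real x - \<i>) * (complex_of_real y + \<i>) = (complex_of_real y - \<i>) * (complex_of_real x + \<i>)"
        using eq nz[of x] nz[of y] by (simp add: cayley_boundary_def cayley_def frac_eq_eq)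
      then show "p = q" by (simp add: complex_eq_iff)
    qed (use eq ne1 ne1[symmetric] in \<open>auto simp: cayley_boundary_def\<close>)
  qed
  moreover have "cayley_boundary p \<in> sphere 0 1" for p
  proof (cases p)
    case (Some x)
    have "norm (complex_of_real x - \<i>) = norm (complex_of_real x + \<i>)"
      by (simp add: norm_complex_def)
    then show ?thesis using Some nz[of x]
      by (simp add: cayley_boundary_def cayley_def norm_divide)
  qed (simp add: cayley_boundary_def)
  moreover have "w \<in> range cayley_boundary" if w: "w \<in> sphere 0 1" for w
  proof (cases "w = 1")
    case True
    then show ?thesis by (metis cayley_boundary_def option.simps(4) rangeI)
  next
    case False
    define z where "z = \<i> * (1 + w) / (1 - w)"
    have ww: "w * cnj w = 1" using w complex_norm_square[of w] by simp
    have w0: "w \<noteq> 0" using w by auto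
    have "cnj w = inverse w" using ww w0 by (metis inverse_unique)
    then have "cnj z = z" using False w0
      by (simp add: z_def field_simps)
    then have zr: "z = complex_of_real (Re z)" by (simp add: complex_eq_iff)
    have "cayley z = w" using False by (simp add: cayley_def z_def field_simps)
    then have "cayley_boundary (Some (Re z)) = w" using zr by (simp add: cayley_boundary_def)
    then show ?thesis by blast
  qed
  ultimately show ?thesis by (auto simp: bij_betw_def)
qed

lemma space_arclength: "space arclength = sphere 0 1"
proof -
  have "cis ` {0..<2 * pi} = sphere 0 1"
  proof (intro equalityI subsetI)
    fix z :: complex assume "z \<in> sphere 0 1"
    then have n: "norm z = 1" by simp
    then have "z = cis (Arg2pi z)" using Arg2pi_eq[of z] by (simp add: cis_conv_exp)
    then show "z \<in> cis ` {0..<2 * pi}" using Arg2pi_ge_0 Arg2pi_lt_2pi by auto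
  qed auto
  then show ?thesis by (simp add: arclength_def space_embed_measure)
qed

end

theory Submission
  imports Defs
begin

text \<open>The Cayley transform carries \<open>h\<close> to the circle map with increasing lift \<open>lift h\<close>, where
  \<open>lift h (pi + 2 * arctan x) = pi + 2 * arctan (h x)\<close>. On compact arcs away from the point \<open>1\<close> the
  stereographic coordinate is bi-Lipschitz, so everything happens near \<open>\<infinity>\<close>, where the inversion
  \<open>x \<mapsto> - 1 / x\<close> exchanges shells around \<open>\<infinity>\<close> with shells around \<open>0\<close>. Mean oscillation and strong
  quasisymmetry on all intervals are controlled by their versions on intervals inside such shells
  together with a geometric series over the shells, hence both notions are invariant under the
  inversion; and \<open>f \<in> CMO\<close> on the line corresponds to \<open>f\<close> having vanishing mean oscillation on the
  circle. By the chain rule the logarithmic derivative of the circle map is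
  \<open>ln h' + ln (1 + x\<^sup>2) - ln (1 + (h x)\<^sup>2)\<close>. The last two terms are continuous, and they oscillate
  slowly at \<open>\<infinity>\<close> once the logarithmic derivative of \<open>h\<close> or of its lift has vanishing mean
  oscillation there, because then \<open>h\<close> is almost linear on each shell. So they belong to the
  vanishing class.\<close>

subsection \<open>Mean oscillation\<close>

text \<open>Inversion sends an interval around 0 to a neighbourhood of the point at infinity, so
  neither BMO nor strong quasisymmetry can be carried over interval by interval. Only sets whose
  points have comparable distances to 0 can be transported with uniform constants, and the behaviour
  at 0 must be recovered by summation over scales. Conjugation with the inversion gives a
  homeomorphism of the line only when \<open>h 0 = 0\<close>; the normalisation is removed at the
  end because a translation lifts to a bi-Lipschitz map of the circle. The two logarithmic
  derivatives differ by a term that depends on \<open>h\<close> itself, so its slow oscillation has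
  to be proved twice, once from data on the line and once from data on the circle. Oscillation is
  measured about a free centre and with nonnegative integrals, which spares integrability proofs
  along the way and costs only a factor 2 against the mean at the end.\<close>

definition deviation :: "(real \<Rightarrow> real) \<Rightarrow> real set \<Rightarrow> real \<Rightarrow> ennreal" where
  "deviation f S c = (\<integral>\<^sup>+x\<in>S. ennreal \<bar>f x - c\<bar> \<partial>lborel)"

text \<open>Any centre may be used in place of the mean. By \<open>represents_mean_osc\<close> and
  \<open>represents_osc_le\<close> the two choices differ by at most a factor 2.\<close>

definition osc_le :: "(real \<Rightarrow> real) \<Rightarrow> real set \<Rightarrow> real \<Rightarrow> bool" where
  "osc_le f S e \<longleftrightarrow> (\<exists>c. deviation f S c \<le> ennreal (e * measure lborel S))"

lemma deviation_mono: "S \<subseteq> T \<Longrightarrow> deviation f S c \<le> deviation f T c"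
  unfolding deviation_def by (intro nn_integral_mono) (auto simp: indicator_def)

lemma deviation_Un:
  assumes [measurable]: "f \<in> borel_measurable borel" "S \<in> sets borel" "T \<in> sets borel"
  shows "deviation f (S \<union> T) c \<le> deviation f S c + deviation f T c"
proof -
  have "deviation f (S \<union> T) c \<le> (\<integral>\<^sup>+x. ennreal \<bar>f x - c\<bar> * indicator S x + ennreal \<bar>f x - c\<bar> * indicator T x \<partial>lborel)"
    unfolding deviation_def by (intro nn_integral_mono) (auto simp: indicator_def)
  also have "\<dots> = deviation f S c + deviation f T c"
    unfolding deviation_def by (rule nn_integral_add) auto
  finally show ?thesis .
qed

lemma deviation_UN:
  assumes [measurable]: "f \<in> borel_measurable borel" "\<And>i::nat. S i \<in> sets borel"
  shows "deviation f (\<Union>i. S i) c \<le> (\<Sum>i. deviation f (S i) c)"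
proof -
  \<comment> \<open>For a fixed centre the deviation is a measure of the set, so countable
    subadditivity applies.\<close>
  define M where "M = density lborel (\<lambda>x. ennreal \<bar>f x - c\<bar>)"
  have M: "deviation f A c = emeasure M A" if "A \<in> sets borel" for A
    unfolding deviation_def M_def using that by (subst emeasure_density) auto
  have "emeasure M (\<Union>i. S i) \<le> (\<Sum>i. emeasure M (S i))"
    by (rule emeasure_subadditive_countably) (auto simp: M_def)
  then show ?thesis
    by (simp add: M)
qed

lemma nn_integral_const_bounded:
  assumes "S \<in> sets borel" "bounded S" "0 \<le> k"
  shows "(\<integral>\<^sup>+x\<in>S. ennreal k \<partial>lborel) = ennreal (k * measure lborel S)"
  using assms emeasure_bounded_finite[of S]
  by (simp add: nn_integral_cmult_indicator emeasure_eq_ennreal_measure ennreal_mult)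

lemma deviation_add:
  assumes [measurable]: "f \<in> borel_measurable borel" "g \<in> borel_measurable borel" "S \<in> sets borel"
  shows "deviation (\<lambda>x. f x + g x) S (c + d) \<le> deviation f S c + deviation g S d"
proof -
  have "deviation (\<lambda>x. f x + g x) S (c + d)
      \<le> (\<integral>\<^sup>+x. ennreal \<bar>f x - c\<bar> * indicator S x + ennreal \<bar>g x - d\<bar> * indicator S x \<partial>lborel)"
    unfolding deviation_def
    by (intro nn_integral_mono) (auto simp: indicator_def ennreal_plus[symmetric] simp del: ennreal_plus)
  also have "\<dots> = deviation f S c + deviation g S d"
    unfolding deviation_def by (rule nn_integral_add) auto
  finally show ?thesis .
qed

lemma deviation_shift_center:
  assumes [measurable]: "f \<in> borel_measurable borel" "S \<in> sets borel" and "bounded S"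
  shows "deviation f S d \<le> deviation f S c + ennreal (\<bar>c - d\<bar> * measure lborel S)"
proof -
  have "deviation f S d \<le> (\<integral>\<^sup>+x. ennreal \<bar>f x - c\<bar> * indicator S x + ennreal \<bar>c - d\<bar> * indicator S x \<partial>lborel)"
    unfolding deviation_def
    by (intro nn_integral_mono) (auto simp: indicator_def ennreal_plus[symmetric] simp del: ennreal_plus)
  also have "\<dots> = deviation f S c + (\<integral>\<^sup>+x. ennreal \<bar>c - d\<bar> * indicator S x \<partial>lborel)"
    unfolding deviation_def by (rule nn_integral_add) auto
  finally show ?thesis
    using nn_integral_const_bounded[of S "\<bar>c - d\<bar>"] assms by simp
qed

text \<open>Integrate the triangle inequality for \<open>c\<close>, \<open>f x\<close> and
  \<open>d\<close> over \<open>U\<close>. This links centres that were chosen independently on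
  overlapping sets.\<close>

lemma center_distance:
  assumes [measurable]: "f \<in> borel_measurable borel" "U \<in> sets borel" and "bounded U"
    and "deviation f U c \<le> ennreal A" "deviation f U d \<le> ennreal B" "0 \<le> A" "0 \<le> B"
  shows "\<bar>c - d\<bar> * measure lborel U \<le> A + B"
proof -
  have "(\<integral>\<^sup>+x\<in>U. ennreal \<bar>c - d\<bar> \<partial>lborel)
      \<le> (\<integral>\<^sup>+x. ennreal \<bar>f x - c\<bar> * indicator U x + ennreal \<bar>f x - d\<bar> * indicator U x \<partial>lborel)"
    by (intro nn_integral_mono) (auto simp: indicator_def ennreal_plus[symmetric] simp del: ennreal_plus)
  also have "\<dots> = deviation f U c + deviation f U d"
    unfolding deviation_def by (rule nn_integral_add) auto
  also have "\<dots> \<le> ennreal (A + B)"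
    using assms by (simp add: add_mono)
  finally show ?thesis
    using nn_integral_const_bounded[of U "\<bar>c - d\<bar>"] assms by (simp del: ennreal_plus)
qed

lemma osc_le_mono: "osc_le f S e \<Longrightarrow> e \<le> e' \<Longrightarrow> osc_le f S e'"
  unfolding osc_le_def
  by (meson ennreal_leI measure_nonneg mult_right_mono order_trans)

lemma osc_le_subset:
  assumes "osc_le f T e" "S \<subseteq> T" "measure lborel T \<le> K * measure lborel S" "0 \<le> e"
  shows "osc_le f S (K * e)"
proof -
  obtain c where c: "deviation f T c \<le> ennreal (e * measure lborel T)"
    using assms by (auto simp: osc_le_def)
  have "deviation f S c \<le> ennreal (e * measure lborel T)"
    using deviation_mono[OF assms(2)] c order_trans by blast
  also have "\<dots> \<le> ennreal (K * e * measure lborel S)"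
    using mult_left_mono[OF assms(3) assms(4)] by (intro ennreal_leI) (simp add: mult_ac)
  finally show ?thesis by (auto simp: osc_le_def)
qed

lemma osc_le_add:
  assumes "osc_le f S e" "osc_le g S e'" "0 \<le> e" "0 \<le> e'"
    and [measurable]: "f \<in> borel_measurable borel" "g \<in> borel_measurable borel" "S \<in> sets borel"
  shows "osc_le (\<lambda>x. f x + g x) S (e + e')"
proof -
  obtain c d where "deviation f S c \<le> ennreal (e * measure lborel S)"
    "deviation g S d \<le> ennreal (e' * measure lborel S)"
    using assms by (auto simp: osc_le_def)
  then have "deviation f S c + deviation g S d \<le> ennreal (e * measure lborel S) + ennreal (e' * measure lborel S)"
    by (rule add_mono)
  also have "\<dots> = ennreal ((e + e') * measure lborel S)"
    using assms by (simp add: distrib_right ennreal_plus)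
  finally show ?thesis
    using deviation_add[OF assms(5,6,7), of c d] unfolding osc_le_def by (meson order_trans)
qed

lemma osc_le_uminus: "osc_le f S e \<Longrightarrow> osc_le (\<lambda>x. - f x) S e"
proof -
  assume "osc_le f S e"
  then obtain c where c: "deviation f S c \<le> ennreal (e * measure lborel S)" by (auto simp: osc_le_def)
  have "\<bar>- f x - (- c)\<bar> = \<bar>f x - c\<bar>" for x by simp
  then have "deviation (\<lambda>x. - f x) S (- c) = deviation f S c"
    by (simp only: deviation_def)
  with c have "deviation (\<lambda>x. - f x) S (- c) \<le> ennreal (e * measure lborel S)" by simp
  then show ?thesis unfolding osc_le_def by blast
qed

lemma osc_le_diff:
  assumes "osc_le f S e" "osc_le g S e'" "0 \<le> e" "0 \<le> e'"
    and [measurable]: "f \<in> borel_measurable borel" "g \<in> borel_measurable borel" "S \<in> sets borel"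
  shows "osc_le (\<lambda>x. f x - g x) S (e + e')"
  using osc_le_add[OF assms(1) osc_le_uminus[OF assms(2)] assms(3,4)] by simp

lemma osc_le_bounded:
  assumes "\<And>x. x \<in> S \<Longrightarrow> \<bar>f x - c\<bar> \<le> e" "0 \<le> e" "S \<in> sets borel" "bounded S"
  shows "osc_le f S e"
proof -
  have "deviation f S c \<le> (\<integral>\<^sup>+x\<in>S. ennreal e \<partial>lborel)"
    unfolding deviation_def using assms(1)
    by (intro nn_integral_mono) (auto simp: indicator_def intro!: ennreal_leI)
  then show ?thesis
    using nn_integral_const_bounded[of S e] assms by (auto simp: osc_le_def)
qed

lemma osc_le_AE_cong:
  assumes "osc_le f S e" "AE x in lborel. f x = g x"
  shows "osc_le g S e"
proof -
  have "deviation f S c = deviation g S c" for c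
    unfolding deviation_def using assms(2) by (intro nn_integral_cong_AE) auto
  then show ?thesis using assms(1) by (simp add: osc_le_def)
qed

text \<open>On the overlap, which is a fixed proportion of both sets, the two centres differ by at
  most \<open>2 * K * e\<close>; recentring one set at the centre of the other costs that
  amount.\<close>

lemma osc_le_Un:
  assumes [measurable]: "f \<in> borel_measurable borel" "S \<in> sets borel" "T \<in> sets borel"
    and bd: "bounded S" "bounded T" and osc: "osc_le f S e" "osc_le f T e" and e: "0 \<le> e"
    and SK: "measure lborel S \<le> K * measure lborel (S \<inter> T)" and TK: "measure lborel T \<le> K * measure lborel (S \<inter> T)"
  shows "osc_le f (S \<union> T) (2 * K * e + 2 * e)"
proof (cases "measure lborel (S \<inter> T) = 0")
  case True
  obtain c where c: "deviation f S c \<le> ennreal (e * measure lborel S)"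
    using osc by (auto simp: osc_le_def)
  \<comment> \<open>The proportionality bounds force both sets to be null, so any centre will
    do.\<close>
  have "measure lborel S = 0" "measure lborel T = 0"
    using SK TK True measure_nonneg[of lborel] by (auto intro: antisym)
  then have "emeasure lborel S = 0" "emeasure lborel T = 0"
    using bd emeasure_bounded_finite[of S] emeasure_bounded_finite[of T]
    by (auto simp: emeasure_eq_ennreal_measure)
  then have "AE x in lborel. x \<notin> S" "AE x in lborel. x \<notin> T"
    by (auto intro!: AE_not_in simp: null_sets_def)
  then have "AE x in lborel. ennreal \<bar>f x - 0\<bar> * indicator (S \<union> T) x = 0"
    by eventually_elim auto
  then have "deviation f (S \<union> T) 0 = (\<integral>\<^sup>+x. 0 \<partial>(lborel :: real measure))"
    unfolding deviation_def by (rule nn_integral_cong_AE)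
  then show ?thesis by (auto simp: osc_le_def intro!: exI[of _ 0])
next
  case False
  let ?m = "measure lborel"
  obtain c d where c: "deviation f S c \<le> ennreal (e * ?m S)" and d: "deviation f T d \<le> ennreal (e * ?m T)"
    using osc by (auto simp: osc_le_def)
  have fin: "emeasure lborel (S \<union> T) \<noteq> \<infinity>" using bd emeasure_bounded_finite[of "S \<union> T"] by simp
  have pos: "0 < ?m (S \<inter> T)" using False measure_nonneg[of lborel] by (metis less_eq_real_def)
  have "\<bar>c - d\<bar> * ?m (S \<inter> T) \<le> e * ?m S + e * ?m T"
  proof (rule center_distance[of f])
    show "deviation f (S \<inter> T) c \<le> ennreal (e * ?m S)" "deviation f (S \<inter> T) d \<le> ennreal (e * ?m T)"
      using deviation_mono[of "S \<inter> T"] c d by (meson inf_le1 inf_le2 order_trans)+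
  qed (use bd e in \<open>auto simp: bounded_Int\<close>)
  also have "\<dots> \<le> (2 * K * e) * ?m (S \<inter> T)"
    using mult_left_mono[OF SK e] mult_left_mono[OF TK e] by (simp add: algebra_simps)
  finally have cd: "\<bar>c - d\<bar> \<le> 2 * K * e"
    using pos by simp
  have leS: "?m S \<le> ?m (S \<union> T)" and leT: "?m T \<le> ?m (S \<union> T)"
    using fin by (auto intro!: measure_mono_fmeasurable simp: fmeasurable_def top.not_eq_extremum)
  have "deviation f (S \<union> T) c \<le> deviation f S c + deviation f T c"
    by (rule deviation_Un) auto
  also have "deviation f T c \<le> deviation f T d + ennreal (\<bar>d - c\<bar> * ?m T)"
    by (rule deviation_shift_center) (use bd in auto)
  also have "deviation f S c + (deviation f T d + ennreal (\<bar>d - c\<bar> * ?m T))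
      \<le> ennreal (e * ?m S) + (ennreal (e * ?m T) + ennreal (\<bar>d - c\<bar> * ?m T))"
    using c d by (intro add_mono) auto
  also have "\<dots> = ennreal (e * ?m S + e * ?m T + \<bar>d - c\<bar> * ?m T)"
    using e by (simp add: ennreal_plus[symmetric] del: ennreal_plus)
  also have "\<dots> \<le> ennreal ((2 * K * e + 2 * e) * ?m (S \<union> T))"
  proof (rule ennreal_leI)
    have "\<bar>d - c\<bar> * ?m T \<le> (2 * K * e) * ?m (S \<union> T)"
      using cd leT by (intro mult_mono) (auto simp: abs_minus_commute intro: order_trans[OF abs_ge_zero])
    then show "e * ?m S + e * ?m T + \<bar>d - c\<bar> * ?m T \<le> (2 * K * e + 2 * e) * ?m (S \<union> T)"
      using mult_left_mono[OF leS e] mult_left_mono[OF leT e] by (simp add: algebra_simps)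
  qed
  finally show ?thesis by (auto simp: osc_le_def add_left_mono)
qed

section \<open>Dyadic rings around the origin\<close>

text \<open>The ratio 4 makes the rings of radii \<open>r\<close> and \<open>r / 2\<close> share the
  points with \<open>r \<le> \<bar>x\<bar> \<le> 2 * r\<close>. Both signs belong to one ring so
  that one centre links the two half lines.\<close>

definition ring :: "real \<Rightarrow> real set" where
  "ring p = {x. p \<le> \<bar>x\<bar> \<and> \<bar>x\<bar> \<le> 4 * p}"

lemma ring_eq: "0 < p \<Longrightarrow> ring p = {p..4 * p} \<union> {-(4 * p)..-p}"
  by (auto simp: ring_def abs_if)

lemma ring_borel [measurable]: "ring p \<in> sets borel"
  unfolding ring_def by measurable

lemma bounded_ring: "bounded (ring p)"
  by (rule boundedI[of _ "4 * p"]) (auto simp: ring_def)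

lemma measure_symmetric_Un:
  fixes p q :: real
  assumes "0 < p" "p \<le> q"
  shows "measure lborel ({p..q} \<union> {-q..-p}) = 2 * (q - p)"
proof -
  have "measure lborel ({p..q} \<union> {-q..-p}) = measure lborel {p..q} + measure lborel {-q..-p}"
    using assms by (intro measure_Un_AE) (auto simp: fmeasurable_def intro!: AE_I2)
  then show ?thesis using assms by simp
qed

lemma measure_ring: "0 < p \<Longrightarrow> measure lborel (ring p) = 6 * p"
  by (simp add: ring_eq measure_symmetric_Un)

text \<open>The rings shrink geometrically while consecutive centres differ by a bounded multiple of
  \<open>e\<close>, so the deviations from the first centre form a convergent series.\<close>

lemma osc_le_ball_if_rings:
  assumes f [measurable]: "f \<in> borel_measurable borel" and e: "0 \<le> e" and p: "0 < p"
    and rings: "\<And>p. 0 < p \<Longrightarrow> osc_le f (ring p) e"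
  shows "osc_le f {-p..p} (9 * e)"
proof -
  \<comment> \<open>With the radius \<open>p / 4\<close> the outermost ring ends exactly at
    \<open>p\<close>.\<close>
  define A where "A i = ring (p / 4 * (1/2)^i)" for i :: nat
  define r where "r i = p / 4 * (1/2)^i" for i :: nat
  have rpos: "0 < r i" for i using p by (simp add: r_def)
  have A: "A i = ring (r i)" for i by (simp add: A_def r_def)
  have rS: "r (Suc i) = r i / 2" for i by (simp add: r_def)
  have "\<exists>c. deviation f (A i) c \<le> ennreal (e * (6 * r i))" for i
    using rings[OF rpos[of i]] measure_ring[OF rpos[of i]] by (simp add: A osc_le_def)
  then obtain c where c: "\<And>i. deviation f (A i) (c i) \<le> ennreal (e * (6 * r i))" by metis
  \<comment> \<open>The overlap has measure \<open>2 * r i\<close> and the two deviations add up to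
    \<open>9 * e * r i\<close>; the resulting \<open>9 / 2 * e\<close> is rounded up to
    \<open>5 * e\<close>.\<close>
  have step: "\<bar>c i - c (Suc i)\<bar> \<le> 5 * e" for i
  proof -
    let ?U = "{r i..2 * r i} \<union> {-(2 * r i)..-r i}"
    have "?U \<subseteq> A i" "?U \<subseteq> A (Suc i)"
      using rpos[of i] by (auto simp: A ring_def rS)
    then have "deviation f ?U (c i) \<le> ennreal (e * (6 * r i))" "deviation f ?U (c (Suc i)) \<le> ennreal (e * (6 * r (Suc i)))"
      using c deviation_mono order_trans by blast+
    then have "\<bar>c i - c (Suc i)\<bar> * measure lborel ?U \<le> e * (6 * r i) + e * (6 * r (Suc i))"
      using rpos e by (intro center_distance) (auto simp: less_imp_le)
    then have "\<bar>c i - c (Suc i)\<bar> * 2 * r i \<le> (9 * e) * r i"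
      using rpos[of i] by (simp add: measure_symmetric_Un rS algebra_simps)
    then have "\<bar>c i - c (Suc i)\<bar> * 2 \<le> 9 * e"
      using rpos[of i] by simp
    then have "\<bar>c i - c (Suc i)\<bar> \<le> 9 / 2 * e" by simp
    also have "\<dots> \<le> 5 * e" using e by simp
    finally show ?thesis .
  qed
  have c0: "\<bar>c i - c 0\<bar> \<le> 5 * e * real i" for i
  proof (induction i)
    case (Suc i)
    then show ?case using step[of i] by (simp add: algebra_simps abs_if split: if_splits)
  qed auto
  have dev: "deviation f (A i) (c 0) \<le> ennreal (6 * e * (1 + 5 * real i) * r i)" for i
  proof -
    have "deviation f (A i) (c 0) \<le> deviation f (A i) (c i) + ennreal (\<bar>c i - c 0\<bar> * measure lborel (A i))"
      by (rule deviation_shift_center) (auto simp: A bounded_ring)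
    also have "\<dots> \<le> ennreal (e * (6 * r i)) + ennreal (5 * e * real i * (6 * r i))"
      using c[of i] c0[of i] rpos[of i] measure_ring[OF rpos[of i]]
      by (intro add_mono ennreal_leI) (auto simp: A intro!: mult_right_mono)
    also have "\<dots> = ennreal (6 * e * (1 + 5 * real i) * r i)"
      using e rpos[of i] by (subst ennreal_plus[symmetric]) (auto simp: algebra_simps)
    finally show ?thesis .
  qed
  have cover: "{-p..p} \<subseteq> (\<Union>i. A i) \<union> {0}"
  proof
    fix x assume x: "x \<in> {-p..p}"
    show "x \<in> (\<Union>i. A i) \<union> {0}"
    proof (cases "x = 0")
      case False
      then have "0 < \<bar>x\<bar>" by simp
      then obtain n where n: "(1/2)^n < \<bar>x\<bar> / (p / 4)"
        using p real_arch_pow_inv[of "\<bar>x\<bar> / (p / 4)" "1/2"] by auto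
      then have ex: "\<exists>n. r n < \<bar>x\<bar>" using p by (auto simp: r_def field_simps)
      define m where "m = (LEAST n. r n < \<bar>x\<bar>)"
      have m: "r m < \<bar>x\<bar>" using ex unfolding m_def by (rule LeastI_ex)
      have "\<bar>x\<bar> \<le> 4 * r m"
      proof (cases m)
        case 0 then show ?thesis using x by (auto simp: r_def)
      next
        case (Suc k)
        then have "\<not> r k < \<bar>x\<bar>" using not_less_Least[of k "\<lambda>n. r n < \<bar>x\<bar>"] m_def by auto
        then show ?thesis using rS[of k] Suc by auto
      qed
      with m show ?thesis by (auto simp: A ring_def)
    qed simp
  qed
  \<comment> \<open>The total is \<open>6 * e * p / 4 * (2 + 5 * 2) = 18 * e * p\<close>, that is,
    \<open>9 * e\<close> times the length \<open>2 * p\<close>.\<close>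
  have "(\<lambda>i. (1/2::real)^i) sums 2" using geometric_sums[of "1/2::real"] by simp
  moreover have "(\<lambda>i. real i * (1/2)^i) sums 2"
    using sums_diff[OF geometric_deriv_sums[of "1/2::real"] geometric_sums[of "1/2::real"]]
    by (simp add: algebra_simps power2_eq_square)
  ultimately have "(\<lambda>i. (6 * e * p / 4) * ((1/2::real)^i + 5 * (real i * (1/2)^i))) sums ((6 * e * p / 4) * (2 + 5 * 2))"
    by (intro sums_mult sums_add)
  then have sums: "(\<lambda>i. 6 * e * (1 + 5 * real i) * r i) sums (18 * e * p)"
    by (simp add: r_def algebra_simps)
  have "deviation f {-p..p} (c 0) \<le> deviation f ((\<Union>i. A i) \<union> {0}) (c 0)"
    using cover by (rule deviation_mono)
  also have "\<dots> \<le> deviation f (\<Union>i. A i) (c 0) + deviation f {0} (c 0)"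
    by (rule deviation_Un) (auto simp: A)
  also have "deviation f {0} (c 0) = (\<integral>\<^sup>+x. 0 \<partial>(lborel::real measure))"
    unfolding deviation_def using AE_lborel_singleton[of 0] by (intro nn_integral_cong_AE) auto
  also have "deviation f (\<Union>i. A i) (c 0) \<le> (\<Sum>i. deviation f (A i) (c 0))"
    by (rule deviation_UN) (auto simp: A)
  also have "\<dots> \<le> (\<Sum>i. ennreal (6 * e * (1 + 5 * real i) * r i))"
    using dev by (intro suminf_le) auto
  also have "\<dots> = ennreal (18 * e * p)"
    using sums e rpos by (subst suminf_ennreal2) (auto simp: sums_iff less_imp_le)
  finally show ?thesis
    using p by (auto simp: osc_le_def algebra_simps)
qed

section \<open>Change of variables on compact sets\<close>

text \<open>The inverse of a continuous injection on a compact set is continuous, so the image of a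
  Borel set is a Borel preimage.\<close>

lemma borel_image_compact:
  fixes g :: "real \<Rightarrow> real"
  assumes "compact K" "continuous_on K g" "inj_on g K" "S \<in> sets borel" "S \<subseteq> K"
  shows "g ` S \<in> sets borel"
proof -
  let ?i = "the_inv_into K g"
  have "continuous_on (g ` K) ?i"
    using assms by (intro continuous_on_inv_into)
  then have m: "?i \<in> borel_measurable (restrict_space borel (g ` K))"
    by (rule borel_measurable_continuous_on_restrict)
  have cK: "g ` K \<in> sets borel"
    using assms compact_continuous_image borel_compact by blast
  have "?i -` S \<inter> space (restrict_space borel (g ` K)) \<in> sets (restrict_space borel (g ` K))"
    using m assms(4) by (rule measurable_sets)
  moreover have "?i -` S \<inter> space (restrict_space borel (g ` K)) = g ` S"
    using assms(3,5) by (auto simp: space_restrict_space the_inv_into_f_f subset_iff image_iff)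
  ultimately show ?thesis
    using cK by (auto simp: sets_restrict_space_iff)
qed

text \<open>Change of variables for the constant function 1 expresses the measure of the image as
  the integral of \<open>\<bar>g' x\<bar>\<close> over \<open>S\<close>.\<close>

lemma image_measure_bounds:
  fixes g :: "real \<Rightarrow> real"
  assumes K: "compact K" and inj: "inj_on g K"
    and der: "\<And>x. x \<in> K \<Longrightarrow> (g has_real_derivative g' x) (at x within K)"
    and bounds: "\<And>x. x \<in> K \<Longrightarrow> l \<le> \<bar>g' x\<bar> \<and> \<bar>g' x\<bar> \<le> L"
    and S: "S \<in> sets borel" "S \<subseteq> K"
  shows "l * measure lborel S \<le> measure lborel (g ` S)" (is ?thesis1)
    and "measure lborel (g ` S) \<le> L * measure lborel S" (is ?thesis2)
    and "g ` S \<in> sets borel" (is ?thesis3)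
proof -
  have cont: "continuous_on K g"
    using der by (rule DERIV_continuous_on)
  show borel: ?thesis3
    by (rule borel_image_compact[OF K cont inj S])
  have bdS: "bounded S" "bounded (g ` S)"
    using K S cont compact_imp_bounded compact_continuous_image bounded_subset image_mono by metis+
  have lmS: "S \<in> lmeasurable" "g ` S \<in> lmeasurable"
    using bdS S borel by (auto intro!: bounded_set_imp_lmeasurable)
  have one: "(\<lambda>_. 1::real) absolutely_integrable_on g ` S"
    using lmS by (simp add: absolutely_integrable_on_const)
  have *: "(\<lambda>x. \<bar>g' x\<bar> * 1) absolutely_integrable_on S \<and> integral S (\<lambda>x. \<bar>g' x\<bar> * 1) = measure lebesgue (g ` S)"
  proof (rule has_absolute_integral_change_of_variables_1'[where f = "\<lambda>_. 1", THEN iffD2])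
    show "(g has_real_derivative g' x) (at x within S)" if "x \<in> S" for x
      using der S that by (meson DERIV_subset subsetD)
    show "inj_on g S" using inj S inj_on_subset by blast
    show "(\<lambda>_. 1::real) absolutely_integrable_on g ` S \<and> integral (g ` S) (\<lambda>_. 1::real) = measure lebesgue (g ` S)"
      using one lmS by (simp add: lmeasure_integral)
  qed (use S in auto)
  then have int: "(\<lambda>x. \<bar>g' x\<bar>) integrable_on S" and eq: "integral S (\<lambda>x. \<bar>g' x\<bar>) = measure lebesgue (g ` S)"
    by (auto intro: set_lebesgue_integral_eq_integral)
  have const: "integral S (\<lambda>x. k) = k * measure lebesgue S" for k :: real
    using lmS integral_mult_right[of S k "\<lambda>_. 1::real"] by (simp add: lmeasure_integral)
  have "l * measure lebesgue S \<le> measure lebesgue (g ` S)"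
    unfolding eq[symmetric] const[symmetric]
    by (rule integral_le) (use int lmS bounds S in \<open>auto intro: integrable_on_const\<close>)
  moreover have "measure lebesgue (g ` S) \<le> L * measure lebesgue S"
    unfolding eq[symmetric] const[symmetric]
    by (rule integral_le) (use int lmS bounds S in \<open>auto intro: integrable_on_const\<close>)
  ultimately show ?thesis1 ?thesis2
    using S borel by (auto simp: measure_completion)
qed

text \<open>The lower bound on image measures says that the push-forward of Lebesgue measure on
  \<open>K\<close> is dominated, as a measure, by \<open>1 / l\<close> times Lebesgue measure on the
  image. Monotonicity of the integral in the measure then treats all \<open>G\<close> at
  once.\<close>

lemma nn_integral_compose_le:
  fixes g :: "real \<Rightarrow> real" and G :: "real \<Rightarrow> ennreal"
  assumes K: "compact K" and inj: "inj_on g K"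
    and der: "\<And>x. x \<in> K \<Longrightarrow> (g has_real_derivative g' x) (at x within K)"
    and bounds: "\<And>x. x \<in> K \<Longrightarrow> l \<le> \<bar>g' x\<bar> \<and> \<bar>g' x\<bar> \<le> L" and l: "0 < l"
    and [measurable]: "g \<in> borel_measurable borel" "G \<in> borel_measurable borel"
  shows "(\<integral>\<^sup>+x\<in>K. G (g x) \<partial>lborel) \<le> ennreal (1 / l) * (\<integral>\<^sup>+y\<in>g ` K. G y \<partial>lborel)"
proof -
  have cont: "continuous_on K g"
    using der by (rule DERIV_continuous_on)
  have [measurable]: "K \<in> sets borel" "g ` K \<in> sets borel"
    using K cont compact_continuous_image borel_compact by blast+
  define M where "M = distr (density lborel (indicator K)) borel g"
  define N where "N = scale_measure (ennreal (1 / l)) (density lborel (indicator (g ` K)))"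
  have sets: "sets M = sets N" by (simp add: M_def N_def)
  have "emeasure M B \<le> emeasure N B" for B
  proof (cases "B \<in> sets borel")
    case [measurable]: True
    let ?S = "g -` B \<inter> K"
    have gB [measurable]: "g -` B \<in> sets borel" by (rule measurable_sets_borel[of g borel]) auto
    have S: "?S \<in> sets borel" by measurable
    have bd: "bounded ?S" "bounded (g ` K)"
      using K cont compact_imp_bounded compact_continuous_image by (auto simp: bounded_Int)
    have gS: "g ` ?S = g ` K \<inter> B" by auto
    have "emeasure M B = emeasure lborel ?S"
      unfolding M_def by (simp add: emeasure_distr emeasure_restricted Int_commute)
    also have "\<dots> = ennreal (measure lborel ?S)"
      using bd emeasure_bounded_finite[of ?S] by (simp add: emeasure_eq_ennreal_measure)
    also have "\<dots> \<le> ennreal (1 / l * measure lborel (g ` ?S))"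
    proof (rule ennreal_leI)
      have "l * measure lborel ?S \<le> measure lborel (g ` ?S)"
        by (rule image_measure_bounds(1)[OF K inj der bounds S]) auto
      then show "measure lborel ?S \<le> 1 / l * measure lborel (g ` ?S)"
        using l by (simp add: field_simps)
    qed
    also have "\<dots> = ennreal (1 / l) * emeasure lborel (g ` K \<inter> B)"
      using bd emeasure_bounded_finite[of "g ` K \<inter> B"] l
      by (simp add: gS emeasure_eq_ennreal_measure ennreal_mult[symmetric] bounded_Int)
    also have "\<dots> = emeasure N B"
      by (simp add: N_def emeasure_restricted)
    finally show ?thesis .
  next
    case False
    then show ?thesis using emeasure_notin_sets[of B M] by (simp add: M_def)
  qed
  then have "M \<le> N"
    using sets by (intro le_measure[THEN iffD2]) (auto simp: le_fun_def)
  then have "nn_integral M G \<le> nn_integral N G"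
    by (rule nn_integral_mono_measure[OF sets])
  moreover have "nn_integral M G = (\<integral>\<^sup>+x\<in>K. G (g x) \<partial>lborel)"
    by (simp add: M_def nn_integral_distr nn_integral_density mult.commute)
  moreover have "nn_integral N G = ennreal (1 / l) * (\<integral>\<^sup>+y\<in>g ` K. G y \<partial>lborel)"
    by (simp add: N_def nn_integral_scale_measure nn_integral_density mult.commute)
  ultimately show ?thesis by simp
qed

text \<open>The centre is kept. The integral grows by at most \<open>1 / l\<close> while the image
  is at most \<open>L\<close> times as long as \<open>K\<close>, so the distortion is the ratio
  \<open>L / l\<close> and independent of scale.\<close>

lemma osc_le_compose:
  fixes g :: "real \<Rightarrow> real"
  assumes K: "compact K" and inj: "inj_on g K"
    and der: "\<And>x. x \<in> K \<Longrightarrow> (g has_real_derivative g' x) (at x within K)"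
    and bounds: "\<And>x. x \<in> K \<Longrightarrow> l \<le> \<bar>g' x\<bar> \<and> \<bar>g' x\<bar> \<le> L" and l: "0 < l"
    and [measurable]: "g \<in> borel_measurable borel" "f \<in> borel_measurable borel"
    and osc: "osc_le f (g ` K) e" and e: "0 \<le> e"
  shows "osc_le (\<lambda>x. f (g x)) K (L / l * e)"
proof -
  have Kb: "K \<in> sets borel" using K by (rule borel_compact)
  obtain c where c: "deviation f (g ` K) c \<le> ennreal (e * measure lborel (g ` K))"
    using osc by (auto simp: osc_le_def)
  have "deviation (\<lambda>x. f (g x)) K c \<le> ennreal (1 / l) * deviation f (g ` K) c"
    unfolding deviation_def
    by (rule nn_integral_compose_le[OF K inj der bounds l, where G = "\<lambda>y. ennreal \<bar>f y - c\<bar>"]) auto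
  also have "\<dots> \<le> ennreal (1 / l) * ennreal (e * measure lborel (g ` K))"
    using c by (rule mult_left_mono) simp
  also have "\<dots> = ennreal (1 / l * (e * measure lborel (g ` K)))"
    using l e by (subst ennreal_mult[symmetric]) auto
  also have "\<dots> \<le> ennreal (L / l * e * measure lborel K)"
  proof (rule ennreal_leI)
    have "measure lborel (g ` K) \<le> L * measure lborel K"
      by (rule image_measure_bounds(2)[OF K inj der bounds Kb]) auto
    then have "(e / l) * measure lborel (g ` K) \<le> (e / l) * (L * measure lborel K)"
      using l e by (intro mult_left_mono) auto
    then show "1 / l * (e * measure lborel (g ` K)) \<le> L / l * e * measure lborel K"
      by (simp add: algebra_simps)
  qed
  finally show ?thesis by (auto simp: osc_le_def)
qed

subsection \<open>Oscillation on shells and inversion\<close>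

text \<open>The sign makes the inversion increasing on each half line. Since
  \<open>inverse 0 = 0\<close>, it is an involution of all reals; the value at 0 stands in for the
  point at infinity and is harmless up to null sets.\<close>

definition nrecip :: "real \<Rightarrow> real" where
  "nrecip x = - inverse x"

lemma nrecip_nrecip [simp]: "nrecip (nrecip x) = x"
  by (simp add: nrecip_def)

lemma nrecip_measurable [measurable]: "nrecip \<in> borel_measurable borel"
  unfolding nrecip_def by measurable

lemma inj_nrecip: "inj_on nrecip A"
  by (rule inj_onI) (simp add: nrecip_def)

lemma DERIV_nrecip: "x \<noteq> 0 \<Longrightarrow> (nrecip has_real_derivative inverse (x\<^sup>2)) (at x within S)"
  unfolding nrecip_def [abs_def] by (auto intro!: derivative_eq_intros simp: power2_eq_square)

lemma image_Icc_mono: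
  fixes g :: "real \<Rightarrow> real"
  assumes "a \<le> b" "continuous_on {a..b} g" "\<And>x y. a \<le> x \<Longrightarrow> x \<le> y \<Longrightarrow> y \<le> b \<Longrightarrow> g x \<le> g y"
  shows "g ` {a..b} = {g a..g b}"
proof (intro equalityI subsetI)
  fix y assume "y \<in> {g a..g b}"
  then obtain x where "a \<le> x" "x \<le> b" "g x = y"
    using IVT'[of g a y b] assms by auto
  then show "y \<in> g ` {a..b}" by auto
qed (use assms in auto)

lemma abs_nrecip: "\<bar>nrecip x\<bar> = inverse \<bar>x\<bar>"
  by (simp add: nrecip_def)

lemma nrecip_mono: "0 < x * y \<Longrightarrow> x \<le> y \<Longrightarrow> nrecip x \<le> nrecip y"
  by (auto simp: nrecip_def zero_less_mult_iff intro: le_imp_inverse_le le_imp_inverse_le_neg)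

lemma nrecip_image_Icc:
  assumes "0 < a * b" "a \<le> b"
  shows "nrecip ` {a..b} = {nrecip a..nrecip b}"
proof (rule image_Icc_mono[OF assms(2)])
  have nz: "x \<noteq> 0" if "x \<in> {a..b}" for x
    using assms that by (auto simp: zero_less_mult_iff)
  then show "continuous_on {a..b} nrecip"
    unfolding nrecip_def [abs_def] by (intro continuous_intros) auto
  fix x y assume "a \<le> x" "x \<le> y" "y \<le> b"
  then show "nrecip x \<le> nrecip y"
    using assms by (intro nrecip_mono) (auto simp: zero_less_mult_iff)
qed

lemma compact_ring: "compact (ring p)"
proof -
  have "closed (ring p)"
    unfolding ring_def by (intro closed_Collect_conj closed_Collect_le continuous_intros)
  then show ?thesis using bounded_ring by (simp add: compact_eq_bounded_closed)
qed

lemma nrecip_ring: "0 < p \<Longrightarrow> nrecip ` ring p = ring (1 / (4 * p))"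
proof (intro equalityI subsetI)
  have *: "nrecip x \<in> ring (1 / (4 * p))" if "x \<in> ring p" "0 < p" for x p
  proof -
    have x: "p \<le> \<bar>x\<bar>" "\<bar>x\<bar> \<le> 4 * p" using that by (auto simp: ring_def)
    then have "inverse (4 * p) \<le> inverse \<bar>x\<bar>" "inverse \<bar>x\<bar> \<le> inverse p"
      using that by (intro le_imp_inverse_le; simp)+
    moreover have "inverse (4 * p) = 1 / (4 * p)" "inverse p = 4 * (1 / (4 * p))"
      using that by (simp_all add: inverse_eq_divide)
    ultimately show ?thesis
      by (simp only: ring_def abs_nrecip mem_Collect_eq simp_thms)
  qed
  fix y assume "0 < p"
  then show "y \<in> nrecip ` ring p \<Longrightarrow> y \<in> ring (1 / (4 * p))" using * by auto
  assume "y \<in> ring (1 / (4 * p))"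
  then have "nrecip y \<in> ring p" using *[of y "1 / (4 * p)"] \<open>0 < p\<close> by simp
  then show "y \<in> nrecip ` ring p" by (metis image_eqI nrecip_nrecip)
qed

text \<open>On a ring the derivative \<open>1 / x\<^sup>2\<close> varies by a factor of at most 16,
  whatever the radius.\<close>

lemma osc_le_nrecip:
  assumes K: "compact K" "K \<subseteq> ring p" "0 < p" and f [measurable]: "f \<in> borel_measurable borel"
    and "osc_le f (nrecip ` K) e" "0 \<le> e"
  shows "osc_le (\<lambda>x. f (nrecip x)) K (16 * e)"
proof -
  have b: "1 / (16 * p\<^sup>2) \<le> \<bar>inverse (x\<^sup>2)\<bar> \<and> \<bar>inverse (x\<^sup>2)\<bar> \<le> 1 / p\<^sup>2" "x \<noteq> 0" if "x \<in> K" for x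
  proof -
    have x: "p \<le> \<bar>x\<bar>" "\<bar>x\<bar> \<le> 4 * p" using K that by (auto simp: ring_def)
    then show "x \<noteq> 0" using \<open>0 < p\<close> by auto
    have "p\<^sup>2 \<le> x\<^sup>2" "x\<^sup>2 \<le> (4 * p)\<^sup>2"
      using x \<open>0 < p\<close> power_mono[of p "\<bar>x\<bar>" 2] power_mono[of "\<bar>x\<bar>" "4 * p" 2] by auto
    then have "inverse ((4 * p)\<^sup>2) \<le> inverse (x\<^sup>2)" "inverse (x\<^sup>2) \<le> inverse (p\<^sup>2)"
      using \<open>0 < p\<close> \<open>x \<noteq> 0\<close> by (intro le_imp_inverse_le; simp)+
    then show "1 / (16 * p\<^sup>2) \<le> \<bar>inverse (x\<^sup>2)\<bar> \<and> \<bar>inverse (x\<^sup>2)\<bar> \<le> 1 / p\<^sup>2"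
      by (simp add: power_mult_distrib inverse_eq_divide)
  qed
  have "osc_le (\<lambda>x. f (nrecip x)) K ((1 / p\<^sup>2) / (1 / (16 * p\<^sup>2)) * e)"
    using assms b by (intro osc_le_compose[OF K(1) inj_nrecip DERIV_nrecip]) auto
  then show ?thesis using \<open>0 < p\<close> by simp
qed

definition shell_osc :: "(real \<Rightarrow> real) \<Rightarrow> real \<Rightarrow> bool" where
  "shell_osc f e \<longleftrightarrow>
     (\<forall>a b. 0 < a \<and> a < b \<and> b \<le> 4 * a \<longrightarrow> osc_le f {a..b} e \<and> osc_le f {-b..-a} e) \<and>
     (\<forall>p>0. osc_le f (ring p) e)"


lemma shell_osc_Icc:
  assumes "shell_osc f e" "a < b" "0 < a \<and> b \<le> 4 * a \<or> b < 0 \<and> 4 * b \<le> a"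
  shows "osc_le f {a..b} e"
  using assms(3)
proof
  assume "b < 0 \<and> 4 * b \<le> a"
  then have "0 < - b \<and> - b < - a \<and> - a \<le> 4 * (- b)" using assms(2) by auto
  then have "osc_le f {-(-a)..-(-b)} e" using assms(1) unfolding shell_osc_def by blast
  then show ?thesis by simp
qed (use assms in \<open>auto simp: shell_osc_def\<close>)

lemma shell_osc_ring: "shell_osc f e \<Longrightarrow> 0 < p \<Longrightarrow> osc_le f (ring p) e"
  by (simp add: shell_osc_def)

text \<open>An interval shorter than its distance from 0 lies in a shell. Any other interval lies in
  the ball of radius \<open>2 * (b - a)\<close> around 0, which is only four times as long:
  \<open>36 = 4 * 9\<close>.\<close>

lemma bmo_if_shell:
  assumes f: "f \<in> borel_measurable borel" and sh: "shell_osc f e" and e: "0 \<le> e" and ab: "a < b"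
  shows "osc_le f {a..b} (36 * e)"
proof -
  consider "b - a < a \<or> b - a < - b" | "a \<le> b - a" "- b \<le> b - a" by linarith
  then show ?thesis
  proof cases
    case 1
    then have "osc_le f {a..b} e"
      by (intro shell_osc_Icc[OF sh ab]) (use ab in linarith)
    then show ?thesis by (rule osc_le_mono) (use e in simp)
  next
    case 2
    let ?p = "2 * (b - a)"
    have "osc_le f {-?p..?p} (9 * e)"
      by (rule osc_le_ball_if_rings) (use f shell_osc_ring[OF sh] ab e in auto)
    then have "osc_le f {a..b} (4 * (9 * e))"
      by (rule osc_le_subset) (use 2 ab e in auto)
    then show ?thesis by simp
  qed
qed

text \<open>A shell that leaves \<open>{-2..2}\<close> has all its points outside
  \<open>{-1/2..1/2}\<close>, so its inversion lies inside \<open>{-2..2}\<close>; rings are divided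
  in the same way. The constant 32 dominates \<open>16 * (4 / 3)\<close>, the cost of restricting to
  a ring and inverting.\<close>

lemma shell_if_local:
  assumes f [measurable]: "f \<in> borel_measurable borel" and e: "0 \<le> e"
    and loc: "\<And>a b. -2 \<le> a \<Longrightarrow> a < b \<Longrightarrow> b \<le> 2 \<Longrightarrow> osc_le f {a..b} e"
    and loc': "\<And>a b. -2 \<le> a \<Longrightarrow> a < b \<Longrightarrow> b \<le> 2 \<Longrightarrow> osc_le (\<lambda>x. f (nrecip x)) {a..b} e"
  shows "shell_osc f (32 * e)"
proof -
  have ring_small: "osc_le g (ring p) (4 / 3 * e)"
    if "\<And>a b. -2 \<le> a \<Longrightarrow> a < b \<Longrightarrow> b \<le> 2 \<Longrightarrow> osc_le g {a..b} e" "0 < p" "p \<le> 1/2" for g p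
    by (rule osc_le_subset[of g "{-(4 * p)..4 * p}"])
      (use that e measure_ring[of p] in \<open>auto simp: ring_def\<close>)
  have "osc_le f (ring p) (32 * e)" if p: "0 < p" for p
  proof (cases "p \<le> 1/2")
    case True
    then show ?thesis using ring_small[OF loc p] e by (auto intro: osc_le_mono)
  next
    case False
    then have "osc_le (\<lambda>x. f (nrecip x)) (ring (1 / (4 * p))) (4 / 3 * e)"
      by (intro ring_small[OF loc']) (auto simp: field_simps)
    then have "osc_le (\<lambda>x. f (nrecip (nrecip x))) (ring p) (16 * (4 / 3 * e))"
      using p e by (intro osc_le_nrecip[where f = "\<lambda>x. f (nrecip x)"])
        (auto simp: nrecip_ring compact_ring)
    then show ?thesis using e by (auto intro: osc_le_mono)
  qed
  moreover have "osc_le f {a..b} (32 * e)"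
    if ab: "a < b" "0 < a \<and> b \<le> 4 * a \<or> b < 0 \<and> 4 * b \<le> a" for a b
  proof (cases "-2 \<le> a \<and> b \<le> 2")
    case True
    then have "osc_le f {a..b} e" using ab(1) by (intro loc) auto
    then show ?thesis by (rule osc_le_mono) (use e in simp)
  next
    case False
    define p where "p = min \<bar>a\<bar> \<bar>b\<bar>"
    have p: "0 < p" "1/2 < p" "{a..b} \<subseteq> ring p"
      using ab False by (auto simp: p_def ring_def abs_if min_def split: if_splits)
    have im: "nrecip ` {a..b} = {nrecip a..nrecip b}"
      using ab by (intro nrecip_image_Icc) (auto simp: zero_less_mult_iff)
    have "\<bar>nrecip a\<bar> \<le> 2" "\<bar>nrecip b\<bar> \<le> 2"
      using p(2) le_imp_inverse_le[of "1/2" "\<bar>a\<bar>"] le_imp_inverse_le[of "1/2" "\<bar>b\<bar>"]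
      by (auto simp: abs_nrecip p_def)
    moreover have "nrecip a < nrecip b"
      using ab by (auto simp: nrecip_def)
    ultimately have "osc_le (\<lambda>x. f (nrecip x)) (nrecip ` {a..b}) e"
      unfolding im by (intro loc') auto
    then have "osc_le (\<lambda>x. f (nrecip (nrecip x))) {a..b} (16 * e)"
      using p e by (intro osc_le_nrecip[where f = "\<lambda>x. f (nrecip x)" and p = p]) auto
    then show ?thesis using e by (auto intro: osc_le_mono)
  qed
  ultimately show ?thesis
    by (auto simp: shell_osc_def)
qed

lemma shell_if_bmo:
  assumes "f \<in> borel_measurable borel" "0 \<le> e" "\<And>a b. a < b \<Longrightarrow> osc_le f {a..b} e"
  shows "shell_osc f (2 * e)"
proof -
  have "osc_le f (ring p) (4 / 3 * e)" if "0 < p" for p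
    by (rule osc_le_subset[of f "{-(4 * p)..4 * p}"])
      (use that assms measure_ring[of p] in \<open>auto simp: ring_def\<close>)
  then have "osc_le f (ring p) (2 * e)" if "0 < p" for p
    by (rule osc_le_mono) (use that assms(2) in auto)
  moreover have "osc_le f {a..b} (2 * e)" if "a < b" for a b
    by (rule osc_le_mono[OF assms(3)]) (use that assms(2) in auto)
  ultimately show ?thesis
    by (auto simp: shell_osc_def)
qed

lemma shell_nrecip:
  assumes f [measurable]: "f \<in> borel_measurable borel" and "shell_osc f e" "0 \<le> e"
  shows "shell_osc (\<lambda>x. f (nrecip x)) (16 * e)"
proof -
  have "osc_le (\<lambda>x. f (nrecip x)) (ring p) (16 * e)" if "0 < p" for p
    using that assms by (intro osc_le_nrecip[of _ p]) (auto simp: nrecip_ring compact_ring intro: shell_osc_ring)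
  moreover have "osc_le (\<lambda>x. f (nrecip x)) {a..b} (16 * e)"
    if ab: "a < b" "0 < a \<and> b \<le> 4 * a \<or> b < 0 \<and> 4 * b \<le> a" for a b
  proof -
    define p where "p = min \<bar>a\<bar> \<bar>b\<bar>"
    have p: "0 < p" "{a..b} \<subseteq> ring p"
      using ab by (auto simp: p_def ring_def abs_if min_def)
    have im: "nrecip ` {a..b} = {nrecip a..nrecip b}"
      using ab by (intro nrecip_image_Icc) (auto simp: zero_less_mult_iff)
    have "osc_le f {nrecip a..nrecip b} e"
    proof (rule shell_osc_Icc[OF assms(2)])
      show "nrecip a < nrecip b" using ab by (auto simp: nrecip_def)
      show "0 < nrecip a \<and> nrecip b \<le> 4 * nrecip a \<or> nrecip b < 0 \<and> 4 * nrecip b \<le> nrecip a"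
        using ab by (elim disjE; simp add: nrecip_def field_simps)
    qed
    then show ?thesis
      using p assms(3) im by (intro osc_le_nrecip[of _ p]) auto
  qed
  ultimately show ?thesis
    by (auto simp: shell_osc_def)
qed

section \<open>Angles and the stereographic coordinate\<close>

text \<open>\<open>cis t\<close> is the image of \<open>tan ((t - pi) / 2)\<close> under the Cayley transform; the values at multiples
  of \<open>2 * pi\<close>, which correspond to \<open>\<infinity>\<close>, are junk.\<close>

definition circ :: "(real \<Rightarrow> real) \<Rightarrow> real \<Rightarrow> real" where
  "circ f t = f (tan ((t - pi) / 2))"

lemma tan_measurable [measurable]: "(tan :: real \<Rightarrow> real) \<in> borel_measurable borel"
  unfolding tan_def [abs_def] by measurable

lemma circ_measurable [measurable]: "f \<in> borel_measurable borel \<Longrightarrow> circ f \<in> borel_measurable borel"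
  unfolding circ_def [abs_def]
  by (rule measurable_compose[of "\<lambda>t. tan ((t - pi) / 2)" borel borel f]) measurable

lemma tan_minus_half_pi: "tan (x - pi / 2) = nrecip (tan x)"
  by (simp add: tan_def nrecip_def sin_diff cos_diff)

lemma tan_plus_half_pi: "tan (x + pi / 2) = nrecip (tan x)"
  by (simp add: tan_def nrecip_def sin_add cos_add)

lemma tan_periodic_int': "tan (x + pi * of_int n) = tan x"
  using tan_periodic_int[of x n] by (simp add: mult.commute)

text \<open>Around every multiple of \<open>pi\<close> the half-angle tangent is a regular
  coordinate. The even multiples are the angles of the point at infinity, and there the coordinate
  differs from the one on the line by the inversion.\<close>

lemma circ_chart:
  "circ f t = (if even n then f (nrecip (tan ((t - pi * of_int n) / 2))) else f (tan ((t - pi * of_int n) / 2)))"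
proof (cases "even n")
  case True
  then obtain k where "n = 2 * k" by (elim evenE)
  then have "(t - pi) / 2 = ((t - pi * of_int n) / 2 - pi / 2) + pi * of_int k" by (simp add: field_simps)
  then have "tan ((t - pi) / 2) = tan ((t - pi * of_int n) / 2 - pi / 2)"
    by (metis tan_periodic_int')
  then show ?thesis using True by (simp add: circ_def tan_minus_half_pi)
next
  case False
  then obtain k where "n = 2 * k + 1" by (elim oddE)
  then have "(t - pi) / 2 = (t - pi * of_int n) / 2 + pi * of_int k" by (simp add: field_simps)
  then have "tan ((t - pi) / 2) = tan ((t - pi * of_int n) / 2)"
    by (metis tan_periodic_int')
  then show ?thesis using False by (simp add: circ_def)
qed

lemma circ_periodic: "circ f (t + 2 * pi * of_int n) = circ f t"
proof -
  have "(t + 2 * pi * of_int n - pi) / 2 = (t - pi) / 2 + pi * of_int n" by (simp add: field_simps)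
  then show ?thesis unfolding circ_def by (simp only: tan_periodic_int')
qed

lemma circ_arctan: "circ f (pi + 2 * arctan x) = f x"
  by (simp add: circ_def tan_arctan)

lemma circ_arctan': "circ f (2 * arctan x) = f (nrecip x)"
  using circ_chart[of f "2 * arctan x" 0] by (simp add: tan_arctan)

lemma cos_ge_half: "\<bar>x\<bar> \<le> pi / 3 \<Longrightarrow> 1 / 2 \<le> cos x"
  using cos_monotone_0_pi_le[of "\<bar>x\<bar>" "pi / 3"] by (simp add: cos_60)

lemma abs_tan_le_2: "\<bar>x\<bar> \<le> pi / 3 \<Longrightarrow> \<bar>tan x\<bar> \<le> 2"
proof -
  assume x: "\<bar>x\<bar> \<le> pi / 3"
  have "\<bar>sin x\<bar> \<le> 2 * cos x" using cos_ge_half[OF x] abs_sin_le_one[of x] by linarith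
  then show ?thesis using cos_ge_half[OF x] by (simp add: tan_def field_simps)
qed

text \<open>The half angle is at most \<open>pi / 3\<close>, where the cosine is at least
  \<open>1 / 2\<close>.\<close>

lemma tan_half_deriv:
  assumes "\<bar>t - c\<bar> \<le> 2 * pi / 3"
  shows "((\<lambda>t. tan ((t - c) / 2)) has_real_derivative inverse ((cos ((t - c) / 2))\<^sup>2) / 2) (at t within S)"
    and "1 / 2 \<le> inverse ((cos ((t - c) / 2))\<^sup>2) / 2" "inverse ((cos ((t - c) / 2))\<^sup>2) / 2 \<le> 2"
proof -
  let ?x = "(t - c) / 2"
  have c: "1 / 2 \<le> cos ?x" using assms by (intro cos_ge_half) auto
  then have nz: "cos ?x \<noteq> 0" by auto
  show "((\<lambda>t. tan ((t - c) / 2)) has_real_derivative inverse ((cos ?x)\<^sup>2) / 2) (at t within S)"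
    by (auto intro!: derivative_eq_intros nz)
  have "(1 / 2)\<^sup>2 \<le> (cos ?x)\<^sup>2" using c by (intro power_mono) auto
  moreover have "(cos ?x)\<^sup>2 \<le> 1" by (simp add: abs_square_le_1)
  ultimately show "1 / 2 \<le> inverse ((cos ?x)\<^sup>2) / 2" "inverse ((cos ?x)\<^sup>2) / 2 \<le> 2"
    using nz by (auto simp: field_simps power2_eq_square)
qed

text \<open>The midpoint lies within \<open>pi / 2\<close> of a multiple of \<open>pi\<close> and
  half the length adds at most \<open>pi / 6\<close>; the sum is \<open>2 * pi / 3\<close>, the
  range on which \<open>tan_half_deriv\<close> is uniform.\<close>

lemma chart_exists:
  fixes a b :: real
  assumes "a \<le> b" "b - a \<le> pi / 3"
  obtains n :: int where "\<And>t. a \<le> t \<Longrightarrow> t \<le> b \<Longrightarrow> \<bar>t - pi * of_int n\<bar> \<le> 2 * pi / 3"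
proof
  define n where "n = round ((a + b) / (2 * pi))"
  have "\<bar>of_int n - (a + b) / (2 * pi)\<bar> \<le> 1 / 2"
    unfolding n_def by (rule of_int_round_abs_le)
  then have "\<bar>pi * (of_int n - (a + b) / (2 * pi))\<bar> \<le> pi / 2"
    by (simp add: abs_mult)
  moreover have "pi * (of_int n - (a + b) / (2 * pi)) = pi * of_int n - (a + b) / 2"
    using pi_gt_zero by (simp add: right_diff_distrib)
  ultimately have n: "\<bar>pi * of_int n - (a + b) / 2\<bar> \<le> pi / 2"
    by simp
  fix t assume t: "a \<le> t" "t \<le> b"
  have "\<bar>t - (a + b) / 2\<bar> \<le> pi / 6" using t assms by (auto simp: abs_if field_simps)
  with n have "\<bar>t - pi * of_int n\<bar> \<le> pi / 2 + pi / 6" by linarith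
  then show "\<bar>t - pi * of_int n\<bar> \<le> 2 * pi / 3" by simp
qed

lemma tan_half_chart:
  assumes ab: "a \<le> b" and near: "\<And>t. a \<le> t \<Longrightarrow> t \<le> b \<Longrightarrow> \<bar>t - c\<bar> \<le> 2 * pi / 3"
  shows "(\<lambda>t. tan ((t - c) / 2)) ` {a..b} = {tan ((a - c) / 2)..tan ((b - c) / 2)}"
    and "tan ((b - c) / 2) - tan ((a - c) / 2) \<le> 2 * (b - a)"
    and "inj_on (\<lambda>t. tan ((t - c) / 2)) {a..b}"
    and "a < b \<Longrightarrow> tan ((a - c) / 2) < tan ((b - c) / 2)"
    and "- 2 \<le> tan ((a - c) / 2)" "tan ((b - c) / 2) \<le> 2"
proof -
  have lim: "- (pi / 2) < (t - c) / 2 \<and> (t - c) / 2 < pi / 2" if "t \<in> {a..b}" for t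
  proof -
    have "\<bar>t - c\<bar> \<le> 2 * pi / 3" using near that by auto
    then have "\<bar>t - c\<bar> < pi" using pi_gt_zero by linarith
    then show ?thesis by (simp add: abs_less_iff)
  qed
  have mono: "tan ((x - c) / 2) \<le> tan ((y - c) / 2)" if "a \<le> x" "x \<le> y" "y \<le> b" for x y
    using lim[of x] lim[of y] that by (cases "x = y") (auto intro!: less_imp_le tan_monotone)
  have smono: "tan ((x - c) / 2) < tan ((y - c) / 2)" if "a \<le> x" "x < y" "y \<le> b" for x y
    using lim[of x] lim[of y] that by (auto intro!: tan_monotone)
  show "(\<lambda>t. tan ((t - c) / 2)) ` {a..b} = {tan ((a - c) / 2)..tan ((b - c) / 2)}"
    by (intro image_Icc_mono[OF ab] DERIV_continuous_on[OF tan_half_deriv(1)] mono) (use near in auto)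
  show "inj_on (\<lambda>t. tan ((t - c) / 2)) {a..b}"
    by (intro linorder_inj_onI) (use smono in fastforce)+
  show "a < b \<Longrightarrow> tan ((a - c) / 2) < tan ((b - c) / 2)"
    using smono by auto
  have "\<bar>(a - c) / 2\<bar> \<le> pi / 3" "\<bar>(b - c) / 2\<bar> \<le> pi / 3" using near[of a] near[of b] ab by auto
  then show "- 2 \<le> tan ((a - c) / 2)" "tan ((b - c) / 2) \<le> 2"
    using abs_tan_le_2 by (smt (verit))+
  show "tan ((b - c) / 2) - tan ((a - c) / 2) \<le> 2 * (b - a)"
  proof (cases "a < b")
    case True
    obtain z where "a < z" "z < b" "tan ((b - c) / 2) - tan ((a - c) / 2) = (b - a) * (inverse ((cos ((z - c) / 2))\<^sup>2) / 2)"
      using MVT2[OF True, of "\<lambda>t. tan ((t - c) / 2)" "\<lambda>t. inverse ((cos ((t - c) / 2))\<^sup>2) / 2"] tan_half_deriv(1)[OF near]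
      by auto
    then show ?thesis
      using tan_half_deriv(3)[OF near, of z] True mult_left_mono[of "inverse ((cos ((z - c) / 2))\<^sup>2) / 2" 2 "b - a"] by auto
  qed (use ab in auto)
qed

text \<open>One chart covers the interval, with distortion \<open>2 / (1 / 2) = 4\<close> and
  lengths at most doubled. The scale \<open>d\<close> stays a parameter because the lemma serves
  both for bounded oscillation, with \<open>d = pi / 3\<close>, and for vanishing
  oscillation.\<close>

lemma osc_circ_small:
  assumes [measurable]: "f \<in> borel_measurable borel" and e: "0 \<le> e"
    and loc: "\<And>a b. -2 \<le> a \<Longrightarrow> a < b \<Longrightarrow> b \<le> 2 \<Longrightarrow> b - a \<le> 2 * d \<Longrightarrow> osc_le f {a..b} e"
    and loc': "\<And>a b. -2 \<le> a \<Longrightarrow> a < b \<Longrightarrow> b \<le> 2 \<Longrightarrow> b - a \<le> 2 * d \<Longrightarrow> osc_le (\<lambda>x. f (nrecip x)) {a..b} e"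
    and ab: "a < b" "b - a \<le> d" "b - a \<le> pi / 3"
  shows "osc_le (circ f) {a..b} (4 * e)"
proof -
  obtain n :: int where near: "\<And>t. a \<le> t \<Longrightarrow> t \<le> b \<Longrightarrow> \<bar>t - pi * of_int n\<bar> \<le> 2 * pi / 3"
    using chart_exists[of a b] ab by auto
  define c where "c = pi * of_int n"
  define F where "F = (if even n then \<lambda>x. f (nrecip x) else f)"
  have [measurable]: "F \<in> borel_measurable borel" by (simp add: F_def)
  have circ: "circ f t = F (tan ((t - c) / 2))" for t
    by (simp add: circ_chart[of f t n] F_def c_def)
  note near' = near[folded c_def]
  note ch = tan_half_chart[OF less_imp_le[OF ab(1)] near']
  have "osc_le F ((\<lambda>t. tan ((t - c) / 2)) ` {a..b}) e"
    unfolding ch(1) F_def using ch ab by (auto intro!: loc loc')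
  then have "osc_le (\<lambda>t. F (tan ((t - c) / 2))) {a..b} (2 / (1 / 2) * e)"
    by (rule osc_le_compose[OF compact_Icc ch(3) tan_half_deriv(1), rotated -2])
      (use near' tan_half_deriv[OF near'] e in \<open>auto simp: tan_def\<close>)
  then show ?thesis
    unfolding circ [abs_def] by simp
qed

text \<open>Two subintervals of two thirds of the length share the middle third, half of each. Then
  \<open>osc_le_Un\<close> with \<open>K = 2\<close> gives the factor \<open>2 * 2 + 2 = 6\<close>
  for each enlargement by \<open>3 / 2\<close>.\<close>

lemma osc_le_longer:
  assumes [measurable]: "f \<in> borel_measurable borel" and e: "0 \<le> e"
    and short: "\<And>a b. a < b \<Longrightarrow> b - a \<le> d \<Longrightarrow> osc_le f {a..b} e"
    and ab: "a < b" "b - a \<le> (3 / 2) ^ n * d"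
  shows "osc_le f {a..b} (6 ^ n * e)"
  using ab
proof (induction n arbitrary: a b)
  case 0
  then show ?case using short by simp
next
  case (Suc n)
  define l where "l = (b - a) / 3"
  have l: "0 < l" "2 * l \<le> (3 / 2) ^ n * d" "b = a + 3 * l" using Suc.prems by (auto simp: l_def field_simps)
  let ?S = "{a..a + 2 * l}" and ?T = "{a + l..b}"
  have "osc_le f ?S (6 ^ n * e)" "osc_le f ?T (6 ^ n * e)"
    using l by (auto intro!: Suc.IH)
  moreover have "?S \<inter> ?T = {a + l..a + 2 * l}" using l by auto
  moreover have "?S \<union> ?T = {a..b}" using l by auto
  ultimately show ?case
    using osc_le_Un[of f ?S ?T "6 ^ n * e" 2] l e by (simp add: mult_ac)
qed

text \<open>On \<open>{-2..2}\<close> the derivative \<open>2 / (1 + x\<^sup>2)\<close> lies between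
  \<open>2 / 5\<close> and 2, hence the factor 5. The base angle \<open>pi\<close> gives the chart
  at 0 and the base angle 0 the chart at infinity.\<close>

lemma osc_local_if_circ:
  assumes [measurable]: "f \<in> borel_measurable borel" and e: "0 \<le> e"
    and circ: "\<And>a b. a < b \<Longrightarrow> b - a \<le> 2 * pi \<Longrightarrow> osc_le (circ f) {a..b} e"
    and ab: "-2 \<le> a" "a < b" "b \<le> 2"
  shows "osc_le f {a..b} (5 * e)" and "osc_le (\<lambda>x. f (nrecip x)) {a..b} (5 * e)"
proof -
  have *: "osc_le (\<lambda>x. circ f (s + 2 * arctan x)) {a..b} (5 * e)" for s
  proof -
    have der: "((\<lambda>x. s + 2 * arctan x) has_real_derivative 2 / (1 + x\<^sup>2)) (at x within S)" for x S
      by (auto intro!: derivative_eq_intros simp: field_simps)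
    have bd: "2 / 5 \<le> \<bar>2 / (1 + x\<^sup>2)\<bar> \<and> \<bar>2 / (1 + x\<^sup>2)\<bar> \<le> 2" if "x \<in> {a..b}" for x
    proof -
      have "x\<^sup>2 \<le> 2\<^sup>2" using that ab by (intro power2_le_iff_abs_le[THEN iffD2]) auto
      then have "0 < 1 + x\<^sup>2" "1 + x\<^sup>2 \<le> 5" "1 \<le> 1 + x\<^sup>2" by (auto simp: add_pos_nonneg)
      then have "2 / 5 \<le> 2 / (1 + x\<^sup>2)" "2 / (1 + x\<^sup>2) \<le> 2 / 1"
        by (intro divide_left_mono; simp add: add_pos_nonneg)+
      then show ?thesis by simp
    qed
    have im: "(\<lambda>x. s + 2 * arctan x) ` {a..b} = {s + 2 * arctan a..s + 2 * arctan b}"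
      using ab by (intro image_Icc_mono DERIV_continuous_on[OF der]) (auto simp: arctan_le_iff)
    have "osc_le (circ f) ((\<lambda>x. s + 2 * arctan x) ` {a..b}) e"
      unfolding im using ab arctan_less_iff[of a b] arctan_lbound[of a] arctan_ubound[of b]
      by (intro circ) auto
    then have "osc_le (\<lambda>x. circ f (s + 2 * arctan x)) {a..b} (2 / (2 / 5) * e)"
      by (rule osc_le_compose[OF compact_Icc _ der bd, rotated -2])
        (use e in \<open>auto simp: inj_on_def arctan_eq_iff\<close>)
    then show ?thesis by simp
  qed
  show "osc_le f {a..b} (5 * e)" using *[of pi] by (simp add: circ_arctan)
  show "osc_le (\<lambda>x. f (nrecip x)) {a..b} (5 * e)" using *[of 0] by (simp add: circ_arctan')
qed

text \<open>Moebius invariance of BMO: the inversion \<^const>\<open>nrecip\<close> preserves the shell condition,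
  and the circle is covered by two charts on which the stereographic projection is bi-Lipschitz.\<close>

lemma osc_circ_if_bmo:
  assumes f [measurable]: "f \<in> borel_measurable borel" and e: "0 \<le> e"
    and bmo: "\<And>a b. a < b \<Longrightarrow> osc_le f {a..b} e"
    and ab: "a < b" "b - a \<le> 2 * pi"
  shows "osc_le (circ f) {a..b} (6 ^ 5 * 4608 * e)"
proof -
  have "shell_osc f (2 * e)"
    by (rule shell_if_bmo[OF f e bmo])
  then have "shell_osc (\<lambda>x. f (nrecip x)) (32 * e)"
    using shell_nrecip[OF f, of "2 * e"] e by simp
  \<comment> \<open>Here \<open>1152 = 36 * 32\<close>: the inversion turned \<open>2 * e\<close>
    into \<open>32 * e\<close> on shells, and returning to all intervals costs 36.\<close>
  then have bmo': "osc_le (\<lambda>x. f (nrecip x)) {a..b} (1152 * e)" if "a < b" for a b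
    using bmo_if_shell[of "\<lambda>x. f (nrecip x)" "32 * e" a b] that e by simp
  have bmo1: "osc_le f {a..b} (1152 * e)" if "a < b" for a b
    using osc_le_mono[OF bmo[OF that], of "1152 * e"] e by simp
  have "osc_le (circ f) {a..b} (4 * (1152 * e))" if "a < b" "b - a \<le> pi / 3" for a b
    by (rule osc_circ_small[where d = "pi / 3"]) (use bmo1 bmo' e that in auto)
  \<comment> \<open>Five enlargements suffice, since \<open>(3 / 2) ^ 5 > 6\<close> takes
    \<open>pi / 3\<close> beyond \<open>2 * pi\<close>.\<close>
  then have "osc_le (circ f) {a..b} (6 ^ 5 * (4 * (1152 * e)))"
    by (rule osc_le_longer[where d = "pi / 3", rotated 2])
      (use ab e pi_gt_zero in \<open>auto simp: power_divide\<close>)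
  then show ?thesis by simp
qed

lemma bmo_if_osc_circ:
  assumes f [measurable]: "f \<in> borel_measurable borel" and e: "0 \<le> e"
    and circ: "\<And>a b. a < b \<Longrightarrow> b - a \<le> 2 * pi \<Longrightarrow> osc_le (circ f) {a..b} e"
    and ab: "a < b"
  shows "osc_le f {a..b} (5760 * e)"
proof -
  \<comment> \<open>Here \<open>5760 = 36 * 32 * 5\<close>: charts cost 5, shells 32, and arbitrary
    intervals 36.\<close>
  have "shell_osc f (32 * (5 * e))"
    by (rule shell_if_local) (use osc_local_if_circ[OF f e circ] e in auto)
  then show ?thesis
    using bmo_if_shell[of f "32 * (5 * e)" a b] ab e by simp
qed

subsection \<open>Vanishing mean oscillation on the line and on the circle\<close>

definition bmo_le :: "(real \<Rightarrow> real) \<Rightarrow> real \<Rightarrow> bool" where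
  "bmo_le f e \<longleftrightarrow> (\<forall>a b. a < b \<longrightarrow> osc_le f {a..b} e)"

definition cmo_line :: "(real \<Rightarrow> real) \<Rightarrow> bool" where
  "cmo_line f \<longleftrightarrow> (\<exists>e\<ge>0. bmo_le f e) \<and>
     (\<forall>\<epsilon>>0. \<exists>g N. continuous_on UNIV g \<and> (\<forall>x. N \<le> \<bar>x\<bar> \<longrightarrow> g x = 0) \<and> bmo_le (\<lambda>x. f x - g x) \<epsilon>)"

definition vmo_circ :: "(real \<Rightarrow> real) \<Rightarrow> bool" where
  "vmo_circ F \<longleftrightarrow> (\<exists>e\<ge>0. \<forall>a b. a < b \<and> b - a \<le> 2 * pi \<longrightarrow> osc_le F {a..b} e) \<and>
     (\<forall>\<epsilon>>0. \<exists>\<delta>>0. \<forall>a b. a < b \<and> b - a < \<delta> \<longrightarrow> osc_le F {a..b} \<epsilon>)"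

lemma osc_small_if_continuous:
  fixes g :: "real \<Rightarrow> real"
  assumes "continuous_on {A..B} g" "0 < \<epsilon>"
  obtains d where "0 < d" "\<And>a b. A \<le> a \<Longrightarrow> a < b \<Longrightarrow> b \<le> B \<Longrightarrow> b - a \<le> d \<Longrightarrow> osc_le g {a..b} \<epsilon>"
proof -
  have "uniformly_continuous_on {A..B} g"
    using assms by (intro compact_uniformly_continuous) auto
  then obtain d where d: "0 < d" "\<And>x y. x \<in> {A..B} \<Longrightarrow> y \<in> {A..B} \<Longrightarrow> dist y x < d \<Longrightarrow> dist (g y) (g x) < \<epsilon>"
    using assms(2) unfolding uniformly_continuous_on_def by metis
  show ?thesis
  proof (rule that[of "d / 2"])
    fix a b assume ab: "A \<le> a" "a < b" "b \<le> B" "b - a \<le> d / 2"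
    show "osc_le g {a..b} \<epsilon>"
    proof (rule osc_le_bounded)
      fix x assume "x \<in> {a..b}"
      then have "dist (g x) (g a) < \<epsilon>"
        using d ab by (intro d(2)) (auto simp: dist_real_def)
      then show "\<bar>g x - g a\<bar> \<le> \<epsilon>" by (simp add: dist_real_def)
    qed (use assms in auto)
  qed (use d in simp)
qed

text \<open>Replace \<open>f\<close> by a continuous \<open>g\<close> that vanishes near infinity.
  The difference stays small on the circle by Moebius invariance. Seen on the circle,
  \<open>g\<close> extends continuously across the point at infinity, and by uniform continuity in
  the two charts it oscillates little on short intervals.\<close>

lemma vmo_circ_if_cmo_line:
  assumes f [measurable]: "f \<in> borel_measurable borel" and "cmo_line f"
  shows "vmo_circ (circ f)"
  unfolding vmo_circ_def
proof (intro conjI allI impI)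
  define K where "K = (6 ^ 5 * 4608 :: real)"
  have K: "K > 0" by (simp add: K_def)
  obtain e where e: "0 \<le> e" "bmo_le f e" using assms by (auto simp: cmo_line_def)
  then have "\<forall>a b. a < b \<and> b - a \<le> 2 * pi \<longrightarrow> osc_le (circ f) {a..b} (K * e)"
    using osc_circ_if_bmo[OF f e(1)] by (simp add: K_def bmo_le_def)
  then show "\<exists>e\<ge>0. \<forall>a b. a < b \<and> b - a \<le> 2 * pi \<longrightarrow> osc_le (circ f) {a..b} e"
    using e K by (intro exI[of _ "K * e"]) auto
  fix \<epsilon> :: real assume \<epsilon>: "0 < \<epsilon>"
  \<comment> \<open>Half of \<open>\<epsilon>\<close> pays for \<open>f - g\<close> after the loss
    \<open>K\<close>; the other half is \<open>4 * (\<epsilon> / 8)\<close> and pays for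
    \<open>g\<close>.\<close>
  define \<epsilon>1 where "\<epsilon>1 = \<epsilon> / (2 * K)"
  have \<epsilon>1: "0 < \<epsilon>1" using \<epsilon> K by (simp add: \<epsilon>1_def)
  obtain g N where g: "continuous_on UNIV g" "\<And>x. N \<le> \<bar>x\<bar> \<Longrightarrow> g x = 0" "bmo_le (\<lambda>x. f x - g x) \<epsilon>1"
    using assms \<epsilon>1 unfolding cmo_line_def by blast
  have [measurable]: "g \<in> borel_measurable borel"
    using g(1) by (rule borel_measurable_continuous_onI)
  obtain d1 where d1: "0 < d1" "\<And>a b. -2 \<le> a \<Longrightarrow> a < b \<Longrightarrow> b \<le> 2 \<Longrightarrow> b - a \<le> d1 \<Longrightarrow> osc_le g {a..b} (\<epsilon> / 8)"
    using osc_small_if_continuous[of "-2" 2 g "\<epsilon> / 8"] g(1) \<epsilon> continuous_on_subset by (metis subset_UNIV divide_pos_pos zero_less_numeral)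
  \<comment> \<open>Because \<open>nrecip 0 = 0\<close>, the plain composition would take the value
    \<open>g 0\<close> at 0. The continuous extension has the value 0 there; the change affects a
    single point.\<close>
  define g' where "g' v = (if v = 0 then 0 else g (nrecip v))" for v
  have "isCont g' v" for v
  proof (cases "v = 0")
    case False
    have "isCont g (nrecip v)" using g(1) by (simp add: continuous_on_eq_continuous_at)
    moreover have "isCont nrecip v" unfolding nrecip_def [abs_def] using False by (intro continuous_intros)
    ultimately have "isCont (\<lambda>v. g (nrecip v)) v" by (rule isCont_o2[rotated])
    moreover have "\<forall>\<^sub>F x in nhds v. g' x = g (nrecip x)"
      using t1_space_nhds[OF False] by eventually_elim (simp add: g'_def)
    ultimately show ?thesis by (simp add: isCont_cong)
  next
    case True
    have "\<forall>\<^sub>F x in nhds v. \<bar>x\<bar> < 1 / (\<bar>N\<bar> + 1)"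
      using True by (auto simp: eventually_nhds_metric dist_real_def intro!: exI[of _ "1 / (\<bar>N\<bar> + 1)"])
    then have "\<forall>\<^sub>F x in nhds v. g' x = 0"
    proof eventually_elim
      case (elim x)
      show ?case
      proof (cases "x = 0")
        case False
        then have "\<bar>x\<bar> * (\<bar>N\<bar> + 1) < 1" using elim by (simp add: field_simps)
        then have "\<bar>N\<bar> + 1 < inverse \<bar>x\<bar>" using False by (simp add: field_simps)
        then have "N \<le> \<bar>nrecip x\<bar>" by (simp add: abs_nrecip)
        then show ?thesis using False by (simp add: g'_def g)
      qed (simp add: g'_def)
    qed
    then show ?thesis by (simp add: isCont_cong[of g' "\<lambda>_. 0"])
  qed
  then have "continuous_on {-2..2} g'" by (simp add: continuous_at_imp_continuous_on)
  then obtain d2 where d2: "0 < d2" "\<And>a b. -2 \<le> a \<Longrightarrow> a < b \<Longrightarrow> b \<le> 2 \<Longrightarrow> b - a \<le> d2 \<Longrightarrow> osc_le g' {a..b} (\<epsilon> / 8)"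
    using osc_small_if_continuous[of "-2" 2 g' "\<epsilon> / 8"] \<epsilon> by (metis divide_pos_pos zero_less_numeral)
  have g'_eq: "AE v in lborel. g' v = g (nrecip v)"
    using AE_lborel_singleton[of "0::real"] by eventually_elim (simp add: g'_def)
  define d where "d = Min {d1 / 2, d2 / 2, pi / 3}"
  have d: "0 < d" "2 * d \<le> d1" "2 * d \<le> d2" "d \<le> pi / 3"
    using d1 d2 by (auto simp: d_def min_def)
  have "osc_le (circ f) {a..b} \<epsilon>" if ab: "a < b" "b - a < d" for a b
  proof -
    have "osc_le (circ g) {a..b} (4 * (\<epsilon> / 8))"
    proof (rule osc_circ_small[where d = d])
      fix a b :: real assume *: "-2 \<le> a" "a < b" "b \<le> 2" "b - a \<le> 2 * d"
      show "osc_le g {a..b} (\<epsilon> / 8)" using * d by (intro d1(2)) auto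
      have "osc_le g' {a..b} (\<epsilon> / 8)" using * d by (intro d2(2)) auto
      then show "osc_le (\<lambda>x. g (nrecip x)) {a..b} (\<epsilon> / 8)"
        using g'_eq by (rule osc_le_AE_cong)
    qed (use ab d \<epsilon> in auto)
    moreover have "osc_le (circ (\<lambda>x. f x - g x)) {a..b} (K * \<epsilon>1)"
      unfolding K_def
    proof (rule osc_circ_if_bmo)
      show "b - a \<le> 2 * pi" using ab(2) d(4) pi_gt_zero by linarith
    qed (use g(3) \<epsilon>1 ab in \<open>auto simp: bmo_le_def\<close>)
    ultimately have "osc_le (\<lambda>t. circ (\<lambda>x. f x - g x) t + circ g t) {a..b} (K * \<epsilon>1 + 4 * (\<epsilon> / 8))"
      using \<epsilon> \<epsilon>1 K by (intro osc_le_add) auto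
    moreover have "K * \<epsilon>1 + 4 * (\<epsilon> / 8) = \<epsilon>" using K by (simp add: \<epsilon>1_def)
    ultimately show ?thesis by (simp add: circ_def [abs_def])
  qed
  then show "\<exists>\<delta>>0. \<forall>a b. a < b \<and> b - a < \<delta> \<longrightarrow> osc_le (circ f) {a..b} \<epsilon>"
    using d by blast
qed

lemma deviation_shift:
  assumes [measurable]: "F \<in> borel_measurable borel" and per: "\<And>t. F (s + t) = F t"
  shows "deviation F {s + a..s + b} c = deviation F {a..b} c"
proof -
  have "deviation F {s + a..s + b} c
      = ennreal \<bar>1\<bar> * (\<integral>\<^sup>+x. ennreal \<bar>F (s + 1 * x) - c\<bar> * indicator {s + a..s + b} (s + 1 * x) \<partial>lborel)"
    unfolding deviation_def by (rule nn_integral_real_affine) auto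
  also have "\<dots> = deviation F {a..b} c"
    unfolding deviation_def by (auto simp: per indicator_def intro!: nn_integral_cong)
  finally show ?thesis .
qed

text \<open>Averages over subintervals are compared through integrals, so a bound on the deviation
  must be turned into integrability and a bound on the integral.\<close>

lemma mean_near_center:
  assumes [measurable]: "F \<in> borel_measurable borel" and "a < b"
    and dev: "deviation F {a..b} m \<le> ennreal D" and D: "0 \<le> D"
  shows "set_integrable lborel {a..b} F" and "\<bar>integral {a..b} F - m * (b - a)\<bar> \<le> D"
proof -
  have eq: "ennreal (norm (indicator {a..b} x *\<^sub>R (F x - m))) = ennreal \<bar>F x - m\<bar> * indicator {a..b} x" for x
    by (auto simp: indicator_def)
  have int: "set_integrable lborel {a..b} (\<lambda>x. F x - m)"
    unfolding set_integrable_def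
  proof (rule integrableI_bounded)
    show "(\<integral>\<^sup>+x. ennreal (norm (indicator {a..b} x *\<^sub>R (F x - m))) \<partial>lborel) < \<infinity>"
      using dev unfolding eq deviation_def by (auto intro: le_less_trans)
  qed measurable
  have const: "set_integrable lborel {a..b} (\<lambda>x. m)"
    by (rule borel_integrable_atLeastAtMost') simp
  then have "set_integrable lborel {a..b} (\<lambda>x. (F x - m) + m)"
    using int by (intro set_integral_add)
  then show F: "set_integrable lborel {a..b} F" by simp
  have "(LINT x:{a..b}|lborel. F x - m) = integral {a..b} F - m * (b - a)"
    using set_integral_diff(2)[OF F const] set_borel_integral_eq_integral(2)[OF F] \<open>a < b\<close>
    by (simp add: set_lebesgue_integral_def mult.commute)
  moreover have "norm (LINT x:{a..b}|lborel. F x - m) \<le> D"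
  proof -
    have "ennreal (norm (LINT x:{a..b}|lborel. F x - m)) \<le> deviation F {a..b} m"
      unfolding set_lebesgue_integral_def deviation_def eq[symmetric]
      using int unfolding set_integrable_def by (rule integral_norm_bound_ennreal)
    also have "\<dots> \<le> ennreal D" by (rule dev)
    finally show ?thesis using D by simp
  qed
  ultimately show "\<bar>integral {a..b} F - m * (b - a)\<bar> \<le> D" by simp
qed

lemma real_mod_2pi:
  fixes t :: real
  obtains n :: int where "0 \<le> t - 2 * pi * of_int n" "t - 2 * pi * of_int n < 2 * pi"
proof
  define n where "n = \<lfloor>t / (2 * pi)\<rfloor>"
  have "of_int n \<le> t / (2 * pi)" "t / (2 * pi) < of_int n + 1"
    unfolding n_def by linarith+
  then show "0 \<le> t - 2 * pi * of_int n" "t - 2 * pi * of_int n < 2 * pi"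
    using pi_gt_zero by (simp_all add: field_simps)
qed

lemma AE_not_2pi: "AE t in lborel. \<forall>n::int. t \<noteq> 2 * pi * of_int n"
proof -
  have "countable (range (\<lambda>n::int. 2 * pi * of_int n))" by simp
  then have "AE t in lborel. t \<notin> range (\<lambda>n::int. 2 * pi * of_int n)"
    by (intro AE_not_in countable_imp_null_set_lborel)
  then show ?thesis by eventually_elim auto
qed

text \<open>The approximating function is the Steklov mean over \<open>{t - d..t + d}\<close>; subtracting its value
  near \<open>\<infinity>\<close> and truncating small values gives compact support.\<close>

lemma cmo_line_if_vmo_circ:
  assumes f [measurable]: "f \<in> borel_measurable borel" and vmo: "vmo_circ (circ f)"
  shows "cmo_line f"
  unfolding cmo_line_def
proof (intro conjI allI impI)
  obtain e where e: "0 \<le> e" "\<And>a b. a < b \<Longrightarrow> b - a \<le> 2 * pi \<Longrightarrow> osc_le (circ f) {a..b} e"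
    using vmo unfolding vmo_circ_def by blast
  have "bmo_le f (5760 * e)"
    unfolding bmo_le_def using bmo_if_osc_circ[OF f e] by blast
  then show "\<exists>e\<ge>0. bmo_le f e" using e(1) by (intro exI[of _ "5760 * e"]) auto
  define F where "F = circ f"
  have [measurable]: "F \<in> borel_measurable borel" by (simp add: F_def)
  fix \<epsilon> :: real assume \<epsilon>: "0 < \<epsilon>"
  \<comment> \<open>The total loss at the end is \<open>5760 * 8 + 2\<close> times
    \<open>\<eta>\<close>, below \<open>100000 * \<eta>\<close>.\<close>
  define \<eta> where "\<eta> = \<epsilon> / 100000"
  have \<eta>: "0 < \<eta>" using \<epsilon> by (simp add: \<eta>_def)
  obtain d0 where d0: "0 < d0" "\<And>a b. a < b \<Longrightarrow> b - a < d0 \<Longrightarrow> osc_le F {a..b} \<eta>"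
    using vmo[unfolded vmo_circ_def, THEN conjunct2, rule_format, OF \<eta>] unfolding F_def by auto
  \<comment> \<open>Windows of length \<open>4 * d\<close> have to be shorter than
    \<open>d0\<close>.\<close>
  define d where "d = d0 / 5"
  have d: "0 < d" "4 * d < d0" using d0 by (auto simp: d_def)
  define G where "G t = integral {t - d..t + d} F / (2 * d)" for t
  define g where "g x = G (pi + 2 * arctan x)" for x
  have per: "F (2 * pi * of_int n + t) = F t" for n t
    using circ_periodic[of f t n] by (simp add: F_def add.commute)
  have center: "\<exists>m. deviation F {c - 2 * d..c + 2 * d} m \<le> ennreal (\<eta> * (4 * d))" for c
    using d0(2)[of "c - 2 * d" "c + 2 * d"] d by (auto simp: osc_le_def)
  have int: "set_integrable lborel {c - 2 * d..c + 2 * d} F" for c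
  proof -
    obtain m where m: "deviation F {c - 2 * d..c + 2 * d} m \<le> ennreal (\<eta> * (4 * d))" using center by blast
    show ?thesis using mean_near_center(1)[OF _ _ m] d \<eta> by simp
  qed
  have contG: "isCont G c" for c
  proof -
    define J where "J x = integral {c - 2 * d..x} F" for x
    have F_int: "F integrable_on {c - 2 * d..c + 2 * d}"
      by (rule set_borel_integral_eq_integral(1)[OF int])
    have J: "continuous_on {c - 2 * d..c + 2 * d} J"
      unfolding J_def by (intro indefinite_integral_continuous_1 F_int)
    have "G t = (J (t + d) - J (t - d)) / (2 * d)" if t: "\<bar>t - c\<bar> < d" for t
    proof -
      have "integral {c - 2 * d..t - d} F + integral {t - d..t + d} F = integral {c - 2 * d..t + d} F"
        using t by (intro Henstock_Kurzweil_Integration.integral_combine integrable_on_subinterval[OF F_int]) (auto simp: abs_less_iff)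
      then show ?thesis by (simp add: G_def J_def)
    qed
    moreover have "\<forall>\<^sub>F t in nhds c. \<bar>t - c\<bar> < d"
      using d by (auto simp: eventually_nhds_metric dist_real_def intro!: exI[of _ d])
    ultimately have "\<forall>\<^sub>F t in nhds c. G t = (J (t + d) - J (t - d)) / (2 * d)"
      by (meson eventually_mono)
    then have eq: "isCont G c = isCont (\<lambda>t. (J (t + d) - J (t - d)) / (2 * d)) c"
      by (rule isCont_cong)
    have JC: "isCont J x" if "c - 2 * d < x" "x < c + 2 * d" for x
      by (rule continuous_on_interior[OF J]) (use that in simp)
    have "isCont (\<lambda>t. J (t + d)) c"
      by (rule isCont_o2[where g = J, OF _ JC]) (use d in \<open>auto intro: continuous_intros\<close>)
    moreover have "isCont (\<lambda>t. J (t - d)) c"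
      by (rule isCont_o2[where g = J, OF _ JC]) (use d in \<open>auto intro: continuous_intros\<close>)
    ultimately show ?thesis unfolding eq
      using d by (intro continuous_intros) auto
  qed
  have contg: "continuous_on UNIV g"
  proof -
    have "isCont g x" for x
    proof -
      show ?thesis unfolding g_def [abs_def]
        by (rule isCont_o2[OF _ contG]) (intro continuous_intros isCont_arctan)
    qed
    then show ?thesis by (simp add: continuous_at_imp_continuous_on)
  qed
  have [measurable]: "g \<in> borel_measurable borel"
    using contg by (rule borel_measurable_continuous_onI)
  \<comment> \<open>The averaging interval around \<open>t\<close> lies in the window around
    \<open>c\<close> and has half its length, so its mean is within \<open>2 * \<eta>\<close> of the
    centre of the window. Multiples of \<open>2 * pi\<close> are excluded because
    \<open>circ g\<close> has default values there.\<close>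
  have near: "\<bar>circ g t - m\<bar> \<le> 2 * \<eta>"
    if m: "deviation F {c - 2 * d..c + 2 * d} m \<le> ennreal (\<eta> * (4 * d))" and t: "\<bar>t - c\<bar> \<le> d" "\<And>n::int. t \<noteq> 2 * pi * of_int n"
    for c t m
  proof -
    obtain n :: int where n: "0 \<le> t - 2 * pi * of_int n" "t - 2 * pi * of_int n < 2 * pi" by (rule real_mod_2pi)
    define s where "s = t - 2 * pi * of_int n"
    have s: "0 < s" "s < 2 * pi" "t = s + 2 * pi * of_int n" using n t(2)[of n] by (auto simp: s_def)
    have "arctan (tan ((s - pi) / 2)) = (s - pi) / 2" using s by (intro arctan_tan) auto
    then have "pi + 2 * arctan (tan ((s - pi) / 2)) = s" by simp
    then have "circ g s = G s" unfolding circ_def g_def by (simp only:)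
    then have "circ g t = G s" using circ_periodic[of g s n] s(3) by simp
    moreover have "\<bar>G s - m\<bar> \<le> 2 * \<eta>"
    proof -
      have "deviation F {s - d..s + d} m = deviation F {2 * pi * of_int n + (s - d)..2 * pi * of_int n + (s + d)} m"
        using deviation_shift[of F "2 * pi * of_int n" "s - d" "s + d" m] per by simp
      also have "\<dots> \<le> deviation F {c - 2 * d..c + 2 * d} m"
        using t(1) by (intro deviation_mono) (auto simp: s(3) abs_le_iff)
      also have "\<dots> \<le> ennreal (\<eta> * (4 * d))" by (rule m)
      finally have "\<bar>integral {s - d..s + d} F - m * ((s + d) - (s - d))\<bar> \<le> \<eta> * (4 * d)"
        using d \<eta> by (intro mean_near_center(2)) auto
      then have "\<bar>integral {s - d..s + d} F - m * (2 * d)\<bar> / (2 * d) \<le> \<eta> * (4 * d) / (2 * d)"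
        using d by (intro divide_right_mono) auto
      then have "\<bar>(integral {s - d..s + d} F - m * (2 * d)) / (2 * d)\<bar> \<le> \<eta> * (4 * d) / (2 * d)"
        using d by (simp only: abs_divide)
      moreover have "(integral {s - d..s + d} F - m * (2 * d)) / (2 * d) = G s - m"
        using d by (simp add: G_def diff_divide_distrib)
      ultimately show ?thesis using d by simp
    qed
    ultimately show ?thesis by simp
  qed
  define P where "P = circ (\<lambda>x. f x - g x)"
  have P: "P t = F t - circ g t" for t by (simp add: P_def F_def circ_def)
  have [measurable]: "P \<in> borel_measurable borel" unfolding P_def by measurable
  have circg_osc: "deviation (circ g) {a..b} m \<le> ennreal (2 * \<eta> * (b - a))"
    if m: "deviation F {c - 2 * d..c + 2 * d} m \<le> ennreal (\<eta> * (4 * d))" and ab: "a \<le> b" "c - d \<le> a" "b \<le> c + d" for a b c m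
  proof -
    have "AE t in lborel. ennreal \<bar>circ g t - m\<bar> * indicator {a..b} t \<le> ennreal (2 * \<eta>) * indicator {a..b} t"
      using AE_not_2pi
    proof eventually_elim
      case (elim t)
      show ?case
      proof (cases "t \<in> {a..b}")
        case True
        then have "\<bar>t - c\<bar> \<le> d" using ab by (auto simp: abs_le_iff)
        then have "\<bar>circ g t - m\<bar> \<le> 2 * \<eta>" using elim by (intro near[OF m]) auto
        then show ?thesis using True by (simp add: ennreal_leI)
      qed simp
    qed
    then have "deviation (circ g) {a..b} m \<le> (\<integral>\<^sup>+t\<in>{a..b}. ennreal (2 * \<eta>) \<partial>lborel)"
      unfolding deviation_def by (rule nn_integral_mono_AE)
    also have "\<dots> = ennreal (2 * \<eta> * (b - a))"
      using nn_integral_const_bounded[of "{a..b}" "2 * \<eta>"] ab \<eta> by simp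
    finally show ?thesis .
  qed
  \<comment> \<open>The deviation of \<open>F\<close> is at most \<open>4 * d * \<eta>\<close> and
    that of the means at most \<open>2 * \<eta> * (b - a)\<close>. As \<open>d \<le> b - a\<close>,
    the sum is at most \<open>6 * \<eta> * (b - a)\<close>. The centre of \<open>F\<close> cancels
    against that of its means, which leaves the centre 0.\<close>
  have P_short: "deviation P {a..b} 0 \<le> ennreal (8 * \<eta> * (b - a))" if ab: "d \<le> b - a" "b - a \<le> 2 * d" for a b
  proof -
    define c where "c = (a + b) / 2"
    have c: "c - d \<le> a" "b \<le> c + d" "c - 2 * d \<le> a" "b \<le> c + 2 * d" "a \<le> b" using ab d by (auto simp: c_def field_simps)
    obtain m where m: "deviation F {c - 2 * d..c + 2 * d} m \<le> ennreal (\<eta> * (4 * d))" using center by blast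
    have "deviation (\<lambda>t. F t + (- circ g t)) {a..b} (m + - m) \<le> deviation F {a..b} m + deviation (\<lambda>t. - circ g t) {a..b} (- m)"
      by (rule deviation_add) auto
    also have "deviation (\<lambda>t. - circ g t) {a..b} (- m) = deviation (circ g) {a..b} m"
      unfolding deviation_def by (simp add: abs_minus_commute)
    also have "deviation F {a..b} m \<le> ennreal (\<eta> * (4 * d))"
      using m c by (intro order_trans[OF deviation_mono[of "{a..b}" "{c - 2 * d..c + 2 * d}"]]) auto
    also have "deviation (circ g) {a..b} m \<le> ennreal (2 * \<eta> * (b - a))"
      using c by (intro circg_osc[OF m]) auto
    also have "ennreal (\<eta> * (4 * d)) + ennreal (2 * \<eta> * (b - a)) = ennreal (\<eta> * (4 * d) + 2 * \<eta> * (b - a))"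
      using \<eta> d ab by (subst ennreal_plus) auto
    also have "\<dots> \<le> ennreal (8 * \<eta> * (b - a))"
      using mult_left_mono[OF ab(1), of \<eta>] mult_pos_pos[OF \<eta> d(1)] \<eta>
      by (intro ennreal_leI) (simp add: algebra_simps)
    finally show ?thesis by (simp add: P [abs_def] add_mono)
  qed
  \<comment> \<open>With the common centre 0 the deviations of adjacent halves add up without loss,
    so bisection reaches intervals of every length.\<close>
  have P_long: "deviation P {a..b} 0 \<le> ennreal (8 * \<eta> * (b - a))" if "d \<le> b - a" "b - a \<le> 2 ^ n * (2 * d)" for a b n
    using that
  proof (induction n arbitrary: a b)
    case 0
    then show ?case using P_short by simp
  next
    case (Suc n)
    show ?case
    proof (cases "b - a \<le> 2 * d")
      case False
      define c where "c = (a + b) / 2"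
      have c: "d \<le> c - a" "d \<le> b - c" "c - a \<le> 2 ^ n * (2 * d)" "b - c \<le> 2 ^ n * (2 * d)" "a \<le> c" "c \<le> b"
        using False Suc.prems d by (auto simp: c_def field_simps)
      have "deviation P {a..b} 0 \<le> deviation P {a..c} 0 + deviation P {c..b} 0"
        using deviation_Un[of P "{a..c}" "{c..b}" 0] c by (simp add: ivl_disj_un_two_touch)
      also have "\<dots> \<le> ennreal (8 * \<eta> * (c - a)) + ennreal (8 * \<eta> * (b - c))"
        using c by (intro add_mono Suc.IH) auto
      also have "\<dots> = ennreal (8 * \<eta> * (b - a))"
        using \<eta> c by (subst ennreal_plus[symmetric]) (auto simp: algebra_simps)
      finally show ?thesis .
    qed (use P_short Suc.prems in auto)
  qed
  have oscP: "osc_le P {a..b} (8 * \<eta>)" if ab: "a < b" for a b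
  proof (cases "d \<le> b - a")
    case True
    obtain n where "(b - a) / (2 * d) < 2 ^ n" using real_arch_pow[of 2 "(b - a) / (2 * d)"] by auto
    then have "b - a \<le> 2 ^ n * (2 * d)" using d by (simp add: field_simps)
    then have "deviation P {a..b} 0 \<le> ennreal (8 * \<eta> * (b - a))" using True by (intro P_long)
    then show ?thesis using ab by (auto simp: osc_le_def)
  next
    case False
    obtain m where m: "deviation F {a - 2 * d..a + 2 * d} m \<le> ennreal (\<eta> * (4 * d))" using center by blast
    have "deviation (circ g) {a..b} m \<le> ennreal (2 * \<eta> * (b - a))"
      using False ab d by (intro circg_osc[OF m]) auto
    then have "osc_le (circ g) {a..b} (2 * \<eta>)" using ab by (auto simp: osc_le_def)
    moreover have "osc_le F {a..b} \<eta>" using False ab d by (intro d0(2)) auto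
    ultimately have "osc_le (\<lambda>t. F t - circ g t) {a..b} (\<eta> + 2 * \<eta>)"
      using \<eta> by (intro osc_le_diff) auto
    then have "osc_le P {a..b} (\<eta> + 2 * \<eta>)" by (simp add: P [abs_def])
    then show ?thesis by (rule osc_le_mono) (use \<eta> in simp)
  qed
  have fg: "osc_le (\<lambda>x. f x - g x) {a..b} (5760 * (8 * \<eta>))" if "a < b" for a b
    by (rule bmo_if_osc_circ) (use oscP \<eta> that in \<open>auto simp: P_def\<close>)
  obtain m where m: "deviation F {0 - 2 * d..0 + 2 * d} m \<le> ennreal (\<eta> * (4 * d))" using center by blast
  define g1 where "g1 x = (g x - m) - max (- (2 * \<eta>)) (min (2 * \<eta>) (g x - m))" for x
  have "g1 x = 0" if x: "2 / d \<le> \<bar>x\<bar>" for x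
  proof -
    \<comment> \<open>In the chart at infinity the angle of \<open>x\<close> is at most
      \<open>2 / \<bar>x\<bar>\<close>, hence at most \<open>d\<close>; the window around the angle
      0 controls it.\<close>
    define t where "t = 2 * arctan (nrecip x)"
    have x0: "x \<noteq> 0" using x d by auto
    have "\<bar>t\<bar> \<le> 2 * \<bar>nrecip x\<bar>" unfolding t_def using abs_arctan_le[of "nrecip x"] by (simp add: abs_mult)
    also have "\<dots> \<le> d" using x d x0 by (simp add: abs_nrecip field_simps)
    finally have "\<bar>t\<bar> \<le> d" .
    moreover have "t \<noteq> 2 * pi * of_int n" for n :: int
    proof
      assume eq: "t = 2 * pi * of_int n"
      have "\<bar>t\<bar> < pi" using arctan_bounded[of "nrecip x"] by (auto simp: t_def abs_less_iff)
      then have "\<bar>pi * (2 * of_int n)\<bar> < pi * 1" using eq by simp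
      then have "\<bar>2 * of_int n :: real\<bar> < 1" using pi_gt_zero by (simp add: abs_mult)
      then have "n = 0" by linarith
      then have "nrecip x = 0" using eq by (simp add: t_def)
      then show False using x0 by (simp add: nrecip_def)
    qed
    ultimately have "\<bar>circ g t - m\<bar> \<le> 2 * \<eta>" by (intro near[OF m]) auto
    then have "\<bar>g x - m\<bar> \<le> 2 * \<eta>" by (simp add: t_def circ_arctan')
    then show ?thesis by (auto simp: g1_def)
  qed
  moreover have "continuous_on UNIV g1"
    unfolding g1_def [abs_def] by (intro continuous_intros contg)
  moreover have "bmo_le (\<lambda>x. f x - g1 x) \<epsilon>"
    unfolding bmo_le_def
  proof (intro allI impI)
    fix a b :: real assume ab: "a < b"
    have "osc_le (\<lambda>x. g x - g1 x) {a..b} (2 * \<eta>)"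
      by (rule osc_le_bounded[where c = m]) (use \<eta> in \<open>auto simp: g1_def\<close>)
    moreover have [measurable]: "g1 \<in> borel_measurable borel" unfolding g1_def [abs_def] by measurable
    ultimately have "osc_le (\<lambda>x. (f x - g x) + (g x - g1 x)) {a..b} (5760 * (8 * \<eta>) + 2 * \<eta>)"
      using \<eta> by (intro osc_le_add fg ab) auto
    then have "osc_le (\<lambda>x. f x - g1 x) {a..b} (5760 * (8 * \<eta>) + 2 * \<eta>)" by simp
    then show "osc_le (\<lambda>x. f x - g1 x) {a..b} \<epsilon>"
      by (rule osc_le_mono) (use \<epsilon> in \<open>simp add: \<eta>_def\<close>)
  qed
  ultimately show "\<exists>g N. continuous_on UNIV g \<and> (\<forall>x. N \<le> \<bar>x\<bar> \<longrightarrow> g x = 0) \<and> bmo_le (\<lambda>x. f x - g x) \<epsilon>"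
    by blast
qed

subsection \<open>Strong quasisymmetry\<close>

text \<open>A strictly increasing surjection of the line is automatically a homeomorphism; see
  \<open>line_homeo_continuous\<close> and \<open>line_homeo_inv\<close>.\<close>

definition line_homeo :: "(real \<Rightarrow> real) \<Rightarrow> bool" where
  "line_homeo h \<longleftrightarrow> strict_mono h \<and> surj h"

text \<open>The condition is stated for one interval and with explicit constants, so that bounds
  known only on some intervals can be transported and summed uniformly. Borel sets suffice:
  \<open>borel_sandwich\<close> later supplies the Lebesgue measurable ones.\<close>

definition sqs_on :: "(real \<Rightarrow> real) \<Rightarrow> real \<Rightarrow> real \<Rightarrow> real \<Rightarrow> real \<Rightarrow> bool" where
  "sqs_on h C \<kappa> a b \<longleftrightarrow> (\<forall>A\<in>sets borel. A \<subseteq> {a..b} \<longrightarrow>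
     measure lborel (h ` A) \<le> C * (h b - h a) * (measure lborel A / (b - a)) powr \<kappa>)"

lemma line_homeo_less_iff: "line_homeo h \<Longrightarrow> h x < h y \<longleftrightarrow> x < y"
  by (simp add: line_homeo_def strict_mono_less)

lemma line_homeo_le_iff: "line_homeo h \<Longrightarrow> h x \<le> h y \<longleftrightarrow> x \<le> y"
  by (simp add: line_homeo_def strict_mono_less_eq)

lemma line_homeo_inj: "line_homeo h \<Longrightarrow> inj_on h A"
  by (auto simp: line_homeo_def inj_on_def dest: strict_mono_eq)

lemma line_homeo_continuous: "line_homeo h \<Longrightarrow> continuous_on A h"
proof -
  assume h: "line_homeo h"
  have "continuous_on UNIV h"
    by (rule continuous_onI_mono) (use h in \<open>auto simp: line_homeo_le_iff line_homeo_def\<close>)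
  then show ?thesis by (rule continuous_on_subset) simp
qed

lemma line_homeo_Icc: "line_homeo h \<Longrightarrow> a \<le> b \<Longrightarrow> h ` {a..b} = {h a..h b}"
  by (intro image_Icc_mono line_homeo_continuous) (auto simp: line_homeo_le_iff)

lemma line_homeo_borel:
  assumes h: "line_homeo h" and A: "A \<in> sets borel"
  shows "h ` A \<in> sets borel"
proof -
  have 1: "h ` (A \<inter> {-real n..real n}) \<in> sets borel" for n
    using A by (intro borel_image_compact[of "{-real n..real n}"] line_homeo_continuous line_homeo_inj h) auto
  have "x \<in> (\<Union>n. A \<inter> {-real n..real n})" if "x \<in> A" for x
  proof -
    obtain n where "\<bar>x\<bar> \<le> real n" using real_arch_simple by blast
    then show ?thesis using that by (auto simp: abs_le_iff intro!: exI[of _ n])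
  qed
  then have "A = (\<Union>n. A \<inter> {-real n..real n})" by blast
  then have "h ` A = (\<Union>n. h ` (A \<inter> {-real n..real n}))" by blast
  then show ?thesis using 1 by auto
qed

lemma measure_le_Icc:
  fixes A :: "real set"
  assumes "A \<subseteq> {a..b}" "a \<le> b"
  shows "measure lborel A \<le> b - a"
proof -
  have "measure lborel A \<le> measure lborel {a..b}"
  proof (cases "A \<in> sets lborel")
    case True
    then show ?thesis using assms by (intro measure_mono_fmeasurable) (auto simp: fmeasurable_def)
  qed (simp add: measure_notin_sets)
  then show ?thesis using assms by simp
qed

text \<open>Relative measures are at most 1, so their powers increase when the exponent is
  lowered.\<close>

lemma sqs_on_mono:
  assumes h: "line_homeo h" and sqs: "sqs_on h C \<kappa> a b" and "a < b" "C \<le> C'" "\<kappa>' \<le> \<kappa>" "0 \<le> C" "0 < \<kappa>'"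
  shows "sqs_on h C' \<kappa>' a b"
  unfolding sqs_on_def
proof (intro ballI impI)
  fix A :: "real set" assume A: "A \<in> sets borel" "A \<subseteq> {a..b}"
  let ?r = "measure lborel A / (b - a)"
  have r: "0 \<le> ?r" "?r \<le> 1"
    using measure_le_Icc[OF A(2)] \<open>a < b\<close> by auto
  have "?r powr \<kappa> \<le> ?r powr \<kappa>'"
    using r assms by (cases "?r = 0") (auto intro!: powr_mono')
  moreover have "0 \<le> h b - h a" using h \<open>a < b\<close> by (simp add: line_homeo_le_iff)
  ultimately have "C * (h b - h a) * ?r powr \<kappa> \<le> C' * (h b - h a) * ?r powr \<kappa>'"
    using assms by (intro mult_mono mult_nonneg_nonneg) auto
  then show "measure lborel (h ` A) \<le> C' * (h b - h a) * ?r powr \<kappa>'"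
    using sqs A unfolding sqs_on_def by force
qed

text \<open>The two end pieces have relative measure at most \<open>\<eta>\<close>, so their images
  fill at most half of the image interval and the rest belongs to the middle piece.\<close>

lemma sqs_on_shrink_step:
  assumes h: "line_homeo h" and sqs: "sqs_on h C \<kappa> a b" and "a < b" and C: "0 < C" "0 < \<kappa>"
    and \<eta>: "0 < \<eta>" "C * \<eta> powr \<kappa> \<le> 1 / 2"
    and pq: "a \<le> p" "p < q" "q \<le> b" "(b - a) - (q - p) \<le> \<eta> * (b - a)"
  shows "(h b - h a) / 2 \<le> h q - h p"
proof -
  let ?A = "{a..p} \<union> {q..b}"
  have m: "measure lborel ({s..t} \<union> {u..v}) = (t - s) + (v - u)" if "s \<le> t" "t < u" "u \<le> v" for s t u v :: real
  proof -
    have "measure lborel ({s..t} \<union> {u..v}) = measure lborel {s..t} + measure lborel {u..v}"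
      using that by (intro measure_Union) auto
    then show ?thesis using that by simp
  qed
  have "h ` ?A = {h a..h p} \<union> {h q..h b}"
    using pq by (simp add: image_Un line_homeo_Icc[OF h])
  then have hA: "measure lborel (h ` ?A) = (h p - h a) + (h b - h q)"
    using m[of "h a" "h p" "h q" "h b"] pq h by (simp add: line_homeo_le_iff line_homeo_less_iff)
  have A: "measure lborel ?A = (p - a) + (b - q)"
    using m[of a p q b] pq by simp
  have r: "measure lborel ?A / (b - a) \<le> \<eta>"
    using pq \<open>a < b\<close> A by (simp add: field_simps)
  have pos: "0 \<le> h b - h a" using h \<open>a < b\<close> by (simp add: line_homeo_le_iff)
  have "measure lborel (h ` ?A) \<le> C * (h b - h a) * (measure lborel ?A / (b - a)) powr \<kappa>"
    using sqs pq unfolding sqs_on_def by auto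
  also have "\<dots> \<le> C * (h b - h a) * \<eta> powr \<kappa>"
    using r C \<open>a < b\<close> pos by (intro mult_left_mono powr_mono2) auto
  also have "\<dots> = (C * \<eta> powr \<kappa>) * (h b - h a)" by simp
  also have "\<dots> \<le> 1 / 2 * (h b - h a)"
    using \<eta> pos by (intro mult_right_mono)
  finally show ?thesis using hA by (simp add: field_simps)
qed

text \<open>Pass through a chain of nested intervals, each \<open>1 - \<eta>\<close> times as long
  as the one before; every link costs a factor \<open>1 / 2\<close>.\<close>

lemma sqs_on_shrink:
  assumes h: "line_homeo h" and C: "0 < C" "0 < \<kappa>"
    and \<eta>: "0 < \<eta>" "\<eta> < 1" "C * \<eta> powr \<kappa> \<le> 1 / 2"
    and sqs: "\<And>a' b'. a \<le> a' \<Longrightarrow> a' < b' \<Longrightarrow> b' \<le> b \<Longrightarrow> sqs_on h C \<kappa> a' b'"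
    and pq: "a \<le> p" "p < q" "q \<le> b" "(1 - \<eta>) ^ n * (b - a) \<le> q - p"
  shows "(1 / 2) ^ n * (h b - h a) \<le> h q - h p"
  using sqs pq
proof (induction n arbitrary: a b)
  case 0
  then have "p = a" "q = b" by auto
  then show ?case by simp
next
  case (Suc n)
  have ab: "a < b" using Suc.prems by auto
  show ?case
  proof (cases "(1 - \<eta>) * (b - a) \<le> q - p")
    case True
    have "(h b - h a) / 2 \<le> h q - h p"
      by (rule sqs_on_shrink_step[OF h Suc.prems(1) ab C \<eta>(1,3)])
        (use Suc.prems True ab in \<open>auto simp: algebra_simps\<close>)
    moreover have "(1 / 2) ^ Suc n * (h b - h a) \<le> 1 / 2 * (h b - h a)"
      using h ab by (intro mult_right_mono) (auto simp: line_homeo_le_iff power_le_one)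
    ultimately show ?thesis by simp
  next
    case False
    \<comment> \<open>The interval with parameter \<open>\<mu>\<close> is \<open>{p..q}\<close> for
      \<open>\<mu> = 0\<close> and \<open>{a..b}\<close> for \<open>\<mu> = 1\<close>; the value
      chosen makes its length exactly \<open>(1 - \<eta>) * (b - a)\<close>.\<close>
    define \<mu> where "\<mu> = ((1 - \<eta>) * (b - a) - (q - p)) / ((b - a) - (q - p))"
    have d: "0 < (b - a) - (q - p)"
    proof -
      have "(1 - \<eta>) * (b - a) \<le> 1 * (b - a)" using \<eta> ab by (intro mult_right_mono) auto
      then show ?thesis using False by simp
    qed
    have \<mu>: "0 \<le> \<mu>" "\<mu> \<le> 1" "\<mu> * ((b - a) - (q - p)) = (1 - \<eta>) * (b - a) - (q - p)"
      using False d \<eta> ab by (auto simp: \<mu>_def field_simps)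
    define a1 b1 where "a1 = p - \<mu> * (p - a)" and "b1 = q + \<mu> * (b - q)"
    have "\<mu> * (p - a) \<le> 1 * (p - a)" "\<mu> * (b - q) \<le> 1 * (b - q)"
      using \<mu> Suc.prems by (intro mult_right_mono; simp)+
    moreover have "0 \<le> \<mu> * (p - a)" "0 \<le> \<mu> * (b - q)"
      using \<mu> Suc.prems by auto
    ultimately have 1: "a \<le> a1" "a1 \<le> p" "q \<le> b1" "b1 \<le> b" by (auto simp: a1_def b1_def)
    have len: "b1 - a1 = (1 - \<eta>) * (b - a)"
      using \<mu>(3) by (simp add: a1_def b1_def algebra_simps)
    have "(h b - h a) / 2 \<le> h b1 - h a1"
      by (rule sqs_on_shrink_step[OF h Suc.prems(1) ab C \<eta>(1,3)])
        (use Suc.prems 1 len ab in \<open>auto simp: algebra_simps\<close>)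
    then have "(1 / 2) ^ n * ((h b - h a) / 2) \<le> (1 / 2) ^ n * (h b1 - h a1)"
      by (intro mult_left_mono) auto
    also have "\<dots> \<le> h q - h p"
      by (rule Suc.IH) (use Suc.prems 1 len in \<open>auto simp: mult_ac\<close>)
    finally show ?thesis by simp
  qed
qed

text \<open>Subintervals of comparable length have images of comparable length. The constant depends
  on \<open>C\<close>, \<open>\<kappa>\<close> and \<open>M\<close> only, so that one constant
  serves a homeomorphism and its conjugate under the inversion.\<close>

lemma sqs_on_comparable:
  assumes C: "0 < C" "0 < \<kappa>" and M: "0 < M"
  obtains c where "0 < c" "c < 1"
    "\<And>h a b p q. line_homeo h \<Longrightarrow> (\<And>a' b'. a \<le> a' \<Longrightarrow> a' < b' \<Longrightarrow> b' \<le> b \<Longrightarrow> sqs_on h C \<kappa> a' b') \<Longrightarrow>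
       a \<le> p \<Longrightarrow> p < q \<Longrightarrow> q \<le> b \<Longrightarrow> b - a \<le> M * (q - p) \<Longrightarrow> c * (h b - h a) \<le> h q - h p"
proof -
  define \<eta> where "\<eta> = min (1 / 2) ((1 / (2 * C)) powr (1 / \<kappa>))"
  have \<eta>: "0 < \<eta>" "\<eta> < 1" using C by (auto simp: \<eta>_def min_def)
  have "\<eta> powr \<kappa> \<le> ((1 / (2 * C)) powr (1 / \<kappa>)) powr \<kappa>"
    using \<eta> C by (intro powr_mono2) (auto simp: \<eta>_def)
  also have "\<dots> = 1 / (2 * C)" using C by (simp add: powr_powr)
  finally have \<eta>C: "C * \<eta> powr \<kappa> \<le> 1 / 2" using C by (simp add: field_simps)
  obtain n where n: "(1 - \<eta>) ^ n < 1 / M" using real_arch_pow_inv[of "1 / M" "1 - \<eta>"] \<eta> M by auto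
  show ?thesis
  \<comment> \<open>The additional factor \<open>1 / 2\<close> keeps the constant below 1 even if
    \<open>n = 0\<close>.\<close>
  proof (rule that[of "(1 / 2) ^ Suc n"])
    show "(1 / 2) ^ Suc n < (1 :: real)" by (rule power_Suc_less_one) auto
    fix h a b p q
    assume h: "line_homeo h" and sqs: "\<And>a' b'. a \<le> a' \<Longrightarrow> a' < b' \<Longrightarrow> b' \<le> b \<Longrightarrow> sqs_on h C \<kappa> a' b'"
      and pq: "a \<le> p" "p < q" "q \<le> b" "b - a \<le> M * (q - p)"
    have "(1 - \<eta>) ^ n * (b - a) \<le> 1 / M * (M * (q - p))"
      using n pq M \<eta> by (intro mult_mono) auto
    then have "(1 / 2) ^ n * (h b - h a) \<le> h q - h p"
      using M by (intro sqs_on_shrink[OF h C \<eta> \<eta>C sqs pq(1-3)]) auto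
    moreover have "(1 / 2) ^ Suc n * (h b - h a) \<le> (1 / 2) ^ n * (h b - h a)"
      using h pq by (intro mult_right_mono) (auto simp: line_homeo_le_iff)
    ultimately show "(1 / 2) ^ Suc n * (h b - h a) \<le> h q - h p" by linarith
  qed auto
qed

section \<open>Bi-Lipschitz changes of coordinates\<close>

text \<open>The two bounds are asymmetric on purpose: in the quotients of the strong quasisymmetry
  condition the subset stands in the numerator and the whole interval in the denominator.\<close>

definition bilip :: "(real \<Rightarrow> real) \<Rightarrow> real \<Rightarrow> real \<Rightarrow> real \<Rightarrow> real \<Rightarrow> bool" where
  "bilip g l L a b \<longleftrightarrow> l * (b - a) \<le> g b - g a \<and>
     (\<forall>A\<in>sets borel. A \<subseteq> {a..b} \<longrightarrow> g ` A \<in> sets borel \<and> measure lborel (g ` A) \<le> L * measure lborel A)"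

lemma bilip_if_deriv:
  assumes "a \<le> b" and mono: "\<And>x y. a \<le> x \<Longrightarrow> x < y \<Longrightarrow> y \<le> b \<Longrightarrow> g x < g y"
    and der: "\<And>x. a \<le> x \<Longrightarrow> x \<le> b \<Longrightarrow> (g has_real_derivative g' x) (at x within {a..b})"
    and bounds: "\<And>x. a \<le> x \<Longrightarrow> x \<le> b \<Longrightarrow> l \<le> \<bar>g' x\<bar> \<and> \<bar>g' x\<bar> \<le> L"
  shows "bilip g l L a b"
proof -
  have inj: "inj_on g {a..b}"
    by (intro linorder_inj_onI) (use mono in fastforce)+
  have der': "(g has_real_derivative g' x) (at x within {a..b})" if "x \<in> {a..b}" for x using der that by auto
  have bounds': "l \<le> \<bar>g' x\<bar> \<and> \<bar>g' x\<bar> \<le> L" if "x \<in> {a..b}" for x using bounds that by auto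
  have "g ` {a..b} = {g a..g b}"
    using assms(1) mono
    by (intro image_Icc_mono DERIV_continuous_on[OF der']) (auto simp: le_less)
  moreover have "l * measure lborel {a..b} \<le> measure lborel (g ` {a..b})"
    by (rule image_measure_bounds(1)[OF compact_Icc inj der' bounds']) auto
  moreover have "g a \<le> g b" using mono[of a b] assms(1) by (cases "a = b") auto
  ultimately have "l * (b - a) \<le> g b - g a" using assms(1) by simp
  then show ?thesis
    using image_measure_bounds(2,3)[OF compact_Icc inj der' bounds'] by (auto simp: bilip_def)
qed

text \<open>A coordinate change in the domain enlarges relative measures by at most
  \<open>L1 / l1\<close>, which enters with the exponent \<open>\<kappa>\<close>. A change in the
  range enlarges relative image measures by at most \<open>L2 / l2\<close>.\<close>

lemma sqs_on_compose:
  assumes sqs: "sqs_on h1 C \<kappa> (\<sigma> a) (\<sigma> b)" and "a < b" and C: "0 < C" "0 < \<kappa>" and h1: "line_homeo h1"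
    and \<sigma>: "bilip \<sigma> l1 L1 a b" "0 < l1" "0 \<le> L1" "\<sigma> ` {a..b} \<subseteq> {\<sigma> a..\<sigma> b}"
    and \<tau>: "bilip \<tau> l2 L2 (h1 (\<sigma> a)) (h1 (\<sigma> b))" "0 < l2" "0 \<le> L2"
    and h2: "\<And>x. a \<le> x \<Longrightarrow> x \<le> b \<Longrightarrow> h2 x = \<tau> (h1 (\<sigma> x))"
  shows "sqs_on h2 (C * (L2 / l2) * (L1 / l1) powr \<kappa>) \<kappa> a b"
  unfolding sqs_on_def
proof (intro ballI impI)
  fix A :: "real set" assume A: "A \<in> sets borel" "A \<subseteq> {a..b}"
  let ?m = "measure lborel"
  have lenpos: "0 < l1 * (b - a)" using \<sigma>(2) \<open>a < b\<close> by simp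
  have len: "l1 * (b - a) \<le> \<sigma> b - \<sigma> a" using \<sigma>(1) by (simp add: bilip_def)
  then have ab': "\<sigma> a < \<sigma> b" using lenpos by linarith
  have \<sigma>A: "\<sigma> ` A \<in> sets borel" "?m (\<sigma> ` A) \<le> L1 * ?m A" "\<sigma> ` A \<subseteq> {\<sigma> a..\<sigma> b}"
    using \<sigma> A unfolding bilip_def by blast+
  have hA: "h1 ` \<sigma> ` A \<in> sets borel" "h1 ` \<sigma> ` A \<subseteq> {h1 (\<sigma> a)..h1 (\<sigma> b)}"
    using line_homeo_borel[OF h1 \<sigma>A(1)] \<sigma>A(3) line_homeo_Icc[OF h1 less_imp_le[OF ab']] by blast+
  have h2A: "h2 ` A = \<tau> ` h1 ` \<sigma> ` A"
    using A(2) h2 by (force simp: image_iff)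
  define H where "H = h1 (\<sigma> b) - h1 (\<sigma> a)"
  have H: "0 < H" using ab' h1 by (simp add: H_def line_homeo_less_iff)
  have h2len: "l2 * H \<le> h2 b - h2 a"
    using \<tau>(1) h2[of a] h2[of b] \<open>a < b\<close> by (simp add: bilip_def H_def)
  have ratio: "?m (\<sigma> ` A) / (\<sigma> b - \<sigma> a) \<le> (L1 / l1) * (?m A / (b - a))"
  proof -
    have "?m (\<sigma> ` A) / (\<sigma> b - \<sigma> a) \<le> (L1 * ?m A) / (l1 * (b - a))"
      using \<sigma>A(2) len lenpos by (intro frac_le) (auto intro: order_trans[OF measure_nonneg])
    then show ?thesis by simp
  qed
  have "?m (h2 ` A) \<le> L2 * ?m (h1 ` \<sigma> ` A)"
    using \<tau>(1) hA unfolding h2A bilip_def by blast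
  also have "\<dots> \<le> L2 * (C * H * (?m (\<sigma> ` A) / (\<sigma> b - \<sigma> a)) powr \<kappa>)"
    using sqs \<sigma>A \<tau>(3) unfolding sqs_on_def H_def by (intro mult_left_mono) auto
  also have "\<dots> \<le> L2 * (C * H * ((L1 / l1) * (?m A / (b - a))) powr \<kappa>)"
    using ratio ab' C H \<tau>(3) by (intro mult_left_mono powr_mono2) auto
  also have "\<dots> = (C * (L1 / l1) powr \<kappa> * (?m A / (b - a)) powr \<kappa> * L2) * H"
    using \<sigma> \<open>a < b\<close> by (subst powr_mult) (auto simp: mult_ac)
  also have "\<dots> \<le> (C * (L1 / l1) powr \<kappa> * (?m A / (b - a)) powr \<kappa> * L2) * ((h2 b - h2 a) / l2)"
    using h2len \<tau> C by (intro mult_left_mono) (auto simp: field_simps)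
  also have "\<dots> = C * (L2 / l2) * (L1 / l1) powr \<kappa> * (h2 b - h2 a) * (?m A / (b - a)) powr \<kappa>"
    by (simp add: mult_ac)
  finally show "?m (h2 ` A) \<le> \<dots>" .
qed

section \<open>Strong quasisymmetry from shells around 0\<close>

text \<open>The ratio 8 is that of the interval \<open>{s / 4..2 * s}\<close> used in
  \<open>sqs_if_shell\<close>. The bounds with \<open>D\<close> compare the two half lines and
  neighbouring scales; \<open>\<theta>\<close>, which is taken below 1, makes \<open>h\<close> decay
  geometrically towards 0 and replaces information on intervals that contain 0.\<close>

definition shell_sqs :: "(real \<Rightarrow> real) \<Rightarrow> real \<Rightarrow> real \<Rightarrow> real \<Rightarrow> real \<Rightarrow> bool" where
  "shell_sqs h C \<kappa> D \<theta> \<longleftrightarrow>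
     (\<forall>a b. a < b \<and> (0 < a \<and> b \<le> 8 * a \<or> b < 0 \<and> 8 * b \<le> a) \<longrightarrow> sqs_on h C \<kappa> a b) \<and>
     (\<forall>x. \<bar>h (- x)\<bar> \<le> D * \<bar>h x\<bar> \<and> \<bar>h (2 * x)\<bar> \<le> D * \<bar>h x\<bar> \<and> \<bar>h x\<bar> \<le> \<theta> * \<bar>h (2 * x)\<bar>)"

lemma line_homeo_pos_iff: "line_homeo h \<Longrightarrow> h 0 = 0 \<Longrightarrow> 0 < h x \<longleftrightarrow> 0 < x"
  using line_homeo_less_iff[of h 0 x] by simp

lemma line_homeo_neg_iff: "line_homeo h \<Longrightarrow> h 0 = 0 \<Longrightarrow> h x < 0 \<longleftrightarrow> x < 0"
  using line_homeo_less_iff[of h x 0] by simp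

text \<open>The power \<open>\<kappa>'\<close> is chosen so small that the growth factor \<open>2 powr \<kappa>'\<close> of the relative
  measures along the rings is beaten by the decay \<open>\<theta>\<close> of \<open>h\<close>.\<close>

lemma sqs_central_if_shell:
  assumes h: "line_homeo h" and h0: "h 0 = 0" and sh: "shell_sqs h C \<kappa> D \<theta>"
    and C: "0 < C" "0 < \<kappa>" "0 < D" and \<theta>: "0 < \<theta>" "\<theta> < 1"
  obtains C' \<kappa>' where "0 < C'" "0 < \<kappa>'" "\<kappa>' \<le> \<kappa>"
    "\<And>s A. 0 < s \<Longrightarrow> A \<in> sets borel \<Longrightarrow> A \<subseteq> {-(2 * s)..2 * s} \<Longrightarrow>
       measure lborel (h ` A) \<le> C' * h (2 * s) * (measure lborel A / s) powr \<kappa>'"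
proof -
  let ?m = "measure lborel :: real set \<Rightarrow> real"
  define \<kappa>' where "\<kappa>' = min \<kappa> (log 2 (1 / sqrt \<theta>))"
  have sq: "0 < sqrt \<theta>" "sqrt \<theta> < 1" using \<theta> by auto
  then have \<kappa>': "0 < \<kappa>'" "\<kappa>' \<le> \<kappa>" using C by (auto simp: \<kappa>'_def)
  have "2 powr \<kappa>' \<le> 2 powr (log 2 (1 / sqrt \<theta>))" by (intro powr_mono) (auto simp: \<kappa>'_def)
  also have "\<dots> = 1 / sqrt \<theta>" using sq by simp
  finally have "\<theta> * 2 powr \<kappa>' \<le> \<theta> * (1 / sqrt \<theta>)" using \<theta> by (intro mult_left_mono) auto
  also have "\<dots> = sqrt \<theta>" using \<theta> by (simp add: real_div_sqrt)
  finally have decay: "\<theta> * 2 powr \<kappa>' \<le> sqrt \<theta>" .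
  \<comment> \<open>The value of the geometric series with ratio \<open>sqrt \<theta>\<close>: each
    scale contributes 1 for the positive half and \<open>D\<close> for the negative half.\<close>
  define C' where "C' = C * (1 + D) / (1 - sqrt \<theta>)"
  have C': "0 < C'" using C sq by (auto simp: C'_def)
  show ?thesis
  proof (rule that[OF C' \<kappa>'])
    fix s :: real and A :: "real set" assume s: "0 < s" and A: "A \<in> sets borel" "A \<subseteq> {-(2 * s)..2 * s}"
    define \<delta> where "\<delta> = ?m A / s"
    define r where "r i = s * (1 / 2) ^ i" for i :: nat
    have r: "0 < r i" for i using s by (simp add: r_def)
    define P where "P i = {r i..2 * r i}" for i
    define N where "N i = {-(2 * r i)..- r i}" for i
    have h2s: "0 < h (2 * s)" using s h h0 by (simp add: line_homeo_pos_iff)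
    have hr: "h (2 * r i) \<le> \<theta> ^ i * h (2 * s)" for i
    proof (induction i)
      case (Suc i)
      have "2 * r i = 2 * (2 * r (Suc i))" by (simp add: r_def)
      then have "\<bar>h (2 * r (Suc i))\<bar> \<le> \<theta> * \<bar>h (2 * r i)\<bar>"
        using sh unfolding shell_sqs_def by metis
      then have "h (2 * r (Suc i)) \<le> \<theta> * h (2 * r i)"
        using r h h0 by (auto simp: line_homeo_pos_iff abs_of_pos)
      also have "\<dots> \<le> \<theta> * (\<theta> ^ i * h (2 * s))" using Suc \<theta> by (intro mult_left_mono) auto
      finally show ?case by simp
    qed (simp add: r_def)
    have finA: "A \<in> fmeasurable lborel"
      using A bounded_subset[OF bounded_closed_interval A(2)] emeasure_bounded_finite by (auto simp: fmeasurable_def)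
    have piece: "?m (h ` (A \<inter> J)) \<le> C * (D * h (2 * r i)) * (?m (A \<inter> J) / r i) powr \<kappa>'"
      if "sqs_on h C \<kappa> p q" "J = {p..q}" "q - p = r i" "h q - h p \<le> D * h (2 * r i)" for D p q J i
    proof -
      have "?m (A \<inter> J) \<le> r i" using that measure_le_Icc[of "A \<inter> J" p q] r[of i] by auto
      then have rat: "0 \<le> ?m (A \<inter> J) / r i" "?m (A \<inter> J) / r i \<le> 1" using r[of i] by auto
      have "?m (h ` (A \<inter> J)) \<le> C * (h q - h p) * (?m (A \<inter> J) / (q - p)) powr \<kappa>"
        using that A unfolding sqs_on_def by auto
      also have "\<dots> \<le> C * (D * h (2 * r i)) * (?m (A \<inter> J) / r i) powr \<kappa>"
        using that C by (simp add: mult_right_mono)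
      also have "\<dots> \<le> C * (D * h (2 * r i)) * (?m (A \<inter> J) / r i) powr \<kappa>'"
      proof (intro mult_left_mono)
        show "(?m (A \<inter> J) / r i) powr \<kappa> \<le> (?m (A \<inter> J) / r i) powr \<kappa>'"
          using rat \<kappa>' by (cases "?m (A \<inter> J) / r i = 0") (auto intro!: powr_mono')
        have "h p \<le> h q" using that r[of i] h by (simp add: line_homeo_le_iff)
        then show "0 \<le> C * (D * h (2 * r i))" using that C by simp
      qed
      finally show ?thesis .
    qed
    \<comment> \<open>The measure of the part of \<open>A\<close> is bounded by that of
      \<open>A\<close> at every scale, whereas the length \<open>r i\<close> has shrunk by
      \<open>2 ^ i\<close>.\<close>
    have rel: "(?m (A \<inter> J) / r i) powr \<kappa>' \<le> \<delta> powr \<kappa>' * (2 powr \<kappa>') ^ i" if "J \<in> sets borel" for J i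
    proof -
      have "?m (A \<inter> J) \<le> ?m A"
        using finA A that by (intro measure_mono_fmeasurable) auto
      then have "?m (A \<inter> J) / r i \<le> ?m A / r i" using r[of i] by (intro divide_right_mono) auto
      also have "\<dots> = \<delta> * 2 ^ i" by (simp add: \<delta>_def r_def power_divide)
      finally have "(?m (A \<inter> J) / r i) powr \<kappa>' \<le> (\<delta> * 2 ^ i) powr \<kappa>'"
        using \<kappa>' r[of i] by (intro powr_mono2) auto
      also have "\<dots> = \<delta> powr \<kappa>' * (2 ^ i) powr \<kappa>'"
        by (rule powr_mult)
      also have "(2 ^ i) powr \<kappa>' = (2 powr \<kappa>') ^ i"
        by (simp add: powr_powr powr_realpow[symmetric] mult.commute)
      finally show ?thesis .
    qed
    define E where "E = C * h (2 * s) * \<delta> powr \<kappa>'"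
    have E: "0 \<le> E" using C h2s by (simp add: E_def)
    have bound: "?m (h ` (A \<inter> J)) \<le> D * E * sqrt \<theta> ^ i"
      if "?m (h ` (A \<inter> J)) \<le> C * (D * h (2 * r i)) * (?m (A \<inter> J) / r i) powr \<kappa>'" "0 \<le> D" "J \<in> sets borel" for D J i
    proof -
      have "?m (h ` (A \<inter> J)) \<le> C * (D * (\<theta> ^ i * h (2 * s))) * (\<delta> powr \<kappa>' * (2 powr \<kappa>') ^ i)"
        using that(1) hr[of i] rel[OF that(3), of i] C that(2) h2s \<theta>
        by (elim order_trans) (intro mult_mono mult_left_mono mult_nonneg_nonneg, auto)
      also have "\<dots> = D * E * (\<theta> * 2 powr \<kappa>') ^ i" by (simp add: E_def power_mult_distrib mult_ac)
      also have "\<dots> \<le> D * E * sqrt \<theta> ^ i"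
        using decay \<theta> that(2) E by (intro mult_left_mono power_mono) auto
      finally show ?thesis .
    qed
    have posP: "?m (h ` (A \<inter> P i)) \<le> 1 * E * sqrt \<theta> ^ i" for i
    proof (rule bound[OF piece])
      have "0 < r i \<and> 2 * r i \<le> 8 * r i" "r i < 2 * r i" using r[of i] by auto
      then show "sqs_on h C \<kappa> (r i) (2 * r i)" using sh unfolding shell_sqs_def by blast
      have "0 < h (r i)" using r[of i] h h0 by (simp add: line_homeo_pos_iff)
      then show "h (2 * r i) - h (r i) \<le> 1 * h (2 * r i)" by simp
    qed (auto simp: P_def)
    have posN: "?m (h ` (A \<inter> N i)) \<le> D * E * sqrt \<theta> ^ i" for i
    proof (rule bound[OF piece])
      have "- r i < 0 \<and> 8 * (- r i) \<le> - (2 * r i)" "- (2 * r i) < - r i" using r[of i] by auto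
      then show "sqs_on h C \<kappa> (- (2 * r i)) (- r i)" using sh unfolding shell_sqs_def by blast
      have neg: "h (- r i) < 0" "h (- (2 * r i)) < 0" "0 < h (2 * r i)"
        using r[of i] h h0 by (simp_all add: line_homeo_pos_iff line_homeo_neg_iff)
      have "\<bar>h (- (2 * r i))\<bar> \<le> D * \<bar>h (2 * r i)\<bar>" using sh unfolding shell_sqs_def by blast
      then show "h (- r i) - h (- (2 * r i)) \<le> D * h (2 * r i)" using neg by simp
    qed (use C in \<open>auto simp: N_def\<close>)
    have fm: "emeasure lborel (h ` (A \<inter> {p..q})) = ennreal (?m (h ` (A \<inter> {p..q})))" if "p \<le> q" for p q
    proof -
      have "h ` (A \<inter> {p..q}) \<subseteq> {h p..h q}" using line_homeo_Icc[OF h that] by blast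
      then have "bounded (h ` (A \<inter> {p..q}))" by (rule bounded_subset[OF bounded_closed_interval])
      then show ?thesis
        using emeasure_bounded_finite[of "h ` (A \<inter> {p..q})"] by (intro emeasure_eq_ennreal_measure) auto
    qed
    have "x \<in> (\<Union>i. (A \<inter> P i) \<union> (A \<inter> N i)) \<union> {0}" if x: "x \<in> A" for x
    proof (cases "x = 0")
      case False
      then have "0 < \<bar>x\<bar>" by simp
      then obtain n where n: "(1/2)^n < \<bar>x\<bar> / s"
        using s real_arch_pow_inv[of "\<bar>x\<bar> / s" "1/2"] by auto
      then have ex: "\<exists>n. r n < \<bar>x\<bar>" using s by (auto simp: r_def field_simps)
      define m where "m = (LEAST n. r n < \<bar>x\<bar>)"
      have m: "r m < \<bar>x\<bar>" using ex unfolding m_def by (rule LeastI_ex)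
      have "\<bar>x\<bar> \<le> 2 * r m"
      proof (cases m)
        case 0 then show ?thesis using subsetD[OF A(2) x] by (auto simp: r_def)
      next
        case (Suc k)
        then have "\<not> r k < \<bar>x\<bar>" using not_less_Least[of k "\<lambda>n. r n < \<bar>x\<bar>"] m_def by auto
        then show ?thesis using Suc by (auto simp: r_def)
      qed
      with m x show ?thesis by (auto simp: P_def N_def abs_if intro!: exI[of _ m] split: if_splits)
    qed simp
    then have "h ` A \<subseteq> (\<Union>i. h ` (A \<inter> P i) \<union> h ` (A \<inter> N i)) \<union> {h 0}" by blast
    moreover have b [measurable]: "h ` (A \<inter> P i) \<in> sets borel" "h ` (A \<inter> N i) \<in> sets borel" for i
      using A by (auto intro!: line_homeo_borel[OF h] simp: P_def N_def)
    ultimately have "emeasure lborel (h ` A) \<le> emeasure lborel ((\<Union>i. h ` (A \<inter> P i) \<union> h ` (A \<inter> N i)) \<union> {h 0})"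
      by (intro emeasure_mono) auto
    also have "\<dots> \<le> emeasure lborel (\<Union>i. h ` (A \<inter> P i) \<union> h ` (A \<inter> N i)) + emeasure lborel {h 0}"
      by (intro emeasure_subadditive) auto
    also have "\<dots> \<le> (\<Sum>i. emeasure lborel (h ` (A \<inter> P i) \<union> h ` (A \<inter> N i)))"
      by (simp add: emeasure_subadditive_countably b image_subset_iff)
    also have "\<dots> \<le> (\<Sum>i. ennreal ((1 + D) * E * sqrt \<theta> ^ i))"
    proof (intro suminf_le)
      fix i
      have "emeasure lborel (h ` (A \<inter> P i) \<union> h ` (A \<inter> N i)) \<le> emeasure lborel (h ` (A \<inter> P i)) + emeasure lborel (h ` (A \<inter> N i))"
        by (intro emeasure_subadditive) auto
      also have "\<dots> = ennreal (?m (h ` (A \<inter> P i))) + ennreal (?m (h ` (A \<inter> N i)))"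
        using r[of i] by (simp add: P_def N_def fm)
      also have "\<dots> \<le> ennreal (1 * E * sqrt \<theta> ^ i) + ennreal (D * E * sqrt \<theta> ^ i)"
        using posP posN by (intro add_mono ennreal_leI)
      also have "\<dots> = ennreal ((1 + D) * E * sqrt \<theta> ^ i)"
        using E C sq by (subst ennreal_plus[symmetric]) (auto simp: algebra_simps)
      finally show "emeasure lborel (h ` (A \<inter> P i) \<union> h ` (A \<inter> N i)) \<le> ennreal ((1 + D) * E * sqrt \<theta> ^ i)" .
    qed auto
    also have "\<dots> = ennreal ((1 + D) * E * (1 / (1 - sqrt \<theta>)))"
    proof -
      have "(\<lambda>i. (1 + D) * E * sqrt \<theta> ^ i) sums ((1 + D) * E * (1 / (1 - sqrt \<theta>)))"
        using sq by (intro sums_mult geometric_sums) auto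
      then show ?thesis using E C sq by (intro suminf_ennreal_eq) auto
    qed
    finally have "?m (h ` A) \<le> (1 + D) * E * (1 / (1 - sqrt \<theta>))"
      unfolding measure_def using E C sq by (intro enn2real_leI) auto
    then show "?m (h ` A) \<le> C' * h (2 * s) * (?m A / s) powr \<kappa>'"
      by (simp add: C'_def E_def \<delta>_def mult_ac)
  qed
qed

text \<open>An interval outside the ratio 8 lies within twice its own length \<open>s\<close> of 0,
  so the estimate for central sets applies at scale \<open>s\<close>. It involves
  \<open>h (2 * s)\<close>, and what remains is to bound this by the length of the image
  interval.\<close>

lemma sqs_if_shell:
  assumes h: "line_homeo h" and h0: "h 0 = 0" and sh: "shell_sqs h C \<kappa> D \<theta>"
    and C: "0 < C" "0 < \<kappa>" "0 < D" and \<theta>: "0 < \<theta>" "\<theta> < 1"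
  obtains C' \<kappa>' where "0 < C'" "0 < \<kappa>'" "\<And>a b. a < b \<Longrightarrow> sqs_on h C' \<kappa>' a b"
proof -
  obtain C1 \<kappa>' where C1: "0 < C1" "0 < \<kappa>'" "\<kappa>' \<le> \<kappa>" and
    central: "\<And>s A. 0 < s \<Longrightarrow> A \<in> sets borel \<Longrightarrow> A \<subseteq> {-(2 * s)..2 * s} \<Longrightarrow>
       measure lborel (h ` A) \<le> C1 * h (2 * s) * (measure lborel A / s) powr \<kappa>'"
    using sqs_central_if_shell[OF h h0 sh C \<theta>] by metis
  obtain c where c: "0 < c" "c < 1" and
    comp: "\<And>h a b p q. line_homeo h \<Longrightarrow> (\<And>a' b'. a \<le> a' \<Longrightarrow> a' < b' \<Longrightarrow> b' \<le> b \<Longrightarrow> sqs_on h C \<kappa> a' b') \<Longrightarrow>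
       a \<le> p \<Longrightarrow> p < q \<Longrightarrow> q \<le> b \<Longrightarrow> b - a \<le> 7 * (q - p) \<Longrightarrow> c * (h b - h a) \<le> h q - h p"
    using sqs_on_comparable[of C \<kappa> 7] C by auto
  have sqs: "sqs_on h C \<kappa> a b" if "a < b" "0 < a \<and> b \<le> 8 * a \<or> b < 0 \<and> 8 * b \<le> a" for a b
    using sh that unfolding shell_sqs_def by blast
  have gr: "\<bar>h x\<bar> \<le> \<theta> * \<bar>h (2 * x)\<bar>" and sym: "\<bar>h (- x)\<bar> \<le> D * \<bar>h x\<bar>" for x
    using sh unfolding shell_sqs_def by blast+
  note iff = line_homeo_le_iff[OF h] line_homeo_less_iff[OF h] line_homeo_pos_iff[OF h h0] line_homeo_neg_iff[OF h h0]
  define c2 where "c2 = min (c * (1 - \<theta>)) (c * (1 - \<theta>) / D)"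
  have c2: "0 < c2" "c2 \<le> c * (1 - \<theta>)" "c2 \<le> c * (1 - \<theta>) / D"
    using c \<theta> C by (auto simp: c2_def)
  \<comment> \<open>One end of the interval contains a piece of length \<open>s / 4\<close> inside
    \<open>{s / 4..2 * s}\<close> or its mirror image. That shell is 7 times as long as the piece,
    which explains the constant in \<open>comp\<close>; by the decay with \<open>\<theta>\<close>
    the image of the shell is a fixed proportion of \<open>\<bar>h (2 * s)\<bar>\<close> or of
    \<open>\<bar>h (- (2 * s))\<bar>\<close>.\<close>
  have size: "c2 * h (2 * s) \<le> h b - h a" if s: "0 < s" "s = b - a" "-(2 * s) \<le> a" "b \<le> 2 * s" for a b s
  proof (cases "s / 2 \<le> b")
    case True
    have le: "a \<le> b - s / 4" "b - s / 4 < b" "s / 4 \<le> b - s / 4" using s True by linarith+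
    have "c * (h (2 * s) - h (s / 4)) \<le> h b - h (b - s / 4)"
    proof (rule comp[OF h sqs])
      show "0 < a' \<and> b' \<le> 8 * a' \<or> b' < 0 \<and> 8 * b' \<le> a'" if "s / 4 \<le> a'" "a' < b'" "b' \<le> 2 * s" for a' b'
        using that s(1) by auto
    qed (use le s(4) in \<open>simp_all add: field_simps\<close>)
    also have "\<dots> \<le> h b - h a" using le by (simp add: iff)
    finally have 1: "c * (h (2 * s) - h (s / 4)) \<le> h b - h a" .
    have "h (s / 4) \<le> h s" "0 < h s" "0 < h (2 * s)" using s(1) by (auto simp: iff)
    then have "h (s / 4) \<le> \<theta> * h (2 * s)" using gr[of s] by simp
    then have "(1 - \<theta>) * h (2 * s) \<le> h (2 * s) - h (s / 4)" by (simp add: algebra_simps)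
    then have "c * ((1 - \<theta>) * h (2 * s)) \<le> c * (h (2 * s) - h (s / 4))"
      using c by (intro mult_left_mono) auto
    moreover have "c2 * h (2 * s) \<le> (c * (1 - \<theta>)) * h (2 * s)"
      using c2 \<open>0 < h (2 * s)\<close> by (intro mult_right_mono) auto
    ultimately show ?thesis using 1 by (simp add: mult.assoc)
  next
    case False
    have le: "a + s / 4 \<le> b" "a < a + s / 4" "a + s / 4 \<le> - (s / 4)" using s False by linarith+
    have "c * (h (- (s / 4)) - h (- (2 * s))) \<le> h (a + s / 4) - h a"
    proof (rule comp[OF h sqs])
      show "0 < a' \<and> b' \<le> 8 * a' \<or> b' < 0 \<and> 8 * b' \<le> a'" if "- (2 * s) \<le> a'" "a' < b'" "b' \<le> - (s / 4)" for a' b'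
        using that s(1) by auto
    qed (use le s(3) in \<open>simp_all add: field_simps\<close>)
    also have "\<dots> \<le> h b - h a" using le by (simp add: iff)
    finally have 1: "c * (h (- (s / 4)) - h (- (2 * s))) \<le> h b - h a" .
    have neg: "h (- s) \<le> h (- (s / 4))" "h (- s) < 0" "h (- (2 * s)) < 0" "0 < h (2 * s)" using s(1) by (auto simp: iff)
    then have "- h (- s) \<le> \<theta> * (- h (- (2 * s)))" using gr[of "- s"] by simp
    then have "(1 - \<theta>) * (- h (- (2 * s))) \<le> h (- (s / 4)) - h (- (2 * s))" using neg by (simp add: algebra_simps)
    then have "c * ((1 - \<theta>) * (- h (- (2 * s)))) \<le> c * (h (- (s / 4)) - h (- (2 * s)))"
      using c by (intro mult_left_mono) auto
    moreover have "c2 * h (2 * s) \<le> (c * (1 - \<theta>) / D) * (D * (- h (- (2 * s))))"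
    proof (rule mult_mono)
      show "h (2 * s) \<le> D * - h (- (2 * s))" using sym[of "- (2 * s)"] neg by simp
    qed (use c2 neg c \<theta> C in auto)
    ultimately show ?thesis using 1 C by simp
  qed
  define C' where "C' = max C (C1 / c2)"
  have C': "0 < C'" "C \<le> C'" "C1 / c2 \<le> C'" using C by (auto simp: C'_def)
  have "sqs_on h C' \<kappa>' a b" if ab: "a < b" for a b
  proof (cases "0 < a \<and> b \<le> 8 * a \<or> b < 0 \<and> 8 * b \<le> a")
    case True
    show ?thesis
      by (rule sqs_on_mono[OF h sqs[OF ab True] ab]) (use C C' C1 in auto)
  next
    case False
    define s where "s = b - a"
    have s: "0 < s" "-(2 * s) \<le> a" "b \<le> 2 * s" using False ab by (auto simp: s_def)
    show ?thesis
      unfolding sqs_on_def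
    proof (intro ballI impI)
      fix A :: "real set" assume A: "A \<in> sets borel" "A \<subseteq> {a..b}"
      have "measure lborel (h ` A) \<le> C1 * h (2 * s) * (measure lborel A / s) powr \<kappa>'"
        by (rule central) (use s A in auto)
      also have "\<dots> \<le> C1 * ((h b - h a) / c2) * (measure lborel A / s) powr \<kappa>'"
        using size[OF s(1) s_def s(2,3)] c2 C1
        by (intro mult_right_mono mult_left_mono) (auto simp: field_simps)
      also have "\<dots> = (C1 / c2) * (h b - h a) * (measure lborel A / s) powr \<kappa>'" by simp
      also have "\<dots> \<le> C' * (h b - h a) * (measure lborel A / s) powr \<kappa>'"
        using C' ab by (intro mult_right_mono) (auto simp: iff)
      finally show "measure lborel (h ` A) \<le> C' * (h b - h a) * (measure lborel A / (b - a)) powr \<kappa>'"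
        by (simp add: s_def)
    qed
  qed
  then show ?thesis using that C' C1 by blast
qed

section \<open>Conjugation by the inversion\<close>

text \<open>The map \<open>h\<close> in the coordinate at infinity. For \<open>h 0 = 0\<close> its
  value at 0 is 0, the right one because the extended map fixes the point at infinity.\<close>

definition conj_nrecip :: "(real \<Rightarrow> real) \<Rightarrow> real \<Rightarrow> real" where
  "conj_nrecip h x = nrecip (h (nrecip x))"

lemma nrecip_0 [simp]: "nrecip 0 = 0"
  by (simp add: nrecip_def)

lemma nrecip_minus: "nrecip (- x) = - nrecip x"
  by (simp add: nrecip_def)

lemma conj_nrecip_twice [simp]: "conj_nrecip (conj_nrecip h) = h"
  by (simp add: conj_nrecip_def fun_eq_iff)

lemma nrecip_pos_iff: "0 < nrecip x \<longleftrightarrow> x < 0" and nrecip_neg_iff: "nrecip x < 0 \<longleftrightarrow> 0 < x"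
  by (auto simp: nrecip_def)

lemma nrecip_strict_mono: "0 < x * y \<Longrightarrow> nrecip x < nrecip y \<longleftrightarrow> x < y"
  by (auto simp: nrecip_def zero_less_mult_iff)

text \<open>The inversion is increasing only on each half line; across 0 the order is preserved
  because \<open>h\<close> and its conjugate preserve signs.\<close>

lemma line_homeo_conj_nrecip:
  assumes h: "line_homeo h" and h0: "h 0 = 0"
  shows "line_homeo (conj_nrecip h)" "conj_nrecip h 0 = 0"
proof -
  show "conj_nrecip h 0 = 0" by (simp add: conj_nrecip_def h0)
  have sgn: "0 < conj_nrecip h x \<longleftrightarrow> 0 < x" "conj_nrecip h x < 0 \<longleftrightarrow> x < 0" for x
    by (simp_all add: conj_nrecip_def nrecip_pos_iff nrecip_neg_iff line_homeo_pos_iff[OF h h0] line_homeo_neg_iff[OF h h0])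
  have "conj_nrecip h x < conj_nrecip h y" if "x < y" for x y
  proof (cases "0 < x * y")
    case True
    then have "nrecip x < nrecip y" using that by (simp add: nrecip_strict_mono)
    then have "h (nrecip x) < h (nrecip y)" by (simp add: line_homeo_less_iff[OF h])
    moreover have "0 < h (nrecip x) * h (nrecip y)"
      using True by (auto simp: zero_less_mult_iff line_homeo_pos_iff[OF h h0] line_homeo_neg_iff[OF h h0] nrecip_pos_iff nrecip_neg_iff)
    ultimately show ?thesis by (simp add: conj_nrecip_def nrecip_strict_mono)
  next
    case False
    then have "x \<le> 0" "0 \<le> y" using that by (auto simp: zero_less_mult_iff not_less)
    then have "conj_nrecip h x \<le> 0" "0 \<le> conj_nrecip h y" "conj_nrecip h x < 0 \<or> 0 < conj_nrecip h y"
      using sgn[of x] sgn[of y] that by (auto simp: not_less[symmetric])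
    then show ?thesis by auto
  qed
  moreover have "surj (conj_nrecip h)"
  proof (rule surjI)
    fix y
    have "h (inv h (nrecip y)) = nrecip y" using h by (simp add: line_homeo_def surj_f_inv_f)
    then show "conj_nrecip h (nrecip (inv h (nrecip y))) = y" by (simp add: conj_nrecip_def)
  qed
  ultimately show "line_homeo (conj_nrecip h)" by (simp add: line_homeo_def strict_mono_def)
qed

text \<open>The doubling, decay and symmetry bounds at a single point, in a form stable under
  reciprocals: inversion exchanges the roles of \<open>x\<close> and \<open>2 * x\<close> and of
  \<open>x\<close> and \<open>- x\<close>.\<close>

definition growth :: "(real \<Rightarrow> real) \<Rightarrow> real \<Rightarrow> real \<Rightarrow> bool" where
  "growth h c x \<longleftrightarrow> c * \<bar>h (2 * x)\<bar> \<le> \<bar>h x\<bar> \<and> \<bar>h x\<bar> \<le> (1 - c) * \<bar>h (2 * x)\<bar> \<and> c * \<bar>h (- x)\<bar> \<le> \<bar>h x\<bar>"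

text \<open>Compare the interval between 0 and \<open>2 * x\<close> with its two halves, and the
  interval between \<open>- x\<close> and \<open>x\<close> with the half that ends at
  \<open>x\<close>. One half gives the lower bound and the other half the factor
  \<open>1 - c\<close>.\<close>

lemma growth_if_sqs:
  assumes C: "0 < C" "0 < \<kappa>"
  obtains c where "0 < c" "c < 1"
    "\<And>(h :: real \<Rightarrow> real) x. line_homeo h \<Longrightarrow> h 0 = 0 \<Longrightarrow> 
       (\<And>a b. - (2 * \<bar>x\<bar>) \<le> a \<Longrightarrow> a < b \<Longrightarrow> b \<le> 2 * \<bar>x\<bar> \<Longrightarrow> sqs_on h C \<kappa> a b) \<Longrightarrow> growth h c x"
proof -
  obtain c where c: "0 < c" "c < 1" and
    comp: "\<And>h a b p q. line_homeo h \<Longrightarrow> (\<And>a' b'. a \<le> a' \<Longrightarrow> a' < b' \<Longrightarrow> b' \<le> b \<Longrightarrow> sqs_on h C \<kappa> a' b') \<Longrightarrow>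
       a \<le> p \<Longrightarrow> p < q \<Longrightarrow> q \<le> b \<Longrightarrow> b - a \<le> 2 * (q - p) \<Longrightarrow> c * (h b - h a) \<le> h q - h p"
    using sqs_on_comparable[of C \<kappa> 2] C by auto
  show ?thesis
  proof (rule that[OF c])
    fix h :: "real \<Rightarrow> real" and x :: real
    assume h: "line_homeo h" and h0: "h 0 = 0" and
      sqs: "\<And>a b. - (2 * \<bar>x\<bar>) \<le> a \<Longrightarrow> a < b \<Longrightarrow> b \<le> 2 * \<bar>x\<bar> \<Longrightarrow> sqs_on h C \<kappa> a b"
    note iff = line_homeo_pos_iff[OF h h0] line_homeo_neg_iff[OF h h0]
    have comp': "c * (h b - h a) \<le> h q - h p" if "- (2 * \<bar>x\<bar>) \<le> a" "a \<le> p" "p < q" "q \<le> b" "b \<le> 2 * \<bar>x\<bar>" "b - a \<le> 2 * (q - p)" for a b p q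
      by (rule comp[OF h sqs]) (use that in auto)
    have "c * \<bar>h (2 * x)\<bar> \<le> \<bar>h x\<bar> \<and> \<bar>h x\<bar> \<le> (1 - c) * \<bar>h (2 * x)\<bar> \<and> c * \<bar>h (- x)\<bar> \<le> \<bar>h x\<bar>"
    proof (cases x "0 :: real" rule: linorder_cases)
      case less
      have "c * (h 0 - h (2 * x)) \<le> h 0 - h x" "c * (h 0 - h (2 * x)) \<le> h x - h (2 * x)"
        "c * (h (- x) - h x) \<le> h 0 - h x"
        using less by (intro comp'; simp)+
      moreover have neg: "h x < 0" "h (2 * x) < 0" "0 < h (- x)" using less by (simp_all add: iff)
      moreover have "c * h x < 0" using c neg by (simp add: mult_pos_neg)
      ultimately show ?thesis using h0 by (simp add: algebra_simps)
    next
      case greater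
      have "c * (h (2 * x) - h 0) \<le> h x - h 0" "c * (h (2 * x) - h 0) \<le> h (2 * x) - h x"
        "c * (h x - h (- x)) \<le> h x - h 0"
        using greater by (intro comp'; simp)+
      moreover have pos: "0 < h x" "0 < h (2 * x)" "h (- x) < 0" using greater by (simp_all add: iff)
      moreover have "0 < c * h x" using c pos by simp
      ultimately show ?thesis using h0 by (simp add: algebra_simps)
    qed (simp add: h0)
    then show "growth h c x" by (simp add: growth_def)
  qed
qed

lemma bilip_nrecip:
  assumes "a \<le> b" "0 < p" "{a..b} \<subseteq> {p..M * p} \<or> {a..b} \<subseteq> {-(M * p)..-p}" "0 < M"
  shows "bilip nrecip (inverse ((M * p)\<^sup>2)) (inverse (p\<^sup>2)) a b"
proof (rule bilip_if_deriv)
  have x: "p \<le> \<bar>x\<bar> \<and> \<bar>x\<bar> \<le> M * p" if "a \<le> x" "x \<le> b" for x using assms that by auto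
  then have nz: "x \<noteq> 0" if "a \<le> x" "x \<le> b" for x using that assms(2) by fastforce
  then show "(nrecip has_real_derivative inverse (x\<^sup>2)) (at x within {a..b})" if "a \<le> x" "x \<le> b" for x
    using that by (intro DERIV_nrecip) auto
  show "inverse ((M * p)\<^sup>2) \<le> \<bar>inverse (x\<^sup>2)\<bar> \<and> \<bar>inverse (x\<^sup>2)\<bar> \<le> inverse (p\<^sup>2)" if "a \<le> x" "x \<le> b" for x
  proof -
    have "p\<^sup>2 \<le> \<bar>x\<bar>\<^sup>2" "\<bar>x\<bar>\<^sup>2 \<le> (M * p)\<^sup>2"
      using x[OF that] \<open>0 < p\<close> by (intro power_mono; simp)+
    then have "p\<^sup>2 \<le> x\<^sup>2" "x\<^sup>2 \<le> (M * p)\<^sup>2" by simp_all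
    then have "inverse ((M * p)\<^sup>2) \<le> inverse (x\<^sup>2)" "inverse (x\<^sup>2) \<le> inverse (p\<^sup>2)"
      using \<open>0 < p\<close> nz[OF that] by (intro le_imp_inverse_le; simp)+
    then show ?thesis by simp
  qed
  show "nrecip x < nrecip y" if "a \<le> x" "x < y" "y \<le> b" for x y
  proof -
    have "x \<in> {a..b}" "y \<in> {a..b}" using that by auto
    then have "0 < x \<and> 0 < y \<or> x < 0 \<and> y < 0" using assms by fastforce
    then show ?thesis using that by (auto simp: nrecip_strict_mono zero_less_mult_iff)
  qed
qed (use assms in auto)

text \<open>As \<open>2 * nrecip (2 * x) = nrecip x\<close>, taking reciprocals turns the first two
  bounds at \<open>nrecip (2 * x)\<close> into those at \<open>x\<close>. The bound for the
  reflected point comes from \<open>- nrecip x\<close>.\<close>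

lemma growth_conj_nrecip:
  assumes h: "line_homeo h" and h0: "h 0 = 0" and gr: "growth h c (nrecip (2 * x))" "growth h c (- nrecip x)"
  shows "growth (conj_nrecip h) c x"
proof (cases "x = 0")
  case True
  then show ?thesis by (simp add: growth_def conj_nrecip_def h0)
next
  case False
  note iff = line_homeo_pos_iff[OF h h0] line_homeo_neg_iff[OF h h0]
  have nz: "h y \<noteq> 0" if "y \<noteq> 0" for y using iff[of y] that by (metis linorder_neq_iff)
  have x: "nrecip x \<noteq> 0" "2 * nrecip (2 * x) = nrecip x" using False by (simp_all add: nrecip_def)
  define u v where "u = h (nrecip (2 * x))" and "v = h (nrecip x)"
  have uv: "u \<noteq> 0" "v \<noteq> 0" "h (- nrecip x) \<noteq> 0" using False by (auto intro!: nz simp: nrecip_def u_def v_def)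
  have "c * \<bar>v\<bar> \<le> \<bar>u\<bar>" "\<bar>u\<bar> \<le> (1 - c) * \<bar>v\<bar>" "c * \<bar>v\<bar> \<le> \<bar>h (- nrecip x)\<bar>"
    using gr x(2) unfolding growth_def u_def v_def by (simp_all add: mult.commute[of _ 2])
  then show ?thesis
    using uv unfolding growth_def conj_nrecip_def abs_nrecip nrecip_minus u_def[symmetric] v_def[symmetric]
    by (auto simp: field_simps)
qed

text \<open>Write \<open>h\<close> as the conjugate of its conjugate. The inner inversion has
  distortion \<open>8\<^sup>2 = 64\<close> on an interval of ratio 8. Three doublings bound the
  ratio of the image interval by \<open>1 / c ^ 3\<close>, and the outer inversion contributes its
  square.\<close>

lemma sqs_on_if_conj_nrecip:
  assumes h: "line_homeo h" and h0: "h 0 = 0" and C: "0 < C" "0 < \<kappa>" and c: "0 < c" "c < 1"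
    and gr: "\<And>x. growth h c x" and ab: "a < b" and ratio: "0 < a \<and> b \<le> 8 * a \<or> b < 0 \<and> 8 * b \<le> a"
    and sq: "sqs_on (conj_nrecip h) C \<kappa> (nrecip a) (nrecip b)"
  shows "sqs_on h (C * (1 / c ^ 3)\<^sup>2 * 64 powr \<kappa>) \<kappa> a b"
proof -
  let ?g = "conj_nrecip h"
  note g = line_homeo_conj_nrecip[OF h h0]
  note iff = line_homeo_pos_iff[OF h h0] line_homeo_neg_iff[OF h h0]
  have nz: "h x \<noteq> 0" if "x \<noteq> 0" for x using iff[of x] that by (metis linorder_neq_iff)
  define M where "M = 1 / c ^ 3"
  have M: "1 \<le> M" using c by (simp add: M_def power_le_one)
  have h8: "\<bar>h (8 * x)\<bar> \<le> M * \<bar>h x\<bar>" for x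
  proof -
    have "c * (c * (c * \<bar>h (8 * x)\<bar>)) \<le> c * (c * \<bar>h (4 * x)\<bar>)"
      using gr[of "4 * x", unfolded growth_def] c by (intro mult_left_mono) auto
    also have "\<dots> \<le> c * \<bar>h (2 * x)\<bar>" using gr[of "2 * x", unfolded growth_def] c by (intro mult_left_mono) auto
    also have "\<dots> \<le> \<bar>h x\<bar>" using gr[of x, unfolded growth_def] by simp
    finally show ?thesis using c by (simp add: M_def field_simps power3_eq_cube)
  qed
  define p where "p = min \<bar>a\<bar> \<bar>b\<bar>"
  define H where "H = min \<bar>h a\<bar> \<bar>h b\<bar>"
  have p: "0 < p" "{a..b} \<subseteq> {p..8 * p} \<or> {a..b} \<subseteq> {-(8 * p)..-p}"
    using ratio ab by (auto simp: p_def min_def)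
  have ab0: "0 < a * b" using ratio ab by (auto simp: zero_less_mult_iff)
  have im: "nrecip ` {a..b} = {nrecip a..nrecip b}" using ab ab0 by (intro nrecip_image_Icc) auto
  have gg: "?g (nrecip a) = nrecip (h a)" "?g (nrecip b) = nrecip (h b)" by (simp_all add: conj_nrecip_def)
  have hab: "h a < h b" using ab by (simp add: line_homeo_less_iff[OF h])
  have H: "0 < H" "{h a..h b} \<subseteq> {H..M * H} \<or> {h a..h b} \<subseteq> {-(M * H)..-H}"
  proof -
    show "0 < H" using nz[of a] nz[of b] ab0 by (cases "a = 0"; cases "b = 0") (auto simp: H_def)
    show "{h a..h b} \<subseteq> {H..M * H} \<or> {h a..h b} \<subseteq> {-(M * H)..-H}"
    proof (cases "0 < a")
      case True
      then have "0 < h a" "0 < h b" "h b \<le> h (8 * a)" "0 < h (8 * a)"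
        using ratio ab by (auto simp: iff line_homeo_le_iff[OF h])
      then show ?thesis using h8[of a] hab by (auto simp: H_def min_def)
    next
      case False
      then have "h a < 0" "h b < 0" "h (8 * b) \<le> h a" "h (8 * b) < 0"
        using ratio ab by (auto simp: iff line_homeo_le_iff[OF h])
      then show ?thesis using h8[of b] hab by (auto simp: H_def min_def)
    qed
  qed
  have hab0: "0 < h a * h b" using H hab by (auto simp: zero_less_mult_iff)
  define HM where "HM = inverse (M * H)"
  have bl: "bilip nrecip (inverse ((M * HM)\<^sup>2)) (inverse (HM\<^sup>2)) (nrecip (h a)) (nrecip (h b))"
  proof (rule bilip_nrecip)
    show "nrecip (h a) \<le> nrecip (h b)" using hab0 hab by (intro nrecip_mono) auto
    show "0 < HM" "0 < M" using H M by (auto simp: HM_def)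
    have inv: "inverse (M * H) \<le> inverse \<bar>y\<bar> \<and> inverse \<bar>y\<bar> \<le> inverse H" if "H \<le> \<bar>y\<bar>" "\<bar>y\<bar> \<le> M * H" for y
      using that H by (intro conjI le_imp_inverse_le) auto
    have MH: "M * (inverse M * inverse H) = inverse H" using M by simp
    show "{nrecip (h a)..nrecip (h b)} \<subseteq> {HM..M * HM} \<or> {nrecip (h a)..nrecip (h b)} \<subseteq> {-(M * HM)..-HM}"
    proof (cases "0 < h a")
      case True
      then have "H \<le> \<bar>h a\<bar>" "\<bar>h b\<bar> \<le> M * H" "H \<le> \<bar>h b\<bar>" "\<bar>h a\<bar> \<le> M * H" using H hab by auto
      then show ?thesis using inv[of "h a"] inv[of "h b"] True hab
        by (intro disjI2) (auto simp: MH nrecip_def HM_def)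
    next
      case False
      then have neg: "h a < 0" "h b < 0" using hab0 by (auto simp: zero_less_mult_iff)
      then have "H \<le> \<bar>h a\<bar>" "\<bar>h b\<bar> \<le> M * H" "H \<le> \<bar>h b\<bar>" "\<bar>h a\<bar> \<le> M * H" using H hab by auto
      then show ?thesis using inv[of "h a"] inv[of "h b"] neg
        by (intro disjI1) (auto simp: MH nrecip_def HM_def)
    qed
  qed
  have "sqs_on h (C * (inverse (HM\<^sup>2) / inverse ((M * HM)\<^sup>2)) * (inverse (p\<^sup>2) / inverse ((8 * p)\<^sup>2)) powr \<kappa>) \<kappa> a b"
  proof (rule sqs_on_compose[OF sq ab C g(1) bilip_nrecip])
    show "bilip nrecip (inverse ((M * HM)\<^sup>2)) (inverse (HM\<^sup>2)) (?g (nrecip a)) (?g (nrecip b))"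
      using bl by (simp add: gg)
  qed (use p ab im H M in \<open>auto simp: conj_nrecip_def HM_def\<close>)
  moreover have "inverse (HM\<^sup>2) / inverse ((M * HM)\<^sup>2) = M\<^sup>2" "inverse (p\<^sup>2) / inverse ((8 * p)\<^sup>2) = 64"
    using H M p by (auto simp: HM_def field_simps power_mult_distrib)
  ultimately have "sqs_on h (C * M\<^sup>2 * 64 powr \<kappa>) \<kappa> a b" by (simp only:)
  then show ?thesis by (simp only: M_def)
qed

lemma shell_sqs_if_growth:
  assumes h: "line_homeo h" and c: "0 < c" "c < 1" and gr: "\<And>x. growth h c x"
    and sqs: "\<And>a b. a < b \<Longrightarrow> 0 < a \<and> b \<le> 8 * a \<or> b < 0 \<and> 8 * b \<le> a \<Longrightarrow> sqs_on h C \<kappa> a b"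
  shows "shell_sqs h C \<kappa> (1 / c) (1 - c)"
proof -
  have "\<bar>h (- x)\<bar> \<le> (1 / c) * \<bar>h x\<bar> \<and> \<bar>h (2 * x)\<bar> \<le> (1 / c) * \<bar>h x\<bar> \<and> \<bar>h x\<bar> \<le> (1 - c) * \<bar>h (2 * x)\<bar>" for x
    using gr[of x, unfolded growth_def] c by (auto simp: field_simps)
  then show ?thesis using sqs by (auto simp: shell_sqs_def)
qed

lemma sqs_constant_mono:
  fixes C c \<kappa> :: real
  assumes "0 < C" "0 < \<kappa>" "0 < c" "c < 1"
  shows "C \<le> C * (1 / c ^ 3)\<^sup>2 * 64 powr \<kappa>"
proof -
  have "1 \<le> (1 / c ^ 3)\<^sup>2" using assms by (simp add: power_le_one power_mult[symmetric] power_divide)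
  moreover have "1 \<le> 64 powr \<kappa>" using assms by (simp add: ge_one_powr_ge_zero)
  ultimately have "1 \<le> (1 / c ^ 3)\<^sup>2 * 64 powr \<kappa>" using mult_mono[of 1 "(1 / c ^ 3)\<^sup>2" 1 "64 powr \<kappa>"] by auto
  then show ?thesis using assms mult_left_mono[of 1 "(1 / c ^ 3)\<^sup>2 * 64 powr \<kappa>" C] by (simp add: mult.assoc)
qed

text \<open>Growth at \<open>x\<close> involves intervals up to \<open>2 * \<bar>x\<bar>\<close>, so
  the window \<open>{-4..4}\<close> covers \<open>\<bar>x\<bar> \<le> 2\<close> and the inversion
  covers all larger \<open>x\<close>. An interval of ratio 8 that leaves the window stays outside
  \<open>{-1/2..1/2}\<close> and is inverted into it.\<close>

lemma sqs_line_if_local: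
  assumes h: "line_homeo h" and h0: "h 0 = 0" and C: "0 < C" "0 < \<kappa>"
    and loc: "\<And>a b. -4 \<le> a \<Longrightarrow> a < b \<Longrightarrow> b \<le> 4 \<Longrightarrow> sqs_on h C \<kappa> a b"
    and loc': "\<And>a b. -4 \<le> a \<Longrightarrow> a < b \<Longrightarrow> b \<le> 4 \<Longrightarrow> sqs_on (conj_nrecip h) C \<kappa> a b"
  obtains C' \<kappa>' where "0 < C'" "0 < \<kappa>'" "\<And>a b. a < b \<Longrightarrow> sqs_on h C' \<kappa>' a b"
proof -
  let ?g = "conj_nrecip h"
  note g = line_homeo_conj_nrecip[OF h h0]
  obtain c where c: "0 < c" "c < 1" and
    growth: "\<And>(h :: real \<Rightarrow> real) x. line_homeo h \<Longrightarrow> h 0 = 0 \<Longrightarrow>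
       (\<And>a b. - (2 * \<bar>x\<bar>) \<le> a \<Longrightarrow> a < b \<Longrightarrow> b \<le> 2 * \<bar>x\<bar> \<Longrightarrow> sqs_on h C \<kappa> a b) \<Longrightarrow> growth h c x"
    using growth_if_sqs[OF C] by metis
  have gr: "growth h c x" for x
  proof (cases "\<bar>x\<bar> \<le> 2")
    case True
    then show ?thesis by (intro growth[OF h h0 loc]) auto
  next
    case False
    have small: "\<bar>nrecip y\<bar> \<le> 2" if "1 / 2 \<le> \<bar>y\<bar>" for y
      using le_imp_inverse_le[OF that] by (simp add: abs_nrecip)
    have "\<bar>nrecip (2 * x)\<bar> \<le> 2" "\<bar>- nrecip x\<bar> \<le> 2"
      using False by (auto intro!: small)
    then have "growth ?g c (nrecip (2 * x))" "growth ?g c (- nrecip x)"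
      by (intro growth[OF g loc']; linarith)+
    then show ?thesis using growth_conj_nrecip[OF g, of c x] by simp
  qed
  let ?C = "C * (1 / c ^ 3)\<^sup>2 * 64 powr \<kappa>"
  have "sqs_on h ?C \<kappa> a b" if ab: "a < b" and ratio: "0 < a \<and> b \<le> 8 * a \<or> b < 0 \<and> 8 * b \<le> a" for a b
  proof (cases "-4 \<le> a \<and> b \<le> 4")
    case True
    show ?thesis by (rule sqs_on_mono[OF h loc]) (use True ab C sqs_constant_mono[OF C c] in auto)
  next
    case False
    have small: "\<bar>nrecip x\<bar> \<le> 2" if "1 / 2 \<le> \<bar>x\<bar>" for x
      using le_imp_inverse_le[OF that] by (simp add: abs_nrecip)
    have "\<bar>nrecip a\<bar> \<le> 2" "\<bar>nrecip b\<bar> \<le> 2" using False ratio ab by (auto intro!: small)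
    moreover have "nrecip a < nrecip b" using ab ratio by (auto simp: nrecip_strict_mono zero_less_mult_iff)
    ultimately show ?thesis
      by (intro sqs_on_if_conj_nrecip[OF h h0 C c gr ab ratio] loc') auto
  qed
  then have "shell_sqs h ?C \<kappa> (1 / c) (1 - c)"
    by (intro shell_sqs_if_growth[OF h c gr])
  moreover have "0 < ?C" "0 < 1 / c" "0 < 1 - c" "1 - c < 1" using C c by simp_all
  ultimately show ?thesis
    by (rule sqs_if_shell[OF h h0 _ _ C(2)]) (rule that)
qed

lemma sqs_line_conj_nrecip:
  assumes h: "line_homeo h" and h0: "h 0 = 0" and C: "0 < C" "0 < \<kappa>"
    and sqs: "\<And>a b. a < b \<Longrightarrow> sqs_on h C \<kappa> a b"
  obtains C' \<kappa>' where "0 < C'" "0 < \<kappa>'" "\<And>a b. a < b \<Longrightarrow> sqs_on (conj_nrecip h) C' \<kappa>' a b"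
proof -
  let ?g = "conj_nrecip h"
  note g = line_homeo_conj_nrecip[OF h h0]
  obtain c where c: "0 < c" "c < 1" and
    growth: "\<And>(h :: real \<Rightarrow> real) x. line_homeo h \<Longrightarrow> h 0 = 0 \<Longrightarrow>
       (\<And>a b. - (2 * \<bar>x\<bar>) \<le> a \<Longrightarrow> a < b \<Longrightarrow> b \<le> 2 * \<bar>x\<bar> \<Longrightarrow> sqs_on h C \<kappa> a b) \<Longrightarrow> growth h c x"
    using growth_if_sqs[OF C] by metis
  have gr: "growth ?g c x" for x
    by (intro growth_conj_nrecip[OF h h0] growth[OF h h0] sqs)
  let ?C = "C * (1 / c ^ 3)\<^sup>2 * 64 powr \<kappa>"
  have "sqs_on ?g ?C \<kappa> a b" if ab: "a < b" and ratio: "0 < a \<and> b \<le> 8 * a \<or> b < 0 \<and> 8 * b \<le> a" for a b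
  proof (rule sqs_on_if_conj_nrecip[OF g C c gr ab ratio])
    have "nrecip a < nrecip b" using ab ratio by (auto simp: nrecip_strict_mono zero_less_mult_iff)
    then show "sqs_on (conj_nrecip ?g) C \<kappa> (nrecip a) (nrecip b)" by (simp add: sqs)
  qed
  then have "shell_sqs ?g ?C \<kappa> (1 / c) (1 - c)"
    by (intro shell_sqs_if_growth[OF g(1) c gr])
  moreover have "0 < ?C" "0 < 1 / c" "0 < 1 - c" "1 - c < 1" using C c by simp_all
  ultimately show ?thesis
    by (rule sqs_if_shell[OF g _ _ C(2)]) (rule that)
qed

subsection \<open>The lift of the circle map\<close>

text \<open>Multiples of \<open>2 * pi\<close> are the angles of the point at infinity. There the
  tangent has a pole, so the fixed point of the circle map is prescribed by hand.\<close>

definition lift :: "(real \<Rightarrow> real) \<Rightarrow> real \<Rightarrow> real" where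
  "lift h t = (let n = \<lfloor>t / (2 * pi)\<rfloor>; s = t - 2 * pi * of_int n
     in 2 * pi * of_int n + (if s = 0 then 0 else pi + 2 * arctan (h (tan ((s - pi) / 2)))))"

lemma floor_2pi: "0 \<le> s \<Longrightarrow> s < 2 * pi \<Longrightarrow> \<lfloor>(2 * pi * of_int n + s) / (2 * pi)\<rfloor> = n"
  using pi_gt_zero by (intro floor_unique) (auto simp: field_simps)

lemma lift_eq:
  assumes "0 \<le> s" "s < 2 * pi"
  shows "lift h (2 * pi * of_int n + s) = 2 * pi * of_int n + (if s = 0 then 0 else pi + 2 * arctan (h (tan ((s - pi) / 2))))"
  using floor_2pi[OF assms, of n] by (simp add: lift_def)

lemma split_2pi:
  fixes t :: real
  obtains n :: int and s where "t = 2 * pi * of_int n + s" "0 \<le> s" "s < 2 * pi"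
  using real_mod_2pi[of t] by (metis add.commute diff_add_cancel)

lemma lift_0 [simp]: "lift h 0 = 0"
  using lift_eq[of 0 h 0] by simp

lemma lift_2pi [simp]: "lift h (2 * pi * of_int n) = 2 * pi * of_int n"
  using lift_eq[of 0 h n] by simp

lemma lift_mid: "0 < s \<Longrightarrow> s < 2 * pi \<Longrightarrow> lift h s = pi + 2 * arctan (h (tan ((s - pi) / 2)))"
  using lift_eq[of s h 0] by simp

lemma lift_periodic: "lift h (t + 2 * pi * of_int n) = lift h t + 2 * pi * of_int n"
proof -
  obtain m :: int and s where t: "t = 2 * pi * of_int m + s" "0 \<le> s" "s < 2 * pi" by (rule split_2pi)
  then have "t + 2 * pi * of_int n = 2 * pi * of_int (m + n) + s" by (simp add: algebra_simps)
  then show ?thesis using lift_eq[OF t(2,3), of h "m + n"] lift_eq[OF t(2,3), of h m] t(1) by (simp add: algebra_simps)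
qed

lemma lift_mid_bounds: "0 < s \<Longrightarrow> s < 2 * pi \<Longrightarrow> 0 < lift h s \<and> lift h s < 2 * pi"
  using arctan_lbound[of "h (tan ((s - pi) / 2))"] arctan_ubound[of "h (tan ((s - pi) / 2))"]
  by (auto simp: lift_mid)

lemma lift_arctan: "lift h (pi + 2 * arctan x) = pi + 2 * arctan (h x)"
  using arctan_lbound[of x] arctan_ubound[of x] by (subst lift_mid) (auto simp: tan_arctan)

lemma tan_half_mono:
  assumes "c - pi < s" "s < t" "t < c + pi"
  shows "tan ((s - c) / 2) < tan ((t - c) / 2)"
  using assms by (intro tan_monotone) auto

lemma line_homeo_lift:
  assumes h: "line_homeo h"
  shows "line_homeo (lift h)"
proof -
  have mono: "lift h t < lift h t'" if "t < t'" for t t'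
  proof -
    obtain n :: int and s where t: "t = 2 * pi * of_int n + s" "0 \<le> s" "s < 2 * pi" by (rule split_2pi)
    obtain n' :: int and s' where t': "t' = 2 * pi * of_int n' + s'" "0 \<le> s'" "s' < 2 * pi" by (rule split_2pi)
    have b: "0 \<le> lift h s \<and> lift h s < 2 * pi" "0 \<le> lift h s' \<and> lift h s' < 2 * pi"
      using lift_mid_bounds[of s h] lift_mid_bounds[of s' h] t t' by (cases "s = 0"; cases "s' = 0"; force)+
    have e: "lift h t = lift h s + 2 * pi * of_int n" "lift h t' = lift h s' + 2 * pi * of_int n'"
      using lift_periodic[of h s n] lift_periodic[of h s' n'] t t' by (simp_all add: add.commute)
    show ?thesis
    proof (cases n n' rule: linorder_cases)
      case less
      then have "of_int n + 1 \<le> (of_int n' :: real)" by linarith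
      then have "2 * pi * (of_int n + 1) \<le> 2 * pi * of_int n'" by (intro mult_left_mono) auto
      then show ?thesis using b e by (simp add: algebra_simps)
    next
      case equal
      then have s: "s < s'" using that t t' by simp
      show ?thesis
      proof (cases "s = 0")
        case True
        then show ?thesis using lift_mid_bounds[of s' h] s t' e equal by simp
      next
        case False
        have "tan ((s - pi) / 2) < tan ((s' - pi) / 2)"
          using s t t' False by (intro tan_half_mono) auto
        then show ?thesis
          using s t t' False e equal by (simp add: lift_mid arctan_less_iff line_homeo_less_iff[OF h])
      qed
    next
      case greater
      then have "of_int n' + 1 \<le> (of_int n :: real)" by linarith
      then have "2 * pi * (of_int n' + 1) \<le> 2 * pi * of_int n" by (intro mult_left_mono) auto
      then show ?thesis using that t t' by (simp add: algebra_simps)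
    qed
  qed
  moreover have "\<exists>t. y = lift h t" for y
  proof -
    obtain n :: int and s where y: "y = 2 * pi * of_int n + s" "0 \<le> s" "s < 2 * pi" by (rule split_2pi)
    show ?thesis
    proof (cases "s = 0")
      case True
      then show ?thesis using y by (intro exI[of _ "2 * pi * of_int n"]) simp
    next
      case False
      define x where "x = inv h (tan ((s - pi) / 2))"
      have "h x = tan ((s - pi) / 2)" using h unfolding x_def line_homeo_def by (simp add: surj_f_inv_f)
      moreover have "arctan (tan ((s - pi) / 2)) = (s - pi) / 2" using y False by (intro arctan_tan) auto
      ultimately have "2 * arctan (h x) = s - pi" by simp
      then have "lift h (pi + 2 * arctan x) = s" unfolding lift_arctan by simp
      then show ?thesis using y lift_periodic[of h "pi + 2 * arctan x" n]
        by (intro exI[of _ "pi + 2 * arctan x + 2 * pi * of_int n"]) simp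
    qed
  qed
  ultimately show ?thesis by (auto simp: line_homeo_def strict_mono_def surj_def)
qed

lemma two_arctan_nrecip:
  shows "0 < y \<Longrightarrow> 2 * arctan (nrecip y) = 2 * arctan y - pi"
    and "y < 0 \<Longrightarrow> 2 * arctan (nrecip y) = 2 * arctan y + pi"
proof -
  show "2 * arctan (nrecip y) = 2 * arctan y - pi" if "0 < y"
    using arctan_inverse[OF that] by (simp add: nrecip_def arctan_minus)
  show "2 * arctan (nrecip y) = 2 * arctan y + pi" if "y < 0"
    using arctan_inverse[of "- y"] that by (simp add: nrecip_def arctan_minus)
qed

text \<open>The two sides of the angle 0 belong to different periods in the definition of the lift.
  The coordinate at infinity glues them: the jump of \<open>2 * arctan\<close> under the inversion
  accounts for the change of period.\<close>

lemma lift_chart_even: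
  assumes h: "line_homeo h" and h0: "h 0 = 0" and s: "\<bar>s\<bar> < pi"
  shows "lift h s = 2 * arctan (conj_nrecip h (tan (s / 2)))"
proof -
  have pos: "lift h s = 2 * arctan (conj_nrecip h (tan (s / 2)))" if s: "0 < s" "s < pi" for s
  proof -
    define y where "y = h (nrecip (tan (s / 2)))"
    have "0 < tan (s / 2)" using s by (intro tan_gt_zero) auto
    then have "y < 0" by (simp add: y_def line_homeo_neg_iff[OF h h0] nrecip_neg_iff)
    moreover have "tan ((s - pi) / 2) = nrecip (tan (s / 2))"
      by (simp only: diff_divide_distrib tan_minus_half_pi)
    moreover have "lift h s = pi + 2 * arctan (h (tan ((s - pi) / 2)))" using s by (intro lift_mid) auto
    ultimately show ?thesis
      by (simp only: conj_nrecip_def y_def[symmetric] two_arctan_nrecip)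
  qed
  have neg: "lift h s = 2 * arctan (conj_nrecip h (tan (s / 2)))" if s: "- pi < s" "s < 0" for s
  proof -
    define y where "y = h (nrecip (tan (s / 2)))"
    have "tan (s / 2) < 0" using s by (intro tan_less_zero) auto
    then have "0 < y" by (simp add: y_def line_homeo_pos_iff[OF h h0] nrecip_pos_iff)
    moreover have "tan ((s + 2 * pi - pi) / 2) = nrecip (tan (s / 2))"
    proof -
      have "(s + 2 * pi - pi) / 2 = s / 2 + pi / 2" by (simp add: add_divide_distrib)
      then show ?thesis by (simp only: tan_plus_half_pi)
    qed
    moreover have "lift h s = lift h (s + 2 * pi) - 2 * pi" using lift_periodic[of h s 1] by simp
    moreover have "lift h (s + 2 * pi) = pi + 2 * arctan (h (tan ((s + 2 * pi - pi) / 2)))"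
      using s by (intro lift_mid) auto
    ultimately show ?thesis
      by (simp only: conj_nrecip_def y_def[symmetric] two_arctan_nrecip)
  qed
  consider "s = 0" | "0 < s" "s < pi" | "- pi < s" "s < 0" using s by linarith
  then show ?thesis
    by cases (simp_all add: pos neg line_homeo_conj_nrecip[OF h h0])
qed

lemma lift_chart:
  assumes h: "line_homeo h" and h0: "h 0 = 0" and t: "\<bar>t - pi * of_int n\<bar> < pi"
  shows "lift h t = pi * of_int n + 2 * arctan ((if even n then conj_nrecip h else h) (tan ((t - pi * of_int n) / 2)))"
proof (cases "even n")
  case True
  then obtain k where k: "n = 2 * k" by (elim evenE)
  have "lift h t = lift h (t - pi * of_int n) + pi * of_int n"
    using lift_periodic[of h "t - pi * of_int n" k] by (simp add: k algebra_simps)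
  then show ?thesis using lift_chart_even[OF h h0 t] True by simp
next
  case False
  then obtain k where k: "n = 2 * k + 1" by (elim oddE)
  define s where "s = t - pi * of_int n + pi"
  have s: "0 < s" "s < 2 * pi" "(s - pi) / 2 = (t - pi * of_int n) / 2" using t by (auto simp: s_def)
  have "t = s + 2 * pi * of_int k" by (simp add: s_def k algebra_simps)
  then have "lift h t = lift h s + 2 * pi * of_int k" using lift_periodic[of h s k] by simp
  then show ?thesis using False unfolding lift_mid[OF s(1,2)] s(3) by (simp add: k algebra_simps)
qed

lemma bilip_tan:
  assumes "p \<le> q" "c - pi < p" "q < c + pi" and Y: "\<And>y. p \<le> y \<Longrightarrow> y \<le> q \<Longrightarrow> \<bar>tan ((y - c) / 2)\<bar> \<le> Y"
  shows "bilip (\<lambda>y. tan ((y - c) / 2)) (1 / 2) ((1 + Y\<^sup>2) / 2) p q"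
proof (rule bilip_if_deriv)
  have nz: "cos ((y - c) / 2) \<noteq> 0" if "p \<le> y" "y \<le> q" for y
  proof -
    have "0 < cos ((y - c) / 2)" using assms that by (intro cos_gt_zero_pi) auto
    then show ?thesis by simp
  qed
  show "((\<lambda>y. tan ((y - c) / 2)) has_real_derivative (1 + (tan ((y - c) / 2))\<^sup>2) / 2) (at y within {p..q})" if "p \<le> y" "y \<le> q" for y
    using nz[OF that] by (auto intro!: derivative_eq_intros simp: tan_sec power_inverse)
  show "1 / 2 \<le> \<bar>(1 + (tan ((y - c) / 2))\<^sup>2) / 2\<bar> \<and> \<bar>(1 + (tan ((y - c) / 2))\<^sup>2) / 2\<bar> \<le> (1 + Y\<^sup>2) / 2" if "p \<le> y" "y \<le> q" for y
  proof -
    have "\<bar>tan ((y - c) / 2)\<bar>\<^sup>2 \<le> Y\<^sup>2" using Y[OF that] by (intro power_mono) auto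
    then show ?thesis by (simp add: add_nonneg_nonneg)
  qed
  show "tan ((x - c) / 2) < tan ((y - c) / 2)" if "p \<le> x" "x < y" "y \<le> q" for x y
    using assms that by (intro tan_half_mono) auto
qed (use assms in auto)

lemma bilip_arctan:
  assumes "a \<le> b" "-N \<le> a" "b \<le> N"
  shows "bilip (\<lambda>x. s + 2 * arctan x) (2 / (1 + N\<^sup>2)) 2 a b"
proof (rule bilip_if_deriv)
  show "((\<lambda>x. s + 2 * arctan x) has_real_derivative 2 / (1 + x\<^sup>2)) (at x within {a..b})" for x
    by (auto intro!: derivative_eq_intros simp: field_simps)
  show "2 / (1 + N\<^sup>2) \<le> \<bar>2 / (1 + x\<^sup>2)\<bar> \<and> \<bar>2 / (1 + x\<^sup>2)\<bar> \<le> 2" if "a \<le> x" "x \<le> b" for x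
  proof -
    have "\<bar>x\<bar>\<^sup>2 \<le> N\<^sup>2" using that assms by (intro power_mono) auto
    then have "2 / (1 + N\<^sup>2) \<le> 2 / (1 + x\<^sup>2)" "2 / (1 + x\<^sup>2) \<le> 2 / 1"
      by (intro divide_left_mono; simp add: add_pos_nonneg)+
    then show ?thesis by simp
  qed
qed (use assms in \<open>auto simp: arctan_less_iff\<close>)

section \<open>Strong quasisymmetry of a map and of its lift\<close>

text \<open>Used with \<open>s = pi\<close> for \<open>h\<close> and with \<open>s = 0\<close> for
  its conjugate by the inversion. The outer tangent has no uniform Lipschitz bound, so the constant
  depends on the map through the bound \<open>Y\<close> of its values on
  \<open>{-4..4}\<close>.\<close>

lemma sqs_local_if_lift:
  assumes h: "line_homeo h" and H: "line_homeo H" and C: "0 < C" "0 < \<kappa>"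
    and sqs: "\<And>a b. a < b \<Longrightarrow> b - a \<le> 2 * pi \<Longrightarrow> sqs_on (lift h) C \<kappa> a b"
    and Hh: "\<And>x. lift h (s + 2 * arctan x) = s + 2 * arctan (H x)"
  obtains C' where "0 < C'" "\<And>a b. -4 \<le> a \<Longrightarrow> a < b \<Longrightarrow> b \<le> 4 \<Longrightarrow> sqs_on H C' \<kappa> a b"
proof -
  define Y where "Y = max \<bar>H (-4)\<bar> \<bar>H 4\<bar>"
  define C' where "C' = C * ((1 + Y\<^sup>2) / 2 / (1 / 2)) * (2 / (2 / (1 + 4\<^sup>2))) powr \<kappa>"
  have "sqs_on H C' \<kappa> a b" if ab: "-4 \<le> a" "a < b" "b \<le> 4" for a b
    unfolding C'_def
  proof (rule sqs_on_compose[where \<sigma> = "\<lambda>x. s + 2 * arctan x" and \<tau> = "\<lambda>y. tan ((y - s) / 2)"])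
    show "sqs_on (lift h) C \<kappa> (s + 2 * arctan a) (s + 2 * arctan b)"
      using ab arctan_lbound[of a] arctan_ubound[of b] by (intro sqs) (auto simp: arctan_less_iff)
    show "bilip (\<lambda>y. tan ((y - s) / 2)) (1 / 2) ((1 + Y\<^sup>2) / 2) (lift h (s + 2 * arctan a)) (lift h (s + 2 * arctan b))"
      unfolding Hh
    proof (rule bilip_tan)
      show "s + 2 * arctan (H a) \<le> s + 2 * arctan (H b)" using ab by (simp add: arctan_le_iff line_homeo_le_iff[OF H])
      show "s - pi < s + 2 * arctan (H a)" "s + 2 * arctan (H b) < s + pi"
        using arctan_lbound[of "H a"] arctan_ubound[of "H b"] by auto
      fix y assume y: "s + 2 * arctan (H a) \<le> y" "y \<le> s + 2 * arctan (H b)"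
      define z where "z = tan ((y - s) / 2)"
      have z: "(y - s) / 2 = arctan z" unfolding z_def
        using y arctan_lbound[of "H a"] arctan_ubound[of "H b"] by (subst arctan_tan) auto
      then have "arctan (H a) \<le> arctan z" "arctan z \<le> arctan (H b)" using y by auto
      then have "H a \<le> z" "z \<le> H b" by (simp_all add: arctan_le_iff)
      moreover have "H (-4) \<le> H a" "H b \<le> H 4" using ab by (simp_all add: line_homeo_le_iff[OF H])
      ultimately show "\<bar>tan ((y - s) / 2)\<bar> \<le> Y" unfolding z_def[symmetric] Y_def by auto
    qed
    show "(\<lambda>x. s + 2 * arctan x) ` {a..b} \<subseteq> {s + 2 * arctan a..s + 2 * arctan b}" by (auto simp: arctan_le_iff)
    show "H x = tan ((lift h (s + 2 * arctan x) - s) / 2)" for x unfolding Hh by (simp add: tan_arctan)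
    show "bilip (\<lambda>x. s + 2 * arctan x) (2 / (1 + 4\<^sup>2)) 2 a b" using ab by (intro bilip_arctan) auto
  qed (use C ab line_homeo_lift[OF h] in \<open>auto simp: add_nonneg_nonneg\<close>)
  moreover have "0 < C'" using C by (auto simp: C'_def intro!: mult_pos_pos add_pos_nonneg)
  ultimately show ?thesis using that by blast
qed

lemma sqs_line_if_lift:
  assumes h: "line_homeo h" and h0: "h 0 = 0" and C: "0 < C" "0 < \<kappa>"
    and sqs: "\<And>a b. a < b \<Longrightarrow> b - a \<le> 2 * pi \<Longrightarrow> sqs_on (lift h) C \<kappa> a b"
  obtains C' \<kappa>' where "0 < C'" "0 < \<kappa>'" "\<And>a b. a < b \<Longrightarrow> sqs_on h C' \<kappa>' a b"
proof -
  obtain C1 where C1: "0 < C1" "\<And>a b. -4 \<le> a \<Longrightarrow> a < b \<Longrightarrow> b \<le> 4 \<Longrightarrow> sqs_on h C1 \<kappa> a b"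
    using sqs_local_if_lift[OF h h C sqs lift_arctan] by metis
  have e: "lift h (0 + 2 * arctan x) = 0 + 2 * arctan (conj_nrecip h x)" for x
    using lift_chart_even[OF h h0, of "2 * arctan x"] arctan_lbound[of x] arctan_ubound[of x]
    by (simp add: abs_less_iff tan_arctan)
  obtain C2 where C2: "0 < C2" "\<And>a b. -4 \<le> a \<Longrightarrow> a < b \<Longrightarrow> b \<le> 4 \<Longrightarrow> sqs_on (conj_nrecip h) C2 \<kappa> a b"
    using sqs_local_if_lift[OF h line_homeo_conj_nrecip(1)[OF h h0] C sqs e] by metis
  let ?C = "max C1 C2"
  have 1: "sqs_on h ?C \<kappa> a b" if "-4 \<le> a" "a < b" "b \<le> 4" for a b
    by (rule sqs_on_mono[OF h C1(2)]) (use that C C1(1) in auto)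
  have 2: "sqs_on (conj_nrecip h) ?C \<kappa> a b" if "-4 \<le> a" "a < b" "b \<le> 4" for a b
    by (rule sqs_on_mono[OF line_homeo_conj_nrecip(1)[OF h h0] C2(2)]) (use that C C2(1) in auto)
  have "0 < ?C" using C1 by auto
  then show ?thesis by (rule sqs_line_if_local[OF h h0 _ C(2) 1 2]) (assumption+, rule that)
qed

text \<open>Passing to one half at most doubles the relative measure of the set, and the images of
  the two halves fill the image of the interval. Each doubling therefore costs
  \<open>2 powr \<kappa>\<close>.\<close>

lemma sqs_on_double:
  assumes h: "line_homeo h" and C: "0 < C" "0 < \<kappa>"
    and short: "\<And>a b. a < b \<Longrightarrow> b - a \<le> d \<Longrightarrow> sqs_on h C \<kappa> a b"
    and ab: "a < b" "b - a \<le> 2 ^ n * d"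
  shows "sqs_on h (C * (2 powr \<kappa>) ^ n) \<kappa> a b"
  using ab
proof (induction n arbitrary: a b)
  case 0
  then show ?case using short by simp
next
  case (Suc n)
  define c where "c = (a + b) / 2"
  define K where "K = C * (2 powr \<kappa>) ^ n"
  have c: "a < c" "c < b" "c - a = (b - a) / 2" "b - c = (b - a) / 2" using Suc.prems by (auto simp: c_def field_simps)
  have 1: "sqs_on h K \<kappa> a c" and 2: "sqs_on h K \<kappa> c b"
    unfolding K_def using c Suc.prems by (auto intro!: Suc.IH)
  have K: "0 < K" using C by (simp add: K_def)
  show ?case
    unfolding sqs_on_def
  proof (intro ballI impI)
    fix A :: "real set" assume A: "A \<in> sets borel" "A \<subseteq> {a..b}"
    let ?m = "measure lborel :: real set \<Rightarrow> real"
    have fm: "B \<in> fmeasurable lborel" if "B \<in> sets borel" "B \<subseteq> {x..y}" for B :: "real set" and x y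
      using that emeasure_bounded_finite[of B] bounded_subset[OF bounded_closed_interval] by (auto simp: fmeasurable_def)
    have part: "?m (h ` (A \<inter> {p..q})) \<le> K * (h q - h p) * (2 powr \<kappa> * (?m A / (b - a)) powr \<kappa>)"
      if "sqs_on h K \<kappa> p q" "p < q" "q - p = (b - a) / 2" for p q
    proof -
      have ba: "b - a = 2 * (q - p)" using that(3) by simp
      have "?m (A \<inter> {p..q}) \<le> ?m A" using fm[OF A] A by (intro measure_mono_fmeasurable) auto
      then have "?m (A \<inter> {p..q}) / (q - p) \<le> ?m A / (q - p)"
        using that(2) by (intro divide_right_mono) auto
      also have "\<dots> = 2 * (?m A / (b - a))"
      proof -
        have "2 * (x / (2 * y)) = x / y" for x y :: real by simp
        then show ?thesis unfolding ba by (simp only:)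
      qed
      finally have "?m (A \<inter> {p..q}) / (q - p) \<le> 2 * (?m A / (b - a))" .
      then have "(?m (A \<inter> {p..q}) / (q - p)) powr \<kappa> \<le> (2 * (?m A / (b - a))) powr \<kappa>"
        by (rule powr_mono2[rotated 2]) (use that C in auto)
      also have "\<dots> = 2 powr \<kappa> * (?m A / (b - a)) powr \<kappa>" by (rule powr_mult)
      finally have le: "(?m (A \<inter> {p..q}) / (q - p)) powr \<kappa> \<le> 2 powr \<kappa> * (?m A / (b - a)) powr \<kappa>" .
      have "0 \<le> K * (h q - h p)" using K that(2) h by (simp add: line_homeo_le_iff)
      note mult_left_mono[OF le this]
      moreover have "?m (h ` (A \<inter> {p..q})) \<le> K * (h q - h p) * (?m (A \<inter> {p..q}) / (q - p)) powr \<kappa>"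
        using that(1) A unfolding sqs_on_def by auto
      ultimately show ?thesis by simp
    qed
    have A': "A = (A \<inter> {a..c}) \<union> (A \<inter> {c..b})" using A c by auto
    have "?m (h ` A) \<le> ?m (h ` (A \<inter> {a..c})) + ?m (h ` (A \<inter> {c..b}))"
    proof -
      have "h ` (A \<inter> {a..c}) \<subseteq> {h a..h c}" "h ` (A \<inter> {c..b}) \<subseteq> {h c..h b}"
        using line_homeo_Icc[OF h, of a c] line_homeo_Icc[OF h, of c b] c by auto
      then have "h ` (A \<inter> {a..c}) \<in> fmeasurable lborel" "h ` (A \<inter> {c..b}) \<in> fmeasurable lborel"
        using A by (auto intro!: fm line_homeo_borel[OF h])
      then show ?thesis
        by (subst A', subst image_Un) (intro measure_Un_le; auto dest: fmeasurableD)
    qed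
    also have "\<dots> \<le> K * (h c - h a) * (2 powr \<kappa> * (?m A / (b - a)) powr \<kappa>) + K * (h b - h c) * (2 powr \<kappa> * (?m A / (b - a)) powr \<kappa>)"
      using 1 2 c by (intro add_mono part) auto
    also have "\<dots> = C * (2 powr \<kappa>) ^ Suc n * (h b - h a) * (?m A / (b - a)) powr \<kappa>"
      by (simp add: K_def algebra_simps)
    finally show "?m (h ` A) \<le> \<dots>" .
  qed
qed

text \<open>Every short interval lies in a chart where the lift is \<open>h\<close> or its
  conjugate, composed with bi-Lipschitz maps. The tangent coordinate stays in
  \<open>{-2..2}\<close>, so finitely many values of the two maps bound the distortion of the outer
  arctangent.\<close>

lemma sqs_lift_if_line:
  assumes h: "line_homeo h" and h0: "h 0 = 0" and C: "0 < C" "0 < \<kappa>"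
    and sqs: "\<And>a b. a < b \<Longrightarrow> sqs_on h C \<kappa> a b"
  obtains C' \<kappa>' where "0 < C'" "0 < \<kappa>'" "\<And>a b. a < b \<Longrightarrow> b - a \<le> 2 * pi \<Longrightarrow> sqs_on (lift h) C' \<kappa>' a b"
proof -
  let ?g = "conj_nrecip h"
  note g = line_homeo_conj_nrecip[OF h h0]
  obtain C1 \<kappa>1 where C1: "0 < C1" "0 < \<kappa>1" and sqs_g: "\<And>a b. a < b \<Longrightarrow> sqs_on ?g C1 \<kappa>1 a b"
    using sqs_line_conj_nrecip[OF h h0 C sqs] by metis
  define \<kappa>' where "\<kappa>' = min \<kappa> \<kappa>1"
  define C2 where "C2 = max C C1"
  have C2: "0 < C2" "0 < \<kappa>'" "C \<le> C2" "C1 \<le> C2" "\<kappa>' \<le> \<kappa>" "\<kappa>' \<le> \<kappa>1" using C C1 by (auto simp: C2_def \<kappa>'_def)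
  define Y where "Y = Max {\<bar>h (-2)\<bar>, \<bar>h 2\<bar>, \<bar>?g (-2)\<bar>, \<bar>?g 2\<bar>}"
  define C3 where "C3 = C2 * (2 / (2 / (1 + Y\<^sup>2))) * (2 / (1 / 2)) powr \<kappa>'"
  have C3: "0 < C3" using C2 by (auto simp: C3_def intro!: mult_pos_pos add_pos_nonneg)
  have "sqs_on (lift h) C3 \<kappa>' a b" if ab: "a < b" "b - a \<le> pi / 3" for a b
  proof -
    obtain n :: int where near: "\<And>t. a \<le> t \<Longrightarrow> t \<le> b \<Longrightarrow> \<bar>t - pi * of_int n\<bar> \<le> 2 * pi / 3"
      using chart_exists[of a b] ab by auto
    define c where "c = pi * of_int n"
    define H where "H = (if even n then ?g else h)"
    have H: "line_homeo H" using h g by (simp add: H_def)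
    have sqsH: "sqs_on H C2 \<kappa>' p q" if "p < q" for p q
      using sqs_on_mono[OF h sqs[OF that] that C2(3,5)] sqs_on_mono[OF g(1) sqs_g[OF that] that C2(4,6)] C C1 C2
      by (auto simp: H_def)
    have "\<bar>H (-2)\<bar> \<le> Y" "\<bar>H 2\<bar> \<le> Y" by (simp_all add: H_def Y_def le_max_iff_disj)
    then have HY: "-Y \<le> H (-2)" "H 2 \<le> Y" by linarith+
    note near' = near[folded c_def]
    note ch = tan_half_chart[OF less_imp_le[OF ab(1)] near']
    show ?thesis
      unfolding C3_def
    proof (rule sqs_on_compose[where \<sigma> = "\<lambda>t. tan ((t - c) / 2)" and \<tau> = "\<lambda>x. c + 2 * arctan x" and ?h1.0 = H])
      show "sqs_on H C2 \<kappa>' (tan ((a - c) / 2)) (tan ((b - c) / 2))" using ch ab by (intro sqsH) auto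
      show "bilip (\<lambda>t. tan ((t - c) / 2)) (1 / 2) 2 a b"
      proof (rule bilip_if_deriv)
        show "((\<lambda>t. tan ((t - c) / 2)) has_real_derivative inverse ((cos ((t - c) / 2))\<^sup>2) / 2) (at t within {a..b})" if "a \<le> t" "t \<le> b" for t
          by (rule tan_half_deriv(1)[OF near'[OF that]])
        show "1 / 2 \<le> \<bar>inverse ((cos ((t - c) / 2))\<^sup>2) / 2\<bar> \<and> \<bar>inverse ((cos ((t - c) / 2))\<^sup>2) / 2\<bar> \<le> 2" if "a \<le> t" "t \<le> b" for t
          using tan_half_deriv(2,3)[OF near'[OF that]] by auto
        show "tan ((x - c) / 2) < tan ((y - c) / 2)" if "a \<le> x" "x < y" "y \<le> b" for x y
        proof (rule tan_half_mono)
          have "2 * pi / 3 < pi" using pi_gt_zero by simp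
          then have "\<bar>x - c\<bar> < pi" "\<bar>y - c\<bar> < pi" using near'[of x] near'[of y] that by linarith+
          then show "c - pi < x" "y < c + pi" by linarith+
        qed (use that in auto)
      qed (use ab in auto)
      show "bilip (\<lambda>x. c + 2 * arctan x) (2 / (1 + Y\<^sup>2)) 2 (H (tan ((a - c) / 2))) (H (tan ((b - c) / 2)))"
      proof (rule bilip_arctan)
        show "H (tan ((a - c) / 2)) \<le> H (tan ((b - c) / 2))" using ch(4) ab by (simp add: line_homeo_le_iff[OF H])
        have "H (-2) \<le> H (tan ((a - c) / 2))" "H (tan ((b - c) / 2)) \<le> H 2" using ch(5,6) by (simp_all add: line_homeo_le_iff[OF H])
        then show "-Y \<le> H (tan ((a - c) / 2))" "H (tan ((b - c) / 2)) \<le> Y" using HY by auto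
      qed
      show "lift h t = c + 2 * arctan (H (tan ((t - c) / 2)))" if "a \<le> t" "t \<le> b" for t
      proof -
        have "2 * pi / 3 < pi" using pi_gt_zero by simp
        then have "\<bar>t - pi * of_int n\<bar> < pi" using near[OF that] by linarith
        then show ?thesis using lift_chart[OF h h0] by (simp add: c_def H_def)
      qed
    qed (use C2 ab H ch(1) in \<open>auto simp: add_pos_nonneg\<close>)
  qed
  \<comment> \<open>Three doublings take \<open>pi / 3\<close> to \<open>8 * pi / 3\<close>, beyond
    a full turn.\<close>
  then have "sqs_on (lift h) (C3 * (2 powr \<kappa>') ^ 3) \<kappa>' a b" if "a < b" "b - a \<le> 2 * pi" for a b
    using that by (intro sqs_on_double[OF line_homeo_lift[OF h] C3 C2(2), where d = "pi / 3"]) auto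
  moreover have "0 < C3 * (2 powr \<kappa>') ^ 3" using C3 by simp
  ultimately show ?thesis using that C2(2) by blast
qed

section \<open>Removing the normalisation \<open>h 0 = 0\<close>\<close>

definition sqs_line :: "(real \<Rightarrow> real) \<Rightarrow> bool" where
  "sqs_line h \<longleftrightarrow> (\<exists>C>0. \<exists>\<kappa>>0. \<forall>a b. a < b \<longrightarrow> sqs_on h C \<kappa> a b)"

definition sqs_circ :: "(real \<Rightarrow> real) \<Rightarrow> bool" where
  "sqs_circ \<phi> \<longleftrightarrow> (\<exists>C>0. \<exists>\<kappa>>0. \<forall>a b. a < b \<and> b - a \<le> 2 * pi \<longrightarrow> sqs_on \<phi> C \<kappa> a b)"

lemma line_homeo_translate: "line_homeo h \<Longrightarrow> line_homeo (\<lambda>x. h x - k)"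
  unfolding line_homeo_def strict_mono_def surj_def by (metis add_diff_cancel_right' diff_strict_right_mono)

lemma line_homeo_id_minus: "line_homeo (\<lambda>x. x - k)"
  by (rule line_homeo_translate[of "\<lambda>x. x"]) (auto simp: line_homeo_def strict_mono_def)

lemma bilip_affine: "a \<le> b \<Longrightarrow> bilip (\<lambda>x. x - k) 1 1 a b"
  by (rule bilip_if_deriv[where g' = "\<lambda>_. 1"]) (auto intro!: derivative_eq_intros)

lemma sqs_on_post_bilip:
  assumes "sqs_on h C \<kappa> a b" "line_homeo h" "a < b" "0 < C" "0 < \<kappa>"
    and "bilip m l L (h a) (h b)" "0 < l" "0 \<le> L"
  shows "sqs_on (\<lambda>x. m (h x)) (C * (L / l)) \<kappa> a b"
proof -
  have id: "bilip (\<lambda>x. x - 0) 1 1 a b" using assms by (intro bilip_affine) auto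
  have "sqs_on (\<lambda>x. m (h x)) (C * (L / l) * (1 / 1) powr \<kappa>) \<kappa> a b"
    by (rule sqs_on_compose[where \<sigma> = "\<lambda>x. x - 0" and \<tau> = m and ?h1.0 = h]) (use assms id in auto)
  then show ?thesis by simp
qed

lemma sqs_line_translate:
  assumes h: "line_homeo h" and "sqs_line h"
  shows "sqs_line (\<lambda>x. h x - k)"
proof -
  obtain C \<kappa> where C: "0 < C" "0 < \<kappa>" "\<And>a b. a < b \<Longrightarrow> sqs_on h C \<kappa> a b"
    using assms by (auto simp: sqs_line_def)
  have "sqs_on (\<lambda>x. h x - k) (C * (1 / 1)) \<kappa> a b" if "a < b" for a b
    by (rule sqs_on_post_bilip[OF C(3)[OF that] h that C(1,2)])
      (use that h in \<open>auto intro!: bilip_affine simp: line_homeo_le_iff\<close>)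
  then show ?thesis using C unfolding sqs_line_def by (intro exI[of _ C] exI[of _ \<kappa>]) auto
qed

text \<open>Peetre's inequality. It bounds the derivative
  \<open>(1 + x\<^sup>2) / (1 + (x - k)\<^sup>2)\<close> of a lifted translation from above and,
  with \<open>x - k\<close> and \<open>- k\<close> for \<open>x\<close> and \<open>k\<close>, from
  below.\<close>

lemma peetre: "1 + x\<^sup>2 \<le> 2 * (1 + k\<^sup>2) * (1 + (x - k)\<^sup>2)" for x k :: real
proof -
  have "2 * (1 + k\<^sup>2) * (1 + (x - k)\<^sup>2) - (1 + x\<^sup>2) = 1 + (x - 2 * k)\<^sup>2 + 2 * (k * (x - k))\<^sup>2"
    by (simp add: power2_eq_square algebra_simps)
  also have "\<dots> \<ge> 0" by simp
  finally show ?thesis by simp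
qed

text \<open>The lift of a translation is smooth across \<open>2 * pi * n\<close>, where it equals
  \<open>2 arctan (v / (1 + k v))\<close> in the coordinate \<open>v = tan (s / 2)\<close>.\<close>

lemma lift_translation_deriv_0: "(lift (\<lambda>x. x - k) has_real_derivative 1) (at 0)"
proof -
  define m where "m = lift (\<lambda>x. x - k)"
  have eq: "m s = 2 * arctan (tan (s / 2) / (1 + k * tan (s / 2)))" if s: "\<bar>s\<bar> < pi" "\<bar>k * tan (s / 2)\<bar> < 1" for s
  proof -
    define v where "v = tan (s / 2)"
    have kv: "0 < 1 + k * v" using s(2) by (simp add: v_def abs_less_iff)
    consider "s = 0" | "0 < s" | "s < 0" by linarith
    then show ?thesis
    proof cases
      case 2
      then have v: "0 < v" unfolding v_def using s by (intro tan_gt_zero) auto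
      have y: "nrecip v - k = - ((1 + k * v) / v)" using v by (simp add: nrecip_def field_simps)
      have y0: "nrecip v - k < 0" unfolding y using v kv by simp
      have "tan ((s - pi) / 2) = nrecip v" unfolding v_def by (simp only: diff_divide_distrib tan_minus_half_pi)
      moreover have "m s = pi + 2 * arctan (tan ((s - pi) / 2) - k)" unfolding m_def using 2 s by (intro lift_mid) auto
      moreover have "nrecip (nrecip v - k) = v / (1 + k * v)" unfolding y using v kv by (simp add: nrecip_def)
      ultimately show ?thesis using two_arctan_nrecip(2)[OF y0] by (simp add: v_def)
    next
      case 3
      then have v: "v < 0" unfolding v_def using s by (intro tan_less_zero) auto
      have y: "nrecip v - k = - ((1 + k * v) / v)" using v by (simp add: nrecip_def field_simps)
      have y0: "0 < nrecip v - k" unfolding y using v kv by (simp add: divide_pos_neg)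
      have "(s + 2 * pi - pi) / 2 = s / 2 + pi / 2" by (simp add: add_divide_distrib)
      then have "tan ((s + 2 * pi - pi) / 2) = nrecip v" unfolding v_def by (simp only: tan_plus_half_pi)
      moreover have "m (s + 2 * pi) = pi + 2 * arctan (tan ((s + 2 * pi - pi) / 2) - k)" unfolding m_def using 3 s by (intro lift_mid) auto
      moreover have "m s = m (s + 2 * pi) - 2 * pi" using lift_periodic[of "\<lambda>x. x - k" s 1] by (simp add: m_def)
      moreover have "nrecip (nrecip v - k) = v / (1 + k * v)" unfolding y using v kv by (simp add: nrecip_def)
      ultimately show ?thesis using two_arctan_nrecip(1)[OF y0] by (simp add: v_def)
    qed (simp add: m_def)
  qed
  have "isCont (\<lambda>s. \<bar>k * tan (s / 2)\<bar>) 0" by (intro continuous_intros isCont_tan') auto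
  then have "\<forall>\<^sub>F s in nhds 0. \<bar>k * tan (s / 2)\<bar> < 1"
    by (intro order_tendstoD(2)[where y = "\<bar>k * tan (0 / 2)\<bar>"]) (auto simp: continuous_at tendsto_nhds_iff)
  moreover have "\<forall>\<^sub>F s in nhds (0 :: real). \<bar>s\<bar> < pi"
    using pi_gt_zero by (auto simp: eventually_nhds_metric dist_real_def intro!: exI[of _ pi])
  ultimately have ev: "\<forall>\<^sub>F s in nhds 0. m s = 2 * arctan (tan (s / 2) / (1 + k * tan (s / 2)))"
    by eventually_elim (rule eq)
  have "((\<lambda>s. 2 * arctan (tan (s / 2) / (1 + k * tan (s / 2)))) has_real_derivative 1) (at 0)"
    by (auto intro!: derivative_eq_intros)
  then show ?thesis
    using DERIV_cong_ev[OF refl ev refl] by (simp add: m_def)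
qed

lemma lift_deriv_shift:
  assumes "(lift h has_real_derivative D) (at s)"
  shows "(lift h has_real_derivative D) (at (2 * pi * of_int n + s))"
proof -
  have "((\<lambda>t. lift h (t - 2 * pi * of_int n) + 2 * pi * of_int n) has_real_derivative D) (at (2 * pi * of_int n + s))"
    by (rule derivative_eq_intros DERIV_chain'[where g = "lift h" and E = D and D = 1] | use assms in simp)+
  moreover have "lift h (t - 2 * pi * of_int n) + 2 * pi * of_int n = lift h t" for t
    using lift_periodic[of h "t - 2 * pi * of_int n" n] by simp
  ultimately show ?thesis by simp
qed

text \<open>The inner tangent contributes \<open>(1 + x\<^sup>2) / 2\<close> and the outer
  arctangent \<open>2 / (1 + (h x)\<^sup>2)\<close>; the logarithm of their product is
  \<open>cayley_factor h x\<close>.\<close>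

lemma lift_deriv_mid:
  assumes s: "0 < s" "s < 2 * pi" and h: "(h has_real_derivative D) (at (tan ((s - pi) / 2)))"
  shows "(lift h has_real_derivative D * (1 + (tan ((s - pi) / 2))\<^sup>2) / (1 + (h (tan ((s - pi) / 2)))\<^sup>2)) (at s)"
proof -
  define x where "x = tan ((s - pi) / 2)"
  have c: "cos ((s - pi) / 2) \<noteq> 0"
  proof -
    have "0 < cos ((s - pi) / 2)" using s by (intro cos_gt_zero_pi) auto
    then show ?thesis by simp
  qed
  have t: "((\<lambda>s. tan ((s - pi) / 2)) has_real_derivative (1 + x\<^sup>2) / 2) (at s)"
    using c by (auto intro!: derivative_eq_intros simp: tan_sec x_def power_inverse)
  have 1: "((\<lambda>s. h (tan ((s - pi) / 2))) has_real_derivative D * ((1 + x\<^sup>2) / 2)) (at s)"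
    by (rule DERIV_chain'[where g = h, OF t h, THEN DERIV_cong]) simp
  have 2: "((\<lambda>s. arctan (h (tan ((s - pi) / 2)))) has_real_derivative inverse (1 + (h x)\<^sup>2) * (D * ((1 + x\<^sup>2) / 2))) (at s)"
    by (rule DERIV_chain'[where g = arctan, OF 1 DERIV_arctan, THEN DERIV_cong]) (simp add: x_def)
  have d: "((\<lambda>s. pi + 2 * arctan (h (tan ((s - pi) / 2)))) has_real_derivative D * (1 + x\<^sup>2) / (1 + (h x)\<^sup>2)) (at s)"
  proof (rule DERIV_add[OF DERIV_const DERIV_cmult[OF 2], THEN DERIV_cong])
    have "0 + 2 * (inverse a * (D * (b / 2))) = D * b / a" for a b :: real
      by (simp add: inverse_eq_divide)
    then show "0 + 2 * (inverse (1 + (h x)\<^sup>2) * (D * ((1 + x\<^sup>2) / 2))) = D * (1 + x\<^sup>2) / (1 + (h x)\<^sup>2)" .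
  qed
  have ev: "\<forall>\<^sub>F t in nhds s. lift h t = pi + 2 * arctan (h (tan ((t - pi) / 2)))"
  proof -
    have "\<forall>\<^sub>F t in nhds s. t \<in> {0<..<2 * pi}" using s by (intro eventually_nhds_in_open) auto
    then show ?thesis by eventually_elim (simp add: lift_mid)
  qed
  show ?thesis
    using iffD2[OF DERIV_cong_ev[OF refl ev refl] d] by (simp only: x_def)
qed

text \<open>Off the multiples of \<open>2 * pi\<close> the derivative is pinched by
  \<open>peetre\<close>; at the multiples it is 1. A translation of the line thus becomes a
  bi-Lipschitz change of coordinate on the circle.\<close>

lemma bilip_lift_translation:
  assumes "a \<le> b"
  shows "bilip (lift (\<lambda>x. x - k)) (1 / (2 * (1 + k\<^sup>2))) (2 * (1 + k\<^sup>2)) a b"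
proof -
  let ?m = "lift (\<lambda>x. x - k)" and ?L = "2 * (1 + k\<^sup>2)"
  have L: "1 \<le> ?L" by simp
  have "1 / y \<le> 1" if "1 \<le> y" for y :: real using that by simp
  note L' = this[OF L]
  have frac: "1 / y \<le> b / c" if "0 < y" "0 < c" "c \<le> y * b" for y b c :: real
    using that by (simp add: field_simps)
  have "\<exists>D. (?m has_real_derivative D) (at t) \<and> 1 / ?L \<le> D \<and> D \<le> ?L" for t
  proof -
    obtain n :: int and s where t: "t = 2 * pi * of_int n + s" "0 \<le> s" "s < 2 * pi" by (rule split_2pi)
    show ?thesis
    proof (cases "s = 0")
      case True
      then show ?thesis
        using lift_deriv_shift[OF lift_translation_deriv_0, of k n] t L L' by (intro exI[of _ 1]) auto
    next
      case False
      define x where "x = tan ((s - pi) / 2)"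
      define D where "D = (1 + x\<^sup>2) / (1 + (x - k)\<^sup>2)"
      have "(?m has_real_derivative 1 * (1 + x\<^sup>2) / (1 + (x - k)\<^sup>2)) (at s)"
        unfolding x_def using t False by (intro lift_deriv_mid) (auto intro!: derivative_eq_intros)
      then have "(?m has_real_derivative D) (at t)"
        unfolding t(1) by (intro lift_deriv_shift) (simp add: D_def)
      moreover have "D \<le> ?L" using peetre[of x k] by (simp add: D_def pos_divide_le_eq add_pos_nonneg)
      moreover have "1 / ?L \<le> D"
      proof -
        have "1 + (x - k)\<^sup>2 \<le> ?L * (1 + x\<^sup>2)" using peetre[of "x - k" "- k"] by simp
        moreover have "0 < 1 + (x - k)\<^sup>2" by (simp add: add_pos_nonneg)
        moreover have "0 < ?L" using L by linarith
        ultimately show ?thesis unfolding D_def by (intro frac)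
      qed
      ultimately show ?thesis by blast
    qed
  qed
  then obtain D where D: "\<And>t. (?m has_real_derivative D t) (at t)" "\<And>t. 1 / ?L \<le> D t \<and> D t \<le> ?L" by metis
  show ?thesis
  proof (rule bilip_if_deriv[OF assms, where g' = D])
    show "(?m has_real_derivative D x) (at x within {a..b})" for x
      using D(1) by (rule has_field_derivative_at_within)
    show "1 / ?L \<le> \<bar>D x\<bar> \<and> \<bar>D x\<bar> \<le> ?L" for x
    proof -
      have "0 < ?L" using L by linarith
      then have "0 < 1 / ?L" by (rule divide_pos_pos[OF zero_less_one])
      then have "0 < D x" using D(2)[of x] by linarith
      then show ?thesis using D(2)[of x] by simp
    qed
    show "?m x < ?m y" if "x < y" for x y
      using line_homeo_lift[OF line_homeo_id_minus[of k]] that by (simp add: line_homeo_less_iff)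
  qed
qed

lemma lift_translate: "lift (\<lambda>x. h x - k) t = lift (\<lambda>x. x - k) (lift h t)"
proof -
  obtain n :: int and s where t: "t = 2 * pi * of_int n + s" "0 \<le> s" "s < 2 * pi" by (rule split_2pi)
  show ?thesis
  proof (cases "s = 0")
    case False
    define x where "x = tan ((s - pi) / 2)"
    have 1: "lift g t = pi + 2 * arctan (g x) + 2 * pi * of_int n" for g
      using lift_eq[OF t(2,3), of g n] False by (simp add: t(1) x_def)
    show ?thesis unfolding 1 by (simp only: lift_periodic lift_arctan)
  qed (simp add: t(1))
qed

lemma sqs_circ_translate:
  assumes h: "line_homeo h" and "sqs_circ (lift h)"
  shows "sqs_circ (lift (\<lambda>x. h x - k))"
proof -
  obtain C \<kappa> where C: "0 < C" "0 < \<kappa>" "\<And>a b. a < b \<Longrightarrow> b - a \<le> 2 * pi \<Longrightarrow> sqs_on (lift h) C \<kappa> a b"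
    using assms by (auto simp: sqs_circ_def)
  let ?L = "2 * (1 + k\<^sup>2)"
  have "1 \<le> ?L" by simp
  then have L: "0 < ?L" by linarith
  have L2: "0 < 2 + 2 * k\<^sup>2" by (rule add_pos_nonneg) auto
  have H: "line_homeo (lift h)" by (rule line_homeo_lift[OF h])
  have "sqs_on (lift (\<lambda>x. h x - k)) (C * (?L / (1 / ?L))) \<kappa> a b" if "a < b" "b - a \<le> 2 * pi" for a b
    unfolding lift_translate [abs_def, of h k]
    by (rule sqs_on_post_bilip[OF C(3)[OF that] H that(1) C(1,2) bilip_lift_translation])
      (use that L2 H in \<open>auto simp: line_homeo_le_iff\<close>)
  moreover have "0 < C * (?L / (1 / ?L))" using C L by (intro mult_pos_pos divide_pos_pos) auto
  ultimately show ?thesis using C(2) unfolding sqs_circ_def by blast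
qed

text \<open>Subtracting \<open>h 0\<close> is an isometry of the line and bi-Lipschitz on the
  circle, so it changes neither side and the normalised case suffices.\<close>

lemma sqs_line_iff_circ:
  assumes h: "line_homeo h"
  shows "sqs_line h \<longleftrightarrow> sqs_circ (lift h)"
proof -
  define k where "k = h 0"
  define g where "g x = h x - k" for x
  have g: "line_homeo g" "g 0 = 0" unfolding g_def [abs_def] using line_homeo_translate[OF h] by (auto simp: k_def)
  have eq: "(\<lambda>x. g x - (- k)) = h" "(\<lambda>x. h x - k) = g" by (simp_all add: g_def [abs_def])
  have "sqs_line h \<longleftrightarrow> sqs_line g"
    using sqs_line_translate[OF h, of k, unfolded eq] sqs_line_translate[OF g(1), of "- k", unfolded eq] by blast
  also have "\<dots> \<longleftrightarrow> sqs_circ (lift g)"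
  proof
    assume "sqs_line g"
    then obtain C \<kappa> where C: "0 < C" "0 < \<kappa>" "\<And>a b. a < b \<Longrightarrow> sqs_on g C \<kappa> a b" by (auto simp: sqs_line_def)
    obtain C' \<kappa>' where "0 < C'" "0 < \<kappa>'" "\<And>a b. a < b \<Longrightarrow> b - a \<le> 2 * pi \<Longrightarrow> sqs_on (lift g) C' \<kappa>' a b"
      using sqs_lift_if_line[OF g C] by metis
    then show "sqs_circ (lift g)" unfolding sqs_circ_def by blast
  next
    assume "sqs_circ (lift g)"
    then obtain C \<kappa> where C: "0 < C" "0 < \<kappa>" "\<And>a b. a < b \<Longrightarrow> b - a \<le> 2 * pi \<Longrightarrow> sqs_on (lift g) C \<kappa> a b" by (auto simp: sqs_circ_def)
    obtain C' \<kappa>' where "0 < C'" "0 < \<kappa>'" "\<And>a b. a < b \<Longrightarrow> sqs_on g C' \<kappa>' a b"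
      using sqs_line_if_lift[OF g C] by metis
    then show "sqs_line g" unfolding sqs_line_def by blast
  qed
  also have "\<dots> \<longleftrightarrow> sqs_circ (lift h)"
    using sqs_circ_translate[OF h, of k, unfolded eq] sqs_circ_translate[OF g(1), of "- k", unfolded eq] by blast
  finally show ?thesis .
qed

section \<open>Differentiation of indefinite integrals almost everywhere\<close>

text \<open>Lebesgue differentiation over cubes with lower corner \<open>x\<close>, which in
  dimension one is a one-sided statement.\<close>

lemma right_derivative_AE:
  fixes h w :: "real \<Rightarrow> real"
  assumes w: "\<And>a b. w integrable_on {a..b}" "\<And>a b. a \<le> b \<Longrightarrow> integral {a..b} w = h b - h a"
  obtains N where "negligible N" "\<And>x. x \<notin> N \<Longrightarrow> ((\<lambda>s. (h (x + s) - h x) / s) \<longlongrightarrow> w x) (at_right 0)"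
proof -
  obtain N where N: "negligible N" and
    lim: "\<And>x e. x \<notin> N \<Longrightarrow> 0 < e \<Longrightarrow> \<exists>d>0. \<forall>s. 0 < s \<and> s < d \<longrightarrow>
            norm (integral (cbox x (x + s *\<^sub>R One)) w /\<^sub>R s ^ DIM(real) - w x) < e"
    using integrable_ccontinuous_explicit[of w] w(1) by (metis box_real(2))
  show ?thesis
  proof (rule that[OF N])
    fix x assume x: "x \<notin> N"
    show "((\<lambda>s. (h (x + s) - h x) / s) \<longlongrightarrow> w x) (at_right 0)"
    proof (rule tendstoI)
      fix e :: real assume "0 < e"
      then obtain d where d: "0 < d" "\<forall>s. 0 < s \<and> s < d \<longrightarrow> \<bar>inverse s * integral {x..x + s} w - w x\<bar> < e"
        using lim[OF x \<open>0 < e\<close>] by auto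
      have "dist ((h (x + s) - h x) / s) (w x) < e" if "0 < s" "s < d" for s
      proof -
        have "\<bar>inverse s * integral {x..x + s} w - w x\<bar> < e" using d(2) that by blast
        moreover have "integral {x..x + s} w = h (x + s) - h x" using w(2) that by simp
        ultimately show ?thesis by (simp add: dist_real_def divide_inverse mult.commute)
      qed
      then show "\<forall>\<^sub>F s in at_right 0. dist ((h (x + s) - h x) / s) (w x) < e"
        using d(1) by (auto simp: eventually_at_right_field)
    qed
  qed
qed

text \<open>The left derivative of \<open>h\<close> at \<open>x\<close> is the right derivative of
  the reflected function at \<open>- x\<close>.\<close>

lemma derivative_AE:
  fixes h w :: "real \<Rightarrow> real"
  assumes w: "\<And>a b. w integrable_on {a..b}" "\<And>a b. a \<le> b \<Longrightarrow> integral {a..b} w = h b - h a"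
  obtains N where "negligible N" "\<And>x. x \<notin> N \<Longrightarrow> (h has_real_derivative w x) (at x)"
proof -
  obtain N1 where N1: "negligible N1" "\<And>x. x \<notin> N1 \<Longrightarrow> ((\<lambda>s. (h (x + s) - h x) / s) \<longlongrightarrow> w x) (at_right 0)"
    using right_derivative_AE[OF w] by metis
  define h' where "h' x = - h (- x)" for x
  define w' where "w' x = w (- x)" for x
  have i1: "w' integrable_on {a..b}" for a b
    unfolding w'_def using Henstock_Kurzweil_Integration.integrable_reflect_real[where f = w and a = "- b" and b = "- a"] w(1) by simp
  have i2: "integral {a..b} w' = h' b - h' a" if "a \<le> b" for a b
  proof -
    have "integral {- (-a)..- (-b)} (\<lambda>x. w (- x)) = integral {-b..-a} w"
      using Henstock_Kurzweil_Integration.integral_reflect_real[of "-a" "-b" w] by simp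
    then show ?thesis using w(2)[of "-b" "-a"] that by (simp add: w'_def [abs_def] h'_def)
  qed
  obtain N2 where N2: "negligible N2" "\<And>x. x \<notin> N2 \<Longrightarrow> ((\<lambda>s. (h' (x + s) - h' x) / s) \<longlongrightarrow> w' x) (at_right 0)"
    using right_derivative_AE[OF i1 i2] by metis
  show ?thesis
  proof (rule that[of "N1 \<union> uminus ` N2"])
    have "negligible (uminus ` N2)"
      using N2(1) by (intro negligible_differentiable_image_negligible) (auto simp: differentiable_on_def intro!: derivative_intros)
    then show "negligible (N1 \<union> uminus ` N2)" using N1(1) by (rule negligible_Un[rotated])
    fix x assume x: "x \<notin> N1 \<union> uminus ` N2"
    then have "- x \<notin> N2" by (metis UnI2 image_eqI minus_minus)
    then have "((\<lambda>s. (h' (- x + s) - h' (- x)) / s) \<longlongrightarrow> w x) (at_right 0)"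
      using N2(2)[of "- x"] by (simp add: w'_def)
    moreover have "(h' (- x + s) - h' (- x)) / s = (h (x + - s) - h x) / (- s)" for s
      by (simp add: h'_def divide_simps)
    ultimately have "((\<lambda>s. (h (x + - s) - h x) / (- s)) \<longlongrightarrow> w x) (at_right 0)" by simp
    then have "((\<lambda>s. (h (x + s) - h x) / s) \<longlongrightarrow> w x) (at_left 0)"
      by (subst filterlim_at_left_to_right) simp
    then have "((\<lambda>s. (h (x + s) - h x) / s) \<longlongrightarrow> w x) (at 0)"
      using N1(2)[of x] x by (intro filterlim_split_at) auto
    then show "(h has_real_derivative w x) (at x)" by (simp add: DERIV_def)
  qed
qed

subsection \<open>Logarithmic derivatives\<close>

lemma line_homeo_inv: "line_homeo h \<Longrightarrow> line_homeo (inv h)"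
proof -
  assume h: "line_homeo h"
  then have b: "bij h" by (auto simp: line_homeo_def bij_def strict_mono_eq inj_on_def)
  have "inv h x < inv h y" if "x < y" for x y
    using that line_homeo_less_iff[OF h, of "inv h x" "inv h y"] b by (simp add: bij_is_surj surj_f_inv_f)
  then show ?thesis using bij_imp_bij_inv[OF b] by (auto simp: line_homeo_def strict_mono_def bij_is_surj)
qed

lemma line_homeo_measurable [measurable_dest]: "line_homeo h \<Longrightarrow> h \<in> borel_measurable borel"
  by (intro borel_measurable_continuous_onI line_homeo_continuous)

text \<open>Measuring images under \<open>h\<close> is the distribution of Lebesgue measure under
  the inverse. Its Radon-Nikodym density is locally integrable, hence finite almost everywhere, and
  it is the derivative of \<open>h\<close> almost everywhere.\<close>

lemma line_homeo_density:
  assumes h: "line_homeo h" and ac: "\<And>A. A \<in> null_sets lborel \<Longrightarrow> emeasure lborel (h ` A) = 0"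
  obtains w :: "real \<Rightarrow> real" where "w \<in> borel_measurable borel" "\<And>x. 0 \<le> w x"
    "\<And>A. A \<in> sets borel \<Longrightarrow> emeasure lborel (h ` A) = (\<integral>\<^sup>+x\<in>A. ennreal (w x) \<partial>lborel)"
    "AE x in lborel. (h has_real_derivative w x) (at x)"
proof -
  have b: "bij h" using h by (auto simp: line_homeo_def bij_def strict_mono_eq inj_on_def)
  have [measurable]: "inv h \<in> borel_measurable borel" using line_homeo_inv[OF h] by measurable
  define N where "N = distr lborel borel (inv h)"
  have N: "emeasure N A = emeasure lborel (h ` A)" if "A \<in> sets borel" for A
    using that bij_vimage_eq_inv_image[OF bij_imp_bij_inv[OF b]] b
    by (simp add: N_def emeasure_distr inv_inv_eq)
  have "absolutely_continuous lborel N"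
    unfolding absolutely_continuous_def
  proof
    fix A :: "real set" assume A: "A \<in> null_sets lborel"
    then have "A \<in> sets borel" by auto
    then show "A \<in> null_sets N" using N ac[OF A] by (simp add: null_sets_def N_def)
  qed
  moreover have "sets N = sets lborel" by (simp add: N_def)
  ultimately obtain f where f [measurable]: "f \<in> borel_measurable lborel" and fN: "density lborel f = N"
    using sigma_finite_measure.Radon_Nikodym[OF sigma_finite_lborel] by blast
  have Af: "emeasure lborel (h ` A) = (\<integral>\<^sup>+x\<in>A. f x \<partial>lborel)" if [measurable]: "A \<in> sets borel" for A
    using N[OF that] by (simp add: fN[symmetric] emeasure_density)
  define w where "w x = enn2real (f x)" for x
  have [measurable]: "w \<in> borel_measurable borel" unfolding w_def [abs_def] by measurable
  have fin: "AE x in lborel. x \<in> {- real n..real n} \<longrightarrow> f x \<noteq> \<infinity>" for n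
  proof -
    have "(\<integral>\<^sup>+x\<in>{- real n..real n}. f x \<partial>lborel) = ennreal (h (real n) - h (- real n))"
      using Af[of "{- real n..real n}"] line_homeo_Icc[OF h, of "- real n" "real n"] h by (simp add: line_homeo_le_iff)
    then have "AE x in lborel. f x * indicator {- real n..real n} x \<noteq> \<infinity>"
      by (intro nn_integral_PInf_AE) auto
    then show ?thesis by eventually_elim (auto simp: indicator_def)
  qed
  have "AE x in lborel. \<forall>n. x \<in> {- real n..real n} \<longrightarrow> f x \<noteq> \<infinity>"
    using fin by (subst AE_all_countable) auto
  then have fw: "AE x in lborel. f x = ennreal (w x)"
  proof eventually_elim
    case (elim x)
    obtain n where "\<bar>x\<bar> \<le> real n" using real_arch_simple by blast
    then have "f x \<noteq> \<infinity>" using elim by (auto simp: abs_le_iff)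
    then show ?case by (simp add: w_def top.not_eq_extremum)
  qed
  have Aw: "emeasure lborel (h ` A) = (\<integral>\<^sup>+x\<in>A. ennreal (w x) \<partial>lborel)" if "A \<in> sets borel" for A
    unfolding Af[OF that]
  proof (rule nn_integral_cong_AE)
    show "AE x in lborel. f x * indicator A x = ennreal (w x) * indicator A x"
      using fw by eventually_elim simp
  qed
  have w0: "0 \<le> w x" for x by (simp add: w_def)
  have int: "(w has_integral (h b - h a)) {a..b}" if "a \<le> b" for a b
  proof -
    have "(\<integral>\<^sup>+x. ennreal (w x * indicator {a..b} x) \<partial>lborel) = (\<integral>\<^sup>+x\<in>{a..b}. ennreal (w x) \<partial>lborel)"
      by (intro nn_integral_cong) (auto simp: indicator_def)
    also have "\<dots> = ennreal (h b - h a)"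
      using Aw[of "{a..b}"] line_homeo_Icc[OF h that] h that by (simp add: line_homeo_le_iff)
    finally have "((\<lambda>x. w x * indicator {a..b} x) has_integral (h b - h a)) UNIV"
      using h that w0 by (intro nn_integral_has_integral) (auto simp: line_homeo_le_iff)
    moreover have "(\<lambda>x. w x * indicator {a..b} x) = (\<lambda>x. if x \<in> {a..b} then w x else 0)" by auto
    ultimately show ?thesis by (simp only: has_integral_restrict_UNIV)
  qed
  have w1: "w integrable_on {a..b}" "a \<le> b \<Longrightarrow> integral {a..b} w = h b - h a" for a b
    using int[of a b] by (cases "a \<le> b"; auto simp: integral_unique has_integral_integrable)+
  obtain N where N: "negligible N" "\<And>x. x \<notin> N \<Longrightarrow> (h has_real_derivative w x) (at x)"
    using derivative_AE[OF w1] by metis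
  have "AE x in lebesgue. x \<notin> N" using N(1) by (intro AE_not_in) (simp add: negligible_iff_null_sets)
  then have "AE x in lborel. x \<notin> N" by (simp add: AE_completion_iff)
  then have "AE x in lborel. (h has_real_derivative w x) (at x)" by eventually_elim (rule N(2))
  then show ?thesis using that[of w] Aw w0 by auto
qed

text \<open>On unit intervals a null set has relative measure 0, and
  \<open>0 powr \<kappa> = 0\<close>.\<close>

lemma sqs_null:
  assumes h: "line_homeo h" and \<kappa>: "0 < \<kappa>" and sqs: "\<And>a b. a < b \<Longrightarrow> b - a \<le> 1 \<Longrightarrow> sqs_on h C \<kappa> a b"
    and A: "A \<in> null_sets lborel"
  shows "emeasure lborel (h ` A) = 0"
proof -
  have 1: "h ` (A \<inter> {of_int i..of_int i + 1}) \<in> null_sets lborel" for i :: int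
  proof -
    let ?B = "A \<inter> {of_int i..of_int i + 1}"
    have B: "?B \<in> sets borel" using A by auto
    have "emeasure lborel ?B = 0" using A by (metis Int_lower1 emeasure_mono le_zero_eq null_setsD1 null_setsD2)
    then have m: "measure lborel ?B = 0" by (simp add: measure_def)
    have "measure lborel (h ` ?B) \<le> C * (h (of_int i + 1) - h (of_int i)) * (measure lborel ?B / (of_int i + 1 - of_int i)) powr \<kappa>"
      using sqs[of "of_int i" "of_int i + 1"] B unfolding sqs_on_def by auto
    then have "measure lborel (h ` ?B) = 0" using m measure_nonneg[of lborel "h ` ?B"] by simp
    moreover have "h ` ?B \<subseteq> {h (of_int i)..h (of_int i + 1)}" using line_homeo_Icc[OF h, of "of_int i" "of_int i + 1"] by auto
    then have "emeasure lborel (h ` ?B) < \<infinity>"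
      by (intro emeasure_bounded_finite) (rule bounded_subset[OF bounded_closed_interval])
    ultimately have "emeasure lborel (h ` ?B) = 0" by (simp add: emeasure_eq_ennreal_measure)
    then show ?thesis using line_homeo_borel[OF h B] by (simp add: null_sets_def)
  qed
  have "x \<in> (\<Union>i::int. A \<inter> {of_int i..of_int i + 1})" if "x \<in> A" for x
    using that by (auto intro!: exI[of _ "\<lfloor>x\<rfloor>"])
  then have "h ` A = (\<Union>i::int. h ` (A \<inter> {of_int i..of_int i + 1}))" by blast
  then have "h ` A \<in> null_sets lborel" using null_sets_UN[of "\<lambda>i::int. h ` (A \<inter> {of_int i..of_int i + 1})" lborel] 1 by simp
  then show ?thesis by auto
qed

text \<open>At a density point of \<open>{w = 0}\<close> a short interval would be mapped mostly by a set of small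
  relative measure, against strong quasisymmetry.\<close>

lemma sqs_density_pos:
  assumes h: "line_homeo h" and C: "0 < C" "0 < \<kappa>" and sqs: "\<And>a b. a < b \<Longrightarrow> b - a \<le> 1 \<Longrightarrow> sqs_on h C \<kappa> a b"
    and w [measurable]: "w \<in> borel_measurable borel"
    and dens: "\<And>A. A \<in> sets borel \<Longrightarrow> emeasure lborel (h ` A) = (\<integral>\<^sup>+x\<in>A. ennreal (w x) \<partial>lborel)"
  shows "AE x in lborel. 0 < w x"
proof -
  define Z where "Z = {x. w x \<le> 0}"
  have Z [measurable]: "Z \<in> sets borel" unfolding Z_def by measurable
  have hZ0: "emeasure lborel (h ` Z) = 0"
    unfolding dens[OF Z] by (rule nn_integral_0_iff_AE[THEN iffD2]) (auto simp: Z_def indicator_def ennreal_neg)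
  have hZ: "h ` Z \<in> null_sets lborel" using hZ0 line_homeo_borel[OF h Z] by (simp add: null_sets_def)
  \<comment> \<open>A set of relative measure at most \<open>\<eta>\<close> carries at most half of
    the image, as in \<open>sqs_on_comparable\<close>.\<close>
  define \<eta> where "\<eta> = min (1 / 2) ((1 / (2 * C)) powr (1 / \<kappa>))"
  have \<eta>: "0 < \<eta>" "\<eta> < 1" using C by (auto simp: \<eta>_def min_def)
  have "\<eta> powr \<kappa> \<le> ((1 / (2 * C)) powr (1 / \<kappa>)) powr \<kappa>"
    using \<eta> C by (intro powr_mono2) (auto simp: \<eta>_def)
  also have "\<dots> = 1 / (2 * C)" using C by (simp add: powr_powr)
  finally have \<eta>C: "C * \<eta> powr \<kappa> \<le> 1 / 2" using C by (simp add: field_simps)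
  have iZ: "indicat_real Z integrable_on {a..b}" for a b
  proof -
    have "Z \<inter> {a..b} \<in> lmeasurable" by (intro bounded_set_imp_lmeasurable) (auto intro: bounded_subset[OF bounded_closed_interval])
    then show ?thesis by (simp add: integrable_on_indicator Int_commute)
  qed
  obtain N where N: "negligible N" and
    lim: "\<And>x e. x \<notin> N \<Longrightarrow> 0 < e \<Longrightarrow> \<exists>d>0. \<forall>s. 0 < s \<and> s < d \<longrightarrow>
            norm (integral (cbox x (x + s *\<^sub>R One)) (indicat_real Z) /\<^sub>R s ^ DIM(real) - indicat_real Z x) < e"
    using integrable_ccontinuous_explicit[of "indicat_real Z"] iZ by (metis box_real(2))
  have "x \<in> N" if x: "x \<in> Z" for x
  proof (rule ccontr)
    assume "x \<notin> N"
    then obtain d where d: "0 < d" "\<forall>s. 0 < s \<and> s < d \<longrightarrow> \<bar>inverse s * integral {x..x + s} (indicat_real Z) - 1\<bar> < \<eta>"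
      using lim[OF _ \<eta>(1), of x] x by auto
    define s where "s = min (d / 2) 1"
    have s: "0 < s" "s < d" "s \<le> 1" using d(1) by (auto simp: s_def)
    have ZI: "Z \<inter> {x..x + s} \<in> lmeasurable"
      by (intro bounded_set_imp_lmeasurable) (auto intro: bounded_subset[OF bounded_closed_interval])
    have "integral {x..x + s} (indicat_real Z) = measure lebesgue (Z \<inter> {x..x + s})"
      using ZI by (simp add: integral_indicator Int_commute)
    also have "\<dots> = measure lborel (Z \<inter> {x..x + s})" by (simp add: measure_completion)
    finally have eq: "integral {x..x + s} (indicat_real Z) = measure lborel (Z \<inter> {x..x + s})" .
    have "\<bar>inverse s * integral {x..x + s} (indicat_real Z) - 1\<bar> < \<eta>" using d(2) s by blast
    then have "\<bar>inverse s * measure lborel (Z \<inter> {x..x + s}) - 1\<bar> < \<eta>" by (simp only: eq)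
    then have "1 - \<eta> < inverse s * measure lborel (Z \<inter> {x..x + s})" by (simp add: abs_less_iff)
    then have big: "(1 - \<eta>) * s < measure lborel (Z \<inter> {x..x + s})" using s by (simp add: field_simps)
    let ?A = "{x..x + s} - Z"
    have "measure lborel ?A = measure lborel {x..x + s} - measure lborel (Z \<inter> {x..x + s})"
    proof -
      have A: "?A = {x..x + s} - (Z \<inter> {x..x + s})" by auto
      show ?thesis unfolding A by (rule measure_Diff) (use s in auto)
    qed
    then have "measure lborel ?A / s \<le> \<eta>" using big s by (simp add: field_simps)
    moreover have "measure lborel (h ` ?A) \<le> C * (h (x + s) - h x) * (measure lborel ?A / ((x + s) - x)) powr \<kappa>"
      using sqs[of x "x + s"] s unfolding sqs_on_def by auto
    moreover have pos: "0 < h (x + s) - h x" using s h by (simp add: line_homeo_less_iff)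
    ultimately have "measure lborel (h ` ?A) \<le> C * (h (x + s) - h x) * \<eta> powr \<kappa>"
      using C s by (elim order_trans) (auto intro!: mult_left_mono powr_mono2)
    also have "\<dots> = (C * \<eta> powr \<kappa>) * (h (x + s) - h x)" by simp
    also have "\<dots> \<le> 1 / 2 * (h (x + s) - h x)" using \<eta>C pos by (intro mult_right_mono) auto
    finally have small: "measure lborel (h ` ?A) \<le> 1 / 2 * (h (x + s) - h x)" .
    \<comment> \<open>As the image of \<open>Z\<close> is null, the complement of \<open>Z\<close>
      carries the whole image interval although its relative measure is at most
      \<open>\<eta>\<close>.\<close>
    have "h ` ?A = {h x..h (x + s)} - h ` Z"
      using line_homeo_Icc[OF h, of x "x + s"] s line_homeo_inj[OF h, of UNIV] by (simp add: image_set_diff)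
    then have "measure lborel (h ` ?A) = measure lborel {h x..h (x + s)}"
      using hZ by (simp add: measure_Diff_null_set)
    then show False using small pos by simp
  qed
  then have "negligible Z" using N negligible_subset by blast
  then have "AE x in lebesgue. x \<notin> Z" by (intro AE_not_in) (simp add: negligible_iff_null_sets)
  then have "AE x in lborel. x \<notin> Z" by (simp add: AE_completion_iff)
  then show ?thesis by eventually_elim (simp add: Z_def)
qed

section \<open>Averages of the derivative and of its logarithm\<close>

lemma nn_integral_Markov_Icc:
  assumes [measurable]: "F \<in> borel_measurable borel" and "a < b" "0 < \<delta>"
    and dev: "deviation F {a..b} c \<le> ennreal D" and D: "0 \<le> D"
  shows "\<delta> * measure lborel {t \<in> {a..b}. \<delta> < \<bar>F t - c\<bar>} \<le> D"
proof -
  let ?B = "{t \<in> {a..b}. \<delta> < \<bar>F t - c\<bar>}"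
  have B: "?B \<in> sets borel" by measurable
  have bd: "bounded ?B" by (rule bounded_subset[OF bounded_closed_interval[of a b]]) auto
  have "ennreal (\<delta> * measure lborel ?B) = (\<integral>\<^sup>+t\<in>?B. ennreal \<delta> \<partial>lborel)"
    using nn_integral_const_bounded[OF B bd, of \<delta>] \<open>0 < \<delta>\<close> by simp
  also have "\<dots> \<le> deviation F {a..b} c"
    unfolding deviation_def by (intro nn_integral_mono) (auto simp: indicator_def intro!: ennreal_leI)
  also have "\<dots> \<le> ennreal D" by (rule dev)
  finally show ?thesis using D by simp
qed

lemma measure_image_density:
  assumes h: "line_homeo h" and w [measurable]: "w \<in> borel_measurable borel"
    and dens: "\<And>A. A \<in> sets borel \<Longrightarrow> emeasure lborel (h ` A) = (\<integral>\<^sup>+x\<in>A. ennreal (w x) \<partial>lborel)"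
    and G: "G \<in> sets borel" "G \<subseteq> {a..b}" and lu: "AE x in lborel. x \<in> G \<longrightarrow> l \<le> w x \<and> w x \<le> u" "0 \<le> l" "0 \<le> u"
    and "a \<le> b"
  shows "l * measure lborel G \<le> measure lborel (h ` G)" "measure lborel (h ` G) \<le> u * measure lborel G"
proof -
  have bd: "bounded G" using G(2) bounded_subset bounded_closed_interval by blast
  have "h ` G \<subseteq> {h a..h b}" using G(2) line_homeo_Icc[OF h \<open>a \<le> b\<close>] by blast
  then have "bounded (h ` G)" using bounded_subset bounded_closed_interval by blast
  then have e: "ennreal (measure lborel (h ` G)) = (\<integral>\<^sup>+x\<in>G. ennreal (w x) \<partial>lborel)"
    using dens[OF G(1)] emeasure_bounded_finite[of "h ` G"] emeasure_eq_ennreal_measure[of lborel "h ` G"] by auto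
  have "ennreal (l * measure lborel G) = (\<integral>\<^sup>+x\<in>G. ennreal l \<partial>lborel)"
    using nn_integral_const_bounded[OF G(1) bd lu(2)] by simp
  also have "\<dots> \<le> (\<integral>\<^sup>+x\<in>G. ennreal (w x) \<partial>lborel)"
  proof (rule nn_integral_mono_AE)
    show "AE x in lborel. ennreal l * indicator G x \<le> ennreal (w x) * indicator G x"
      using lu(1) by eventually_elim (auto simp: indicator_def intro!: ennreal_leI)
  qed
  finally show "l * measure lborel G \<le> measure lborel (h ` G)" by (simp add: e[symmetric])
  have "(\<integral>\<^sup>+x\<in>G. ennreal (w x) \<partial>lborel) \<le> (\<integral>\<^sup>+x\<in>G. ennreal u \<partial>lborel)"
  proof (rule nn_integral_mono_AE)
    show "AE x in lborel. ennreal (w x) * indicator G x \<le> ennreal u * indicator G x"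
      using lu(1) by eventually_elim (auto simp: indicator_def intro!: ennreal_leI)
  qed
  also have "\<dots> = ennreal (u * measure lborel G)"
    using nn_integral_const_bounded[OF G(1) bd lu(3)] by simp
  finally show "measure lborel (h ` G) \<le> u * measure lborel G" using lu(3) by (simp add: e[symmetric])
qed

text \<open>Strong quasisymmetry makes the set where \<open>ln w\<close> is far from \<open>c\<close> negligible for the image
  measure as well, so no John-Nirenberg inequality is needed to compare the mean of \<open>w\<close> with
  the exponential of the mean of \<open>ln w\<close>.\<close>

lemma log_average_near:
  assumes h: "line_homeo h" and C: "0 < C" "0 < \<kappa>" and \<eta>: "0 < \<eta>"
    and w [measurable]: "w \<in> borel_measurable borel" "F \<in> borel_measurable borel"
    and dens: "\<And>A. A \<in> sets borel \<Longrightarrow> emeasure lborel (h ` A) = (\<integral>\<^sup>+x\<in>A. ennreal (w x) \<partial>lborel)"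
    and wF: "AE x in lborel. w x = exp (F x)"
  obtains \<epsilon> where "0 < \<epsilon>" "\<And>a b c. a < b \<Longrightarrow> sqs_on h C \<kappa> a b \<Longrightarrow> deviation F {a..b} c \<le> ennreal (\<epsilon> * (b - a)) \<Longrightarrow>
      \<bar>ln ((h b - h a) / (b - a)) - c\<bar> \<le> \<eta>"
proof -
  \<comment> \<open>A factor \<open>exp \<delta>\<close> is lost twice: in the values of
    \<open>w\<close> on the good set, and in replacing the interval or its image by the good part.
    Together this gives \<open>\<eta>\<close>.\<close>
  define \<delta> where "\<delta> = \<eta> / 2"
  have \<delta>: "0 < \<delta>" using \<eta> by (simp add: \<delta>_def)
  define q where "q = 1 - exp (- \<delta>)"
  have q: "0 < q" "q < 1" using \<delta> by (auto simp: q_def)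
  \<comment> \<open>If the bad set has relative measure at most \<open>\<rho>\<close>, it takes at
    most the share \<open>q\<close> both of the interval and of its image.\<close>
  define \<rho> where "\<rho> = min q ((q / C) powr (1 / \<kappa>))"
  have \<rho>: "0 < \<rho>" "\<rho> \<le> q" using q C by (auto simp: \<rho>_def)
  have "\<rho> powr \<kappa> \<le> ((q / C) powr (1 / \<kappa>)) powr \<kappa>"
    using \<rho> C by (intro powr_mono2) (auto simp: \<rho>_def)
  also have "\<dots> = q / C" using q C by (simp add: powr_powr)
  finally have \<rho>C: "C * \<rho> powr \<kappa> \<le> q" using C by (simp add: field_simps)
  show ?thesis
  proof (rule that[of "\<rho> * \<delta>"])
    show "0 < \<rho> * \<delta>" using \<rho> \<delta> by simp
    fix a b c :: real
    assume ab: "a < b" and sqs: "sqs_on h C \<kappa> a b" and dev: "deviation F {a..b} c \<le> ennreal (\<rho> * \<delta> * (b - a))"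
    define B where "B = {t \<in> {a..b}. \<delta> < \<bar>F t - c\<bar>}"
    define G where "G = {t \<in> {a..b}. \<bar>F t - c\<bar> \<le> \<delta>}"
    let ?m = "measure lborel :: real set \<Rightarrow> real"
    have BG: "B \<in> sets borel" "G \<in> sets borel" "B \<union> G = {a..b}" "B \<inter> G = {}" "B \<subseteq> {a..b}" "G \<subseteq> {a..b}"
      unfolding B_def G_def by (measurable, auto)
    have fm: "A \<in> fmeasurable lborel" if "A \<in> sets borel" "A \<subseteq> {x..y}" for A :: "real set" and x y
      using that emeasure_bounded_finite[of A] bounded_subset[OF bounded_closed_interval] by (auto simp: fmeasurable_def)
    have "\<delta> * ?m B \<le> \<rho> * \<delta> * (b - a)"
      unfolding B_def using \<delta> \<rho> ab by (intro nn_integral_Markov_Icc dev) auto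
    then have mB: "?m B \<le> \<rho> * (b - a)" using \<delta> by (simp add: mult.commute mult.left_commute)
    have "?m (B \<union> G) = ?m B + ?m G"
      using BG fm[OF BG(1,5)] fm[OF BG(2,6)] by (intro measure_Union) (auto simp: fmeasurable_def)
    then have sum: "?m B + ?m G = b - a" using BG(3) ab by simp
    have GG: "?m G \<le> b - a" using sum measure_nonneg[of lborel B] by linarith
    have hl: "0 < h b - h a" using ab h by (simp add: line_homeo_less_iff)
    have hB: "h ` B \<subseteq> {h a..h b}" "h ` G \<subseteq> {h a..h b}" using BG line_homeo_Icc[OF h less_imp_le[OF ab]] by blast+
    have hBG: "h ` B \<in> sets borel" "h ` G \<in> sets borel" using BG by (auto intro: line_homeo_borel[OF h])
    have "?m (h ` B \<union> h ` G) = ?m (h ` B) + ?m (h ` G)"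
      using BG hBG fm[OF hBG(1) hB(1)] fm[OF hBG(2) hB(2)] line_homeo_inj[OF h, of UNIV]
      by (intro measure_Union) (auto simp: fmeasurable_def dest: injD)
    then have hsum: "?m (h ` B) + ?m (h ` G) = h b - h a"
      using line_homeo_Icc[OF h less_imp_le[OF ab]] hl by (simp add: image_Un[symmetric] BG(3))
    have "?m (h ` B) \<le> C * (h b - h a) * (?m B / (b - a)) powr \<kappa>"
      using sqs BG unfolding sqs_on_def by blast
    also have "\<dots> \<le> C * (h b - h a) * \<rho> powr \<kappa>"
      using mB ab C hl by (intro mult_left_mono powr_mono2) (auto simp: field_simps)
    also have "\<dots> = (C * \<rho> powr \<kappa>) * (h b - h a)" by simp
    also have "\<dots> \<le> q * (h b - h a)" using \<rho>C hl by (intro mult_right_mono) auto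
    finally have hG: "exp (- \<delta>) * (h b - h a) \<le> ?m (h ` G)" using hsum by (simp add: q_def algebra_simps)
    have mG: "exp (- \<delta>) * (b - a) \<le> ?m G"
    proof -
      have "\<rho> * (b - a) \<le> q * (b - a)" using \<rho> ab by (intro mult_right_mono) auto
      then show ?thesis using sum mB by (simp add: q_def algebra_simps)
    qed
    have "AE x in lborel. x \<in> G \<longrightarrow> exp (c - \<delta>) \<le> w x \<and> w x \<le> exp (c + \<delta>)"
      using wF by eventually_elim (auto simp: G_def abs_le_iff)
    note bounds = measure_image_density[OF h w(1) dens BG(2,6) this _ _ less_imp_le[OF ab]]
    have "exp (- \<delta>) * (h b - h a) \<le> exp (c + \<delta>) * (b - a)"
    proof -
      have "?m (h ` G) \<le> exp (c + \<delta>) * ?m G" by (rule bounds(2)) auto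
      also have "\<dots> \<le> exp (c + \<delta>) * (b - a)" using GG by (intro mult_left_mono) auto
      finally show ?thesis using hG by simp
    qed
    then have "h b - h a \<le> exp \<delta> * (exp (c + \<delta>) * (b - a))"
      by (simp add: exp_minus field_simps)
    then have up: "(h b - h a) / (b - a) \<le> exp (c + \<eta>)"
      using ab by (simp add: pos_divide_le_eq \<delta>_def exp_add[symmetric] mult.assoc[symmetric] add.commute add.left_commute)
    have "exp (c - \<delta>) * (exp (- \<delta>) * (b - a)) \<le> exp (c - \<delta>) * ?m G" using mG by (intro mult_left_mono) auto
    also have "\<dots> \<le> ?m (h ` G)" by (rule bounds(1)) auto
    also have "\<dots> \<le> h b - h a" using hsum measure_nonneg[of lborel "h ` B"] by linarith
    finally have "exp (c - \<eta>) * (b - a) \<le> h b - h a"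
      by (simp add: \<delta>_def exp_add[symmetric] mult.assoc[symmetric])
    then have low: "exp (c - \<eta>) \<le> (h b - h a) / (b - a)" using ab by (simp add: pos_le_divide_eq)
    have "0 < (h b - h a) / (b - a)" using hl ab by simp
    then have "ln ((h b - h a) / (b - a)) \<le> ln (exp (c + \<eta>))" "ln (exp (c - \<eta>)) \<le> ln ((h b - h a) / (b - a))"
      using up low by (subst ln_le_cancel_iff; simp)+
    then show "\<bar>ln ((h b - h a) / (b - a)) - c\<bar> \<le> \<eta>" by (simp add: abs_le_iff)
  qed
qed

text \<open>The intervals between 0 and \<open>x\<close> and between 0 and \<open>y\<close> fill
  fixed proportions of \<open>{-r..r}\<close>. A single centre for the large interval is therefore
  close to both logarithmic quotients.\<close>

lemma slow_quotient:
  assumes h: "line_homeo h" and C: "0 < C" "0 < \<kappa>" and \<eta>: "0 < \<eta>"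
    and w: "w \<in> borel_measurable borel" "F \<in> borel_measurable borel"
    and dens: "\<And>A. A \<in> sets borel \<Longrightarrow> emeasure lborel (h ` A) = (\<integral>\<^sup>+x\<in>A. ennreal (w x) \<partial>lborel)"
    and wF: "AE x in lborel. w x = exp (F x)"
  obtains \<epsilon> where "0 < \<epsilon>" "\<And>r x y. 0 < r \<Longrightarrow> r / 2 \<le> \<bar>x\<bar> \<Longrightarrow> \<bar>x\<bar> \<le> r \<Longrightarrow> r / 2 \<le> \<bar>y\<bar> \<Longrightarrow> \<bar>y\<bar> \<le> r \<Longrightarrow>
      (\<And>a b. a < b \<Longrightarrow> b - a \<le> r \<Longrightarrow> sqs_on h C \<kappa> a b) \<Longrightarrow> osc_le F {-r..r} \<epsilon> \<Longrightarrow>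
      \<bar>ln ((h x - h 0) / x) - ln ((h y - h 0) / y)\<bar> \<le> \<eta>"
proof -
  obtain \<epsilon> where \<epsilon>: "0 < \<epsilon>" and near: "\<And>a b c. a < b \<Longrightarrow> sqs_on h C \<kappa> a b \<Longrightarrow> deviation F {a..b} c \<le> ennreal (\<epsilon> * (b - a)) \<Longrightarrow>
      \<bar>ln ((h b - h a) / (b - a)) - c\<bar> \<le> \<eta> / 2"
    using log_average_near[OF h C, of "\<eta> / 2", OF _ w dens wF] \<eta> by (metis half_gt_zero)
  show ?thesis
  \<comment> \<open>The window has length \<open>2 * r\<close> and the smaller interval length at
    least \<open>r / 2\<close>, a ratio of 4.\<close>
  proof (rule that[of "\<epsilon> / 4"])
    fix r x y :: real
    assume r: "0 < r" and x: "r / 2 \<le> \<bar>x\<bar>" "\<bar>x\<bar> \<le> r" and y: "r / 2 \<le> \<bar>y\<bar>" "\<bar>y\<bar> \<le> r"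
      and sqs: "\<And>a b. a < b \<Longrightarrow> b - a \<le> r \<Longrightarrow> sqs_on h C \<kappa> a b" and osc: "osc_le F {-r..r} (\<epsilon> / 4)"
    obtain c where c: "deviation F {-r..r} c \<le> ennreal (\<epsilon> / 4 * (2 * r))" using osc r by (auto simp: osc_le_def)
    have Q: "\<bar>ln ((h z - h 0) / z) - c\<bar> \<le> \<eta> / 2" if z: "r / 2 \<le> \<bar>z\<bar>" "\<bar>z\<bar> \<le> r" for z
    proof -
      define a b where "a = min 0 z" and "b = max 0 z"
      have ab: "a < b" "b - a = \<bar>z\<bar>" "{a..b} \<subseteq> {-r..r}" using z r by (auto simp: a_def b_def)
      have "deviation F {a..b} c \<le> ennreal (\<epsilon> / 4 * (2 * r))"
        using deviation_mono[OF ab(3)] c order_trans by blast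
      also have "\<dots> \<le> ennreal (\<epsilon> * (b - a))"
      proof (rule ennreal_leI)
        have "\<epsilon> * (r / 2) \<le> \<epsilon> * (b - a)" using ab(2) z \<epsilon> by (intro mult_left_mono) auto
        then show "\<epsilon> / 4 * (2 * r) \<le> \<epsilon> * (b - a)" by simp
      qed
      finally have "\<bar>ln ((h b - h a) / (b - a)) - c\<bar> \<le> \<eta> / 2"
        using ab z by (intro near sqs) auto
      moreover have "(h b - h a) / (b - a) = (h z - h 0) / z"
      proof (cases "0 < z")
        case False
        then have "a = z" "b = 0" by (auto simp: a_def b_def)
        then show ?thesis using minus_divide_divide[of "h z - h 0" z] by simp
      qed (simp add: a_def b_def)
      ultimately show ?thesis by simp
    qed
    show "\<bar>ln ((h x - h 0) / x) - ln ((h y - h 0) / y)\<bar> \<le> \<eta>"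
      using Q[OF x] Q[OF y] by linarith
  qed (use \<epsilon> in simp)
qed

section \<open>Functions that oscillate slowly at infinity\<close>

text \<open>Only absolute values of the arguments are compared, so the values at \<open>x\<close>
  and \<open>- x\<close> must approach each other as well. The function itself may be
  unbounded.\<close>

definition slow :: "(real \<Rightarrow> real) \<Rightarrow> bool" where
  "slow u \<longleftrightarrow> (\<forall>\<epsilon>>0. \<exists>N. \<forall>x y. N \<le> \<bar>x\<bar> \<and> \<bar>x\<bar> \<le> \<bar>y\<bar> \<and> \<bar>y\<bar> \<le> 2 * \<bar>x\<bar> \<longrightarrow> \<bar>u x - u y\<bar> \<le> \<epsilon>)"

lemma slow_add_vanishing:
  assumes u: "slow u" and E: "(E \<longlongrightarrow> 0) at_infinity"
  shows "slow (\<lambda>x. u x + E x :: real)"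
  unfolding slow_def
proof (intro allI impI)
  fix \<epsilon> :: real assume \<epsilon>: "0 < \<epsilon>"
  obtain N where N: "\<And>x y. N \<le> \<bar>x\<bar> \<Longrightarrow> \<bar>x\<bar> \<le> \<bar>y\<bar> \<Longrightarrow> \<bar>y\<bar> \<le> 2 * \<bar>x\<bar> \<Longrightarrow> \<bar>u x - u y\<bar> \<le> \<epsilon> / 2"
    using u[unfolded slow_def, rule_format, of "\<epsilon> / 2"] \<epsilon> by auto
  have "\<forall>\<^sub>F x in at_infinity. dist (E x) 0 < \<epsilon> / 4" using E \<epsilon> by (intro tendstoD) auto
  then obtain M where M: "\<And>x. M \<le> \<bar>x\<bar> \<Longrightarrow> \<bar>E x\<bar> < \<epsilon> / 4" by (auto simp: eventually_at_infinity)
  show "\<exists>N. \<forall>x y. N \<le> \<bar>x\<bar> \<and> \<bar>x\<bar> \<le> \<bar>y\<bar> \<and> \<bar>y\<bar> \<le> 2 * \<bar>x\<bar> \<longrightarrow> \<bar>u x + E x - (u y + E y)\<bar> \<le> \<epsilon>"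
  proof (intro exI[of _ "max N M"] allI impI)
    fix x y :: real assume "max N M \<le> \<bar>x\<bar> \<and> \<bar>x\<bar> \<le> \<bar>y\<bar> \<and> \<bar>y\<bar> \<le> 2 * \<bar>x\<bar>"
    then have xy: "N \<le> \<bar>x\<bar>" "M \<le> \<bar>x\<bar>" "M \<le> \<bar>y\<bar>" "\<bar>x\<bar> \<le> \<bar>y\<bar>" "\<bar>y\<bar> \<le> 2 * \<bar>x\<bar>" by auto
    show "\<bar>u x + E x - (u y + E y)\<bar> \<le> \<epsilon>"
      using N[OF xy(1,4,5)] M[OF xy(2)] M[OF xy(3)] by linarith
  qed
qed

lemma bmo_le_compact_support:
  assumes g: "continuous_on UNIV g" "\<And>x. N \<le> \<bar>x\<bar> \<Longrightarrow> g x = (0::real)"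
  obtains M where "0 \<le> M" "\<And>x. \<bar>g x\<bar> \<le> M" "bmo_le g M"
proof -
  have "compact (g ` {- \<bar>N\<bar>..\<bar>N\<bar>})"
    using g(1) by (intro compact_continuous_image continuous_on_subset[OF g(1)]) auto
  then obtain M where M: "\<And>x. x \<in> {- \<bar>N\<bar>..\<bar>N\<bar>} \<Longrightarrow> \<bar>g x\<bar> \<le> M" 
    using compact_imp_bounded bounded_iff by (metis imageI real_norm_def)
  have gM: "\<bar>g x\<bar> \<le> \<bar>M\<bar>" for x
  proof (cases "x \<in> {- \<bar>N\<bar>..\<bar>N\<bar>}")
    case True then show ?thesis using M[of x] by linarith
  next
    case False
    then have "\<not> \<bar>x\<bar> \<le> \<bar>N\<bar>" by (auto simp: abs_le_iff)
    then show ?thesis using g(2)[of x] by simp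
  qed
  show ?thesis
  proof (rule that[of "\<bar>M\<bar>"])
    show "bmo_le g \<bar>M\<bar>" unfolding bmo_le_def by (auto intro!: osc_le_bounded[where c = 0] gM)
  qed (use gM in auto)
qed

lemma cmo_line_if_slow:
  assumes u: "continuous_on UNIV u" and slow: "slow u"
  shows "cmo_line u"
proof -
  have [measurable]: "u \<in> borel_measurable borel" using u by (rule borel_measurable_continuous_onI)
  have approx: "\<exists>g N. continuous_on UNIV g \<and> (\<forall>x. N \<le> \<bar>x\<bar> \<longrightarrow> g x = 0) \<and> bmo_le (\<lambda>x. u x - g x) \<epsilon>"
    if \<epsilon>: "0 < \<epsilon>" for \<epsilon>
  proof -
    \<comment> \<open>The total loss is \<open>36 * 3 + 1 = 109\<close> times \<open>\<eta>\<close>,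
      below \<open>200 * \<eta>\<close>.\<close>
    define \<eta> where "\<eta> = \<epsilon> / 200"
    have \<eta>: "0 < \<eta>" using \<epsilon> by (simp add: \<eta>_def)
    obtain N0 where N0: "\<And>x y. N0 \<le> \<bar>x\<bar> \<Longrightarrow> \<bar>x\<bar> \<le> \<bar>y\<bar> \<Longrightarrow> \<bar>y\<bar> \<le> 2 * \<bar>x\<bar> \<Longrightarrow> \<bar>u x - u y\<bar> \<le> \<eta>"
      using slow[unfolded slow_def, rule_format, OF \<eta>] by auto
    define N where "N = max 1 N0"
    have N: "0 < N" "\<And>x y. N \<le> \<bar>x\<bar> \<Longrightarrow> \<bar>x\<bar> \<le> \<bar>y\<bar> \<Longrightarrow> \<bar>y\<bar> \<le> 2 * \<bar>x\<bar> \<Longrightarrow> \<bar>u x - u y\<bar> \<le> \<eta>"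
      using N0 by (auto simp: N_def)
    \<comment> \<open>Slowness covers the ratio 2; the ratio 4 of rings is reached through the
      intermediate point \<open>2 * x\<close>.\<close>
    have N4': "\<bar>u x - u y\<bar> \<le> 2 * \<eta>" if "N \<le> \<bar>x\<bar>" "\<bar>x\<bar> \<le> \<bar>y\<bar>" "\<bar>y\<bar> \<le> 4 * \<bar>x\<bar>" for x y
    proof (cases "\<bar>y\<bar> \<le> 2 * \<bar>x\<bar>")
      case True
      then show ?thesis using N(2)[of x y] that \<eta> by linarith
    next
      case False
      have "\<bar>u x - u (2 * x)\<bar> \<le> \<eta>" using that by (intro N(2)) (auto simp: abs_mult)
      moreover have "\<bar>u (2 * x) - u y\<bar> \<le> \<eta>" using that False N(1) by (intro N(2)) (auto simp: abs_mult)
      ultimately show ?thesis by linarith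
    qed
    have N4: "\<bar>u x - u y\<bar> \<le> 2 * \<eta>" if "N \<le> \<bar>x\<bar>" "N \<le> \<bar>y\<bar>" "\<bar>y\<bar> \<le> 4 * \<bar>x\<bar>" "\<bar>x\<bar> \<le> 4 * \<bar>y\<bar>" for x y
      using N4'[of x y] N4'[of y x] that by (cases "\<bar>x\<bar> \<le> \<bar>y\<bar>") (auto simp: abs_minus_commute)
    define cl where "cl x = max (- N) (min N x)" for x :: real
    define b where "b x = u x - u (cl x)" for x
    have cont_cl: "continuous_on UNIV (\<lambda>x. u (cl x))"
      unfolding cl_def by (rule continuous_on_compose2[OF u]) (auto intro!: continuous_intros)
    have [measurable]: "(\<lambda>x. u (cl x)) \<in> borel_measurable borel" using cont_cl by (rule borel_measurable_continuous_onI)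
    have [measurable]: "b \<in> borel_measurable borel" unfolding b_def [abs_def] by measurable
    have cl1: "cl x = x" if "\<bar>x\<bar> \<le> N" for x using that by (auto simp: cl_def abs_le_iff)
    have cl2: "\<bar>cl x\<bar> = N" if "N \<le> \<bar>x\<bar>" for x using that N(1) by (auto simp: cl_def abs_if min_def max_def split: if_splits)
    have clN: "\<bar>u y - u z\<bar> \<le> \<eta>" if "\<bar>y\<bar> = N" "\<bar>z\<bar> = N" for y z using that N(1) by (intro N(2)) auto
    have b_ring: "\<bar>b x - b y\<bar> \<le> 3 * \<eta>" if xy: "\<bar>y\<bar> \<le> 4 * \<bar>x\<bar>" "\<bar>x\<bar> \<le> 4 * \<bar>y\<bar>" for x y
    proof -
      have half: "\<bar>b y\<bar> \<le> 2 * \<eta>" if "\<bar>x\<bar> \<le> N" "N \<le> \<bar>y\<bar>" "\<bar>y\<bar> \<le> 4 * \<bar>x\<bar>" for x y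
        unfolding b_def using that cl2[of y] N(1) by (intro N4) auto
      consider "N \<le> \<bar>x\<bar>" "N \<le> \<bar>y\<bar>" | "\<bar>x\<bar> \<le> N" "N \<le> \<bar>y\<bar>" | "N \<le> \<bar>x\<bar>" "\<bar>y\<bar> \<le> N" | "\<bar>x\<bar> \<le> N" "\<bar>y\<bar> \<le> N" by linarith
      then show ?thesis
      proof cases
        case 1
        then have "\<bar>u x - u y\<bar> \<le> 2 * \<eta>" "\<bar>u (cl x) - u (cl y)\<bar> \<le> \<eta>" using xy by (auto intro!: N4 clN cl2)
        then show ?thesis unfolding b_def by linarith
      next
        case 2
        then have "b x = 0" by (simp add: b_def cl1)
        then show ?thesis using half[OF 2 xy(1)] \<eta> by simp
      next
        case 3
        then have "b y = 0" by (simp add: b_def cl1)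
        then show ?thesis using half[OF 3(2,1) xy(2)] \<eta> by simp
      qed (use \<eta> in \<open>simp add: b_def cl1\<close>)
    qed
    have oscb: "osc_le b S (3 * \<eta>)" if "S \<in> sets borel" "S \<subseteq> ring p" "0 < p" for S p
    proof (rule osc_le_bounded[where c = "b p"])
      fix x assume "x \<in> S"
      then have "p \<le> \<bar>x\<bar>" "\<bar>x\<bar> \<le> 4 * p" using that by (auto simp: ring_def)
      then show "\<bar>b x - b p\<bar> \<le> 3 * \<eta>" using that by (intro b_ring) auto
    qed (use that \<eta> bounded_subset[OF bounded_ring] in auto)
    have "shell_osc b (3 * \<eta>)"
      unfolding shell_osc_def
    proof (intro conjI allI impI)
      fix p q :: real assume pq: "0 < p \<and> p < q \<and> q \<le> 4 * p"
      show "osc_le b {p..q} (3 * \<eta>)" "osc_le b {-q..-p} (3 * \<eta>)"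
        by (rule oscb[of _ p]; use pq in \<open>auto simp: ring_def\<close>)+
    qed (auto intro!: oscb)
    then have bb: "osc_le b {p..q} (36 * (3 * \<eta>))" if "p < q" for p q
      using \<eta> that by (intro bmo_if_shell) auto
    define v where "v x = u (cl x) - u N" for x
    define g where "g x = v x - max (- \<eta>) (min \<eta> (v x))" for x
    have "g x = 0" if "N \<le> \<bar>x\<bar>" for x
    proof -
      have "\<bar>v x\<bar> \<le> \<eta>" unfolding v_def using N(1) cl2[OF that] by (intro clN) auto
      then show ?thesis by (auto simp: g_def)
    qed
    moreover have contg: "continuous_on UNIV g"
      unfolding g_def [abs_def] v_def by (intro continuous_intros cont_cl)
    moreover have "bmo_le (\<lambda>x. u x - g x) \<epsilon>"
      unfolding bmo_le_def
    proof (intro allI impI)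
      fix p q :: real assume pq: "p < q"
      have [measurable]: "g \<in> borel_measurable borel" using contg by (rule borel_measurable_continuous_onI)
      have "osc_le (\<lambda>x. u (cl x) - g x) {p..q} \<eta>"
        by (rule osc_le_bounded[where c = "u N"]) (use \<eta> in \<open>auto simp: g_def v_def\<close>)
      then have "osc_le (\<lambda>x. b x + (u (cl x) - g x)) {p..q} (36 * (3 * \<eta>) + \<eta>)"
        using \<eta> by (intro osc_le_add bb pq) auto
      then have "osc_le (\<lambda>x. u x - g x) {p..q} (36 * (3 * \<eta>) + \<eta>)" by (simp add: b_def)
      then show "osc_le (\<lambda>x. u x - g x) {p..q} \<epsilon>" by (rule osc_le_mono) (use \<epsilon> in \<open>simp add: \<eta>_def\<close>)
    qed
    ultimately show ?thesis by blast
  qed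
  obtain g N where g: "continuous_on UNIV g" "\<And>x. N \<le> \<bar>x\<bar> \<Longrightarrow> g x = 0" "bmo_le (\<lambda>x. u x - g x) 1"
    using approx[of 1] by auto
  obtain M where M: "0 \<le> M" "bmo_le g M" using bmo_le_compact_support[OF g(1,2)] by metis
  have [measurable]: "g \<in> borel_measurable borel" using g(1) by (rule borel_measurable_continuous_onI)
  have "osc_le (\<lambda>x. (u x - g x) + g x) {a..b} (1 + M)" if "a < b" for a b
    using g(3) M that unfolding bmo_le_def by (intro osc_le_add) auto
  then have "bmo_le u (1 + M)" by (simp add: bmo_le_def)
  then show ?thesis using approx M(1) unfolding cmo_line_def by (intro conjI exI[of _ "1 + M"]) auto
qed

lemma cmo_line_combine:
  assumes [measurable]: "f \<in> borel_measurable borel" "u \<in> borel_measurable borel" and f: "cmo_line f" and u: "cmo_line u"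
  shows "cmo_line (\<lambda>x. f x + u x)"
  unfolding cmo_line_def
proof (intro conjI allI impI)
  obtain e e' where e: "0 \<le> e" "bmo_le f e" "0 \<le> e'" "bmo_le u e'" using f u by (auto simp: cmo_line_def)
  then have "bmo_le (\<lambda>x. f x + u x) (e + e')" unfolding bmo_le_def by (auto intro!: osc_le_add)
  then show "\<exists>e\<ge>0. bmo_le (\<lambda>x. f x + u x) e" using e by (intro exI[of _ "e + e'"]) auto
  fix \<epsilon> :: real assume \<epsilon>: "0 < \<epsilon>"
  obtain g N where g: "continuous_on UNIV g" "\<And>x. N \<le> \<bar>x\<bar> \<Longrightarrow> g x = 0" "bmo_le (\<lambda>x. f x - g x) (\<epsilon> / 2)"
    using f[unfolded cmo_line_def, THEN conjunct2, rule_format, of "\<epsilon> / 2"] \<epsilon> by auto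
  obtain g' N' where g': "continuous_on UNIV g'" "\<And>x. N' \<le> \<bar>x\<bar> \<Longrightarrow> g' x = 0" "bmo_le (\<lambda>x. u x - g' x) (\<epsilon> / 2)"
    using u[unfolded cmo_line_def, THEN conjunct2, rule_format, of "\<epsilon> / 2"] \<epsilon> by auto
  have [measurable]: "g \<in> borel_measurable borel" "g' \<in> borel_measurable borel"
    using g(1) g'(1) by (auto intro: borel_measurable_continuous_onI)
  have "osc_le (\<lambda>x. (f x - g x) + (u x - g' x)) {a..b} (\<epsilon> / 2 + \<epsilon> / 2)" if "a < b" for a b
    using g(3) g'(3) that \<epsilon> unfolding bmo_le_def by (intro osc_le_add) auto
  then have "bmo_le (\<lambda>x. f x + u x - (g x + g' x)) \<epsilon>" by (simp add: bmo_le_def algebra_simps)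
  moreover have "continuous_on UNIV (\<lambda>x. g x + g' x)" using g(1) g'(1) by (rule continuous_on_add)
  moreover have "g x + g' x = 0" if "max N N' \<le> \<bar>x\<bar>" for x using that g(2) g'(2) by simp
  ultimately show "\<exists>g N. continuous_on UNIV g \<and> (\<forall>x. N \<le> \<bar>x\<bar> \<longrightarrow> g x = 0) \<and> bmo_le (\<lambda>x. f x + u x - g x) \<epsilon>"
    by blast
qed

lemma cmo_line_uminus:
  assumes "cmo_line f"
  shows "cmo_line (\<lambda>x. - f x)"
proof -
  have minus: "bmo_le (\<lambda>x. - f x) e" if "bmo_le f e" for f e
    using that osc_le_uminus unfolding bmo_le_def by blast
  show ?thesis
    unfolding cmo_line_def
  proof (intro conjI allI impI)
    show "\<exists>e\<ge>0. bmo_le (\<lambda>x. - f x) e" using assms minus unfolding cmo_line_def by blast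
    fix \<epsilon> :: real assume "0 < \<epsilon>"
    then obtain g N where g: "continuous_on UNIV g" "\<forall>x. N \<le> \<bar>x\<bar> \<longrightarrow> g x = 0" "bmo_le (\<lambda>x. f x - g x) \<epsilon>"
      using assms unfolding cmo_line_def by blast
    have "bmo_le (\<lambda>x. - f x - (- g x)) \<epsilon>" using minus[OF g(3)] by (simp add: algebra_simps)
    moreover have "continuous_on UNIV (\<lambda>x. - g x)" using g(1) by (rule continuous_on_minus)
    ultimately show "\<exists>g N. continuous_on UNIV g \<and> (\<forall>x. N \<le> \<bar>x\<bar> \<longrightarrow> g x = 0) \<and> bmo_le (\<lambda>x. - f x - g x) \<epsilon>"
      using g(2) by (intro exI[of _ "\<lambda>x. - g x"] exI[of _ N]) auto
  qed
qed

text \<open>A bounded function with compact support contributes a fixed amount to the deviation,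
  which is negligible against the length of a large ball.\<close>

lemma cmo_line_large:
  assumes [measurable]: "f \<in> borel_measurable borel" and f: "cmo_line f" and \<epsilon>: "0 < \<epsilon>"
  obtains R where "0 < R" "\<And>r. R \<le> r \<Longrightarrow> osc_le f {-r..r} \<epsilon>"
proof -
  obtain g N where g: "continuous_on UNIV g" "\<And>x. N \<le> \<bar>x\<bar> \<Longrightarrow> g x = 0" "bmo_le (\<lambda>x. f x - g x) (\<epsilon> / 2)"
    using f[unfolded cmo_line_def, THEN conjunct2, rule_format, of "\<epsilon> / 2"] \<epsilon> by auto
  obtain M where M: "0 \<le> M" "\<And>x. \<bar>g x\<bar> \<le> M" using bmo_le_compact_support[OF g(1,2)] by metis
  have [measurable]: "g \<in> borel_measurable borel" using g(1) by (rule borel_measurable_continuous_onI)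
  define R where "R = max 1 (2 * M * \<bar>N\<bar> / \<epsilon>)"
  show ?thesis
  proof (rule that[of R])
    show "0 < R" by (simp add: R_def)
    fix r assume "R \<le> r"
    then have r: "0 < r" "2 * M * \<bar>N\<bar> / \<epsilon> \<le> r" by (auto simp: R_def)
    have "deviation g {-r..r} 0 \<le> (\<integral>\<^sup>+x\<in>{- \<bar>N\<bar>..\<bar>N\<bar>}. ennreal M \<partial>lborel)"
      unfolding deviation_def
    proof (intro nn_integral_mono)
      fix x show "ennreal \<bar>g x - 0\<bar> * indicator {-r..r} x \<le> ennreal M * indicator {- \<bar>N\<bar>..\<bar>N\<bar>} x"
      proof (cases "x \<in> {- \<bar>N\<bar>..\<bar>N\<bar>}")
        case True
        then show ?thesis using M(2)[of x] by (auto simp: indicator_def intro!: ennreal_leI)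
      next
        case False
        then have "\<not> \<bar>x\<bar> \<le> \<bar>N\<bar>" by (auto simp: abs_le_iff)
        then have "g x = 0" using g(2)[of x] by simp
        then show ?thesis by simp
      qed
    qed
    also have "\<dots> = ennreal (M * (2 * \<bar>N\<bar>))"
      using nn_integral_const_bounded[of "{- \<bar>N\<bar>..\<bar>N\<bar>}" M] M(1) by simp
    also have "\<dots> \<le> ennreal (\<epsilon> / 2 * (2 * r))"
      using r \<epsilon> by (intro ennreal_leI) (simp add: field_simps)
    finally have "osc_le g {-r..r} (\<epsilon> / 2)" using r by (auto simp: osc_le_def)
    moreover have "osc_le (\<lambda>x. f x - g x) {-r..r} (\<epsilon> / 2)" using g(3) r by (simp add: bmo_le_def)
    ultimately have "osc_le (\<lambda>x. (f x - g x) + g x) {-r..r} (\<epsilon> / 2 + \<epsilon> / 2)" using \<epsilon> by (intro osc_le_add) auto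
    then show "osc_le f {-r..r} \<epsilon>" by simp
  qed
qed

section \<open>The correction term between the two logarithmic derivatives\<close>

definition cayley_factor :: "(real \<Rightarrow> real) \<Rightarrow> real \<Rightarrow> real" where
  "cayley_factor h x = ln (1 + x\<^sup>2) - ln (1 + (h x)\<^sup>2)"

lemma one_plus_square_pos: "0 < 1 + (x::real)\<^sup>2"
  by (rule add_pos_nonneg) auto

lemma continuous_cayley_factor: "line_homeo h \<Longrightarrow> continuous_on UNIV (cayley_factor h)"
  unfolding cayley_factor_def [abs_def]
  by (intro continuous_intros line_homeo_continuous) (simp_all add: one_plus_square_pos less_imp_neq[symmetric] add_nonneg_eq_0_iff)

lemma line_homeo_at_infinity:
  assumes h: "line_homeo h"
  shows "filterlim h at_infinity at_infinity"
proof (subst filterlim_at_infinity[OF order_refl], intro allI impI)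
  fix B :: real assume B: "0 < B"
  have s: "h (inv h y) = y" for y using h by (simp add: line_homeo_def surj_f_inv_f)
  define N where "N = max \<bar>inv h B\<bar> \<bar>inv h (- B)\<bar>"
  have "B \<le> \<bar>h x\<bar>" if "N \<le> \<bar>x\<bar>" for x
  proof (cases "0 \<le> x")
    case True
    then have "inv h B \<le> x" using that by (auto simp: N_def)
    then have "B \<le> h x" using line_homeo_le_iff[OF h, of "inv h B" x] s by simp
    then show ?thesis by simp
  next
    case False
    then have "x \<le> inv h (- B)" using that by (auto simp: N_def)
    then have "h x \<le> - B" using line_homeo_le_iff[OF h, of x "inv h (- B)"] s by simp
    then show ?thesis by simp
  qed
  then show "\<forall>\<^sub>F x in at_infinity. B \<le> norm (h x)" by (auto simp: eventually_at_infinity)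
qed

text \<open>Near infinity \<open>1 + y\<^sup>2\<close> may be replaced by
  \<open>(y - k)\<^sup>2\<close>. This turns \<open>cayley_factor h\<close> into \<open>-2\<close>
  times the logarithm of a difference quotient of \<open>h\<close>.\<close>

lemma tendsto_log_quotient:
  "((\<lambda>y. ln ((1 + y\<^sup>2) / (y - k)\<^sup>2)) \<longlongrightarrow> 0) (at_infinity :: real filter)"
proof -
  have inv: "((\<lambda>y. inverse y) \<longlongrightarrow> 0) (at_infinity :: real filter)" by (rule tendsto_inverse_0)
  have "((\<lambda>y. ln (((inverse y)\<^sup>2 + 1) / (1 - k * inverse y)\<^sup>2)) \<longlongrightarrow> ln ((0\<^sup>2 + 1) / (1 - k * 0)\<^sup>2)) (at_infinity :: real filter)"
    by (intro tendsto_intros inv) auto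
  moreover have "\<forall>\<^sub>F y in (at_infinity :: real filter). ln (((inverse y)\<^sup>2 + 1) / (1 - k * inverse y)\<^sup>2) = ln ((1 + y\<^sup>2) / (y - k)\<^sup>2)"
  proof -
    have "((inverse y)\<^sup>2 + 1) / (1 - k * inverse y)\<^sup>2 = (1 + y\<^sup>2) / (y - k)\<^sup>2" if "1 \<le> \<bar>y\<bar>" for y :: real
    proof -
      have y: "y \<noteq> 0" using that by auto
      have "(inverse y)\<^sup>2 + 1 = (1 + y\<^sup>2) / y\<^sup>2" "(1 - k * inverse y)\<^sup>2 = (y - k)\<^sup>2 / y\<^sup>2"
        using y by (simp_all add: field_simps power2_eq_square)
      then show ?thesis using y by simp
    qed
    then show ?thesis unfolding eventually_at_infinity by (intro exI[of _ 1]) auto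
  qed
  ultimately show ?thesis using tendsto_cong by force
qed

text \<open>The counterpart on the circle: \<open>2 * arctan (nrecip y)\<close> is the angle of
  \<open>y\<close> measured from the point at infinity, so \<open>1 + y\<^sup>2\<close> is
  comparable to 4 over its square.\<close>

lemma tendsto_log_arctan:
  "((\<lambda>y. ln ((1 + y\<^sup>2) * (arctan (nrecip y))\<^sup>2)) \<longlongrightarrow> 0) (at_infinity :: real filter)"
proof -
  have inv: "((\<lambda>y. inverse y) \<longlongrightarrow> 0) (at_infinity :: real filter)" by (rule tendsto_inverse_0)
  have "((\<lambda>z. arctan z / z) \<longlongrightarrow> 1) (at (0::real))"
    using DERIV_arctan[of 0] by (simp add: DERIV_def)
  moreover have "filterlim (\<lambda>y::real. inverse y) (at 0) at_infinity"
    unfolding filterlim_at using inv by (auto simp: eventually_at_infinity intro!: exI[of _ 1])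
  ultimately have q: "((\<lambda>y. arctan (inverse y) / inverse y) \<longlongrightarrow> 1) (at_infinity :: real filter)"
    by (rule filterlim_compose)
  have "((\<lambda>y. ln (((inverse y)\<^sup>2 + 1) * (arctan (inverse y) / inverse y)\<^sup>2)) \<longlongrightarrow> ln ((0\<^sup>2 + 1) * 1\<^sup>2)) (at_infinity :: real filter)"
    by (intro tendsto_intros inv q) auto
  moreover have "\<forall>\<^sub>F y in (at_infinity :: real filter). ln (((inverse y)\<^sup>2 + 1) * (arctan (inverse y) / inverse y)\<^sup>2) = ln ((1 + y\<^sup>2) * (arctan (nrecip y))\<^sup>2)"
  proof -
    have "((inverse y)\<^sup>2 + 1) * (arctan (inverse y) / inverse y)\<^sup>2 = (1 + y\<^sup>2) * (arctan (nrecip y))\<^sup>2" if "1 \<le> \<bar>y\<bar>" for y :: real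
    proof -
      have y: "y \<noteq> 0" using that by auto
      have "(inverse y)\<^sup>2 + 1 = (1 + y\<^sup>2) / y\<^sup>2" "(arctan (inverse y) / inverse y)\<^sup>2 = (arctan (inverse y))\<^sup>2 * y\<^sup>2"
        using y by (simp_all add: field_simps power2_eq_square)
      then show ?thesis using y by (simp add: nrecip_def arctan_minus)
    qed
    then show ?thesis unfolding eventually_at_infinity by (intro exI[of _ 1]) auto
  qed
  ultimately show ?thesis using tendsto_cong by force
qed

text \<open>Up to a vanishing error the correction is \<open>- 2 * Q x\<close>, with
  \<open>Q\<close> the logarithmic difference quotient of \<open>h\<close> at 0. Over large balls
  around 0 the function \<open>F\<close> oscillates little, so \<open>slow_quotient\<close> applies
  at scale \<open>2 * \<bar>x\<bar>\<close>.\<close>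

lemma slow_cayley_factor_line:
  assumes h: "line_homeo h" and sqs: "sqs_line h"
    and w: "w \<in> borel_measurable borel" "F \<in> borel_measurable borel"
    and dens: "\<And>A. A \<in> sets borel \<Longrightarrow> emeasure lborel (h ` A) = (\<integral>\<^sup>+x\<in>A. ennreal (w x) \<partial>lborel)"
    and wF: "AE x in lborel. w x = exp (F x)" and cmo: "cmo_line F"
  shows "slow (cayley_factor h)"
proof -
  define Q where "Q x = ln ((h x - h 0) / x)" for x
  define E where "E x = cayley_factor h x + 2 * Q x" for x
  obtain C \<kappa> where C: "0 < C" "0 < \<kappa>" "\<And>a b. a < b \<Longrightarrow> sqs_on h C \<kappa> a b" using sqs by (auto simp: sqs_line_def)
  have "slow (\<lambda>x. - 2 * Q x)"
    unfolding slow_def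
  proof (intro allI impI)
    fix \<eta> :: real assume \<eta>: "0 < \<eta>"
    obtain \<epsilon> where \<epsilon>: "0 < \<epsilon>" and near: "\<And>r x y. 0 < r \<Longrightarrow> r / 2 \<le> \<bar>x\<bar> \<Longrightarrow> \<bar>x\<bar> \<le> r \<Longrightarrow> r / 2 \<le> \<bar>y\<bar> \<Longrightarrow> \<bar>y\<bar> \<le> r \<Longrightarrow>
        (\<And>a b. a < b \<Longrightarrow> b - a \<le> r \<Longrightarrow> sqs_on h C \<kappa> a b) \<Longrightarrow> osc_le F {-r..r} \<epsilon> \<Longrightarrow>
        \<bar>ln ((h x - h 0) / x) - ln ((h y - h 0) / y)\<bar> \<le> \<eta> / 2"
      using slow_quotient[OF h C(1,2), of "\<eta> / 2", OF _ w dens wF] \<eta> by (metis half_gt_zero)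
    obtain R where R: "0 < R" "\<And>r. R \<le> r \<Longrightarrow> osc_le F {-r..r} \<epsilon>" using cmo_line_large[OF w(2) cmo \<epsilon>] by metis
    have "\<bar>- 2 * Q x - - 2 * Q y\<bar> \<le> \<eta>" if "R \<le> \<bar>x\<bar>" "\<bar>x\<bar> \<le> \<bar>y\<bar>" "\<bar>y\<bar> \<le> 2 * \<bar>x\<bar>" for x y
    proof -
      have "\<bar>Q x - Q y\<bar> \<le> \<eta> / 2" unfolding Q_def
        by (rule near[of "2 * \<bar>x\<bar>"]) (use that R C in auto)
      then show ?thesis by linarith
    qed
    then show "\<exists>N. \<forall>x y. N \<le> \<bar>x\<bar> \<and> \<bar>x\<bar> \<le> \<bar>y\<bar> \<and> \<bar>y\<bar> \<le> 2 * \<bar>x\<bar> \<longrightarrow> \<bar>- 2 * Q x - - 2 * Q y\<bar> \<le> \<eta>" by blast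
  qed
  moreover have "(E \<longlongrightarrow> 0) at_infinity"
  proof -
    have "((\<lambda>x. ln ((1 + x\<^sup>2) / (x - 0)\<^sup>2) - ln ((1 + (h x)\<^sup>2) / (h x - h 0)\<^sup>2)) \<longlongrightarrow> 0 - 0) at_infinity"
      by (intro tendsto_diff tendsto_log_quotient filterlim_compose[OF tendsto_log_quotient line_homeo_at_infinity[OF h]])
    moreover have "\<forall>\<^sub>F x in at_infinity. ln ((1 + x\<^sup>2) / (x - 0)\<^sup>2) - ln ((1 + (h x)\<^sup>2) / (h x - h 0)\<^sup>2) = E x"
    proof -
      have "ln ((1 + x\<^sup>2) / (x - 0)\<^sup>2) - ln ((1 + (h x)\<^sup>2) / (h x - h 0)\<^sup>2) = E x" if "1 \<le> \<bar>x\<bar>" for x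
      proof -
        have x: "x \<noteq> 0" using that by auto
        then have hx: "h x - h 0 \<noteq> 0" using line_homeo_inj[OF h, of UNIV] by (auto dest: injD)
        have "0 < (h x - h 0) / x"
          using line_homeo_less_iff[OF h, of x 0] line_homeo_less_iff[OF h, of 0 x] x
          by (cases "0 < x") (auto simp: divide_neg_neg)
        then have "2 * Q x = ln (((h x - h 0) / x)\<^sup>2)" by (simp add: Q_def ln_realpow)
        also have "\<dots> = ln ((h x - h 0)\<^sup>2) - ln (x\<^sup>2)" using x hx by (simp add: power_divide ln_div)
        finally show ?thesis using x hx one_plus_square_pos[of x] one_plus_square_pos[of "h x"]
          by (simp add: E_def cayley_factor_def ln_div)
      qed
      then show ?thesis unfolding eventually_at_infinity by (intro exI[of _ 1]) auto
    qed
    ultimately show ?thesis using tendsto_cong by force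
  qed
  ultimately have "slow (\<lambda>x. - 2 * Q x + E x)" by (rule slow_add_vanishing)
  moreover have "- 2 * Q x + E x = cayley_factor h x" for x by (simp add: E_def)
  ultimately show ?thesis by simp
qed

text \<open>For equal signs of \<open>x\<close> and \<open>h x\<close> the angle jumps by the same
  multiple of \<open>pi\<close> on both sides, so the shifts cancel.\<close>

lemma lift_near_0:
  assumes "0 < x * h x"
  shows "lift h (2 * arctan (nrecip x)) = 2 * arctan (nrecip (h x))"
proof (cases "0 < x")
  case True
  then have hx: "0 < h x" using assms by (simp add: zero_less_mult_iff)
  have "2 * arctan (nrecip x) + 2 * pi * of_int 1 = pi + 2 * arctan x" using two_arctan_nrecip(1)[OF True] by simp
  then have "lift h (2 * arctan (nrecip x)) + 2 * pi * of_int 1 = pi + 2 * arctan (h x)"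
    by (metis lift_periodic lift_arctan)
  then show ?thesis using two_arctan_nrecip(1)[OF hx] by simp
next
  case False
  then have x: "x < 0" "h x < 0" using assms by (auto simp: zero_less_mult_iff)
  have "2 * arctan (nrecip x) = pi + 2 * arctan x" using two_arctan_nrecip(2)[OF x(1)] by simp
  then have "lift h (2 * arctan (nrecip x)) = pi + 2 * arctan (h x)" by (simp only: lift_arctan)
  then show ?thesis using two_arctan_nrecip(2)[OF x(2)] by simp
qed

text \<open>This is needed so that doubling \<open>\<bar>x\<bar>\<close> at most halves the angle of
  \<open>x\<close> measured from infinity. The double angle formula gives it.\<close>

lemma arctan_half:
  assumes "0 \<le> z" "z < 2"
  shows "arctan z \<le> 2 * arctan (z / 2)"
proof -
  define y where "y = z / 2"
  have y: "0 \<le> y" "y < 1" "z = 2 * y" using assms by (auto simp: y_def)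
  have "y\<^sup>2 < 1" using y by (simp add: power_less_one_iff abs_square_less_1)
  then have "2 * y \<le> 2 * y / (1 - y\<^sup>2)" using y by (simp add: pos_le_divide_eq mult_left_le algebra_simps)
  then have "arctan (2 * y) \<le> arctan (2 * y / (1 - y\<^sup>2))" by (simp only: arctan_le_iff)
  also have "\<dots> = 2 * arctan y" using arctan_double[of y] y by simp
  finally show ?thesis by (simp add: y_def)
qed

text \<open>On the circle the point at infinity has angle 0, and up to a vanishing error the
  correction is \<open>2 * Q x\<close>, with \<open>Q\<close> the logarithmic difference quotient of
  the lift at 0. Vanishing mean oscillation on short intervals around 0 takes the place of large
  balls.\<close>

lemma slow_cayley_factor_circ:
  assumes h: "line_homeo h" and sqs: "sqs_circ (lift h)"
    and w: "w \<in> borel_measurable borel" "F \<in> borel_measurable borel"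
    and dens: "\<And>A. A \<in> sets borel \<Longrightarrow> emeasure lborel (lift h ` A) = (\<integral>\<^sup>+x\<in>A. ennreal (w x) \<partial>lborel)"
    and wF: "AE x in lborel. w x = exp (F x)" and vmo: "vmo_circ F"
  shows "slow (cayley_factor h)"
proof -
  define Q where "Q x = ln (arctan (nrecip (h x)) / arctan (nrecip x))" for x
  define E where "E x = cayley_factor h x - 2 * Q x" for x
  obtain C \<kappa> where C: "0 < C" "0 < \<kappa>" "\<And>a b. a < b \<Longrightarrow> b - a \<le> 2 * pi \<Longrightarrow> sqs_on (lift h) C \<kappa> a b"
    using sqs by (auto simp: sqs_circ_def)
  have "\<forall>\<^sub>F x in at_infinity. max 1 (\<bar>h 0\<bar> + 1) \<le> norm (h x)"
    using line_homeo_at_infinity[OF h] by (subst (asm) filterlim_at_infinity[OF order_refl]) auto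
  then obtain N0 where N0: "\<And>x. N0 \<le> \<bar>x\<bar> \<Longrightarrow> \<bar>h 0\<bar> + 1 \<le> \<bar>h x\<bar>"
    by (auto simp: eventually_at_infinity)
  have sgn: "0 < x * h x" if "N0 \<le> \<bar>x\<bar>" "x \<noteq> 0" for x
  proof (cases "0 < x")
    case True
    then have "h 0 < h x" by (simp add: line_homeo_less_iff[OF h])
    then have "0 < h x" using N0[OF that(1)] by linarith
    then show ?thesis using True by simp
  next
    case False
    then have "x < 0" using that by simp
    then have "h x < h 0" by (simp add: line_homeo_less_iff[OF h])
    then have "h x < 0" using N0[OF that(1)] by linarith
    then show ?thesis using \<open>x < 0\<close> by (simp add: mult_neg_neg)
  qed
  have "slow (\<lambda>x. 2 * Q x)"
    unfolding slow_def
  proof (intro allI impI)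
    fix \<eta> :: real assume \<eta>: "0 < \<eta>"
    obtain \<epsilon> where \<epsilon>: "0 < \<epsilon>" and near: "\<And>r x y. 0 < r \<Longrightarrow> r / 2 \<le> \<bar>x\<bar> \<Longrightarrow> \<bar>x\<bar> \<le> r \<Longrightarrow> r / 2 \<le> \<bar>y\<bar> \<Longrightarrow> \<bar>y\<bar> \<le> r \<Longrightarrow>
        (\<And>a b. a < b \<Longrightarrow> b - a \<le> r \<Longrightarrow> sqs_on (lift h) C \<kappa> a b) \<Longrightarrow> osc_le F {-r..r} \<epsilon> \<Longrightarrow>
        \<bar>ln ((lift h x - lift h 0) / x) - ln ((lift h y - lift h 0) / y)\<bar> \<le> \<eta> / 2"
      using slow_quotient[OF line_homeo_lift[OF h] C(1,2), of "\<eta> / 2", OF _ w dens wF] \<eta> by (metis half_gt_zero)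
    obtain \<delta> where \<delta>: "0 < \<delta>" "\<And>a b. a < b \<Longrightarrow> b - a < \<delta> \<Longrightarrow> osc_le F {a..b} \<epsilon>"
      using vmo[unfolded vmo_circ_def, THEN conjunct2, rule_format, OF \<epsilon>] by auto
    \<comment> \<open>Beyond \<open>N0\<close> the signs of \<open>x\<close> and \<open>h x\<close>
      agree; the bound \<open>4 / \<delta>\<close> makes the window \<open>{-r..r}\<close> shorter
      than \<open>\<delta>\<close>.\<close>
    define N where "N = Max {1, N0, 4 / \<delta> + 1}"
    have N: "1 \<le> N" "N0 \<le> N" "4 / \<delta> < N" by (auto simp: N_def less_max_iff_disj)
    have "\<bar>2 * Q x - 2 * Q y\<bar> \<le> \<eta>" if xy: "N \<le> \<bar>x\<bar>" "\<bar>x\<bar> \<le> \<bar>y\<bar>" "\<bar>y\<bar> \<le> 2 * \<bar>x\<bar>" for x y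
    proof -
      define r where "r = 2 * arctan (inverse \<bar>x\<bar>)"
      have abs: "\<bar>2 * arctan (nrecip z)\<bar> = 2 * arctan (inverse \<bar>z\<bar>)" for z :: real
        by (cases "z < 0") (simp_all add: nrecip_def arctan_minus abs_mult abs_if)
      have x0: "x \<noteq> 0" "y \<noteq> 0" "0 < \<bar>x\<bar>" "0 < \<bar>y\<bar>" using xy N by auto
      have q: "ln ((lift h (2 * arctan (nrecip z)) - lift h 0) / (2 * arctan (nrecip z))) = Q z" if "N \<le> \<bar>z\<bar>" "z \<noteq> 0" for z
        using sgn[of z] that N(2) by (simp add: lift_near_0 Q_def)
      have "inverse \<bar>y\<bar> \<le> inverse \<bar>x\<bar>" using xy x0 by (intro le_imp_inverse_le) auto
      then have 1: "\<bar>2 * arctan (nrecip y)\<bar> \<le> r" unfolding abs r_def by (simp add: arctan_le_iff)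
      have i1: "inverse \<bar>x\<bar> \<le> 1" using xy N x0 by (simp add: inverse_le_1_iff)
      have "arctan (inverse \<bar>x\<bar>) \<le> 2 * arctan (inverse \<bar>x\<bar> / 2)" using x0 i1 by (intro arctan_half) auto
      moreover have "inverse \<bar>x\<bar> / 2 \<le> inverse \<bar>y\<bar>"
      proof -
        have "inverse (2 * \<bar>x\<bar>) \<le> inverse \<bar>y\<bar>" using xy x0 by (intro le_imp_inverse_le) auto
        then show ?thesis by simp
      qed
      then have "arctan (inverse \<bar>x\<bar> / 2) \<le> arctan (inverse \<bar>y\<bar>)" by (simp only: arctan_le_iff)
      ultimately have 2: "r / 2 \<le> \<bar>2 * arctan (nrecip y)\<bar>" unfolding abs r_def by simp
      have r: "0 < r" unfolding r_def using x0 by simp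
      have "r \<le> 2 * inverse \<bar>x\<bar>" unfolding r_def using abs_arctan_le[of "inverse \<bar>x\<bar>"] by simp
      moreover have "4 * inverse \<bar>x\<bar> < \<delta>"
      proof -
        have "4 < N * \<delta>" using N(3) \<delta>(1) by (simp add: pos_divide_less_eq)
        also have "\<dots> \<le> \<bar>x\<bar> * \<delta>" using xy \<delta> by (intro mult_right_mono) auto
        finally show ?thesis using x0 by (simp add: field_simps)
      qed
      ultimately have osc: "osc_le F {-r..r} \<epsilon>" using r by (intro \<delta>(2)) auto
      have "\<bar>Q x - Q y\<bar> \<le> \<eta> / 2"
      proof -
        have "r \<le> 2 * pi" unfolding r_def using arctan_ubound[of "inverse \<bar>x\<bar>"] pi_gt_zero by linarith
        then have "\<bar>ln ((lift h (2 * arctan (nrecip x)) - lift h 0) / (2 * arctan (nrecip x)))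
            - ln ((lift h (2 * arctan (nrecip y)) - lift h 0) / (2 * arctan (nrecip y)))\<bar> \<le> \<eta> / 2"
          using r 1 2 osc by (intro near[of r] C(3)) (auto simp: abs[of x] r_def)
        moreover have "N \<le> \<bar>y\<bar>" using xy by linarith
        ultimately show ?thesis using q[OF xy(1) x0(1)] q[of y] x0(2) by simp
      qed
      then show ?thesis by linarith
    qed
    then show "\<exists>N. \<forall>x y. N \<le> \<bar>x\<bar> \<and> \<bar>x\<bar> \<le> \<bar>y\<bar> \<and> \<bar>y\<bar> \<le> 2 * \<bar>x\<bar> \<longrightarrow> \<bar>2 * Q x - 2 * Q y\<bar> \<le> \<eta>" by blast
  qed
  moreover have "(E \<longlongrightarrow> 0) at_infinity"
  proof -
    have "((\<lambda>x. ln ((1 + x\<^sup>2) * (arctan (nrecip x))\<^sup>2) - ln ((1 + (h x)\<^sup>2) * (arctan (nrecip (h x)))\<^sup>2)) \<longlongrightarrow> 0 - 0) at_infinity"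
      by (intro tendsto_diff tendsto_log_arctan filterlim_compose[OF tendsto_log_arctan line_homeo_at_infinity[OF h]])
    moreover have "\<forall>\<^sub>F x in at_infinity. ln ((1 + x\<^sup>2) * (arctan (nrecip x))\<^sup>2) - ln ((1 + (h x)\<^sup>2) * (arctan (nrecip (h x)))\<^sup>2) = E x"
    proof -
      have "ln ((1 + x\<^sup>2) * (arctan (nrecip x))\<^sup>2) - ln ((1 + (h x)\<^sup>2) * (arctan (nrecip (h x)))\<^sup>2) = E x" if x: "max 1 N0 \<le> \<bar>x\<bar>" for x
      proof -
        have x0: "x \<noteq> 0" using x by auto
        have s: "0 < x * h x" using x x0 by (intro sgn) auto
        then have hx0: "h x \<noteq> 0" by auto
        have a0: "arctan (nrecip x) \<noteq> 0" "arctan (nrecip (h x)) \<noteq> 0" using x0 hx0 by (auto simp: nrecip_def)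
        have "0 < arctan (nrecip (h x)) / arctan (nrecip x)"
          using s by (auto simp: zero_less_mult_iff zero_less_divide_iff nrecip_def arctan_minus)
        then have "2 * Q x = ln ((arctan (nrecip (h x)) / arctan (nrecip x))\<^sup>2)" by (simp add: Q_def ln_realpow)
        also have "\<dots> = ln ((arctan (nrecip (h x)))\<^sup>2) - ln ((arctan (nrecip x))\<^sup>2)" using a0 by (simp add: power_divide ln_div)
        finally show ?thesis using a0 one_plus_square_pos[of x] one_plus_square_pos[of "h x"]
          by (simp add: E_def cayley_factor_def ln_mult)
      qed
      then show ?thesis unfolding eventually_at_infinity by (intro exI[of _ "max 1 N0"]) auto
    qed
    ultimately show ?thesis using tendsto_cong by force
  qed
  ultimately have "slow (\<lambda>x. 2 * Q x + E x)" by (rule slow_add_vanishing)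
  moreover have "2 * Q x + E x = cayley_factor h x" for x by (simp add: E_def)
  ultimately show ?thesis by simp
qed

text \<open>Each branch of the angle is a differentiable function of the real coordinate and so
  preserves null sets. Countably many branches and the multiples of \<open>2 * pi\<close> account
  for all angles.\<close>

lemma AE_circ:
  assumes P: "AE x in lborel. P x"
  shows "AE t in lborel. P (tan ((t - pi) / 2))"
proof -
  obtain N where N: "N \<in> null_sets lborel" "{x. \<not> P x} \<subseteq> N" using P by (auto elim!: AE_E simp: null_sets_def)
  then have "negligible N" by (simp add: negligible_iff_null_sets null_sets_completionI)
  have neg1: "negligible ((\<lambda>x. 2 * pi * of_int n + (pi + 2 * arctan x)) ` N)" for n :: int
  proof (rule negligible_differentiable_image_negligible[OF order_refl \<open>negligible N\<close>])
    have "((\<lambda>x. 2 * pi * of_int n + (pi + 2 * arctan x)) has_real_derivative 2 / (1 + x\<^sup>2)) (at x within N)" for x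
      by (auto intro!: derivative_eq_intros simp: field_simps)
    then show "(\<lambda>x. 2 * pi * of_int n + (pi + 2 * arctan x)) differentiable_on N"
      unfolding differentiable_on_def real_differentiable_def by blast
  qed
  have "negligible (\<Union>(range (\<lambda>n::int. (\<lambda>x. 2 * pi * of_int n + (pi + 2 * arctan x)) ` N)))"
  proof (rule negligible_countable_Union)
    fix S assume "S \<in> range (\<lambda>n::int. (\<lambda>x. 2 * pi * of_int n + (pi + 2 * arctan x)) ` N)"
    then show "negligible S" using neg1 by blast
  qed simp
  then have "AE t in lebesgue. t \<notin> (\<Union>n::int. (\<lambda>x. 2 * pi * of_int n + (pi + 2 * arctan x)) ` N)"
    by (intro AE_not_in) (simp add: negligible_iff_null_sets)
  then have "AE t in lborel. t \<notin> (\<Union>n::int. (\<lambda>x. 2 * pi * of_int n + (pi + 2 * arctan x)) ` N)"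
    by (simp add: AE_completion_iff)
  with AE_not_2pi show ?thesis
  proof eventually_elim
    case (elim t)
    obtain n :: int and s where t: "t = 2 * pi * of_int n + s" "0 \<le> s" "s < 2 * pi" by (rule split_2pi)
    have "s \<noteq> 0" using elim(1) t by auto
    then have "arctan (tan ((s - pi) / 2)) = (s - pi) / 2" using t by (intro arctan_tan) auto
    moreover have "tan ((t - pi) / 2) = tan ((s - pi) / 2)"
      using circ_periodic[of "\<lambda>x. x" s n] by (simp add: circ_def t(1) add.commute)
    ultimately have "t = 2 * pi * of_int n + (pi + 2 * arctan (tan ((t - pi) / 2)))" using t(1) by simp
    then have "tan ((t - pi) / 2) \<notin> N" using elim(2) by blast
    then show ?case using N(2) by blast
  qed
qed

text \<open>The logarithmic derivatives of \<open>h\<close> and of its lift differ by \<^const>\<open>cayley_factor\<close>, which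
  oscillates slowly at infinity if either of them has vanishing mean oscillation there.\<close>

lemma log_derivative_cmo_iff_vmo:
  assumes h: "line_homeo h" and sqs: "sqs_line h"
  obtains F where "F \<in> borel_measurable borel"
    "AE x in lborel. (h has_real_derivative exp (F x)) (at x)"
    "AE t in lborel. (lift h has_real_derivative exp (circ (\<lambda>x. F x + cayley_factor h x) t)) (at t)"
    "cmo_line F \<longleftrightarrow> vmo_circ (circ (\<lambda>x. F x + cayley_factor h x))"
proof -
  have sqs': "sqs_circ (lift h)" using sqs sqs_line_iff_circ[OF h] by simp
  note H = line_homeo_lift[OF h]
  obtain C \<kappa> where C: "0 < C" "0 < \<kappa>" "\<And>a b. a < b \<Longrightarrow> sqs_on h C \<kappa> a b" using sqs by (auto simp: sqs_line_def)
  obtain C' \<kappa>' where C': "0 < C'" "0 < \<kappa>'" "\<And>a b. a < b \<Longrightarrow> b - a \<le> 2 * pi \<Longrightarrow> sqs_on (lift h) C' \<kappa>' a b"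
    using sqs' by (auto simp: sqs_circ_def)
  have C'1: "sqs_on (lift h) C' \<kappa>' a b" if "a < b" "b - a \<le> 1" for a b
    using that pi_ge_two by (intro C'(3)) auto
  have ac: "emeasure lborel (h ` A) = 0" if "A \<in> null_sets lborel" for A
    by (rule sqs_null[OF h C(2) C(3) that])
  have ac': "emeasure lborel (lift h ` A) = 0" if "A \<in> null_sets lborel" for A
    by (rule sqs_null[OF H C'(2) C'1 that])
  have "\<exists>w. w \<in> borel_measurable borel \<and>
      (\<forall>A\<in>sets borel. emeasure lborel (h ` A) = (\<integral>\<^sup>+x\<in>A. ennreal (w x) \<partial>lborel)) \<and>
      (AE x in lborel. (h has_real_derivative w x) (at x))"
    by (rule line_homeo_density[OF h ac]) (assumption, intro exI conjI ballI, assumption, simp, assumption)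
  then obtain w where w [measurable]: "w \<in> borel_measurable borel" and
    dens: "\<And>A. A \<in> sets borel \<Longrightarrow> emeasure lborel (h ` A) = (\<integral>\<^sup>+x\<in>A. ennreal (w x) \<partial>lborel)" and
    der: "AE x in lborel. (h has_real_derivative w x) (at x)"
    by auto
  have "\<exists>w. w \<in> borel_measurable borel \<and>
      (\<forall>A\<in>sets borel. emeasure lborel (lift h ` A) = (\<integral>\<^sup>+x\<in>A. ennreal (w x) \<partial>lborel)) \<and>
      (AE x in lborel. (lift h has_real_derivative w x) (at x))"
    by (rule line_homeo_density[OF H ac']) (assumption, intro exI conjI ballI, assumption, simp, assumption)
  then obtain w' where w' [measurable]: "w' \<in> borel_measurable borel" and
    dens': "\<And>A. A \<in> sets borel \<Longrightarrow> emeasure lborel (lift h ` A) = (\<integral>\<^sup>+x\<in>A. ennreal (w' x) \<partial>lborel)" and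
    der': "AE x in lborel. (lift h has_real_derivative w' x) (at x)"
    by auto
  have pos: "AE x in lborel. 0 < w x" by (rule sqs_density_pos[OF h C(1,2) C(3) w dens])
  define F where "F x = ln (w x)" for x
  have F [measurable]: "F \<in> borel_measurable borel" unfolding F_def [abs_def] by measurable
  have wF: "AE x in lborel. w x = exp (F x)" using pos by eventually_elim (simp add: F_def)
  have 1: "AE x in lborel. (h has_real_derivative exp (F x)) (at x)"
    using der wF by eventually_elim simp
  let ?u = "cayley_factor h"
  have contu: "continuous_on UNIV ?u" by (rule continuous_cayley_factor[OF h])
  have u [measurable]: "?u \<in> borel_measurable borel" using contu by (rule borel_measurable_continuous_onI)
  define G where "G = circ (\<lambda>x. F x + ?u x)"
  have G [measurable]: "G \<in> borel_measurable borel" unfolding G_def by measurable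
  have 2: "AE t in lborel. (lift h has_real_derivative exp (G t)) (at t)"
    using AE_circ[OF 1] AE_not_2pi
  proof eventually_elim
    case (elim t)
    obtain n :: int and s where t: "t = 2 * pi * of_int n + s" "0 \<le> s" "s < 2 * pi" by (rule split_2pi)
    have s: "0 < s" using elim(2) t by (cases "s = 0") auto
    define x where "x = tan ((s - pi) / 2)"
    have tx: "tan ((t - pi) / 2) = x"
      using circ_periodic[of "\<lambda>x. x" s n] by (simp add: circ_def t(1) add.commute x_def)
    have "(lift h has_real_derivative exp (F x) * (1 + x\<^sup>2) / (1 + (h x)\<^sup>2)) (at s)"
      using lift_deriv_mid[OF s t(3), of h "exp (F x)"] elim(1) unfolding tx x_def by simp
    then have "(lift h has_real_derivative exp (F x) * (1 + x\<^sup>2) / (1 + (h x)\<^sup>2)) (at t)"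
      unfolding t(1) by (rule lift_deriv_shift)
    moreover have "exp (G t) = exp (F x) * (1 + x\<^sup>2) / (1 + (h x)\<^sup>2)"
      using one_plus_square_pos[of x] one_plus_square_pos[of "h x"]
      by (simp add: G_def circ_def tx cayley_factor_def exp_add exp_diff)
    ultimately show ?case by simp
  qed
  \<comment> \<open>Uniqueness of derivatives identifies the density of the lift with the chain rule
    expression, as \<open>slow_cayley_factor_circ\<close> requires.\<close>
  have wG: "AE t in lborel. w' t = exp (G t)"
    using der' 2 by eventually_elim (rule DERIV_unique)
  have "cmo_line F \<longleftrightarrow> vmo_circ G"
  proof
    assume F: "cmo_line F"
    have "slow ?u" by (rule slow_cayley_factor_line[OF h sqs w \<open>F \<in> borel_measurable borel\<close> dens wF F])
    then have "cmo_line (\<lambda>x. F x + ?u x)" by (intro cmo_line_combine cmo_line_if_slow contu F) auto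
    then show "vmo_circ G" unfolding G_def by (intro vmo_circ_if_cmo_line) auto
  next
    assume V: "vmo_circ G"
    have "slow ?u" by (rule slow_cayley_factor_circ[OF h sqs' w' G dens' wG V])
    then have "cmo_line (\<lambda>x. - ?u x)" by (intro cmo_line_uminus cmo_line_if_slow contu)
    moreover have "cmo_line (\<lambda>x. F x + ?u x)" using V unfolding G_def by (intro cmo_line_if_vmo_circ) auto
    ultimately have "cmo_line (\<lambda>x. (F x + ?u x) + - ?u x)"
      by (intro cmo_line_combine[where f = "\<lambda>x. F x + ?u x" and u = "\<lambda>x. - ?u x"]) auto
    then show "cmo_line F" by simp
  qed
  then show ?thesis using that F 1 2 unfolding G_def by blast
qed

subsection \<open>Arc length\<close>

text \<open>The mean itself lies within \<open>e\<close> of the centre \<open>c\<close>, so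
  replacing \<open>c\<close> by the mean at most doubles the bound.\<close>

lemma mean_osc_le:
  assumes I: "I \<in> sets M" "emeasure M I = ennreal m" "0 < m" and f [measurable]: "f \<in> borel_measurable M"
    and dev: "(\<integral>\<^sup>+z\<in>I. ennreal \<bar>f z - c\<bar> \<partial>M) \<le> ennreal (e * m)" and e: "0 \<le> e"
  shows "set_integrable M I f" and "mean_osc M I f \<le> 2 * e"
proof -
  note [measurable] = I(1)
  have m: "measure M I = m" using I by (simp add: measure_def)
  have eq: "ennreal (norm (indicator I z *\<^sub>R (f z - c))) = ennreal \<bar>f z - c\<bar> * indicator I z" for z
    by (auto simp: indicator_def)
  have int: "set_integrable M I (\<lambda>z. f z - c)"
    unfolding set_integrable_def
  proof (rule integrableI_bounded)
    show "(\<integral>\<^sup>+z. ennreal (norm (indicator I z *\<^sub>R (f z - c))) \<partial>M) < \<infinity>"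
      unfolding eq using dev by (auto intro: le_less_trans)
  qed measurable
  have const: "set_integrable M I (\<lambda>z. k)" for k :: real
    using I unfolding set_integrable_def by (intro integrable_scaleR_left integrable_real_indicator) auto
  have const_int: "(LINT z:I|M. k) = k * m" for k :: real
    using m sets.Int_space_eq2[OF I(1)] by (simp add: set_lebesgue_integral_def)
  have "set_integrable M I (\<lambda>z. (f z - c) + c)" by (intro set_integral_add int const)
  then show fint: "set_integrable M I f" by simp
  have absint: "set_integrable M I (\<lambda>z. \<bar>f z - k\<bar>)" for k
    by (intro set_integrable_abs set_integral_diff fint const)
  have J: "(LINT z:I|M. \<bar>f z - c\<bar>) \<le> e * m"
  proof -
    have "ennreal (LINT z:I|M. \<bar>f z - c\<bar>) = (\<integral>\<^sup>+z. ennreal (indicator I z *\<^sub>R \<bar>f z - c\<bar>) \<partial>M)"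
      unfolding set_lebesgue_integral_def using absint[of c] unfolding set_integrable_def
      by (intro nn_integral_eq_integral[symmetric]) auto
    also have "\<dots> = (\<integral>\<^sup>+z\<in>I. ennreal \<bar>f z - c\<bar> \<partial>M)"
      by (intro nn_integral_cong) (auto simp: indicator_def)
    also have "\<dots> \<le> ennreal (e * m)" by (rule dev)
    finally show ?thesis using e I(3) by simp
  qed
  have "(LINT z:I|M. f z) - c * m = (LINT z:I|M. f z - c)"
    using set_integral_diff(2)[OF fint const[of c]] const_int[of c] by simp
  moreover have "\<bar>LINT z:I|M. f z - c\<bar> \<le> (LINT z:I|M. \<bar>f z - c\<bar>)"
  proof -
    have "\<bar>LINT z:I|M. f z - c\<bar> \<le> (\<integral>z. \<bar>indicator I z *\<^sub>R (f z - c)\<bar> \<partial>M)"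
      unfolding set_lebesgue_integral_def by (rule integral_abs_bound)
    also have "\<dots> = (LINT z:I|M. \<bar>f z - c\<bar>)"
      unfolding set_lebesgue_integral_def by (intro Bochner_Integration.integral_cong) (auto simp: indicator_def)
    finally show ?thesis .
  qed
  ultimately have "\<bar>(LINT z:I|M. f z) - c * m\<bar> \<le> e * m" using J by simp
  then have "\<bar>mean_on M I f * m - c * m\<bar> \<le> e * m" using I(3) by (simp add: mean_on_def m)
  then have "\<bar>mean_on M I f - c\<bar> * m \<le> e * m" using I(3) by (simp add: left_diff_distrib[symmetric] abs_mult)
  then have mean: "\<bar>mean_on M I f - c\<bar> * m \<le> e * m" .
  have "(LINT z:I|M. \<bar>f z - mean_on M I f\<bar>) \<le> (LINT z:I|M. \<bar>f z - c\<bar> + \<bar>mean_on M I f - c\<bar>)"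
    by (intro set_integral_mono absint set_integral_add const) auto
  also have "\<dots> = (LINT z:I|M. \<bar>f z - c\<bar>) + \<bar>mean_on M I f - c\<bar> * m"
    by (subst set_integral_add(2)[OF absint const]) (simp add: const_int)
  also have "\<dots> \<le> e * m + e * m" using J mean by (rule add_mono)
  finally have "(LINT z:I|M. \<bar>f z - mean_on M I f\<bar>) \<le> (2 * e) * m" by simp
  then have "(1 / m) * (LINT z:I|M. \<bar>f z - mean_on M I f\<bar>) \<le> 2 * e"
    using I(3) by (simp add: field_simps)
  then show "mean_osc M I f \<le> 2 * e"
    unfolding mean_osc_def mean_on_def[of M I "\<lambda>x. \<bar>f x - mean_on M I f\<bar>"] m .
qed

lemma nn_integral_mean_osc:
  assumes I: "I \<in> sets M" "emeasure M I = ennreal m" "0 < m" and f: "set_integrable M I f"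
  shows "(\<integral>\<^sup>+z\<in>I. ennreal \<bar>f z - mean_on M I f\<bar> \<partial>M) = ennreal (mean_osc M I f * m)" and "0 \<le> mean_osc M I f"
proof -
  have m: "measure M I = m" using I by (simp add: measure_def)
  have const: "set_integrable M I (\<lambda>z. k)" for k :: real
    using I unfolding set_integrable_def by (intro integrable_scaleR_left integrable_real_indicator) auto
  have absint: "set_integrable M I (\<lambda>z. \<bar>f z - k\<bar>)" for k
    by (intro set_integrable_abs set_integral_diff f const)
  have osc: "mean_osc M I f = (1 / m) * (LINT z:I|M. \<bar>f z - mean_on M I f\<bar>)"
    unfolding mean_osc_def mean_on_def[of M I "\<lambda>x. \<bar>f x - mean_on M I f\<bar>"] m ..
  then have J: "(LINT z:I|M. \<bar>f z - mean_on M I f\<bar>) = mean_osc M I f * m" using I(3) by simp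
  have "(\<integral>\<^sup>+z\<in>I. ennreal \<bar>f z - mean_on M I f\<bar> \<partial>M) = (\<integral>\<^sup>+z. ennreal (indicator I z *\<^sub>R \<bar>f z - mean_on M I f\<bar>) \<partial>M)"
    by (intro nn_integral_cong) (auto simp: indicator_def)
  also have "\<dots> = ennreal (LINT z:I|M. \<bar>f z - mean_on M I f\<bar>)"
    unfolding set_lebesgue_integral_def using absint unfolding set_integrable_def
    by (intro nn_integral_eq_integral) auto
  finally show "(\<integral>\<^sup>+z\<in>I. ennreal \<bar>f z - mean_on M I f\<bar> \<partial>M) = ennreal (mean_osc M I f * m)" by (simp add: J)
  have "0 \<le> (LINT z:I|M. \<bar>f z - mean_on M I f\<bar>)"
    unfolding set_lebesgue_integral_def by (intro Bochner_Integration.integral_nonneg) auto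
  then show "0 \<le> mean_osc M I f" using I(3) by (simp add: osc)
qed

text \<open>On \<open>I\<close> the function \<open>f\<close> has the same deviations as
  \<open>f0\<close> has on the closed interval, about every centre. Line and circle, open and closed
  ends, and changes of \<open>f\<close> on null sets are all absorbed here.\<close>

definition represents :: "'a measure \<Rightarrow> 'a set \<Rightarrow> ('a \<Rightarrow> real) \<Rightarrow> (real \<Rightarrow> real) \<Rightarrow> real \<Rightarrow> real \<Rightarrow> bool" where
  "represents M I f f0 a b \<longleftrightarrow> a < b \<and> I \<in> sets M \<and> emeasure M I = ennreal (b - a) \<and> f \<in> borel_measurable M \<and>
     (\<forall>c. (\<integral>\<^sup>+z\<in>I. ennreal \<bar>f z - c\<bar> \<partial>M) = deviation f0 {a..b} c)"

lemma represents_mean_osc: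
  assumes "represents M I f f0 a b" "osc_le f0 {a..b} e" "0 \<le> e"
  shows "set_integrable M I f" "mean_osc M I f \<le> 2 * e"
proof -
  obtain c where "deviation f0 {a..b} c \<le> ennreal (e * (b - a))"
    using assms by (auto simp: osc_le_def represents_def)
  then show "set_integrable M I f" "mean_osc M I f \<le> 2 * e"
    using assms mean_osc_le[of I M "b - a" f c e] by (auto simp: represents_def)
qed

lemma represents_osc_le:
  assumes "represents M I f f0 a b" "set_integrable M I f"
  shows "osc_le f0 {a..b} (mean_osc M I f)" "0 \<le> mean_osc M I f"
proof -
  note r = assms(1)[unfolded represents_def]
  have I: "I \<in> sets M" "emeasure M I = ennreal (b - a)" "0 < b - a" using r by auto
  show "0 \<le> mean_osc M I f" by (rule nn_integral_mean_osc(2)[OF I assms(2)])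
  have "deviation f0 {a..b} (mean_on M I f) = ennreal (mean_osc M I f * (b - a))"
    using r nn_integral_mean_osc(1)[OF I assms(2)] by simp
  then show "osc_le f0 {a..b} (mean_osc M I f)"
    unfolding osc_le_def using I(3) by (intro exI[of _ "mean_on M I f"]) simp
qed

text \<open>The predicate \<open>P\<close> selects the admissible endpoints: all intervals on the
  line, and those of at most one full turn on the circle.\<close>

lemma BMO_iff_osc_le:
  assumes 1: "\<And>I. I \<in> \<I> \<Longrightarrow> \<exists>a b. P a b \<and> represents M I f f0 a b"
    and 2: "\<And>a b. P a b \<Longrightarrow> \<exists>I\<in>\<I>. represents M I f f0 a b"
  shows "f \<in> BMO M \<I> \<longleftrightarrow> (\<exists>e\<ge>0. \<forall>a b. P a b \<longrightarrow> osc_le f0 {a..b} e)"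
proof
  assume f: "f \<in> BMO M \<I>"
  then obtain B where B: "\<And>I. I \<in> \<I> \<Longrightarrow> mean_osc M I f \<le> B" by (auto simp: BMO_def bdd_above_def)
  have "osc_le f0 {a..b} (max 0 B)" if "P a b" for a b
  proof -
    obtain I where I: "I \<in> \<I>" "represents M I f f0 a b" using 2 \<open>P a b\<close> by blast
    then have "osc_le f0 {a..b} (mean_osc M I f)" using f by (intro represents_osc_le) (auto simp: BMO_def)
    then show ?thesis by (rule osc_le_mono) (use B[OF I(1)] in auto)
  qed
  then show "\<exists>e\<ge>0. \<forall>a b. P a b \<longrightarrow> osc_le f0 {a..b} e" by (intro exI[of _ "max 0 B"]) auto
next
  assume "\<exists>e\<ge>0. \<forall>a b. P a b \<longrightarrow> osc_le f0 {a..b} e"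
  then obtain e where e: "0 \<le> e" "\<And>a b. P a b \<Longrightarrow> osc_le f0 {a..b} e" by blast
  have "set_integrable M I f \<and> mean_osc M I f \<le> 2 * e" if "I \<in> \<I>" for I
    using 1[OF that] e represents_mean_osc by metis
  then show "f \<in> BMO M \<I>" by (auto simp: BMO_def bdd_above_def)
qed

lemma bounded_interval_endpoints:
  assumes "I \<in> bounded_intervals"
  obtains a b where "a < b" "{a<..<b} \<subseteq> I" "I \<subseteq> {a..b}" "I \<in> sets borel"
proof -
  have I: "is_interval I" "bounded I" "0 < measure lebesgue I" using assms by (auto simp: bounded_intervals_def)
  then have ne: "I \<noteq> {}" by auto
  define a b where "a = Inf I" and "b = Sup I"
  have bdd: "bdd_above I" "bdd_below I" using I(2) by (auto simp: bounded_imp_bdd_above bounded_imp_bdd_below)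
  have sub: "I \<subseteq> {a..b}" using bdd by (auto simp: a_def b_def intro: cInf_lower cSup_upper)
  have sup: "{a<..<b} \<subseteq> I"
  proof
    fix x assume x: "x \<in> {a<..<b}"
    then obtain y z where "y \<in> I" "y < x" "z \<in> I" "x < z"
      using ne bdd by (auto simp: a_def b_def cInf_less_iff less_cSup_iff)
    then show "x \<in> I" using I(1) unfolding is_interval_1 by (meson less_imp_le)
  qed
  have "I = {a<..<b} \<union> (I \<inter> {a, b})" using sub sup by force
  moreover have "finite (I \<inter> {a, b})" by simp
  ultimately have borel: "I \<in> sets borel" by (metis borel_open finite_imp_closed borel_closed open_greaterThanLessThan sets.Un)
  have "a < b"
  proof (rule ccontr)
    assume "\<not> a < b"
    then have "I \<subseteq> {a}" using sub by auto
    then have "negligible I" using negligible_subset by blast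
    then show False using I(3) by (simp add: negligible_imp_measure0)
  qed
  then show ?thesis using that sub sup borel by blast
qed

lemma Icc_bounded_intervals: "a < b \<Longrightarrow> {a..b} \<in> bounded_intervals"
  by (simp add: bounded_intervals_def is_interval_cc)

lemma AE_indicator_interval:
  fixes a b :: real
  assumes "{a<..<b} \<subseteq> I" "I \<subseteq> {a..b}"
  shows "AE x in lborel. x \<in> I \<longleftrightarrow> x \<in> {a..b}"
  using AE_lborel_singleton[of a] AE_lborel_singleton[of b]
proof eventually_elim
  case (elim x)
  then have "x \<in> {a..b} \<Longrightarrow> x \<in> {a<..<b}" by auto
  then show ?case using assms by blast
qed

lemma lebesgue_measurable_if_AE:
  fixes f :: "real \<Rightarrow> real"
  assumes "f0 \<in> borel_measurable borel" "AE x in lborel. f x = f0 x"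
  shows "f \<in> borel_measurable lebesgue"
proof (rule borel_measurable_AE)
  show "f0 \<in> borel_measurable lebesgue" using assms(1) by (intro measurable_completion) simp
  have "AE x in lborel. f0 x = f x" using assms(2) by eventually_elim simp
  then show "AE x in lebesgue. f0 x = f x" by (rule AE_completion)
qed

lemma represents_line:
  fixes f f0 :: "real \<Rightarrow> real"
  assumes f0: "f0 \<in> borel_measurable borel" and eq: "AE x in lborel. f x = f0 x"
    and I: "a < b" "{a<..<b} \<subseteq> I" "I \<subseteq> {a..b}" "I \<in> sets borel"
  shows "represents lebesgue I f f0 a b"
proof -
  have nn: "(\<integral>\<^sup>+x\<in>I. g x \<partial>lebesgue) = (\<integral>\<^sup>+x\<in>{a..b}. g' x \<partial>lborel)" if "AE x in lborel. g x = g' x" for g g'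
    unfolding nn_integral_completion
  proof (rule nn_integral_cong_AE)
    show "AE x in lborel. g x * indicator I x = g' x * indicator {a..b} x"
      using that AE_indicator_interval[OF I(2,3)] by eventually_elim (auto simp: indicator_def)
  qed
  have "emeasure lebesgue I = (\<integral>\<^sup>+x\<in>I. 1 \<partial>lebesgue)" using I(4) by simp
  also have "\<dots> = (\<integral>\<^sup>+x\<in>{a..b}. 1 \<partial>lborel)" by (rule nn) simp
  also have "\<dots> = ennreal (b - a)" using I(1) by simp
  finally have m: "emeasure lebesgue I = ennreal (b - a)" .
  have "(\<integral>\<^sup>+x\<in>I. ennreal \<bar>f x - c\<bar> \<partial>lebesgue) = deviation f0 {a..b} c" for c
    unfolding deviation_def by (rule nn) (use eq in \<open>eventually_elim, simp\<close>)
  then show ?thesis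
    using I m lebesgue_measurable_if_AE[OF f0 eq] by (auto simp: represents_def)
qed

lemma BMO_real_iff:
  assumes f0: "f0 \<in> borel_measurable borel" and eq: "AE x in lborel. f x = f0 x"
  shows "f \<in> BMO lebesgue bounded_intervals \<longleftrightarrow> (\<exists>e\<ge>0. bmo_le f0 e)"
  unfolding bmo_le_def
proof (rule BMO_iff_osc_le)
  fix I assume "I \<in> bounded_intervals"
  then obtain a b where "a < b" "{a<..<b} \<subseteq> I" "I \<subseteq> {a..b}" "I \<in> sets borel" by (rule bounded_interval_endpoints)
  then show "\<exists>a b. a < b \<and> represents lebesgue I f f0 a b" using represents_line[OF f0 eq] by blast
next
  fix a b :: real assume "a < b"
  then show "\<exists>I\<in>bounded_intervals. represents lebesgue I f f0 a b"
    by (intro bexI[of _ "{a..b}"] represents_line[OF f0 eq] Icc_bounded_intervals) auto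
qed

lemma bmo_le_iff_mean_osc:
  assumes f0: "f0 \<in> borel_measurable borel" and eq: "AE x in lborel. f x = f0 x" and f: "f \<in> BMO lebesgue bounded_intervals"
  shows "BMO_norm lebesgue bounded_intervals f < \<epsilon> \<Longrightarrow> bmo_le f0 \<epsilon>"
    and "bmo_le f0 \<epsilon> \<Longrightarrow> 0 \<le> \<epsilon> \<Longrightarrow> BMO_norm lebesgue bounded_intervals f \<le> 2 * \<epsilon>"
proof -
  assume norm: "BMO_norm lebesgue bounded_intervals f < \<epsilon>"
  have "osc_le f0 {a..b} \<epsilon>" if ab: "a < b" for a b
  proof -
    have r: "represents lebesgue {a..b} f f0 a b" by (rule represents_line[OF f0 eq ab]) auto
    have I: "{a..b} \<in> bounded_intervals" using ab by (rule Icc_bounded_intervals)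
    have "mean_osc lebesgue {a..b} f \<le> BMO_norm lebesgue bounded_intervals f"
      unfolding BMO_norm_def using f by (intro cSUP_upper[OF I]) (simp add: BMO_def)
    moreover have "osc_le f0 {a..b} (mean_osc lebesgue {a..b} f)"
      using r f I by (intro represents_osc_le) (auto simp: BMO_def)
    ultimately show ?thesis using norm by (auto elim: osc_le_mono)
  qed
  then show "bmo_le f0 \<epsilon>" by (simp add: bmo_le_def)
next
  assume bmo: "bmo_le f0 \<epsilon>" and \<epsilon>: "0 \<le> \<epsilon>"
  show "BMO_norm lebesgue bounded_intervals f \<le> 2 * \<epsilon>"
    unfolding BMO_norm_def
  proof (rule cSUP_least)
    show "bounded_intervals \<noteq> {}" using Icc_bounded_intervals[of 0 1] by auto
    fix I assume "I \<in> bounded_intervals"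
    then obtain a b where ab: "a < b" "{a<..<b} \<subseteq> I" "I \<subseteq> {a..b}" "I \<in> sets borel" by (rule bounded_interval_endpoints)
    show "mean_osc lebesgue I f \<le> 2 * \<epsilon>"
      by (rule represents_mean_osc(2)[OF represents_line[OF f0 eq ab] _ \<epsilon>]) (use bmo ab(1) in \<open>auto simp: bmo_le_def\<close>)
  qed
qed

lemma compact_support_iff:
  fixes g :: "real \<Rightarrow> real"
  shows "compact (closure {x. g x \<noteq> 0}) \<longleftrightarrow> (\<exists>N. \<forall>x. N \<le> \<bar>x\<bar> \<longrightarrow> g x = 0)"
proof
  assume "compact (closure {x. g x \<noteq> 0})"
  then have "bounded {x. g x \<noteq> 0}" by (rule bounded_subset[OF compact_imp_bounded closure_subset])
  then obtain B where "\<And>x. g x \<noteq> 0 \<Longrightarrow> \<bar>x\<bar> \<le> B" by (auto simp: bounded_iff)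
  then show "\<exists>N. \<forall>x. N \<le> \<bar>x\<bar> \<longrightarrow> g x = 0" by (intro exI[of _ "B + 1"]) force
next
  assume "\<exists>N. \<forall>x. N \<le> \<bar>x\<bar> \<longrightarrow> g x = 0"
  then obtain N where "\<And>x. N \<le> \<bar>x\<bar> \<Longrightarrow> g x = 0" by blast
  then have "bounded {x. g x \<noteq> 0}" by (intro boundedI[of _ N]) (auto simp: not_le intro: less_imp_le leI)
  then show "compact (closure {x. g x \<noteq> 0})" by (simp add: compact_closure)
qed

lemma CMO_real_iff:
  assumes f0 [measurable]: "f0 \<in> borel_measurable borel" and eq: "AE x in lborel. f x = f0 x"
  shows "f \<in> CMO_real \<longleftrightarrow> cmo_line f0"
proof -
  \<comment> \<open>\<open>BMO_norm\<close> is a supremum of reals and controls single intervals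
    only when the set of oscillations is bounded; this fact supplies boundedness for the
    differences.\<close>
  have key: "\<exists>e\<ge>0. bmo_le (\<lambda>x. f0 x - g x) e" if b: "\<exists>e\<ge>0. bmo_le f0 e" and g: "continuous_on UNIV g" and N: "\<And>x. N \<le> \<bar>x\<bar> \<Longrightarrow> g x = 0" for g N
  proof -
    obtain M where M: "0 \<le> M" "bmo_le g M" by (rule bmo_le_compact_support[OF g N])
    have [measurable]: "g \<in> borel_measurable borel" using g by (rule borel_measurable_continuous_onI)
    obtain e where "0 \<le> e" "bmo_le f0 e" using b by blast
    then have "bmo_le (\<lambda>x. f0 x - g x) (e + M)" using M unfolding bmo_le_def by (auto intro!: osc_le_diff)
    then show ?thesis using \<open>0 \<le> e\<close> M by (intro exI[of _ "e + M"]) auto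
  qed
  have eqg: "AE x in lborel. f x - g x = f0 x - g x" for g using eq by eventually_elim simp
  show ?thesis
  proof
    assume f: "f \<in> CMO_real"
    then have b: "\<exists>e\<ge>0. bmo_le f0 e" using BMO_real_iff[OF f0 eq] by (simp add: CMO_real_def)
    have "\<exists>g N. continuous_on UNIV g \<and> (\<forall>x. N \<le> \<bar>x\<bar> \<longrightarrow> g x = 0) \<and> bmo_le (\<lambda>x. f0 x - g x) \<epsilon>" if "0 < \<epsilon>" for \<epsilon>
    proof -
      obtain g where g: "continuous_on UNIV g" "compact (closure {x. g x \<noteq> 0})" "BMO_norm lebesgue bounded_intervals (\<lambda>x. f x - g x) < \<epsilon>"
        using f \<open>0 < \<epsilon>\<close> unfolding CMO_real_def by blast
      obtain N where N: "\<And>x. N \<le> \<bar>x\<bar> \<Longrightarrow> g x = 0" using compact_support_iff[THEN iffD1, OF g(2)] by blast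
      have [measurable]: "g \<in> borel_measurable borel" using g(1) by (rule borel_measurable_continuous_onI)
      have m: "(\<lambda>x. f0 x - g x) \<in> borel_measurable borel" by measurable
      have "(\<lambda>x. f x - g x) \<in> BMO lebesgue bounded_intervals"
        using BMO_real_iff[OF m eqg] key[OF b g(1) N] by simp
      then have "bmo_le (\<lambda>x. f0 x - g x) \<epsilon>" using bmo_le_iff_mean_osc(1)[OF m eqg _ g(3)] by simp
      then show ?thesis using g(1) N by blast
    qed
    then show "cmo_line f0" using b by (simp add: cmo_line_def)
  next
    assume c: "cmo_line f0"
    then have b: "\<exists>e\<ge>0. bmo_le f0 e" by (simp add: cmo_line_def)
    have "\<exists>g. continuous_on UNIV g \<and> compact (closure {x. g x \<noteq> 0}) \<and> BMO_norm lebesgue bounded_intervals (\<lambda>x. f x - g x) < \<epsilon>" if \<epsilon>: "0 < \<epsilon>" for \<epsilon>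
    proof -
      \<comment> \<open>The passage from centres to means doubles the bound, and the remaining
        factor 2 gives strict inequality.\<close>
      have "0 < \<epsilon> / 4" using \<epsilon> by simp
      then obtain g N where g: "continuous_on UNIV g" "\<And>x. N \<le> \<bar>x\<bar> \<Longrightarrow> g x = 0" "bmo_le (\<lambda>x. f0 x - g x) (\<epsilon> / 4)"
        using c unfolding cmo_line_def by blast
      have [measurable]: "g \<in> borel_measurable borel" using g(1) by (rule borel_measurable_continuous_onI)
      have m: "(\<lambda>x. f0 x - g x) \<in> borel_measurable borel" by measurable
      have "(\<lambda>x. f x - g x) \<in> BMO lebesgue bounded_intervals"
        using BMO_real_iff[OF m eqg] key[OF b g(1,2)] by simp
      then have "BMO_norm lebesgue bounded_intervals (\<lambda>x. f x - g x) \<le> 2 * (\<epsilon> / 4)"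
        using bmo_le_iff_mean_osc(2)[OF m eqg _ g(3)] \<epsilon> by simp
      moreover have "compact (closure {x. g x \<noteq> 0})"
        by (rule compact_support_iff[THEN iffD2]) (intro exI[of _ N] allI impI g(2))
      ultimately show ?thesis using g(1) \<epsilon> by (intro exI[of _ g] conjI) linarith+
    qed
    then show "f \<in> CMO_real" using BMO_real_iff[OF f0 eq] b by (simp add: CMO_real_def)
  qed
qed

section \<open>Arcs as images of intervals of angles\<close>

lemma inj_on_cis: "inj_on cis {0..<2 * pi}"
proof (rule inj_onI)
  fix x y assume xy: "x \<in> {0..<2 * pi}" "y \<in> {0..<2 * pi}" "cis x = cis y"
  then obtain n :: int where n: "x = y + 2 * pi * n" using sin_cos_eq_iff[of x y] by (auto simp: cis.ctr complex_eq_iff)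
  then have "\<bar>2 * pi * n\<bar> < 2 * pi * 1" using xy by auto
  then have "\<bar>of_int n :: real\<bar> < 1" using pi_gt_zero by (simp add: abs_mult)
  then show "x = y" using n by simp
qed

lemma cis_eq_iff: "cis x = cis y \<longleftrightarrow> (\<exists>n::int. x = y + 2 * pi * n)"
  using sin_cos_eq_iff[of x y] by (auto simp: complex_eq_iff)

lemma cis_periodic: "cis (t + 2 * pi * of_int n) = cis t"
  by (auto simp: cis_eq_iff)

lemma cis_image_shift: "cis ` ((\<lambda>t. t + 2 * pi * of_int n) ` A) = cis ` A"
  by (simp add: image_image cis_periodic)

text \<open>An interval of at most one turn that starts in the fundamental period ends before
  \<open>4 * pi\<close>. A point of the circle therefore has only two candidate angles in it,
  \<open>t\<close> and \<open>t + 2 * pi\<close>.\<close>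

lemma cis_image_fundamental:
  assumes a: "0 \<le> a" "a < 2 * pi" "b \<le> a + 2 * pi" and A: "A \<subseteq> {a..b}"
  shows "t \<in> {0..<2 * pi} \<Longrightarrow> cis t \<in> cis ` A \<longleftrightarrow> t \<in> A \<or> t + 2 * pi \<in> A"
    and "cis ` A = cis ` {t \<in> {0..<2 * pi}. t \<in> A \<or> t + 2 * pi \<in> A}"
proof -
  have *: "t = s \<or> t + 2 * pi = s" if t: "t \<in> {0..<2 * pi}" and s: "s \<in> A" and eq: "cis t = cis s" for t s
  proof -
    obtain n :: int where n: "s = t + 2 * pi * n" using eq cis_eq_iff[of s t] by auto
    have "0 \<le> s" "s < 4 * pi" using s A a by auto
    moreover have "0 \<le> t" "t < 2 * pi" using t by auto
    ultimately have *: "2 * pi * (-1) < 2 * pi * of_int n" "2 * pi * of_int n < 2 * pi * 2" using n by linarith+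
    have "(-1 :: real) < of_int n" "of_int n < (2 :: real)"
      by (rule mult_left_less_imp_less[OF *(1)], simp, rule mult_left_less_imp_less[OF *(2)], simp)
    then have "n = 0 \<or> n = 1" by linarith
    then show ?thesis using n by auto
  qed
  have per: "cis (t + 2 * pi) = cis t" for t using cis_periodic[of t 1] by simp
  show 1: "cis t \<in> cis ` A \<longleftrightarrow> t \<in> A \<or> t + 2 * pi \<in> A" if t: "t \<in> {0..<2 * pi}" for t
  proof
    assume "cis t \<in> cis ` A"
    then obtain s where "s \<in> A" "cis t = cis s" by blast
    then show "t \<in> A \<or> t + 2 * pi \<in> A" using *[OF t] by auto
  next
    assume "t \<in> A \<or> t + 2 * pi \<in> A"
    then show "cis t \<in> cis ` A" using per[of t] by (metis imageI)
  qed
  show "cis ` A = cis ` {t \<in> {0..<2 * pi}. t \<in> A \<or> t + 2 * pi \<in> A}"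
  proof (intro equalityI subsetI)
    fix z assume z: "z \<in> cis ` A"
    then obtain s where s: "s \<in> A" "z = cis s" by blast
    obtain n :: int and t where t: "s = 2 * pi * of_int n + t" "0 \<le> t" "t < 2 * pi" by (rule split_2pi)
    have "z = cis t" using s t cis_periodic[of t n] by (simp add: add.commute)
    then show "z \<in> cis ` {t \<in> {0..<2 * pi}. t \<in> A \<or> t + 2 * pi \<in> A}" using 1[of t] t z by auto
  next
    fix z assume "z \<in> cis ` {t \<in> {0..<2 * pi}. t \<in> A \<or> t + 2 * pi \<in> A}"
    then show "z \<in> cis ` A" using 1 by auto
  qed
qed

lemma cis_image_sets_fundamental:
  assumes a: "0 \<le> a" "a < 2 * pi" "b \<le> a + 2 * pi" and A: "A \<subseteq> {a..b}" "A \<in> sets borel"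
  shows "cis ` A \<in> sets arclength"
proof -
  have "(\<lambda>t. t + 2 * pi) -` A \<inter> space borel \<in> sets borel" by (rule measurable_sets[of _ borel borel]) (use A in auto)
  then have "{0..<2 * pi} \<inter> (A \<union> (\<lambda>t. t + 2 * pi) -` A) \<in> sets borel" using A(2) by auto
  moreover have "{0..<2 * pi} \<inter> (A \<union> (\<lambda>t. t + 2 * pi) -` A) = {t \<in> {0..<2 * pi}. t \<in> A \<or> t + 2 * pi \<in> A}" by auto
  ultimately have "{t \<in> {0..<2 * pi}. t \<in> A \<or> t + 2 * pi \<in> A} \<in> sets borel" by simp
  then have "{t \<in> {0..<2 * pi}. t \<in> A \<or> t + 2 * pi \<in> A} \<in> sets (lebesgue_on {0..<2 * pi})"
    by (auto simp: sets_restrict_space_iff)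
  then show ?thesis
    unfolding cis_image_fundamental(2)[OF a A(1)] arclength_def by (rule in_sets_embed_measure)
qed

lemma nn_integral_arclength:
  assumes "g \<in> borel_measurable arclength"
  shows "(\<integral>\<^sup>+z. g z \<partial>arclength) = (\<integral>\<^sup>+t\<in>{0..<2 * pi}. g (cis t) \<partial>lborel)"
proof -
  have "(\<integral>\<^sup>+z. g z \<partial>arclength) = (\<integral>\<^sup>+t. g (cis t) \<partial>lebesgue_on {0..<2 * pi})"
    using assms inj_on_cis unfolding arclength_def by (intro nn_integral_embed_measure') auto
  also have "\<dots> = (\<integral>\<^sup>+t\<in>{0..<2 * pi}. g (cis t) \<partial>lebesgue)"
    by (intro nn_integral_restrict_space) auto
  finally show ?thesis by (simp add: nn_integral_completion)
qed

text \<open>Cut \<open>A\<close> at \<open>2 * pi\<close> and shift the second part back by one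
  period. Both parts together cover the set of angles of the arc, and they overlap in at most one
  point.\<close>

lemma nn_integral_arc_fundamental:
  assumes a: "0 \<le> a" "a < 2 * pi" "b \<le> a + 2 * pi" and A: "A \<subseteq> {a..b}" "A \<in> sets borel"
    and g: "g \<in> borel_measurable arclength" and G [measurable]: "G \<in> borel_measurable borel"
    and per: "\<And>t. G (t + 2 * pi) = G t" and eq: "AE t in lborel. g (cis t) = G t"
  shows "(\<integral>\<^sup>+z\<in>cis ` A. g z \<partial>arclength) = (\<integral>\<^sup>+t\<in>A. G t \<partial>lborel)"
proof -
  note [measurable] = A(2)
  have iA: "cis ` A \<in> sets arclength" by (rule cis_image_sets_fundamental[OF a A])
  have "(\<integral>\<^sup>+z\<in>cis ` A. g z \<partial>arclength) = (\<integral>\<^sup>+t\<in>{0..<2 * pi}. g (cis t) * indicator (cis ` A) (cis t) \<partial>lborel)"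
    by (rule nn_integral_arclength) (intro borel_measurable_times_ennreal g borel_measurable_indicator iA)
  also have "\<dots> = (\<integral>\<^sup>+t. G t * indicator (A \<inter> {0..<2 * pi}) t + G (2 * pi + 1 * t) * indicator (A \<inter> {2 * pi..<4 * pi}) (2 * pi + 1 * t) \<partial>lborel)"
  proof (rule nn_integral_cong_AE)
    show "AE t in lborel. g (cis t) * indicator (cis ` A) (cis t) * indicator {0..<2 * pi} t
        = G t * indicator (A \<inter> {0..<2 * pi}) t + G (2 * pi + 1 * t) * indicator (A \<inter> {2 * pi..<4 * pi}) (2 * pi + 1 * t)"
      using eq AE_lborel_singleton[of a] AE_lborel_singleton[of "b - 2 * pi"]
    proof eventually_elim
      case (elim t)
      show ?case
      proof (cases "t \<in> {0..<2 * pi}")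
        case True
        \<comment> \<open>Both angles can lie in \<open>A\<close> only for a full turn with
          \<open>t = a\<close>, a single point, which is excluded as null.\<close>
        have "\<not> (t \<in> A \<and> t + 2 * pi \<in> A)"
        proof
          assume "t \<in> A \<and> t + 2 * pi \<in> A"
          then have "a \<le> t" "t + 2 * pi \<le> b" using A(1) by auto
          then have "t = a" using a by auto
          then show False using elim by simp
        qed
        then show ?thesis
          using True cis_image_fundamental(1)[OF a A(1) True] elim(1) per[of t]
          by (auto simp: indicator_def add.commute)
      qed (auto simp: indicator_def)
    qed
  qed
  also have "\<dots> = (\<integral>\<^sup>+t. G t * indicator (A \<inter> {0..<2 * pi}) t \<partial>lborel) + (\<integral>\<^sup>+t. G (2 * pi + 1 * t) * indicator (A \<inter> {2 * pi..<4 * pi}) (2 * pi + 1 * t) \<partial>lborel)"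
    by (rule nn_integral_add) auto
  also have "(\<integral>\<^sup>+t. G (2 * pi + 1 * t) * indicator (A \<inter> {2 * pi..<4 * pi}) (2 * pi + 1 * t) \<partial>lborel)
      = (\<integral>\<^sup>+t. G t * indicator (A \<inter> {2 * pi..<4 * pi}) t \<partial>lborel)"
    using nn_integral_real_affine[of "\<lambda>t. G t * indicator (A \<inter> {2 * pi..<4 * pi}) t" 1 "2 * pi"] by simp
  also have "(\<integral>\<^sup>+t. G t * indicator (A \<inter> {0..<2 * pi}) t \<partial>lborel) + (\<integral>\<^sup>+t. G t * indicator (A \<inter> {2 * pi..<4 * pi}) t \<partial>lborel)
      = (\<integral>\<^sup>+t. G t * indicator (A \<inter> {0..<2 * pi}) t + G t * indicator (A \<inter> {2 * pi..<4 * pi}) t \<partial>lborel)"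
    by (rule nn_integral_add[symmetric]) auto
  also have "\<dots> = (\<integral>\<^sup>+t\<in>A. G t \<partial>lborel)"
  proof (rule nn_integral_cong)
    fix t
    have "t \<in> A \<Longrightarrow> 0 \<le> t \<and> t < 4 * pi" using A(1) a by auto
    then show "G t * indicator (A \<inter> {0..<2 * pi}) t + G t * indicator (A \<inter> {2 * pi..<4 * pi}) t = G t * indicator A t"
      by (auto simp: indicator_def)
  qed
  finally show ?thesis .
qed

lemma shift_to_fundamental:
  fixes a b :: real
  obtains n :: int where "0 \<le> a + 2 * pi * of_int n" "a + 2 * pi * of_int n < 2 * pi"
proof -
  obtain m :: int where "0 \<le> a - 2 * pi * of_int m" "a - 2 * pi * of_int m < 2 * pi" by (rule real_mod_2pi)
  then show ?thesis using that[of "- m"] by simp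
qed

lemma borel_image_translate: "A \<in> sets borel \<Longrightarrow> (\<lambda>t::real. t + s) ` A \<in> sets borel"
proof -
  assume A: "A \<in> sets borel"
  have "(\<lambda>t. t - s) -` A \<inter> space borel \<in> sets borel" by (rule measurable_sets[of _ borel borel]) (use A in auto)
  moreover have "(\<lambda>t. t + s) ` A = (\<lambda>t. t - s) -` A" by (force simp: image_iff)
  ultimately show ?thesis by simp
qed

lemma nn_integral_arc:
  assumes b: "b \<le> a + 2 * pi" and A: "A \<subseteq> {a..b}" "A \<in> sets borel"
    and g: "g \<in> borel_measurable arclength" and G [measurable]: "G \<in> borel_measurable borel"
    and per: "\<And>t n. G (t + 2 * pi * of_int n) = G t" and eq: "AE t in lborel. g (cis t) = G t"
  shows "cis ` A \<in> sets arclength" and "(\<integral>\<^sup>+z\<in>cis ` A. g z \<partial>arclength) = (\<integral>\<^sup>+t\<in>A. G t \<partial>lborel)"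
proof -
  obtain n :: int where n: "0 \<le> a + 2 * pi * of_int n" "a + 2 * pi * of_int n < 2 * pi" by (rule shift_to_fundamental)
  define s where "s = 2 * pi * of_int n"
  define B where "B = (\<lambda>t. t + s) ` A"
  have B: "B \<subseteq> {a + s..b + s}" "B \<in> sets borel" using A borel_image_translate by (auto simp: B_def)
  have ab: "0 \<le> a + s" "a + s < 2 * pi" "b + s \<le> (a + s) + 2 * pi" using n b by (auto simp: s_def)
  have cisB: "cis ` B = cis ` A" unfolding B_def s_def by (rule cis_image_shift)
  show "cis ` A \<in> sets arclength" using cis_image_sets_fundamental[OF ab B] by (simp add: cisB)
  have "(\<integral>\<^sup>+z\<in>cis ` A. g z \<partial>arclength) = (\<integral>\<^sup>+t\<in>B. G t \<partial>lborel)"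
    using nn_integral_arc_fundamental[OF ab B g G _ eq] per[of _ 1] by (simp add: cisB)
  also have "\<dots> = (\<integral>\<^sup>+t. G (s + 1 * t) * indicator B (s + 1 * t) \<partial>lborel)"
    using nn_integral_real_affine[of "\<lambda>t. G t * indicator B t" 1 s] B(2) by simp
  also have "\<dots> = (\<integral>\<^sup>+t\<in>A. G t \<partial>lborel)"
  proof (rule nn_integral_cong)
    fix t
    have "s + t \<in> B \<longleftrightarrow> t \<in> A" by (auto simp: B_def image_iff add.commute)
    moreover have "G (s + t) = G t" using per[of t n] by (simp add: s_def add.commute)
    ultimately show "G (s + 1 * t) * indicator B (s + 1 * t) = G t * indicator A t" by (simp add: indicator_def)
  qed
  finally show "(\<integral>\<^sup>+z\<in>cis ` A. g z \<partial>arclength) = (\<integral>\<^sup>+t\<in>A. G t \<partial>lborel)" .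
qed

lemma emeasure_arc:
  assumes "b \<le> a + 2 * pi" "A \<subseteq> {a..b}" "A \<in> sets borel"
  shows "cis ` A \<in> sets arclength" "emeasure arclength (cis ` A) = emeasure lborel A"
    "measure arclength (cis ` A) = measure lborel A"
proof -
  show s: "cis ` A \<in> sets arclength" by (rule nn_integral_arc(1)[OF assms, of "\<lambda>_. 1" "\<lambda>_. 1"]) auto
  have "(\<integral>\<^sup>+z\<in>cis ` A. 1 \<partial>arclength) = (\<integral>\<^sup>+t\<in>A. 1 \<partial>lborel)"
    by (rule nn_integral_arc(2)[OF assms]) auto
  then show "emeasure arclength (cis ` A) = emeasure lborel A" using s assms(3) by simp
  then show "measure arclength (cis ` A) = measure lborel A" by (simp add: measure_def)
qed

lemma represents_circle:
  assumes F: "F \<in> borel_measurable borel" and per: "\<And>t n. F (t + 2 * pi * of_int n) = F t"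
    and eq: "AE t in lborel. f (cis t) = F t"
    and J: "a < b" "b \<le> a + 2 * pi" "{a<..<b} \<subseteq> J" "J \<subseteq> {a..b}" "J \<in> sets borel"
  shows "represents arclength (cis ` J) f F a b"
proof -
  have "(\<lambda>t. f (cis t)) \<in> borel_measurable (lebesgue_on {0..<2 * pi})"
    using lebesgue_measurable_if_AE[OF F eq] by (rule measurable_restrict_space1)
  then have f: "f \<in> borel_measurable arclength" unfolding arclength_def by (rule measurable_embed_measure1)
  have m: "emeasure lborel J = ennreal (b - a)"
  proof -
    have "emeasure lborel J = (\<integral>\<^sup>+x. indicator J x \<partial>lborel)" using J(5) by simp
    also have "\<dots> = (\<integral>\<^sup>+x. indicator {a..b} x \<partial>lborel)"
    proof (rule nn_integral_cong_AE)
      show "AE x in lborel. (indicator J x :: ennreal) = indicator {a..b} x"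
        using AE_indicator_interval[OF J(3,4)] by eventually_elim (auto simp: indicator_def)
    qed
    also have "\<dots> = ennreal (b - a)" using J(1) by simp
    finally show ?thesis .
  qed
  have "(\<integral>\<^sup>+z\<in>cis ` J. ennreal \<bar>f z - c\<bar> \<partial>arclength) = deviation F {a..b} c" for c
  proof -
    have "(\<integral>\<^sup>+z\<in>cis ` J. ennreal \<bar>f z - c\<bar> \<partial>arclength) = (\<integral>\<^sup>+t\<in>J. ennreal \<bar>F t - c\<bar> \<partial>lborel)"
    proof (rule nn_integral_arc(2)[OF J(2,4,5)])
      show "AE t in lborel. ennreal \<bar>f (cis t) - c\<bar> = ennreal \<bar>F t - c\<bar>" using eq by eventually_elim simp
    qed (use f F per in auto)
    also have "\<dots> = deviation F {a..b} c"
      unfolding deviation_def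
    proof (rule nn_integral_cong_AE)
      show "AE t in lborel. ennreal \<bar>F t - c\<bar> * indicator J t = ennreal \<bar>F t - c\<bar> * indicator {a..b} t"
        using AE_indicator_interval[OF J(3,4)] by eventually_elim (auto simp: indicator_def)
    qed
    finally show ?thesis .
  qed
  then show ?thesis
    using J(1) f m emeasure_arc[OF J(2,4,5)] by (auto simp: represents_def)
qed

lemma measure_interval:
  fixes a b :: real
  assumes "a < b" "{a<..<b} \<subseteq> J" "J \<subseteq> {a..b}" "J \<in> sets borel"
  shows "measure lebesgue J = b - a" "measure lborel J = b - a"
proof -
  have "represents lebesgue J (\<lambda>_. 0) (\<lambda>_. 0) a b" by (rule represents_line) (use assms in auto)
  then have "emeasure lebesgue J = ennreal (b - a)" by (simp add: represents_def)
  then show "measure lebesgue J = b - a" using assms(1) by (simp add: measure_def)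
  then show "measure lborel J = b - a" using assms(4) by (simp add: measure_completion)
qed

lemma arcs_cases:
  assumes "I \<in> arcs"
  obtains a b J where "a < b" "b \<le> a + 2 * pi" "{a<..<b} \<subseteq> J" "J \<subseteq> {a..b}" "J \<in> sets borel" "I = cis ` J"
proof -
  obtain J where J: "J \<in> bounded_intervals" "measure lebesgue J \<le> 2 * pi" "I = cis ` J" using assms by (auto simp: arcs_def)
  obtain a b where ab: "a < b" "{a<..<b} \<subseteq> J" "J \<subseteq> {a..b}" "J \<in> sets borel"
    using J(1) by (rule bounded_interval_endpoints)
  then show ?thesis using measure_interval(1)[OF ab] J by (intro that[of a b J]) auto
qed

lemma Icc_arcs: "a < b \<Longrightarrow> b - a \<le> 2 * pi \<Longrightarrow> cis ` {a..b} \<in> arcs"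
  unfolding arcs_def using Icc_bounded_intervals[of a b] by auto

lemma VMO_circle_iff:
  assumes F: "F \<in> borel_measurable borel" and per: "\<And>t n. F (t + 2 * pi * of_int n) = F t"
    and eq: "AE t in lborel. f (cis t) = F t"
  shows "f \<in> VMO_circle \<longleftrightarrow> vmo_circ F"
proof -
  have rep: "represents arclength (cis ` {a..b}) f F a b" if "a < b" "b - a \<le> 2 * pi" for a b
    by (rule represents_circle[OF F per eq]) (use that in auto)
  have meas: "measure arclength I = b - a" if "represents arclength I f F a b" for I a b
    using that by (simp add: represents_def measure_def)
  have cases: "\<exists>a b. (a < b \<and> b - a \<le> 2 * pi) \<and> represents arclength I f F a b" if I: "I \<in> arcs" for I
  proof -
    obtain a b J where J: "a < b" "b \<le> a + 2 * pi" "{a<..<b} \<subseteq> J" "J \<subseteq> {a..b}" "J \<in> sets borel" "I = cis ` J"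
      using I by (rule arcs_cases)
    then show ?thesis using represents_circle[OF F per eq J(1-5)] by (intro exI[of _ a] exI[of _ b]) auto
  qed
  have BMO: "f \<in> BMO arclength arcs \<longleftrightarrow> (\<exists>e\<ge>0. \<forall>a b. a < b \<and> b - a \<le> 2 * pi \<longrightarrow> osc_le F {a..b} e)"
  proof (rule BMO_iff_osc_le[OF cases])
    fix a b :: real assume "a < b \<and> b - a \<le> 2 * pi"
    then show "\<exists>I\<in>arcs. represents arclength I f F a b" using rep[of a b] Icc_arcs[of a b] by blast
  qed
  show ?thesis
  proof
    assume f: "f \<in> VMO_circle"
    have "\<exists>\<delta>>0. \<forall>a b. a < b \<and> b - a < \<delta> \<longrightarrow> osc_le F {a..b} \<epsilon>" if "0 < \<epsilon>" for \<epsilon>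
    proof -
      obtain \<delta> where \<delta>: "0 < \<delta>" "\<And>I. I \<in> arcs \<Longrightarrow> measure arclength I < \<delta> \<Longrightarrow> mean_osc arclength I f < \<epsilon>"
        using f \<open>0 < \<epsilon>\<close> by (auto simp: VMO_circle_def)
      \<comment> \<open>Intervals longer than a full turn do not give arcs, hence the minimum with
        \<open>2 * pi\<close>.\<close>
      have "osc_le F {a..b} \<epsilon>" if ab: "a < b" "b - a < min \<delta> (2 * pi)" for a b
      proof -
        have I: "cis ` {a..b} \<in> arcs" "represents arclength (cis ` {a..b}) f F a b" using ab by (auto intro!: Icc_arcs rep)
        then have "mean_osc arclength (cis ` {a..b}) f < \<epsilon>" using ab meas[OF I(2)] by (intro \<delta>(2)) auto
        moreover have "osc_le F {a..b} (mean_osc arclength (cis ` {a..b}) f)"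
          using I f by (intro represents_osc_le) (auto simp: VMO_circle_def BMO_def)
        ultimately show ?thesis by (auto elim: osc_le_mono)
      qed
      then show ?thesis using \<delta>(1) by (intro exI[of _ "min \<delta> (2 * pi)"]) auto
    qed
    moreover have "f \<in> BMO arclength arcs" using f by (simp add: VMO_circle_def)
    ultimately show "vmo_circ F" using BMO unfolding vmo_circ_def by simp
  next
    assume F: "vmo_circ F"
    have "\<exists>\<delta>>0. \<forall>I\<in>arcs. measure arclength I < \<delta> \<longrightarrow> mean_osc arclength I f < \<epsilon>" if \<epsilon>: "0 < \<epsilon>" for \<epsilon>
    proof -
      have "0 < \<epsilon> / 4" using \<epsilon> by simp
      then obtain \<delta> where \<delta>: "0 < \<delta>" "\<And>a b. a < b \<Longrightarrow> b - a < \<delta> \<Longrightarrow> osc_le F {a..b} (\<epsilon> / 4)"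
        using F[unfolded vmo_circ_def, THEN conjunct2, rule_format, of "\<epsilon> / 4"] by auto
      have "mean_osc arclength I f < \<epsilon>" if I: "I \<in> arcs" "measure arclength I < \<delta>" for I
      proof -
        obtain a b where r: "a < b" "represents arclength I f F a b" using cases[OF I(1)] by blast
        have "osc_le F {a..b} (\<epsilon> / 4)" by (rule \<delta>(2)[OF r(1)]) (use I(2) meas[OF r(2)] in simp)
        then have "mean_osc arclength I f \<le> 2 * (\<epsilon> / 4)" by (rule represents_mean_osc(2)[OF r(2)]) (use \<epsilon> in simp)
        then show ?thesis using \<epsilon> by linarith
      qed
      then show ?thesis using \<delta>(1) by (intro exI[of _ \<delta>]) simp
    qed
    moreover have "f \<in> BMO arclength arcs" using F BMO unfolding vmo_circ_def by blast
    ultimately show "f \<in> VMO_circle" by (simp add: VMO_circle_def)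
  qed
qed

section \<open>Lebesgue sets in the strong quasisymmetry condition\<close>

text \<open>The original condition quantifies over all measurable sets of a complete measure,
  \<open>sqs_on\<close> over Borel sets. The inner set gives the measure of \<open>A\<close>, and
  the image of the outer set bounds the image of \<open>A\<close>.\<close>

lemma borel_sandwich:
  fixes A :: "real set"
  assumes A: "A \<in> sets lebesgue" "A \<subseteq> {a..b}"
  obtains S T where "S \<in> sets borel" "T \<in> sets borel" "S \<subseteq> A" "A \<subseteq> T" "T \<subseteq> {a..b}"
    "emeasure lborel S = emeasure lborel T"
proof -
  obtain S N N' where S: "A = S \<union> N" "N \<subseteq> N'" "N' \<in> null_sets lborel" "S \<in> sets lborel"
    using A(1) by (rule sets_completionE)
  have N': "N' \<in> sets borel" using S(3) by auto
  have SA: "S \<subseteq> A" using S(1) by auto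
  have "emeasure lborel S = emeasure lborel ((S \<union> N') \<inter> {a..b})"
  proof (rule antisym)
    show "emeasure lborel S \<le> emeasure lborel ((S \<union> N') \<inter> {a..b})"
      using SA A(2) N' S(4) by (intro emeasure_mono) auto
    have "emeasure lborel ((S \<union> N') \<inter> {a..b}) \<le> emeasure lborel (S \<union> N')"
      using N' S(4) by (intro emeasure_mono) auto
    also have "\<dots> = emeasure lborel S" using S by (intro emeasure_Un_null_set)
    finally show "emeasure lborel ((S \<union> N') \<inter> {a..b}) \<le> emeasure lborel S" .
  qed
  moreover have "S \<in> sets borel" "(S \<union> N') \<inter> {a..b} \<in> sets borel" using N' S(4) by auto
  moreover have "A \<subseteq> (S \<union> N') \<inter> {a..b}" using A(2) S(1,2) by blast
  ultimately show ?thesis using SA by (intro that[of S "(S \<union> N') \<inter> {a..b}"]) auto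
qed

text \<open>Both versions of the strong quasisymmetry condition are read off in a coordinate \<open>e\<close>: the
  identity for the line and \<open>cis\<close> for the circle.\<close>

lemma strong_qs_condition_iff:
  assumes \<phi>: "line_homeo \<phi>"
    and intervals: "\<And>I. I \<in> \<I> \<Longrightarrow> \<exists>a b J. P a b \<and> {a<..<b} \<subseteq> J \<and> J \<subseteq> {a..b} \<and> J \<in> sets borel \<and> I = e ` J"
    and Icc: "\<And>a b. P a b \<Longrightarrow> e ` {a..b} \<in> \<I>"
    and less: "\<And>a b. P a b \<Longrightarrow> a < b"
    and chart: "\<And>a b A. P a b \<Longrightarrow> A \<in> sets borel \<Longrightarrow> A \<subseteq> {a..b} \<Longrightarrow>
      e ` A \<in> sets M \<and> emeasure M (e ` A) = emeasure lborel A"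
    and pull: "\<And>a b J B. P a b \<Longrightarrow> J \<in> sets borel \<Longrightarrow> J \<subseteq> {a..b} \<Longrightarrow> B \<in> sets M \<Longrightarrow> B \<subseteq> e ` J \<Longrightarrow>
      \<exists>A\<in>sets lebesgue. A \<subseteq> J \<and> B = e ` A"
    and k: "\<And>t. k (e t) = e (\<phi> t)" and P: "\<And>a b. P a b \<Longrightarrow> P (\<phi> a) (\<phi> b)"
  shows "strong_qs_condition M \<I> k \<longleftrightarrow> (\<exists>C>0. \<exists>\<kappa>>0. \<forall>a b. P a b \<longrightarrow> sqs_on \<phi> C \<kappa> a b)"
proof -
  have img: "k ` e ` A = e ` \<phi> ` A" for A by (simp add: image_image k)
  have Mm: "measure M (e ` A) = measure lborel A" if "P a b" "A \<in> sets borel" "A \<subseteq> {a..b}" for a b A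
    using chart[OF that] by (simp add: measure_def)
  have \<phi>A: "\<phi> ` A \<in> sets borel" "\<phi> ` A \<subseteq> {\<phi> a..\<phi> b}" if "A \<in> sets borel" "A \<subseteq> {a..b}" for A a b
  proof -
    show "\<phi> ` A \<in> sets borel" by (rule line_homeo_borel[OF \<phi> that(1)])
    show "\<phi> ` A \<subseteq> {\<phi> a..\<phi> b}" using that(2) by (auto simp: line_homeo_le_iff[OF \<phi>])
  qed
  have pos: "\<phi> a < \<phi> b" if "P a b" for a b using less[OF that] by (simp add: line_homeo_less_iff[OF \<phi>])
  have Mk: "measure M (k ` e ` A) = measure lborel (\<phi> ` A)" if "P a b" "A \<in> sets borel" "A \<subseteq> {a..b}" for a b A
    unfolding img by (rule Mm[OF P[OF that(1)] \<phi>A[OF that(2,3)]])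
  show ?thesis
  proof
    assume "strong_qs_condition M \<I> k"
    then obtain C \<kappa> where C: "0 < C" "0 < \<kappa>" and qs: "\<forall>I\<in>\<I>. \<forall>A\<in>sets M. A \<subseteq> I \<longrightarrow>
        measure M (k ` A) / measure M (k ` I) \<le> C * (measure M A / measure M I) powr \<kappa>"
      unfolding strong_qs_condition_def by auto
    have "sqs_on \<phi> C \<kappa> a b" if ab: "P a b" for a b
      unfolding sqs_on_def
    proof (intro ballI impI)
      fix A :: "real set" assume A: "A \<in> sets borel" "A \<subseteq> {a..b}"
      have I: "measure M (k ` e ` {a..b}) = \<phi> b - \<phi> a" "measure M (e ` {a..b}) = b - a"
        using Mk[OF ab, of "{a..b}"] Mm[OF ab, of "{a..b}"] less[OF ab] pos[OF ab] line_homeo_Icc[OF \<phi>, of a b] by auto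
      have "e ` A \<in> sets M" using chart[OF ab A] by simp
      then have "measure M (k ` e ` A) / measure M (k ` e ` {a..b}) \<le> C * (measure M (e ` A) / measure M (e ` {a..b})) powr \<kappa>"
        using A(2) by (intro qs[rule_format, OF Icc[OF ab]]) auto
      then have "measure lborel (\<phi> ` A) / (\<phi> b - \<phi> a) \<le> C * (measure lborel A / (b - a)) powr \<kappa>"
        by (simp add: I Mm[OF ab A] Mk[OF ab A])
      then show "measure lborel (\<phi> ` A) \<le> C * (\<phi> b - \<phi> a) * (measure lborel A / (b - a)) powr \<kappa>"
        using pos[OF ab] by (simp add: pos_divide_le_eq mult.commute mult.left_commute)
    qed
    then show "\<exists>C>0. \<exists>\<kappa>>0. \<forall>a b. P a b \<longrightarrow> sqs_on \<phi> C \<kappa> a b" using C by blast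
  next
    assume "\<exists>C>0. \<exists>\<kappa>>0. \<forall>a b. P a b \<longrightarrow> sqs_on \<phi> C \<kappa> a b"
    then obtain C \<kappa> where C: "0 < C" "0 < \<kappa>" and qs: "\<forall>a b. P a b \<longrightarrow> sqs_on \<phi> C \<kappa> a b" by blast
    have "measure M (k ` B) / measure M (k ` I) \<le> C * (measure M B / measure M I) powr \<kappa>"
      if I: "I \<in> \<I>" and B: "B \<in> sets M" "B \<subseteq> I" for I B
    proof -
      obtain a b J where ab: "P a b" and J: "{a<..<b} \<subseteq> J" "J \<subseteq> {a..b}" "J \<in> sets borel" "I = e ` J"
        using intervals[OF I] by blast
      obtain A where A: "A \<in> sets lebesgue" "A \<subseteq> J" "B = e ` A"
        using pull[OF ab J(3,2) B(1)] B(2) J(4) by blast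
      obtain S T where ST: "S \<in> sets borel" "T \<in> sets borel" "S \<subseteq> A" "A \<subseteq> T" "T \<subseteq> {a..b}"
          "emeasure lborel S = emeasure lborel T"
        using A(1) subset_trans[OF A(2) J(2)] by (rule borel_sandwich)
      have Sab: "S \<subseteq> {a..b}" using ST(3-5) by blast
      have "emeasure M (e ` S) \<le> emeasure M B"
        using B(1) ST(3) A(3) by (intro emeasure_mono) auto
      moreover have "emeasure M B \<le> emeasure M (e ` T)"
        using chart[OF ab ST(2,5)] ST(4) A(3) by (intro emeasure_mono) auto
      ultimately have "emeasure M B = emeasure lborel T"
        using chart[OF ab ST(2,5)] chart[OF ab ST(1) Sab] ST(6) by auto
      then have MB: "measure M B = measure lborel T" by (simp add: measure_def)
      have MI: "measure M I = b - a"
        using Mm[OF ab J(3,2)] measure_interval(2)[OF less[OF ab] J(1-3)] J(4) by simp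
      have "{\<phi> a<..<\<phi> b} \<subseteq> \<phi> ` J"
      proof
        fix y assume y: "y \<in> {\<phi> a<..<\<phi> b}"
        obtain x where x: "y = \<phi> x" using \<phi> by (auto simp: line_homeo_def)
        then have "x \<in> {a<..<b}" using y by (simp add: line_homeo_less_iff[OF \<phi>])
        then show "y \<in> \<phi> ` J" using J(1) x by blast
      qed
      then have MkI: "measure M (k ` I) = \<phi> b - \<phi> a"
        using Mk[OF ab J(3,2)] measure_interval(2)[OF pos[OF ab] _ \<phi>A(2)[OF J(3,2)] \<phi>A(1)[OF J(3,2)]] J(4) by simp
      \<comment> \<open>The image is not known to be measurable at this point: if it is not, its
        measure is 0 by convention; otherwise the image of the outer Borel set dominates it.\<close>
      have MkB: "measure M (k ` B) \<le> measure lborel (\<phi> ` T)"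
      proof (cases "k ` B \<in> sets M")
        case True
        note c = chart[OF P[OF ab] \<phi>A[OF ST(2,5)]]
        have "emeasure lborel (\<phi> ` T) \<le> emeasure lborel {\<phi> a..\<phi> b}"
          by (intro emeasure_mono \<phi>A(2)[OF ST(2,5)]) simp
        also have "\<dots> < \<infinity>" using pos[OF ab] by simp
        finally have "emeasure M (e ` \<phi> ` T) \<noteq> \<infinity>" using c by simp
        moreover have "k ` B \<subseteq> e ` \<phi> ` T" unfolding A(3) img using ST(4) by blast
        ultimately have "measure M (k ` B) \<le> measure M (e ` \<phi> ` T)"
          using True c by (intro measure_mono_fmeasurable fmeasurableI) (auto simp: less_top)
        then show ?thesis using c by (simp add: measure_def)
      qed (simp add: measure_notin_sets)
      have "sqs_on \<phi> C \<kappa> a b" using qs ab by blast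
      then have "measure lborel (\<phi> ` T) \<le> C * (\<phi> b - \<phi> a) * (measure lborel T / (b - a)) powr \<kappa>"
        using ST(2,5) unfolding sqs_on_def by blast
      then have "measure M (k ` B) \<le> C * (\<phi> b - \<phi> a) * (measure lborel T / (b - a)) powr \<kappa>" using MkB by linarith
      then show ?thesis
        using pos[OF ab] by (simp add: MB MI MkI pos_divide_le_eq mult.commute mult.left_commute)
    qed
    then show "strong_qs_condition M \<I> k"
      unfolding strong_qs_condition_def by (intro exI[of _ C] exI[of _ \<kappa>] conjI C ballI impI)
  qed
qed

lemma strong_qs_condition_line_iff:
  assumes "line_homeo h"
  shows "strong_qs_condition lebesgue bounded_intervals h \<longleftrightarrow> sqs_line h"
  unfolding sqs_line_def
proof (rule strong_qs_condition_iff[where e = "\<lambda>x. x", OF assms])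
  fix I assume "I \<in> bounded_intervals"
  then obtain a b where "a < b" "{a<..<b} \<subseteq> I" "I \<subseteq> {a..b}" "I \<in> sets borel" by (rule bounded_interval_endpoints)
  then show "\<exists>a b J. a < b \<and> {a<..<b} \<subseteq> J \<and> J \<subseteq> {a..b} \<and> J \<in> sets borel \<and> I = (\<lambda>x. x) ` J"
    by (intro exI[of _ a] exI[of _ b] exI[of _ I]) simp
next
  fix a b :: real and J B :: "real set"
  assume "B \<in> sets lebesgue" "B \<subseteq> (\<lambda>x. x) ` J"
  then show "\<exists>A\<in>sets lebesgue. A \<subseteq> J \<and> B = (\<lambda>x. x) ` A" by (intro bexI[of _ B]) auto
qed (simp_all add: Icc_bounded_intervals line_homeo_less_iff[OF assms])

text \<open>All angles of \<open>B\<close> form a countable union of translates of the angles in one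
  period.\<close>

lemma lebesgue_vimage_cis:
  assumes "B \<in> sets arclength"
  shows "{t. cis t \<in> B} \<in> sets lebesgue"
proof -
  have "sets arclength = {cis ` A |A. A \<in> sets (lebesgue_on {0..<2 * pi})}"
    unfolding arclength_def by (rule sets_embed_measure') (simp add: inj_on_cis)
  then obtain A where A: "B = cis ` A" "A \<in> sets (lebesgue_on {0..<2 * pi})" using assms by auto
  have leb: "A \<in> sets lebesgue" using A(2) by (simp add: sets_restrict_space_iff)
  have "{t. cis t \<in> B} = (\<Union>n::int. (\<lambda>t. 2 * pi * of_int n + t) ` A)"
    by (auto simp: A(1) image_iff cis_eq_iff add.commute)
  also have "\<dots> \<in> sets lebesgue"
    by (rule sets.countable_UN') (use lebesgue_sets_translation[OF leb] in auto)
  finally show ?thesis .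
qed

lemma strong_qs_condition_circle_iff:
  assumes h: "line_homeo h" and k: "\<And>t. k (cis t) = cis (lift h t)"
  shows "strong_qs_condition arclength arcs k \<longleftrightarrow> sqs_circ (lift h)"
  unfolding sqs_circ_def
proof (rule strong_qs_condition_iff[where e = cis, OF line_homeo_lift[OF h]])
  fix I assume "I \<in> arcs"
  then obtain a b J where "a < b" "b \<le> a + 2 * pi" "{a<..<b} \<subseteq> J" "J \<subseteq> {a..b}" "J \<in> sets borel" "I = cis ` J"
    by (rule arcs_cases)
  then show "\<exists>a b J. (a < b \<and> b - a \<le> 2 * pi) \<and> {a<..<b} \<subseteq> J \<and> J \<subseteq> {a..b} \<and> J \<in> sets borel \<and> I = cis ` J"
    by (intro exI[of _ a] exI[of _ b] exI[of _ J]) simp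
next
  fix a b :: real assume "a < b \<and> b - a \<le> 2 * pi"
  then show "cis ` {a..b} \<in> arcs" by (simp add: Icc_arcs)
next
  fix a b :: real and A :: "real set" assume "a < b \<and> b - a \<le> 2 * pi" and A: "A \<in> sets borel" "A \<subseteq> {a..b}"
  then have "b \<le> a + 2 * pi" by simp
  then show "cis ` A \<in> sets arclength \<and> emeasure arclength (cis ` A) = emeasure lborel A"
    using emeasure_arc[OF _ A(2,1)] by blast
next
  fix a b :: real and J :: "real set" and B :: "complex set"
  assume J: "J \<in> sets borel" and B: "B \<in> sets arclength" "B \<subseteq> cis ` J"
  have "J \<inter> {t. cis t \<in> B} \<in> sets lebesgue" using J lebesgue_vimage_cis[OF B(1)] by (intro sets.Int) auto
  moreover have "B = cis ` (J \<inter> {t. cis t \<in> B})" using B(2) by blast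
  ultimately show "\<exists>A\<in>sets lebesgue. A \<subseteq> J \<and> B = cis ` A" by blast
next
  fix a b :: real assume ab: "a < b \<and> b - a \<le> 2 * pi"
  have "lift h b \<le> lift h (a + 2 * pi * of_int 1)" using ab by (simp add: line_homeo_le_iff[OF line_homeo_lift[OF h]])
  also have "\<dots> = lift h a + 2 * pi" by (subst lift_periodic) simp
  finally show "lift h a < lift h b \<and> lift h b - lift h a \<le> 2 * pi"
    using ab by (simp add: line_homeo_less_iff[OF line_homeo_lift[OF h]])
qed (simp_all add: k)

subsection \<open>The Cayley conjugate\<close>

text \<open>With the denominator cleared, the claim is
  \<open>cis (pi + \<theta>) * (x + \<i>) = x - \<i>\<close>; the two identities for
  \<open>sin \<theta>\<close> and \<open>cos \<theta>\<close> are its real and imaginary parts, and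
  they follow from the half-angle formulas.\<close>

lemma cayley_boundary_Some: "cayley_boundary (Some x) = cis (pi + 2 * arctan x)"
proof -
  have s: "1 + x\<^sup>2 \<noteq> 0" using one_plus_square_pos[of x] by simp
  define \<theta> where "\<theta> = 2 * arctan x"
  have c: "cos \<theta> = (1 - x\<^sup>2) / (1 + x\<^sup>2)" "sin \<theta> = 2 * x / (1 + x\<^sup>2)"
    using one_plus_square_pos[of x] unfolding \<theta>_def
    by (simp_all add: cos_double sin_double cos_arctan sin_arctan power_divide diff_divide_distrib)
  have e: "sin \<theta> = x + x * cos \<theta>" "cos \<theta> + x * sin \<theta> = 1"
  proof -
    define q where "q = 1 + x\<^sup>2"
    have q: "cos \<theta> = (2 - q) / q" "sin \<theta> = 2 * x / q" "q \<noteq> 0" "x * x = q - 1"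
      using s c by (simp_all add: q_def power2_eq_square)
    show "sin \<theta> = x + x * cos \<theta>" using q(3) unfolding q(1,2) by (simp add: field_simps)
    have "cos \<theta> + x * sin \<theta> = (2 - q + 2 * (x * x)) / q" unfolding q(1,2) by (simp add: add_divide_distrib)
    also have "\<dots> = 1" unfolding q(4) using q(3) by simp
    finally show "cos \<theta> + x * sin \<theta> = 1" .
  qed
  have "cis (pi + \<theta>) * (complex_of_real x + \<i>) = complex_of_real x - \<i>"
    using e by (simp add: complex_eq_iff algebra_simps)
  moreover have "complex_of_real x + \<i> \<noteq> 0" by (simp add: complex_eq_iff)
  ultimately show ?thesis unfolding \<theta>_def[symmetric] by (simp add: cayley_boundary_def cayley_def field_simps)
qed

lemma inv_cayley_boundary: "inv cayley_boundary (cayley_boundary p) = p"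
  using bij_betw_cayley_boundary by (intro inv_f_f) (simp add: bij_betw_def)

lemma cayley_conj_cis: "cayley_conj h (cis t) = cis (lift h t)"
proof -
  obtain n :: int and s where t: "t = 2 * pi * of_int n + s" "0 \<le> s" "s < 2 * pi" by (rule split_2pi)
  have cis: "cis t = cis s" "cis (lift h t) = cis (lift h s)"
    using cis_periodic[of s n] cis_periodic[of "lift h s" n] lift_periodic[of h s n] by (simp_all add: t(1) add.commute)
  show ?thesis
  proof (cases "s = 0")
    case True
    then show ?thesis
      using inv_cayley_boundary[of None] by (simp add: cis cayley_conj_def cayley_boundary_def)
  next
    case False
    define x where "x = tan ((s - pi) / 2)"
    have "arctan x = (s - pi) / 2" unfolding x_def using False t by (intro arctan_tan) (auto simp: field_simps)
    then have s: "s = pi + 2 * arctan x" by simp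
    have "inv cayley_boundary (cis s) = Some x"
      using inv_cayley_boundary[of "Some x"] unfolding cayley_boundary_Some s[symmetric] .
    then have "cayley_conj h (cis s) = cayley_boundary (Some (h x))" by (simp add: cayley_conj_def)
    then show ?thesis unfolding cis cayley_boundary_Some by (simp add: s lift_arctan)
  qed
qed

lemma sphere_eq_cis: "sphere 0 1 = cis ` {0..2 * pi}"
proof (intro equalityI subsetI)
  fix z :: complex assume "z \<in> sphere 0 1"
  then have "z = cis (Arg2pi z)" using Arg2pi_eq[of z] by (simp add: cis_conv_exp)
  then show "z \<in> cis ` {0..2 * pi}" using Arg2pi_ge_0[of z] Arg2pi_lt_2pi[of z] by (intro image_eqI) auto
qed auto

lemma continuous_on_cis: "continuous_on A cis"
  by (auto simp: cis.ctr Complex_eq intro!: continuous_intros)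

text \<open>\<open>cis\<close> maps a compact interval onto the circle. A closed set of angles in
  that interval is compact, so its image is closed; thus preimages of closed sets under
  \<open>k\<close> are closed.\<close>

lemma continuous_on_circle_if_lift:
  assumes \<phi>: "continuous_on UNIV \<phi>" and k: "\<And>t. k (cis t) = cis (\<phi> t)"
  shows "continuous_on (sphere 0 1) k"
  unfolding continuous_on_closed_vimage[OF closed_sphere]
proof (intro allI impI)
  fix B :: "complex set" assume B: "closed B"
  have "continuous_on {0..2 * pi} (\<lambda>t. cis (\<phi> t))"
    by (intro continuous_on_compose2[OF continuous_on_cis[of UNIV]] continuous_on_subset[OF \<phi>]) auto
  then have "closed ((\<lambda>t. cis (\<phi> t)) -` B \<inter> {0..2 * pi})"
    using B by (simp add: continuous_on_closed_vimage)
  then have "compact ((\<lambda>t. cis (\<phi> t)) -` B \<inter> {0..2 * pi})"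
    using compact_eq_bounded_closed bounded_subset[OF bounded_closed_interval Int_lower2] by metis
  then have "compact (cis ` ((\<lambda>t. cis (\<phi> t)) -` B \<inter> {0..2 * pi}))"
    by (intro compact_continuous_image continuous_on_cis)
  moreover have "k -` B \<inter> sphere 0 1 = cis ` ((\<lambda>t. cis (\<phi> t)) -` B \<inter> {0..2 * pi})"
    unfolding sphere_eq_cis using k by auto
  ultimately show "closed (k -` B \<inter> sphere 0 1)" by (simp add: compact_imp_closed)
qed

lemma cayley_conj_inverse:
  assumes "\<And>x. f (g x) = x" "z \<in> sphere 0 1"
  shows "cayley_conj f (cayley_conj g z) = z"
proof -
  have "z \<in> range cayley_boundary" using bij_betw_cayley_boundary assms(2) by (simp add: bij_betw_def)
  then obtain p where p: "z = cayley_boundary p" by blast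
  have "map_option f (map_option g p) = p" using assms(1) by (cases p) auto
  then show ?thesis by (simp add: p cayley_conj_def inv_cayley_boundary)
qed

lemma sense_preserving_homeo_circle_cayley_conj:
  assumes h: "line_homeo h"
  shows "sense_preserving_homeo_circle (cayley_conj h)"
proof -
  have cont: "continuous_on (sphere 0 1) (cayley_conj f)" if "line_homeo f" for f
    by (rule continuous_on_circle_if_lift[OF line_homeo_continuous[OF line_homeo_lift[OF that]] cayley_conj_cis])
  have sub: "cayley_conj f ` sphere 0 1 \<subseteq> sphere 0 1" for f
    by (auto simp: sphere_eq_cis[unfolded set_eq_iff] cayley_conj_cis cayley_conj_def
        intro: bij_betw_apply[OF bij_betw_cayley_boundary, simplified])
  have inv: "inv h (h x) = x" "h (inv h x) = x" for x
    using line_homeo_inj[OF h, of UNIV] h by (auto simp: line_homeo_def surj_f_inv_f)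
  have "homeomorphism (sphere 0 1) (sphere 0 1) (cayley_conj h) (cayley_conj (inv h))"
    by (intro homeomorphismI cont h line_homeo_inv sub cayley_conj_inverse inv)
  moreover have "continuous_on UNIV (lift h) \<and> strict_mono (lift h) \<and> (\<forall>t. cayley_conj h (cis t) = cis (lift h t))"
    using line_homeo_lift[OF h] line_homeo_continuous[OF line_homeo_lift[OF h]] by (simp add: line_homeo_def cayley_conj_cis)
  ultimately show ?thesis unfolding sense_preserving_homeo_circle_def by blast
qed

text \<open>The principal argument of \<open>cis t\<close> differs from \<open>t\<close> by a
  multiple of \<open>2 * pi\<close>, and the derivative of the lift is unaffected by that
  shift.\<close>

lemma circle_deriv_cayley_conj:
  assumes "(lift h has_real_derivative D) (at t)"
  shows "circle_deriv (cayley_conj h) (cis t) = \<bar>D\<bar>"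
proof -
  have "cis (Arg (cis t)) = cis t" using cis_Arg[of "cis t"] by (simp add: sgn_eq)
  then obtain n :: int where n: "Arg (cis t) = 2 * pi * of_int n + t" by (auto simp: cis_eq_iff add.commute)
  have "((\<lambda>s. cis (lift h s)) has_derivative (\<lambda>u. (D * u) *\<^sub>R (\<i> * cis (lift h (Arg (cis t)))))) (at (Arg (cis t)))"
    using lift_deriv_shift[OF assms, of n] unfolding n has_field_derivative_def by (rule has_derivative_cis)
  then have "((\<lambda>s. cis (lift h s)) has_vector_derivative (D *\<^sub>R (\<i> * cis (lift h (Arg (cis t)))))) (at (Arg (cis t)))"
    by (simp add: has_vector_derivative_def mult.commute)
  then have "vector_derivative (\<lambda>s. cis (lift h s)) (at (Arg (cis t))) = D *\<^sub>R (\<i> * cis (lift h (Arg (cis t))))"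
    by (rule vector_derivative_at)
  then show ?thesis by (simp add: circle_deriv_def cayley_conj_cis norm_mult)
qed

lemma line_homeo_if_sense_preserving: "sense_preserving_homeo_real h \<Longrightarrow> line_homeo h"
  by (auto simp: sense_preserving_homeo_real_def line_homeo_def homeomorphism_def)

theorem theorem1p2:
  fixes h :: "real \<Rightarrow> real"
  assumes "sense_preserving_homeo_real h"
  shows "strongly_vanishing_symmetric h \<longleftrightarrow> strongly_symmetric (cayley_conj h)"
proof -
  have h: "line_homeo h" using assms by (rule line_homeo_if_sense_preserving)
  have line: "h \<in> SQS_real \<longleftrightarrow> sqs_line h"
    using assms by (simp add: SQS_real_def strong_qs_condition_line_iff[OF h])
  have circle: "cayley_conj h \<in> SQS_circle \<longleftrightarrow> sqs_line h"
    unfolding SQS_circle_def sqs_line_iff_circ[OF h]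
    using sense_preserving_homeo_circle_cayley_conj[OF h] strong_qs_condition_circle_iff[OF h cayley_conj_cis] by simp
  \<comment> \<open>Both sides of the theorem contain the same condition \<open>sqs_line h\<close>,
    so the logarithms have to be compared only under it.\<close>
  have "(\<lambda>x. ln (deriv h x)) \<in> CMO_real \<longleftrightarrow> (\<lambda>z. ln (circle_deriv (cayley_conj h) z)) \<in> VMO_circle"
    if sqs: "sqs_line h"
  proof -
    obtain F where F [measurable]: "F \<in> borel_measurable borel"
      and dh: "AE x in lborel. (h has_real_derivative exp (F x)) (at x)"
      and dl: "AE t in lborel. (lift h has_real_derivative exp (circ (\<lambda>x. F x + cayley_factor h x) t)) (at t)"
      and iff: "cmo_line F \<longleftrightarrow> vmo_circ (circ (\<lambda>x. F x + cayley_factor h x))"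
      by (rule log_derivative_cmo_iff_vmo[OF h sqs])
    have "AE x in lborel. ln (deriv h x) = F x"
      using dh by eventually_elim (simp add: DERIV_imp_deriv)
    then have 1: "(\<lambda>x. ln (deriv h x)) \<in> CMO_real \<longleftrightarrow> cmo_line F" by (rule CMO_real_iff[OF F])
    have "cayley_factor h \<in> borel_measurable borel"
      by (intro borel_measurable_continuous_onI continuous_cayley_factor h)
    then have m: "circ (\<lambda>x. F x + cayley_factor h x) \<in> borel_measurable borel"
      by (intro circ_measurable borel_measurable_add F)
    have "AE t in lborel. ln (circle_deriv (cayley_conj h) (cis t)) = circ (\<lambda>x. F x + cayley_factor h x) t"
      using dl by eventually_elim (simp add: circle_deriv_cayley_conj)
    then have "(\<lambda>z. ln (circle_deriv (cayley_conj h) z)) \<in> VMO_circle \<longleftrightarrow> vmo_circ (circ (\<lambda>x. F x + cayley_factor h x))"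
      by (rule VMO_circle_iff[OF m circ_periodic])
    then show ?thesis using 1 iff by simp
  qed
  then show ?thesis unfolding strongly_vanishing_symmetric_def strongly_symmetric_def line circle by blast
qed

end
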